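(* The map $j$ gives ring isomorphisms $j:K\mathcal A(\mathcal C^{\rm fg})\to K(\mathcal C^{\rm fg})^{(0)}$ and $j:K\mathcal A(\mathcal C^{\rm t})\to K(\mathcal C^{\rm t})$. In particular, these maps are injective and thus $\mathrm{Tor}K(\mathcal C^{\rm fg})=0$, $\mathrm{Tor}K(\mathcal C^{\rm t})=0$. Further, $K_\infty(\mathcal C^{\rm fg})=\mathbb Z$ and $K_\infty(\mathcal C^{\rm t})=0$.
   Context: A filtered chain complex over a field $\mathbf k$ is a triple $(C_*,\partial,\ell)$ with $(C_*,\partial)$ a $\mathbb Z$-graded chain complex and $\ell:\oplus_iC_i\to\mathbb R\cup\{-\infty\}$ a filtration function ($\ell(x)=-\infty$ iff $x=0$, $\ell(cx)=\ell(x)$ for $c\ne0$, $\ell(x+y)\le\max\{\ell(x),\ell(y)\}$) with $\ell(\partial x)\le\ell(x)$. Write $C^{\le r}=\{x\mid\ell(x)\le r\}$. It is finitely generated if its total space is finite dimensional, and tame if $\oplus_kC_k^{\le r}$ is finite dimensional for every $r$ and $C^{\le r}=0$ for $r$ sufficiently small. $\mathcal C^{\rm fg}$ and $\mathcal C^{\rm t}$ are the persistence homotopy categories of finitely generated, respectively tame, filtered chain complexes: $\hom^r(C,D)$ is the space of degree-$0$ chain maps $f$ with $\ell(f(x))\le\ell(x)+r$ modulo chain homotopies $h$ with $\ell(h(x))\le\ell(x)+r$. For $\mathcal C\in\{\mathcal C^{\rm fg},\mathcal C^{\rm t}\}$: $\mathcal C_0$ has the morphisms $\hom^0$ and is triangulated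 by filtered mapping cones; $\mathcal C_\infty$ has the same objects and morphisms $\varinjlim_r\hom^r$ and is triangulated (the Verdier quotient $\mathcal C_0/\mathcal A\mathcal C_0$); $\mathcal A\mathcal C$ is the full subcategory of objects $X$ that are $r$-acyclic for some $r\ge0$, i.e. $\mathrm{id}_X$ becomes zero in $\hom^r(X,X)$, and $\mathcal A\mathcal C_0$ is its (triangulated) $0$-level. With $K$ of a triangulated category denoting its Grothendieck group, $K(\mathcal C)=K(\mathcal C_0)$, $K\mathcal A(\mathcal C)=K(\mathcal A\mathcal C_0)$, $K_\infty(\mathcal C)=K(\mathcal C_\infty)$. The map $j:K\mathcal A(\mathcal C)\to K(\mathcal C)$ is induced by the inclusion of objects, and $\mathrm{Tor}K(\mathcal C)=\ker(j)$. The (possibly non-unital) ring structures are $[C]\cdot[D]=[C\otimes D]$, with the usual tensor product and $\ell_{C\otimes D}=\ell_C+\ell_D$. $K(\mathcal C^{\rm fg})^{(0)}=\{A\in K(\mathcal C^{\rm fg})\mid\chi(A)=0\}$, where $\chi:K(\mathcal C^{\rm fg})\to\mathbb Z$ is the Euler characteristic. *)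

theory Defs
  imports
    Complex_Main
    "HOL-Library.Extended_Real"
    "HOL-Library.Nat_Bijection"
    "HOL-Library.Poly_Mapping"
    "HOL-Algebra.Free_Abelian_Groups"
    "HOL-Algebra.QuotRing"
    "HOL-Algebra.IntRing"
begin

section \<open>The ambient vector space\<close>

text \<open>
  All chain groups are subspaces of the space of finitely supported sequences over the field.
  A tame complex is the union of its finite dimensional sublevels at the natural numbers, so its
  total space has countable dimension; hence every finitely generated or tame filtered chain
  complex is isomorphic to one living in this space, and Grothendieck groups may be formed from
  these objects.
\<close>

type_synonym 'k vec = "nat \<Rightarrow>\<^sub>0 'k"

definition vscale :: "'k::field \<Rightarrow> 'k vec \<Rightarrow> 'k vec" where
  "vscale c x = Poly_Mapping.map ((*) c) x"

lemma lookup_vscale [simp]: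
  "Poly_Mapping.lookup (vscale c x) n = c * Poly_Mapping.lookup x n"
  by (simp add: vscale_def Poly_Mapping.map.rep_eq when_def)

interpretation vec: vector_space vscale
  by unfold_locales (auto intro!: poly_mapping_eqI simp: lookup_add algebra_simps)

definition findim :: "'k::field vec set \<Rightarrow> bool" where
  "findim S \<longleftrightarrow> (\<exists>B. finite B \<and> S \<subseteq> vec.span B)"

definition linear_on :: "'k::field vec set \<Rightarrow> ('k vec \<Rightarrow> 'k vec) \<Rightarrow> bool" where
  "linear_on S f \<longleftrightarrow>
     (\<forall>x\<in>S. \<forall>y\<in>S. f (x + y) = f x + f y) \<and> (\<forall>c. \<forall>x\<in>S. f (vscale c x) = vscale c (f x))"

text \<open>
  The ambient space is the direct sum of the images of the injections below (even and odd
  coordinates), with left inverses \<open>prl\<close> and \<open>prr\<close>. It is also its own tensor square through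
  \<open>tens\<close>, which sends a pair of standard basis vectors to a standard basis vector
  bijectively. So for subspaces \<open>S\<close> and \<open>T\<close>, the sum of \<open>inl S\<close> and \<open>inr T\<close> is
  their external direct sum and the span of the vectors \<open>tens x y\<close> is their tensor product.
\<close>

definition inl :: "'k::field vec \<Rightarrow> 'k vec" where
  "inl x = (\<Sum>n\<in>Poly_Mapping.keys x. Poly_Mapping.single (2 * n) (Poly_Mapping.lookup x n))"

definition inr :: "'k::field vec \<Rightarrow> 'k vec" where
  "inr x = (\<Sum>n\<in>Poly_Mapping.keys x. Poly_Mapping.single (2 * n + 1) (Poly_Mapping.lookup x n))"

definition prl :: "'k::field vec \<Rightarrow> 'k vec" where
  "prl z = Poly_Mapping.map_key (\<lambda>n. 2 * n) z"

definition prr :: "'k::field vec \<Rightarrow> 'k vec" where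
  "prr z = Poly_Mapping.map_key (\<lambda>n. 2 * n + 1) z"

definition tens :: "'k::field vec \<Rightarrow> 'k vec \<Rightarrow> 'k vec" where
  "tens x y = (\<Sum>m\<in>Poly_Mapping.keys x. \<Sum>n\<in>Poly_Mapping.keys y.
     Poly_Mapping.single (prod_encode (m, n)) (Poly_Mapping.lookup x m * Poly_Mapping.lookup y n))"


section \<open>Filtered chain complexes\<close>

text \<open>
  The fields \<open>bdry\<close> and \<open>filt\<close> are only meaningful on the total space. The value
  minus infinity of the filtration function is \<open>-\<infinity> :: ereal\<close>; plus infinity is excluded.
\<close>

record (overloaded) 'k fcomplex =
  grade :: "int \<Rightarrow> 'k vec set"
  bdry :: "'k vec \<Rightarrow> 'k vec"
  filt :: "'k vec \<Rightarrow> ereal"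

definition total :: "'k::field fcomplex \<Rightarrow> 'k vec set" where
  "total C = vec.span (\<Union>i. grade C i)"

definition chain_complex :: "'k::field fcomplex \<Rightarrow> bool" where
  "chain_complex C \<longleftrightarrow>
     (\<forall>i. vec.subspace (grade C i)) \<and>
     (\<forall>F x. finite F \<and> (\<forall>i\<in>F. x i \<in> grade C i) \<and> (\<Sum>i\<in>F. x i) = 0 \<longrightarrow> (\<forall>i\<in>F. x i = 0)) \<and>
     linear_on (total C) (bdry C) \<and>
     (\<forall>i. \<forall>x\<in>grade C i. bdry C x \<in> grade C (i - 1)) \<and>
     (\<forall>x\<in>total C. bdry C (bdry C x) = 0)"

text \<open>
  The last clause says that the sublevels of the filtration are graded subspaces, i.e. the
  sublevel at \<open>r\<close> is the direct sum of its homogeneous parts. Without it the tensor product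
  would not be a filtered complex, because of the Koszul sign in its differential.
\<close>

definition filtered_complex :: "'k::field fcomplex \<Rightarrow> bool" where
  "filtered_complex C \<longleftrightarrow>
     chain_complex C \<and>
     (\<forall>x\<in>total C. filt C x \<noteq> \<infinity>) \<and>
     (\<forall>x\<in>total C. filt C x = -\<infinity> \<longleftrightarrow> x = 0) \<and>
     (\<forall>c. \<forall>x\<in>total C. c \<noteq> 0 \<longrightarrow> filt C (vscale c x) = filt C x) \<and>
     (\<forall>x\<in>total C. \<forall>y\<in>total C. filt C (x + y) \<le> max (filt C x) (filt C y)) \<and>
     (\<forall>x\<in>total C. filt C (bdry C x) \<le> filt C x) \<and>
     (\<forall>F x. finite F \<and> (\<forall>i\<in>F. x i \<in> grade C i) \<longrightarrow>
        (\<forall>i\<in>F. filt C (x i) \<le> filt C (\<Sum>i\<in>F. x i)))"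

definition sublevel :: "'k::field fcomplex \<Rightarrow> real \<Rightarrow> 'k vec set" where
  "sublevel C r = {x \<in> total C. filt C x \<le> ereal r}"

definition Cfg :: "'k::field fcomplex set" where
  "Cfg = {C. filtered_complex C \<and> findim (total C)}"

definition Ct :: "'k::field fcomplex set" where
  "Ct = {C. filtered_complex C \<and> (\<forall>r. findim (sublevel C r)) \<and> (\<exists>r0. \<forall>r\<le>r0. sublevel C r = {0})}"


section \<open>Morphisms of the persistence homotopy category\<close>

definition chain_map :: "real \<Rightarrow> 'k::field fcomplex \<Rightarrow> 'k fcomplex \<Rightarrow> ('k vec \<Rightarrow> 'k vec) \<Rightarrow> bool" where
  "chain_map r C D f \<longleftrightarrow>
     linear_on (total C) f \<and>
     (\<forall>i. \<forall>x\<in>grade C i. f x \<in> grade D i) \<and>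
     (\<forall>x\<in>total C. f (bdry C x) = bdry D (f x)) \<and>
     (\<forall>x\<in>total C. filt D (f x) \<le> filt C x + ereal r)"

definition homotopic ::
  "real \<Rightarrow> 'k::field fcomplex \<Rightarrow> 'k fcomplex \<Rightarrow> ('k vec \<Rightarrow> 'k vec) \<Rightarrow> ('k vec \<Rightarrow> 'k vec) \<Rightarrow> bool" where
  "homotopic r C D f g \<longleftrightarrow> (\<exists>h.
     linear_on (total C) h \<and>
     (\<forall>i. \<forall>x\<in>grade C i. h x \<in> grade D (i + 1)) \<and>
     (\<forall>x\<in>total C. filt D (h x) \<le> filt C x + ereal r) \<and>
     (\<forall>x\<in>total C. f x - g x = bdry D (h x) + h (bdry C x)))"

text \<open>
  Morphisms are classes of chain maps modulo homotopy, where \<open>R\<close> is the set of admissible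
  shifts: \<open>R = {r}\<close> gives the space of morphisms of shift \<open>r\<close>, in particular
  \<open>R = {0}\<close> gives the 0-level category. As the structure maps of the directed system are
  induced by the inclusions of chain maps of shift \<open>r\<close> into those of shift \<open>s \<ge> r\<close>,
  \<open>R = UNIV\<close> gives its colimit, the limit category.
\<close>

type_synonym 'k morphism = "('k vec \<Rightarrow> 'k vec) set"

definition hclass ::
  "real set \<Rightarrow> 'k::field fcomplex \<Rightarrow> 'k fcomplex \<Rightarrow> ('k vec \<Rightarrow> 'k vec) \<Rightarrow> 'k morphism" where
  "hclass R C D f = {g. (\<exists>r\<in>R. chain_map r C D g) \<and> (\<exists>r\<in>R. homotopic r C D f g)}"

definition Hom :: "real set \<Rightarrow> 'k::field fcomplex \<Rightarrow> 'k fcomplex \<Rightarrow> 'k morphism set" where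
  "Hom R C D = {hclass R C D f | f. \<exists>r\<in>R. chain_map r C D f}"

definition Comp ::
  "real set \<Rightarrow> 'k::field fcomplex \<Rightarrow> 'k fcomplex \<Rightarrow> 'k morphism \<Rightarrow> 'k morphism \<Rightarrow> 'k morphism" where
  "Comp R A C v u = (\<Union>f\<in>u. \<Union>g\<in>v. hclass R A C (g \<circ> f))"

definition Iso :: "real set \<Rightarrow> 'k::field fcomplex \<Rightarrow> 'k fcomplex \<Rightarrow> 'k morphism \<Rightarrow> bool" where
  "Iso R A B u \<longleftrightarrow> u \<in> Hom R A B \<and>
     (\<exists>v\<in>Hom R B A. Comp R A A v u = hclass R A A id \<and> Comp R B B u v = hclass R B B id)"

definition acyclic :: "real \<Rightarrow> 'k::field fcomplex \<Rightarrow> bool" where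
  "acyclic r X \<longleftrightarrow> hclass {r} X X id = hclass {r} X X (\<lambda>_. 0)"

definition Acyclics :: "'k::field fcomplex set \<Rightarrow> 'k fcomplex set" where
  "Acyclics Ob = {X \<in> Ob. \<exists>r\<ge>0. acyclic r X}"


section \<open>Exact triangles\<close>

definition shift :: "'k::field fcomplex \<Rightarrow> 'k fcomplex" where
  "shift A = \<lparr>grade = (\<lambda>i. grade A (i - 1)), bdry = (\<lambda>x. - bdry A x), filt = filt A\<rparr>"

definition cone :: "'k::field fcomplex \<Rightarrow> 'k fcomplex \<Rightarrow> ('k vec \<Rightarrow> 'k vec) \<Rightarrow> 'k fcomplex" where
  "cone A B f =
     \<lparr>grade = (\<lambda>i. {inl a + inr b | a b. a \<in> grade A (i - 1) \<and> b \<in> grade B i}),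
      bdry = (\<lambda>z. inl (- bdry A (prl z)) + inr (f (prl z) + bdry B (prr z))),
      filt = (\<lambda>z. max (filt A (prl z)) (filt B (prr z)))\<rparr>"

text \<open>
  A candidate triangle \<open>(A, B, C, u, v, w)\<close> stands for
  \<open>A \<rightarrow> B \<rightarrow> C \<rightarrow> shift A\<close>. Since the shift functor does not change the underlying
  maps, and the homotopy \<open>h\<close> becomes \<open>- h\<close>, it acts as the identity on classes; this is why
  \<open>a\<close> itself appears as a map between shifts in the last square below.
\<close>

type_synonym 'k triangle =
  "'k fcomplex \<times> 'k fcomplex \<times> 'k fcomplex \<times> 'k morphism \<times> 'k morphism \<times> 'k morphism"

definition cone_triangle ::
  "real set \<Rightarrow> 'k::field fcomplex \<Rightarrow> 'k fcomplex \<Rightarrow> ('k vec \<Rightarrow> 'k vec) \<Rightarrow> 'k triangle" where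
  "cone_triangle R A B f =
     (A, B, cone A B f,
      hclass R A B f, hclass R B (cone A B f) inr, hclass R (cone A B f) (shift A) prl)"

fun triangle_iso :: "real set \<Rightarrow> 'k::field triangle \<Rightarrow> 'k triangle \<Rightarrow> bool" where
  "triangle_iso R (A, B, C, u, v, w) (A', B', C', u', v', w') \<longleftrightarrow>
     (\<exists>a b c. Iso R A A' a \<and> Iso R B B' b \<and> Iso R C C' c \<and>
        Comp R A B' b u = Comp R A B' u' a \<and>
        Comp R B C' c v = Comp R B C' v' b \<and>
        Comp R C (shift A') a w = Comp R C (shift A') w' c)"

text \<open>
  For \<open>R = {0}\<close> these are the exact triangles of the 0-level, i.e. the triangles isomorphic to
  filtered mapping cones. For \<open>R = UNIV\<close> they are the triangles of the limit category that are
  isomorphic there to the image of an exact triangle of the 0-level, i.e. the exact triangles of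
  the Verdier quotient.
\<close>

definition exact_triangles :: "real set \<Rightarrow> 'k::field fcomplex set \<Rightarrow> 'k triangle set" where
  "exact_triangles R Ob = {(A, B, C, u, v, w).
     A \<in> Ob \<and> B \<in> Ob \<and> C \<in> Ob \<and> u \<in> Hom R A B \<and> v \<in> Hom R B C \<and> w \<in> Hom R C (shift A) \<and>
     (\<exists>A'\<in>Ob. \<exists>B'\<in>Ob. \<exists>f. chain_map 0 A' B' f \<and>
        triangle_iso R (A, B, C, u, v, w) (cone_triangle R A' B' f))}"


section \<open>Tensor products\<close>

text \<open>
  The filtration is given by its sublevels: the sublevel at \<open>r\<close> is spanned by the
  \<open>x \<otimes> y\<close> with \<open>\<ell> x + \<ell> y \<le> r\<close>. Thus the filtration level of \<open>x \<otimes> y\<close> is the sum of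
  those of \<open>x\<close> and \<open>y\<close>.
\<close>

definition tensor :: "'k::field fcomplex \<Rightarrow> 'k fcomplex \<Rightarrow> 'k fcomplex" where
  "tensor C D =
     \<lparr>grade = (\<lambda>n. vec.span (\<Union>p. {tens x y | x y. x \<in> grade C p \<and> y \<in> grade D (n - p)})),
      bdry = (SOME d.
        linear_on (vec.span {tens x y | x y. x \<in> total C \<and> y \<in> total D}) d \<and>
        (\<forall>p. \<forall>x\<in>grade C p. \<forall>y\<in>total D.
           d (tens x y) = tens (bdry C x) y + vscale (if even p then 1 else - 1) (tens x (bdry D y)))),
      filt = (\<lambda>z. Inf {s. z \<in> vec.span {tens x y | x y.
        x \<in> total C \<and> y \<in> total D \<and> filt C x + filt D y \<le> s}})\<rparr>"


section \<open>Grothendieck groups\<close>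

text \<open>
  The free abelian group on \<open>Ob\<close>, with the biadditive product extending \<open>tensor\<close>. The
  unit field of the records in this section carries no meaning.
\<close>

definition free_rng :: "'k::field fcomplex set \<Rightarrow> ('k fcomplex \<Rightarrow>\<^sub>0 int) ring" where
  "free_rng Ob =
     \<lparr>carrier = carrier (free_Abelian_group Ob),
      monoid.mult = (\<lambda>x y. frag_extend (\<lambda>C. frag_extend (\<lambda>D. frag_of (tensor C D)) y) x),
      one = undefined, zero = 0, add = (+)\<rparr>"

definition relations :: "real set \<Rightarrow> 'k::field fcomplex set \<Rightarrow> ('k fcomplex \<Rightarrow>\<^sub>0 int) set" where
  "relations R Ob = generate (free_Abelian_group Ob)
     {frag_of A - frag_of B + frag_of C | A B C u v w. (A, B, C, u, v, w) \<in> exact_triangles R Ob}"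

definition K_ring :: "real set \<Rightarrow> 'k::field fcomplex set \<Rightarrow> ('k fcomplex \<Rightarrow>\<^sub>0 int) set ring" where
  "K_ring R Ob = FactRing (free_rng Ob) (relations R Ob)"

abbreviation K :: "'k::field fcomplex set \<Rightarrow> ('k fcomplex \<Rightarrow>\<^sub>0 int) set ring" where
  "K Ob \<equiv> K_ring {0} Ob"

abbreviation KA :: "'k::field fcomplex set \<Rightarrow> ('k fcomplex \<Rightarrow>\<^sub>0 int) set ring" where
  "KA Ob \<equiv> K_ring {0} (Acyclics Ob)"

abbreviation K_inf :: "'k::field fcomplex set \<Rightarrow> ('k fcomplex \<Rightarrow>\<^sub>0 int) set ring" where
  "K_inf Ob \<equiv> K_ring UNIV Ob"

text \<open>The map sending the class of a combination of acyclic objects to its class in \<open>K Ob\<close>.\<close>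

definition j_map ::
  "'k::field fcomplex set \<Rightarrow> ('k fcomplex \<Rightarrow>\<^sub>0 int) set \<Rightarrow> ('k fcomplex \<Rightarrow>\<^sub>0 int) set" where
  "j_map Ob X = (\<Union>x\<in>X. relations {0} Ob +>\<^bsub>free_rng Ob\<^esub> x)"

definition TorK :: "'k::field fcomplex set \<Rightarrow> ('k fcomplex \<Rightarrow>\<^sub>0 int) set set" where
  "TorK Ob = a_kernel (KA Ob) (K Ob) (j_map Ob)"

definition euler :: "'k::field fcomplex \<Rightarrow> int" where
  "euler C = (\<Sum>i | grade C i \<noteq> {0}. (if even i then 1 else - 1) * int (vec.dim (grade C i)))"

definition chi :: "('k::field fcomplex \<Rightarrow>\<^sub>0 int) set \<Rightarrow> int" where
  "chi X = (THE n. \<forall>x\<in>X. n = (\<Sum>C\<in>Poly_Mapping.keys x. Poly_Mapping.lookup x C * euler C))"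

definition K0fg :: "('k::field fcomplex \<Rightarrow>\<^sub>0 int) set ring" where
  "K0fg = (K Cfg) \<lparr>carrier := {X \<in> carrier (K Cfg). chi X = 0}\<rparr>"


section \<open>Possibly non-unital rings\<close>

definition rng :: "('a, 'm) ring_scheme \<Rightarrow> bool" where
  "rng R \<longleftrightarrow>
     abelian_group R \<and>
     (\<forall>x\<in>carrier R. \<forall>y\<in>carrier R. x \<otimes>\<^bsub>R\<^esub> y \<in> carrier R) \<and>
     (\<forall>x\<in>carrier R. \<forall>y\<in>carrier R. \<forall>z\<in>carrier R.
        (x \<otimes>\<^bsub>R\<^esub> y) \<otimes>\<^bsub>R\<^esub> z = x \<otimes>\<^bsub>R\<^esub> (y \<otimes>\<^bsub>R\<^esub> z) \<and>
        (x \<oplus>\<^bsub>R\<^esub> y) \<otimes>\<^bsub>R\<^esub> z = x \<otimes>\<^bsub>R\<^esub> z \<oplus>\<^bsub>R\<^esub> y \<otimes>\<^bsub>R\<^esub> z \<and>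
        x \<otimes>\<^bsub>R\<^esub> (y \<oplus>\<^bsub>R\<^esub> z) = x \<otimes>\<^bsub>R\<^esub> y \<oplus>\<^bsub>R\<^esub> x \<otimes>\<^bsub>R\<^esub> z)"

definition rng_iso :: "('a, 'm) ring_scheme \<Rightarrow> ('b, 'n) ring_scheme \<Rightarrow> ('a \<Rightarrow> 'b) \<Rightarrow> bool" where
  "rng_iso R S h \<longleftrightarrow>
     rng R \<and> rng S \<and> bij_betw h (carrier R) (carrier S) \<and>
     (\<forall>x\<in>carrier R. \<forall>y\<in>carrier R.
        h (x \<oplus>\<^bsub>R\<^esub> y) = h x \<oplus>\<^bsub>S\<^esub> h y \<and> h (x \<otimes>\<^bsub>R\<^esub> y) = h x \<otimes>\<^bsub>S\<^esub> h y)"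

end

theory Submission
  imports Defs
begin

text \<open>
  Write \<open>Phi C s\<close> for the Euler characteristic of the sublevel of \<open>C\<close> at \<open>s\<close>. This step function of
  \<open>s\<close> is a homotopy invariant at the 0-level and additive on filtered cones, so it extends to the
  Grothendieck groups. Everything rests on the fact that it is a complete invariant there
  (\<open>relations_objs_iff\<close>).

  Completeness comes from reducing every object to a sum of one-dimensional pieces. A non-archimedean
  orthogonal basis adapted to the cycles (\<open>adapted_basis\<close>) splits a complex, as an extension of
  complexes with zero differential, in the same way in which it splits its underlying graded space; so
  forgetting the differential does not change the class. A graded space is moved into degree \<open>0\<close> by the
  relation \<open>[shift C] = - [C]\<close>. In a tame complex infinitely many degrees have to be moved by unbounded
  amounts at once, which a swindle with finitely many additional copies of each generator achieves
  (\<open>rel_std_even_le\<close>). What remains is a formal difference of two locally finite multisets of levels,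
  and the counting functions of these, whose difference is \<open>Phi\<close>, determine them.

  The tensor product acts on \<open>Phi\<close> by convolution: in adapted bases of the factors,
  \<open>Phi (C \<otimes> D) r = (\<Sum>b. \<plusminus> Phi D (r - level of b))\<close>. Hence the relations form an ideal and the product is
  associative, by completeness and without constructing a single isomorphism of complexes.

  To compare with the acyclic objects, let \<open>lev \<phi> C\<close> be \<open>C\<close> with its levels raised by \<open>\<phi>\<close>, and let
  \<open>Theta \<phi> C\<close> be the cone of the identity \<open>lev \<phi> C \<rightarrow> C\<close>. If \<open>\<phi>\<close> raises the levels of each \<open>C\<close> by a
  bounded amount, then \<open>Theta \<phi> C\<close> is acyclic, and since \<open>Theta \<phi>\<close> is exact, it maps the relations among
  all objects to relations among acyclic ones. Moreover \<open>[C] = [Theta \<phi> C] + [lev \<phi> C]\<close>. In the finitely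
  generated case \<open>\<phi>\<close> moves all levels up to one level \<open>M\<close> above those of the complexes under
  consideration. Then \<open>lev \<phi> C\<close> has class zero as soon as the Euler characteristic vanishes, and it is
  contractible within the filtration if \<open>C\<close> is acyclic. In the tame case \<open>\<phi>\<close> raises by one, and the
  remaining term is absorbed by an infinite staircase \<open>stair\<close> with one generator at every natural level:
  \<open>[C \<otimes> stair] = [C] + [lev \<phi> (C \<otimes> stair)]\<close>, so that \<open>[C] = [Theta \<phi> (C \<otimes> stair)]\<close>. Both injectivity
  (\<open>relations_Acyclics\<close>) and the description of the image (\<open>Acyclics_generate\<close>) follow, and with them the
  triviality of \<open>TorK\<close>.

  In the limit category the acyclic objects become zero objects. So every tame class vanishes, and a
  finitely generated class vanishes when its Euler characteristic does; the Euler characteristic itself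
  survives, because it is invariant under homotopies of any shift.
\<close>

section \<open>Linear maps on subspaces\<close>

interpretation vp: vector_space_pair vscale vscale
  by unfold_locales

lemma linear_on_add: "linear_on S f \<Longrightarrow> x \<in> S \<Longrightarrow> y \<in> S \<Longrightarrow> f (x + y) = f x + f y"
  by (simp add: linear_on_def)

lemma linear_on_scale: "linear_on S f \<Longrightarrow> x \<in> S \<Longrightarrow> f (vscale c x) = vscale c (f x)"
  by (simp add: linear_on_def)

lemma linear_on_0: "linear_on S f \<Longrightarrow> x \<in> S \<Longrightarrow> f 0 = 0"
  using linear_on_scale[of S f x 0] by simp

lemma linear_on_neg: "linear_on S f \<Longrightarrow> x \<in> S \<Longrightarrow> f (- x) = - f x"
  using linear_on_scale[of S f x "-1"] by simp

lemma linear_on_diff: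
  assumes "linear_on S f" "vec.subspace S" "x \<in> S" "y \<in> S"
  shows "f (x - y) = f x - f y"
  using linear_on_add[OF assms(1), of x "- y"] linear_on_neg[OF assms(1), of y] assms
    vec.subspace_neg[of S y] by simp

lemma linear_on_subset: "linear_on S f \<Longrightarrow> T \<subseteq> S \<Longrightarrow> linear_on T f"
  unfolding linear_on_def by blast

lemma linear_on_eq_span:
  assumes "linear_on (vec.span G) f" "linear_on (vec.span G) g" "\<And>x. x \<in> G \<Longrightarrow> f x = g x"
    and "x \<in> vec.span G"
  shows "f x = g x"
proof -
  have "x \<in> vec.span G \<and> f x = g x"
    using assms(4)
  proof (induction rule: vec.span_induct_alt)
    case base
    then show ?case
      using linear_on_0[OF assms(1) vec.span_zero] linear_on_0[OF assms(2) vec.span_zero]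
      by (simp add: vec.span_zero)
  next
    case (step c x y)
    then show ?case
      using assms(1-3) by (auto simp: linear_on_add linear_on_scale vec.span_base vec.span_add vec.span_scale)
  qed
  then show ?thesis ..
qed

lemma linear_imp_linear_on: "Vector_Spaces.linear vscale vscale g \<Longrightarrow> linear_on S g"
  unfolding linear_on_def by (auto simp: vp.linear_add vp.linear_scale)

text \<open>Linear maps on a subspace extend to the ambient space, so that library facts on globally
  linear maps apply to them.\<close>

lemma linear_on_extend:
  assumes "linear_on S f" "vec.subspace S"
  obtains g where "Vector_Spaces.linear vscale vscale g" "\<And>x. x \<in> S \<Longrightarrow> g x = f x"
proof -
  obtain B where B: "B \<subseteq> S" "vec.independent B" "S \<subseteq> vec.span B"
    using vec.maximal_independent_subset[of S] by blast
  then have S: "S = vec.span B"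
    using vec.span_minimal[of B S] assms(2) by blast
  obtain g where g: "Vector_Spaces.linear vscale vscale g" "\<forall>x\<in>B. g x = f x"
    using vp.linear_independent_extend[OF B(2)] by blast
  have "g x = f x" if "x \<in> S" for x
    by (rule linear_on_eq_span[of B g f]) (use assms(1) g S that linear_imp_linear_on in auto)
  with g(1) show thesis by (rule that)
qed

lemma subspace_image_on:
  assumes "linear_on S f" "vec.subspace S" shows "vec.subspace (f ` S)"
proof -
  obtain g where g: "Vector_Spaces.linear vscale vscale g" "\<And>x. x \<in> S \<Longrightarrow> g x = f x"
    using linear_on_extend[OF assms] by blast
  then have "f ` S = g ` S" by auto
  then show ?thesis using vp.linear_subspace_image[OF g(1) assms(2)] by simp
qed

lemma linear_on_id [simp]: "linear_on S id" "linear_on S (\<lambda>x. x)"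
  by (auto simp: linear_on_def)

lemma linear_on_zero [simp]: "linear_on S (\<lambda>_. 0)"
  by (auto simp: linear_on_def)

lemma linear_on_comp: "linear_on S f \<Longrightarrow> f ` S \<subseteq> T \<Longrightarrow> linear_on T g \<Longrightarrow> linear_on S (\<lambda>x. g (f x))"
  unfolding linear_on_def by (metis image_subset_iff)

lemma linear_on_plus: "linear_on S f \<Longrightarrow> linear_on S g \<Longrightarrow> linear_on S (\<lambda>x. f x + g x)"
  unfolding linear_on_def by (auto simp: vec.scale_right_distrib algebra_simps)

lemma linear_on_uminus: "linear_on S f \<Longrightarrow> linear_on S (\<lambda>x. - f x)"
  unfolding linear_on_def by (auto simp: algebra_simps)

section \<open>Filtered complexes\<close>

lemma subspace_total [simp]: "vec.subspace (total C)"
  by (simp add: total_def)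

lemma total_0 [simp]: "0 \<in> total C"
  by (rule vec.subspace_0) simp

lemma total_add: "x \<in> total C \<Longrightarrow> y \<in> total C \<Longrightarrow> x + y \<in> total C"
  by (rule vec.subspace_add) auto

lemma total_diff: "x \<in> total C \<Longrightarrow> y \<in> total C \<Longrightarrow> x - y \<in> total C"
  by (rule vec.subspace_diff) auto

lemma total_neg: "x \<in> total C \<Longrightarrow> - x \<in> total C"
  by (rule vec.subspace_neg) auto

lemma total_scale: "x \<in> total C \<Longrightarrow> vscale c x \<in> total C"
  by (rule vec.subspace_scale) auto

lemma grade_total: "x \<in> grade C i \<Longrightarrow> x \<in> total C"
  by (auto simp: total_def intro: vec.span_base)

lemma total_induct [consumes 1, case_names grade zero add scale]:
  assumes "x \<in> total C" "\<And>i x. x \<in> grade C i \<Longrightarrow> P x" "P 0"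
    "\<And>x y. x \<in> total C \<Longrightarrow> y \<in> total C \<Longrightarrow> P x \<Longrightarrow> P y \<Longrightarrow> P (x + y)"
    "\<And>c x. x \<in> total C \<Longrightarrow> P x \<Longrightarrow> P (vscale c x)"
  shows "P x"
proof -
  have "x \<in> total C \<and> P x"
    using assms(1) unfolding total_def
  proof (induction rule: vec.span_induct_alt)
    case (step c x y)
    then obtain i where x: "x \<in> grade C i" by blast
    have cx: "vscale c x \<in> total C" "P (vscale c x)"
      using total_scale[OF grade_total[OF x]] assms(5)[OF grade_total[OF x] assms(2)[OF x]] by auto
    have y: "y \<in> total C" "P y" using step by (auto simp: total_def)
    show ?case
      using assms(4)[OF cx(1) y(1) cx(2) y(2)] total_add[OF cx(1) y(1)] by (simp add: total_def)
  qed (auto simp: vec.span_zero assms(3))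
  then show ?thesis ..
qed

lemma total_cong: "grade C = grade D \<Longrightarrow> total C = total D"
  by (simp add: total_def)

lemma linear_total_into:
  assumes "linear_on (total C) f" "\<And>i x. x \<in> grade C i \<Longrightarrow> f x \<in> T" "vec.subspace T" "x \<in> total C"
  shows "f x \<in> T"
  using assms(4)
proof (induction rule: total_induct)
  case (grade i x)
  then show ?case by (rule assms(2))
next
  case zero
  then show ?case using linear_on_0[OF assms(1) total_0] vec.subspace_0[OF assms(3)] by simp
next
  case (add x y)
  then show ?case using linear_on_add[OF assms(1)] vec.subspace_add[OF assms(3)] by simp
next
  case (scale c x)
  then show ?case using linear_on_scale[OF assms(1)] vec.subspace_scale[OF assms(3)] by simp
qed

lemma linear_total_total:
  assumes "linear_on (total C) f" "\<And>i x. x \<in> grade C i \<Longrightarrow> f x \<in> grade D (k i)" "x \<in> total C"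
  shows "f x \<in> total D"
  by (rule linear_total_into[OF assms(1) grade_total[OF assms(2)] subspace_total assms(3)])

lemma fc_sub:
  assumes "filtered_complex C" shows "vec.subspace (grade C i)"
proof -
  have "(\<forall>i. vec.subspace (grade C i))"
    using assms unfolding filtered_complex_def chain_complex_def by (elim conjE)
  then show "vec.subspace (grade C i)" by blast
qed

lemma fc_lin:
  assumes "filtered_complex C" shows "linear_on (total C) (bdry C)"
  using assms unfolding filtered_complex_def chain_complex_def by (elim conjE)

lemma fc_bdry:
  assumes "filtered_complex C" shows "x \<in> grade C i \<Longrightarrow> bdry C x \<in> grade C (i - 1)"
proof -
  have "(\<forall>i. \<forall>x\<in>grade C i. bdry C x \<in> grade C (i - 1))"
    using assms unfolding filtered_complex_def chain_complex_def by (elim conjE)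
  then show "x \<in> grade C i \<Longrightarrow> bdry C x \<in> grade C (i - 1)" by blast
qed

lemma fc_bb:
  assumes "filtered_complex C" shows "x \<in> total C \<Longrightarrow> bdry C (bdry C x) = 0"
proof -
  have "(\<forall>x\<in>total C. bdry C (bdry C x) = 0)"
    using assms unfolding filtered_complex_def chain_complex_def by (elim conjE)
  then show "x \<in> total C \<Longrightarrow> bdry C (bdry C x) = 0" by blast
qed

lemma fc_noinf:
  assumes "filtered_complex C" shows "x \<in> total C \<Longrightarrow> filt C x \<noteq> \<infinity>"
proof -
  have "(\<forall>x\<in>total C. filt C x \<noteq> \<infinity>)"
    using assms unfolding filtered_complex_def chain_complex_def by (elim conjE)
  then show "x \<in> total C \<Longrightarrow> filt C x \<noteq> \<infinity>" by blast
qed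

lemma fc_minf:
  assumes "filtered_complex C" shows "x \<in> total C \<Longrightarrow> filt C x = -\<infinity> \<longleftrightarrow> x = 0"
proof -
  have "(\<forall>x\<in>total C. filt C x = -\<infinity> \<longleftrightarrow> x = 0)"
    using assms unfolding filtered_complex_def chain_complex_def by (elim conjE)
  then show "x \<in> total C \<Longrightarrow> filt C x = -\<infinity> \<longleftrightarrow> x = 0" by blast
qed

lemma fc_scale:
  assumes "filtered_complex C" shows "x \<in> total C \<Longrightarrow> c \<noteq> 0 \<Longrightarrow> filt C (vscale c x) = filt C x"
proof -
  have "(\<forall>c. \<forall>x\<in>total C. c \<noteq> 0 \<longrightarrow> filt C (vscale c x) = filt C x)"
    using assms unfolding filtered_complex_def chain_complex_def by (elim conjE)
  then show "x \<in> total C \<Longrightarrow> c \<noteq> 0 \<Longrightarrow> filt C (vscale c x) = filt C x" by blast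
qed

lemma fc_add:
  assumes "filtered_complex C" shows "x \<in> total C \<Longrightarrow> y \<in> total C \<Longrightarrow> filt C (x + y) \<le> max (filt C x) (filt C y)"
proof -
  have "(\<forall>x\<in>total C. \<forall>y\<in>total C. filt C (x + y) \<le> max (filt C x) (filt C y))"
    using assms unfolding filtered_complex_def chain_complex_def by (elim conjE)
  then show "x \<in> total C \<Longrightarrow> y \<in> total C \<Longrightarrow> filt C (x + y) \<le> max (filt C x) (filt C y)" by blast
qed

lemma fc_fbdry:
  assumes "filtered_complex C" shows "x \<in> total C \<Longrightarrow> filt C (bdry C x) \<le> filt C x"
proof -
  have "(\<forall>x\<in>total C. filt C (bdry C x) \<le> filt C x)"
    using assms unfolding filtered_complex_def chain_complex_def by (elim conjE)
  then show "x \<in> total C \<Longrightarrow> filt C (bdry C x) \<le> filt C x" by blast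
qed

lemma fc_indep:
  assumes "filtered_complex C" "finite F" "\<And>i. i \<in> F \<Longrightarrow> y i \<in> grade C i" "(\<Sum>i\<in>F. y i) = 0" "i \<in> F"
  shows "y i = 0"
proof -
  have "\<forall>F x. finite F \<and> (\<forall>i\<in>F. x i \<in> grade C i) \<and> (\<Sum>i\<in>F. x i) = 0 \<longrightarrow> (\<forall>i\<in>F. x i = 0)"
    using assms(1) unfolding filtered_complex_def chain_complex_def by (elim conjE)
  then show ?thesis using assms(2-5) by blast
qed

lemma fc_homog:
  assumes "filtered_complex C" "finite F" "\<And>i. i \<in> F \<Longrightarrow> y i \<in> grade C i" "i \<in> F"
  shows "filt C (y i) \<le> filt C (\<Sum>i\<in>F. y i)"
proof -
  have "\<forall>F x. finite F \<and> (\<forall>i\<in>F. x i \<in> grade C i) \<longrightarrow> (\<forall>i\<in>F. filt C (x i) \<le> filt C (\<Sum>i\<in>F. x i))"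
    using assms(1) unfolding filtered_complex_def by (elim conjE)
  then show ?thesis using assms(2-4) by blast
qed

lemma fc_0: "filtered_complex C \<Longrightarrow> filt C 0 = -\<infinity>"
  using fc_minf[of C 0] by simp

lemma fc_neg: "filtered_complex C \<Longrightarrow> x \<in> total C \<Longrightarrow> filt C (- x) = filt C x"
  using fc_scale[of C x "-1"] by simp

lemma fc_diff: "filtered_complex C \<Longrightarrow> x \<in> total C \<Longrightarrow> y \<in> total C \<Longrightarrow> filt C (x - y) \<le> max (filt C x) (filt C y)"
  using fc_add[of C x "- y"] fc_neg[of C y] total_neg[of y C] by simp

lemma fc_bdry_total:
  assumes "filtered_complex C" "x \<in> total C" shows "bdry C x \<in> total C"
  by (rule linear_total_total[OF fc_lin[OF assms(1)] fc_bdry[OF assms(1)] assms(2)])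

lemma fc_bdry_add: "filtered_complex C \<Longrightarrow> x \<in> total C \<Longrightarrow> y \<in> total C \<Longrightarrow> bdry C (x + y) = bdry C x + bdry C y"
  by (rule linear_on_add[OF fc_lin])

lemma fc_bdry_neg: "filtered_complex C \<Longrightarrow> x \<in> total C \<Longrightarrow> bdry C (- x) = - bdry C x"
  by (rule linear_on_neg[OF fc_lin])

lemma fc_bdry_scale: "filtered_complex C \<Longrightarrow> x \<in> total C \<Longrightarrow> bdry C (vscale c x) = vscale c (bdry C x)"
  by (rule linear_on_scale[OF fc_lin])

lemma fc_bdry_0: "filtered_complex C \<Longrightarrow> bdry C 0 = 0"
  by (rule linear_on_0[OF fc_lin total_0])

section \<open>Homotopy classes\<close>

definition cmap :: "real set \<Rightarrow> 'k::field fcomplex \<Rightarrow> 'k fcomplex \<Rightarrow> ('k vec \<Rightarrow> 'k vec) \<Rightarrow> bool" where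
  "cmap R C D f \<longleftrightarrow> (\<exists>r\<in>R. chain_map r C D f)"

definition heq ::
  "real set \<Rightarrow> 'k::field fcomplex \<Rightarrow> 'k fcomplex \<Rightarrow> ('k vec \<Rightarrow> 'k vec) \<Rightarrow> ('k vec \<Rightarrow> 'k vec) \<Rightarrow> bool" where
  "heq R C D f g \<longleftrightarrow> (\<exists>r\<in>R. homotopic r C D f g)"

text \<open>The closure properties of a set of admissible shifts that make homotopy classes a category;
  the instances of interest are \<open>{0}\<close> and \<open>UNIV\<close>.\<close>

definition shifts :: "real set \<Rightarrow> bool" where
  "shifts R \<longleftrightarrow> 0 \<in> R \<and> (\<forall>r\<in>R. \<forall>s\<in>R. r + s \<in> R \<and> max r s \<in> R)"

lemma shifts_zero [simp]: "shifts {0}" and shifts_UNIV [simp]: "shifts UNIV"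
  by (auto simp: shifts_def)

lemma cmapD:
  assumes "cmap R C D f"
  shows "linear_on (total C) f" "x \<in> grade C i \<Longrightarrow> f x \<in> grade D i"
    "x \<in> total C \<Longrightarrow> f (bdry C x) = bdry D (f x)"
  using assms by (auto simp: cmap_def chain_map_def)

lemma cmap_total:
  assumes "cmap R C D f" "x \<in> total C" shows "f x \<in> total D"
  by (rule linear_total_total[OF cmapD(1)[OF assms(1)] cmapD(2)[OF assms(1)] assms(2)])

lemma chain_map_total: "chain_map r C D f \<Longrightarrow> x \<in> total C \<Longrightarrow> f x \<in> total D"
  by (rule cmap_total[of "{r}"]) (auto simp: cmap_def)

lemma cmap_comp:
  assumes "shifts R" "cmap R C D f" "cmap R D E g" shows "cmap R C E (g \<circ> f)"
proof -
  obtain r s where rs: "r \<in> R" "s \<in> R" "chain_map r C D f" "chain_map s D E g"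
    using assms by (auto simp: cmap_def)
  have "filt E (g (f x)) \<le> filt C x + ereal (r + s)" if "x \<in> total C" for x
  proof -
    have "filt E (g (f x)) \<le> filt D (f x) + ereal s"
      using rs that chain_map_total[OF rs(3)] by (auto simp: chain_map_def)
    also have "\<dots> \<le> (filt C x + ereal r) + ereal s"
      using rs that by (intro add_right_mono) (auto simp: chain_map_def)
    finally show ?thesis by (simp add: add.assoc)
  qed
  moreover have "linear_on (total C) (\<lambda>x. g (f x))"
    by (rule linear_on_comp[OF cmapD(1)[OF assms(2)] _ cmapD(1)[OF assms(3)]])
      (use chain_map_total[OF rs(3)] in auto)
  ultimately have "chain_map (r + s) C E (g \<circ> f)"
    using rs chain_map_total[OF rs(3)] by (auto simp: chain_map_def comp_def)
  then show ?thesis using rs assms(1) by (auto simp: cmap_def shifts_def)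
qed

lemma filt_le_shift: "filtered_complex C \<Longrightarrow> x \<in> total C \<Longrightarrow> y \<le> filt C x + ereal r \<Longrightarrow> r \<le> s \<Longrightarrow> y \<le> filt C x + ereal s"
  by (meson add_left_mono ereal_less_eq(3) order_trans)

lemma chain_map_0I:
  assumes "linear_on (total C) f" "\<And>i x. x \<in> grade C i \<Longrightarrow> f x \<in> grade D i"
    "\<And>x. x \<in> total C \<Longrightarrow> f (bdry C x) = bdry D (f x)" "\<And>x. x \<in> total C \<Longrightarrow> filt D (f x) \<le> filt C x"
  shows "chain_map 0 C D f"
  using assms by (auto simp: chain_map_def)

lemma cmap_0: "shifts R \<Longrightarrow> chain_map 0 C D f \<Longrightarrow> cmap R C D f"
  by (auto simp: shifts_def cmap_def)

lemma chain_map_id: "chain_map 0 C C id"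
  by (rule chain_map_0I) auto

lemma cmap_id: "shifts R \<Longrightarrow> cmap R C C id"
  by (intro cmap_0 chain_map_id)

lemma heq_zeroI:
  assumes "shifts R" "filtered_complex C" "filtered_complex D" "\<And>x. x \<in> total C \<Longrightarrow> f x = g x"
  shows "heq R C D f g"
proof -
  have "homotopic 0 C D f g"
    unfolding homotopic_def
    by (rule exI[of _ "\<lambda>_. 0"]) (use assms in \<open>auto simp: fc_0 fc_bdry_0 intro!: vec.subspace_0 fc_sub\<close>)
  then show ?thesis using assms(1) by (auto simp: heq_def shifts_def)
qed

lemma homotopic_mapsto:
  assumes "linear_on (total C) h" "\<forall>i. \<forall>x\<in>grade C i. h x \<in> grade D (i + 1)" "x \<in> total C"
  shows "h x \<in> total D"
  by (rule linear_total_total[OF assms(1) _ assms(3), where k = "\<lambda>i. i + 1"]) (use assms(2) in blast)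

lemma heq_sym:
  assumes "filtered_complex C" "filtered_complex D" "heq R C D f g"
  shows "heq R C D g f"
proof -
  obtain r h where r: "r \<in> R" and h: "linear_on (total C) h" "\<forall>i. \<forall>x\<in>grade C i. h x \<in> grade D (i + 1)"
     "\<forall>x\<in>total C. filt D (h x) \<le> filt C x + ereal r"
     "\<forall>x\<in>total C. f x - g x = bdry D (h x) + h (bdry C x)"
    using assms(3) by (auto simp: heq_def homotopic_def)
  have "g x - f x = bdry D (- h x) + - h (bdry C x)" if "x \<in> total C" for x
    using h(4) that homotopic_mapsto[OF h(1,2) that] fc_bdry_neg[OF assms(2)]
    by (metis add_uminus_conv_diff minus_add_distrib minus_diff_eq)
  then have "homotopic r C D g f"
    unfolding homotopic_def
    by (intro exI[of _ "\<lambda>x. - h x"])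
      (use h homotopic_mapsto[OF h(1,2)] in \<open>auto simp: fc_neg[OF assms(2)] intro: linear_on_uminus vec.subspace_neg fc_sub[OF assms(2)]\<close>)
  then show ?thesis using r by (auto simp: heq_def)
qed

lemma heq_trans_max:
  assumes "\<forall>r\<in>R. \<forall>s\<in>R. max r s \<in> R" "filtered_complex C" "filtered_complex D" "heq R C D f g" "heq R C D g k"
  shows "heq R C D f k"
proof -
  obtain r h where r: "r \<in> R" and h: "linear_on (total C) h" "\<forall>i. \<forall>x\<in>grade C i. h x \<in> grade D (i + 1)"
     "\<forall>x\<in>total C. filt D (h x) \<le> filt C x + ereal r"
     "\<forall>x\<in>total C. f x - g x = bdry D (h x) + h (bdry C x)"
    using assms(4) by (auto simp: heq_def homotopic_def)
  obtain s h' where s: "s \<in> R" and h': "linear_on (total C) h'" "\<forall>i. \<forall>x\<in>grade C i. h' x \<in> grade D (i + 1)"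
     "\<forall>x\<in>total C. filt D (h' x) \<le> filt C x + ereal s"
     "\<forall>x\<in>total C. g x - k x = bdry D (h' x) + h' (bdry C x)"
    using assms(5) by (auto simp: heq_def homotopic_def)
  note ht = homotopic_mapsto[OF h(1,2)] homotopic_mapsto[OF h'(1,2)]
  have "filt D (h x + h' x) \<le> filt C x + ereal (max r s)" if x: "x \<in> total C" for x
  proof -
    have "filt D (h x + h' x) \<le> max (filt D (h x)) (filt D (h' x))"
      using fc_add[OF assms(3)] ht x by blast
    also have "\<dots> \<le> filt C x + ereal (max r s)"
      using filt_le_shift[OF assms(2) x _ max.cobounded1] filt_le_shift[OF assms(2) x _ max.cobounded2]
        h(3) h'(3) x by auto
    finally show ?thesis .
  qed
  moreover have "f x - k x = bdry D (h x + h' x) + (h (bdry C x) + h' (bdry C x))" if x: "x \<in> total C" for x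
  proof -
    have "f x - k x = (f x - g x) + (g x - k x)" by simp
    then show ?thesis using h(4) h'(4) x ht[OF x] fc_bdry_add[OF assms(3)] by (simp add: algebra_simps)
  qed
  ultimately have "homotopic (max r s) C D f k"
    unfolding homotopic_def
    by (intro exI[of _ "\<lambda>x. h x + h' x"])
      (use h h' in \<open>auto intro: linear_on_plus vec.subspace_add fc_sub[OF assms(3)]\<close>)
  then show ?thesis using r s assms(1) by (auto simp: heq_def)
qed

lemma heq_trans:
  assumes "shifts R" "filtered_complex C" "filtered_complex D" "heq R C D f g" "heq R C D g k"
  shows "heq R C D f k"
  by (rule heq_trans_max[OF _ assms(2-5)]) (use assms(1) in \<open>simp add: shifts_def\<close>)

lemma heq_comp_left:
  assumes "shifts R" "filtered_complex C" "filtered_complex D" "filtered_complex E"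
    and f: "cmap R C D f" "cmap R C D f'" "heq R C D f f'" and g: "cmap R D E g"
  shows "heq R C E (g \<circ> f) (g \<circ> f')"
proof -
  obtain r h where r: "r \<in> R" and h: "linear_on (total C) h" "\<forall>i. \<forall>x\<in>grade C i. h x \<in> grade D (i + 1)"
     "\<forall>x\<in>total C. filt D (h x) \<le> filt C x + ereal r"
     "\<forall>x\<in>total C. f x - f' x = bdry D (h x) + h (bdry C x)"
    using f(3) by (auto simp: heq_def homotopic_def)
  obtain s where s: "s \<in> R" "chain_map s D E g" using g by (auto simp: cmap_def)
  note ht = homotopic_mapsto[OF h(1,2)]
  have "filt E (g (h x)) \<le> filt C x + ereal (r + s)" if "x \<in> total C" for x
  proof -
    have "filt E (g (h x)) \<le> filt D (h x) + ereal s"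
      using s that ht by (auto simp: chain_map_def)
    also have "\<dots> \<le> (filt C x + ereal r) + ereal s"
      using h that by (intro add_right_mono) auto
    finally show ?thesis by (simp add: add.assoc)
  qed
  moreover have "g (f x) - g (f' x) = bdry E (g (h x)) + g (h (bdry C x))" if x: "x \<in> total C" for x
  proof -
    have "g (f x) - g (f' x) = g (f x - f' x)"
      using linear_on_diff[OF cmapD(1)[OF g]] cmap_total[OF f(1) x] cmap_total[OF f(2) x] by simp
    also have "\<dots> = g (bdry D (h x)) + g (h (bdry C x))"
      using h(4) x ht linear_on_add[OF cmapD(1)[OF g]] fc_bdry_total assms by metis
    finally show ?thesis using cmapD(3)[OF g] ht x by simp
  qed
  moreover have "linear_on (total C) (\<lambda>x. g (h x))"
    by (rule linear_on_comp[OF h(1) _ cmapD(1)[OF g]]) (use ht in auto)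
  ultimately have "homotopic (r + s) C E (g \<circ> f) (g \<circ> f')"
    unfolding homotopic_def
    by (intro exI[of _ "\<lambda>x. g (h x)"]) (use h cmapD(2)[OF g] in auto)
  then show ?thesis using r s assms(1) by (auto simp: heq_def shifts_def)
qed

lemma heq_comp_right:
  assumes "shifts R" "heq R D E g g'" and f: "cmap R C D f"
  shows "heq R C E (g \<circ> f) (g' \<circ> f)"
proof -
  obtain r h where r: "r \<in> R" and h: "linear_on (total D) h" "\<forall>i. \<forall>x\<in>grade D i. h x \<in> grade E (i + 1)"
     "\<forall>x\<in>total D. filt E (h x) \<le> filt D x + ereal r"
     "\<forall>x\<in>total D. g x - g' x = bdry E (h x) + h (bdry D x)"
    using assms(2) by (auto simp: heq_def homotopic_def)
  obtain s where s: "s \<in> R" "chain_map s C D f" using f by (auto simp: cmap_def)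
  note ft = cmap_total[OF f]
  have "filt E (h (f x)) \<le> filt C x + ereal (s + r)" if "x \<in> total C" for x
  proof -
    have "filt E (h (f x)) \<le> filt D (f x) + ereal r"
      using h that ft by auto
    also have "\<dots> \<le> (filt C x + ereal s) + ereal r"
      using s that by (intro add_right_mono) (auto simp: chain_map_def)
    finally show ?thesis by (simp add: add.assoc)
  qed
  moreover have "linear_on (total C) (\<lambda>x. h (f x))"
    by (rule linear_on_comp[OF cmapD(1)[OF f] _ h(1)]) (use ft in auto)
  ultimately have "homotopic (s + r) C E (g \<circ> f) (g' \<circ> f)"
    unfolding homotopic_def
    by (intro exI[of _ "\<lambda>x. h (f x)"]) (use h ft cmapD[OF f] in auto)
  then show ?thesis using r s assms(1) by (auto simp: heq_def shifts_def)
qed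

lemma hclass_alt: "hclass R C D f = {g. cmap R C D g \<and> heq R C D f g}"
  by (simp add: hclass_def cmap_def heq_def)

lemma Hom_alt: "Hom R C D = hclass R C D ` {f. cmap R C D f}"
  by (auto simp: Hom_def cmap_def)

lemma hclass_self: "shifts R \<Longrightarrow> filtered_complex C \<Longrightarrow> filtered_complex D \<Longrightarrow> cmap R C D f \<Longrightarrow> f \<in> hclass R C D f"
  by (auto simp: hclass_alt intro: heq_zeroI)

lemma hclass_eqI:
  assumes "shifts R" "filtered_complex C" "filtered_complex D" "heq R C D f g"
  shows "hclass R C D f = hclass R C D g"
  using assms heq_trans heq_sym unfolding hclass_alt by blast

lemma hclass_eqD:
  assumes "shifts R" "filtered_complex C" "filtered_complex D" "cmap R C D f" "hclass R C D g = hclass R C D f"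
  shows "heq R C D g f"
  using hclass_self[OF assms(1-4)] assms(5) by (auto simp: hclass_alt)

lemma Comp_hclass:
  assumes R: "shifts R" and fc: "filtered_complex A" "filtered_complex B" "filtered_complex C"
    and f: "cmap R A B f" and g: "cmap R B C g"
  shows "Comp R A C (hclass R B C g) (hclass R A B f) = hclass R A C (g \<circ> f)"
proof -
  have "hclass R A C (g' \<circ> f') = hclass R A C (g \<circ> f)"
    if "f' \<in> hclass R A B f" "g' \<in> hclass R B C g" for f' g'
  proof -
    have f': "cmap R A B f'" "heq R A B f f'" and g': "cmap R B C g'" "heq R B C g g'"
      using that by (auto simp: hclass_alt)
    have "heq R A C (g \<circ> f) (g' \<circ> f')"
      using heq_trans[OF R fc(1,3) heq_comp_left[OF R fc f f' g] heq_comp_right[OF R g'(2) f'(1)]] .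
    then show ?thesis using hclass_eqI[OF R fc(1,3)] by blast
  qed
  then show ?thesis
    using hclass_self[OF R fc(1,2) f] hclass_self[OF R fc(2,3) g] unfolding Comp_def by blast
qed

definition hequiv :: "real set \<Rightarrow> 'k::field fcomplex \<Rightarrow> 'k fcomplex \<Rightarrow> ('k vec \<Rightarrow> 'k vec) \<Rightarrow> ('k vec \<Rightarrow> 'k vec) \<Rightarrow> bool" where
  "hequiv R C D f g \<longleftrightarrow> cmap R C D f \<and> cmap R D C g \<and> heq R C C (g \<circ> f) id \<and> heq R D D (f \<circ> g) id"

lemma hequiv_sym: "hequiv R C D f g \<Longrightarrow> hequiv R D C g f"
  by (auto simp: hequiv_def)

lemma Iso_hequiv:
  assumes R: "shifts R" and fc: "filtered_complex C" "filtered_complex D" and "hequiv R C D f g"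
  shows "Iso R C D (hclass R C D f)"
proof -
  have f: "cmap R C D f" and g: "cmap R D C g" and "heq R C C (g \<circ> f) id" "heq R D D (f \<circ> g) id"
    using assms(4) by (auto simp: hequiv_def)
  then have "Comp R C C (hclass R D C g) (hclass R C D f) = hclass R C C id"
    "Comp R D D (hclass R C D f) (hclass R D C g) = hclass R D D id"
    using Comp_hclass[OF R fc fc(1) f g] Comp_hclass[OF R fc(2,1,2) g f]
      hclass_eqI[OF R fc(1,1)] hclass_eqI[OF R fc(2,2)] by auto
  then show ?thesis using f g unfolding Iso_def Hom_alt by blast
qed

lemma hequiv_Iso:
  assumes R: "shifts R" and fc: "filtered_complex C" "filtered_complex D" and "Iso R C D u"
  obtains f g where "hequiv R C D f g"
proof -
  obtain f g where f: "cmap R C D f" "u = hclass R C D f" and g: "cmap R D C g"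
    "Comp R C C (hclass R D C g) u = hclass R C C id" "Comp R D D u (hclass R D C g) = hclass R D D id"
    using assms(4) unfolding Iso_def Hom_alt by blast
  have "hclass R C C (g \<circ> f) = hclass R C C id" "hclass R D D (f \<circ> g) = hclass R D D id"
    using Comp_hclass[OF R fc fc(1) f(1) g(1)] Comp_hclass[OF R fc(2,1,2) g(1) f(1)] f g by auto
  then have "heq R C C (g \<circ> f) id" "heq R D D (f \<circ> g) id"
    using hclass_eqD[OF R fc(1,1) cmap_id[OF R]] hclass_eqD[OF R fc(2,2) cmap_id[OF R]] by auto
  then show thesis using that f g by (auto simp: hequiv_def)
qed

lemma hequiv_mono: "hequiv R C D f g \<Longrightarrow> R \<subseteq> R' \<Longrightarrow> hequiv R' C D f g"
  unfolding hequiv_def cmap_def heq_def by blast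

text \<open>A filtration preserving linear map is injective, since only \<open>0\<close> has level \<open>-\<infinity>\<close>;
  so surjectivity in each degree suffices for a strict isomorphism.\<close>

lemma hequiv_strict:
  assumes R: "shifts R" and fc: "filtered_complex C" "filtered_complex D"
    and lin: "linear_on (total C) f" and gr: "\<And>i. f ` grade C i = grade D i"
    and bd: "\<And>x. x \<in> total C \<Longrightarrow> f (bdry C x) = bdry D (f x)"
    and fi: "\<And>x. x \<in> total C \<Longrightarrow> filt D (f x) = filt C x"
  obtains g where "hequiv R C D f g"
proof -
  have fm: "chain_map 0 C D f" using gr by (intro chain_map_0I) (use lin bd fi in auto)
  note ft = chain_map_total[OF fm]
  have inj: "inj_on f (total C)"
  proof (rule inj_onI)
    fix x y assume xy: "x \<in> total C" "y \<in> total C" "f x = f y"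
    then have "f (x - y) = 0" using linear_on_diff[OF lin] by simp
    then have "filt C (x - y) = -\<infinity>" using fi[OF total_diff[OF xy(1,2)]] fc_0[OF fc(2)] by simp
    then show "x = y" using fc_minf[OF fc(1) total_diff[OF xy(1,2)]] by simp
  qed
  have sub: "vec.subspace (f ` total C)"
    by (rule subspace_image_on[OF lin]) simp
  have surj: "f ` total C = total D"
  proof
    have "grade D i \<subseteq> f ` total C" for i
      unfolding gr[of i, symmetric] by (intro image_mono subsetI grade_total)
    then have "(\<Union>i. grade D i) \<subseteq> f ` total C" by blast
    then show "total D \<subseteq> f ` total C" using vec.span_minimal[OF _ sub] by (simp add: total_def)
  qed (use ft in auto)
  define g where "g = inv_into (total C) f"
  have gf: "g (f x) = x" if "x \<in> total C" for x
    using inj that by (simp add: g_def)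
  have fg: "f (g y) = y" "g y \<in> total C" if "y \<in> total D" for y
    using surj that by (simp_all add: g_def f_inv_into_f inv_into_into)
  have gm: "chain_map 0 D C g"
  proof (rule chain_map_0I)
    show "linear_on (total D) g"
      unfolding linear_on_def
    proof (intro conjI ballI allI)
      fix x y assume xy: "x \<in> total D" "y \<in> total D"
      have "f (g x + g y) = x + y" using linear_on_add[OF lin] fg xy by simp
      then show "g (x + y) = g x + g y" using gf[OF total_add[OF fg(2)[OF xy(1)] fg(2)[OF xy(2)]]] by simp
    next
      fix c x assume x: "x \<in> total D"
      have "f (vscale c (g x)) = vscale c x" using linear_on_scale[OF lin] fg x by simp
      then show "g (vscale c x) = vscale c (g x)" using gf[OF total_scale[OF fg(2)[OF x]]] by metis
    qed
    show "g x \<in> grade C i" if "x \<in> grade D i" for i x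
    proof -
      have "x \<in> f ` grade C i" using that gr[of i] by simp
      then obtain y where y: "y \<in> grade C i" "x = f y" by (elim imageE)
      then show ?thesis using gf[OF grade_total[OF y(1)]] by simp
    qed
    show "g (bdry D x) = bdry C (g x)" if "x \<in> total D" for x
      using bd[OF fg(2)[OF that]] gf[OF fc_bdry_total[OF fc(1) fg(2)[OF that]]] fg(1)[OF that] by simp
    show "filt C (g x) \<le> filt D x" if "x \<in> total D" for x
      using fi[OF fg(2)[OF that]] fg(1)[OF that] by simp
  qed
  have "heq R C C (g \<circ> f) id" "heq R D D (f \<circ> g) id"
    by (rule heq_zeroI[OF R fc(1,1)], simp add: gf, rule heq_zeroI[OF R fc(2,2)], simp add: fg)
  then have "hequiv R C D f g"
    unfolding hequiv_def using cmap_0[OF R fm] cmap_0[OF R gm] by blast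
  then show thesis by (rule that)
qed

section \<open>Cones and the zero complex\<close>

lemma lookup_inl: "Poly_Mapping.lookup (inl x) k = (if even k then Poly_Mapping.lookup x (k div 2) else 0)"
proof -
  have "Poly_Mapping.lookup (inl x) k = (\<Sum>n\<in>Poly_Mapping.keys x. (Poly_Mapping.lookup x n when 2 * n = k))"
    by (simp add: inl_def lookup_sum lookup_single)
  also have "\<dots> = (\<Sum>n\<in>Poly_Mapping.keys x. if n = k div 2 then (Poly_Mapping.lookup x n when even k) else 0)"
    by (intro sum.cong) (auto simp: when_def)
  also have "\<dots> = (if even k then Poly_Mapping.lookup x (k div 2) else 0)"
    by (auto simp: when_def in_keys_iff)
  finally show ?thesis .
qed

lemma lookup_inr: "Poly_Mapping.lookup (inr x) k = (if odd k then Poly_Mapping.lookup x (k div 2) else 0)"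
proof -
  have "Poly_Mapping.lookup (inr x) k = (\<Sum>n\<in>Poly_Mapping.keys x. (Poly_Mapping.lookup x n when 2 * n + 1 = k))"
    by (simp add: inr_def lookup_sum lookup_single)
  also have "\<dots> = (\<Sum>n\<in>Poly_Mapping.keys x. if n = k div 2 then (Poly_Mapping.lookup x n when odd k) else 0)"
    by (intro sum.cong) (auto simp: when_def)
  also have "\<dots> = (if odd k then Poly_Mapping.lookup x (k div 2) else 0)"
    by (auto simp: when_def in_keys_iff)
  finally show ?thesis .
qed

lemma lookup_prl: "Poly_Mapping.lookup (prl z) n = Poly_Mapping.lookup z (2 * n)"
  unfolding prl_def by (subst map_key.rep_eq) (auto intro: injI)

lemma lookup_prr: "Poly_Mapping.lookup (prr z) n = Poly_Mapping.lookup z (2 * n + 1)"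
  unfolding prr_def by (subst map_key.rep_eq) (auto intro: injI)

lemmas lookup_sides = lookup_inl lookup_inr lookup_prl lookup_prr

lemma prl_inl [simp]: "prl (inl x) = x" and prr_inr [simp]: "prr (inr x) = x"
  and prl_inr [simp]: "prl (inr x) = 0" and prr_inl [simp]: "prr (inl x) = 0"
  by (auto intro!: poly_mapping_eqI simp: lookup_sides)

lemma inl_prl_inr_prr [simp]: "inl (prl z) + inr (prr z) = z"
  by (auto intro!: poly_mapping_eqI simp: lookup_sides lookup_add)

lemma side_add [simp]:
  "inl (x + y) = inl x + inl y" "inr (x + y) = inr x + inr y"
  "prl (x + y) = prl x + prl y" "prr (x + y) = prr x + prr y"
  by (auto intro!: poly_mapping_eqI simp: lookup_sides lookup_add)

lemma side_scale [simp]: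
  "inl (vscale c x) = vscale c (inl x)" "inr (vscale c x) = vscale c (inr x)"
  "prl (vscale c x) = vscale c (prl x)" "prr (vscale c x) = vscale c (prr x)"
  by (auto intro!: poly_mapping_eqI simp: lookup_sides)

lemma side_0 [simp]: "inl 0 = 0" "inr 0 = 0" "prl 0 = 0" "prr 0 = 0"
  by (auto intro!: poly_mapping_eqI simp: lookup_sides)

lemma linear_sides:
  "Vector_Spaces.linear vscale vscale inl" "Vector_Spaces.linear vscale vscale inr"
  "Vector_Spaces.linear vscale vscale prl" "Vector_Spaces.linear vscale vscale prr"
  by (simp_all add: Vector_Spaces.linear_iff vec.vector_space_axioms)

lemma linear_on_sides [simp]: "linear_on S inl" "linear_on S inr" "linear_on S prl" "linear_on S prr"
  by (simp_all add: linear_on_def)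

lemma side_neg [simp]: "inl (- x) = - inl x" "inr (- x) = - inr x" "prl (- x) = - prl x" "prr (- x) = - prr x"
  by (rule linear_sides[THEN vp.linear_neg])+

lemma side_diff [simp]: "inl (x - y) = inl x - inl y" "inr (x - y) = inr x - inr y"
  "prl (x - y) = prl x - prl y" "prr (x - y) = prr x - prr y"
  by (rule linear_sides[THEN vp.linear_diff])+

lemma side_sum: "prl (\<Sum>i\<in>F. y i) = (\<Sum>i\<in>F. prl (y i))" "prr (\<Sum>i\<in>F. y i) = (\<Sum>i\<in>F. prr (y i))"
  by (rule linear_sides[THEN vp.linear_sum])+

lemma side_eqI: "prl x = prl y \<Longrightarrow> prr x = prr y \<Longrightarrow> x = y"
  by (metis inl_prl_inr_prr)

lemma side_eq_0_iff: "z = 0 \<longleftrightarrow> prl z = 0 \<and> prr z = 0"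
  using side_eqI[of z 0] by auto

lemma cone_grade: "z \<in> grade (cone A B f) i \<longleftrightarrow> prl z \<in> grade A (i - 1) \<and> prr z \<in> grade B i"
proof
  assume "prl z \<in> grade A (i - 1) \<and> prr z \<in> grade B i"
  then have "\<exists>a b. z = inl a + inr b \<and> a \<in> grade A (i - 1) \<and> b \<in> grade B i"
    by (intro exI[of _ "prl z"] exI[of _ "prr z"]) simp
  then show "z \<in> grade (cone A B f) i"
    by (simp add: cone_def)
qed (auto simp: cone_def)

lemma cone_bdry_sides: "prl (bdry (cone A B f) z) = - bdry A (prl z)"
    "prr (bdry (cone A B f) z) = f (prl z) + bdry B (prr z)"
  by (auto simp: cone_def)

lemma cone_filt: "filt (cone A B f) z = max (filt A (prl z)) (filt B (prr z))"
  by (simp add: cone_def)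

lemma cone_total:
  assumes A: "filtered_complex A" and B: "filtered_complex B"
  shows "z \<in> total (cone A B f) \<longleftrightarrow> prl z \<in> total A \<and> prr z \<in> total B"
proof
  assume z: "z \<in> total (cone A B f)"
  have "prl z \<in> total A"
    by (rule linear_total_total[OF linear_on_sides(3) _ z, where k = "\<lambda>i. i - 1"]) (simp add: cone_grade)
  moreover have "prr z \<in> total B"
    by (rule linear_total_total[OF linear_on_sides(4) _ z, where k = "\<lambda>i. i"]) (simp add: cone_grade)
  ultimately show "prl z \<in> total A \<and> prr z \<in> total B" ..
next
  assume z: "prl z \<in> total A \<and> prr z \<in> total B"
  have "inl x \<in> grade (cone A B f) (i + 1)" if "x \<in> grade A i" for x i
    using that vec.subspace_0[OF fc_sub[OF B]] by (simp add: cone_grade)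
  then have 1: "inl (prl z) \<in> total (cone A B f)"
    using linear_total_total[OF linear_on_sides(1), of A "cone A B f" "\<lambda>i. i + 1"] z by blast
  have "inr x \<in> grade (cone A B f) i" if "x \<in> grade B i" for x i
    using that vec.subspace_0[OF fc_sub[OF A]] by (simp add: cone_grade)
  then have 2: "inr (prr z) \<in> total (cone A B f)"
    using linear_total_total[OF linear_on_sides(2), of B "cone A B f" "\<lambda>i. i"] z by blast
  show "z \<in> total (cone A B f)"
    using total_add[OF 1 2] by simp
qed

lemma filtered_complexI:
  assumes "\<And>i. vec.subspace (grade C i)"
    and "\<And>F y i. finite F \<Longrightarrow> (\<And>i. i \<in> F \<Longrightarrow> y i \<in> grade C i) \<Longrightarrow> (\<Sum>i\<in>F. y i) = 0 \<Longrightarrow> i \<in> F \<Longrightarrow> y i = 0"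
    and "linear_on (total C) (bdry C)"
    and "\<And>i x. x \<in> grade C i \<Longrightarrow> bdry C x \<in> grade C (i - 1)"
    and "\<And>x. x \<in> total C \<Longrightarrow> bdry C (bdry C x) = 0"
    and "\<And>x. x \<in> total C \<Longrightarrow> filt C x \<noteq> \<infinity>"
    and "\<And>x. x \<in> total C \<Longrightarrow> filt C x = -\<infinity> \<longleftrightarrow> x = 0"
    and "\<And>c x. x \<in> total C \<Longrightarrow> c \<noteq> 0 \<Longrightarrow> filt C (vscale c x) = filt C x"
    and "\<And>x y. x \<in> total C \<Longrightarrow> y \<in> total C \<Longrightarrow> filt C (x + y) \<le> max (filt C x) (filt C y)"
    and "\<And>x. x \<in> total C \<Longrightarrow> filt C (bdry C x) \<le> filt C x"
    and "\<And>F y i. finite F \<Longrightarrow> (\<And>i. i \<in> F \<Longrightarrow> y i \<in> grade C i) \<Longrightarrow> i \<in> F \<Longrightarrow> filt C (y i) \<le> filt C (\<Sum>i\<in>F. y i)"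
  shows "filtered_complex C"
proof -
  have 1: "\<forall>F x. finite F \<and> (\<forall>i\<in>F. x i \<in> grade C i) \<and> (\<Sum>i\<in>F. x i) = 0 \<longrightarrow> (\<forall>i\<in>F. x i = 0)"
    by (intro allI impI ballI, elim conjE, rule assms(2)) auto
  have 2: "\<forall>F x. finite F \<and> (\<forall>i\<in>F. x i \<in> grade C i) \<longrightarrow> (\<forall>i\<in>F. filt C (x i) \<le> filt C (\<Sum>i\<in>F. x i))"
    by (intro allI impI ballI, elim conjE, rule assms(11)) auto
  show ?thesis
    unfolding filtered_complex_def chain_complex_def
    by (intro conjI 1 2 allI ballI impI assms(1,3-10)) assumption+
qed

lemma shift_sel [simp]: "grade (shift A) i = grade A (i - 1)" "bdry (shift A) x = - bdry A x"
  "filt (shift A) = filt A"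
  by (simp_all add: shift_def)

lemma total_shift [simp]: "total (shift A) = total A"
proof -
  have "(\<Union>i. grade A (i - 1)) = (\<Union>i. grade A i)"
    by (intro equalityI UN_least UN_upper[of _ UNIV "\<lambda>i. grade A i"] UNIV_I)
      (use UN_upper[of "_ + 1" UNIV "\<lambda>i. grade A (i - 1)"] in simp)
  then show ?thesis by (simp add: total_def)
qed

lemma filtered_translate:
  assumes A: "filtered_complex A" and "\<And>i. grade S i = grade A (i + k)" "\<And>x. bdry S x = - bdry A x"
    "filt S = filt A" "total S = total A"
  shows "filtered_complex S"
proof (rule filtered_complexI)
  show "y i = 0" if h: "finite F" "\<And>i. i \<in> F \<Longrightarrow> y i \<in> grade S i" "sum y F = 0" "i \<in> F" for F y i
  proof -
    have "(\<Sum>j\<in>(\<lambda>i. i + k) ` F. y (j - k)) = sum y F" by (simp add: sum.reindex inj_on_def)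
    moreover have "y (j - k) \<in> grade A j" if "j \<in> (\<lambda>i. i + k) ` F" for j
      using that h(2) assms(2) by auto
    ultimately show ?thesis
      using fc_indep[OF A finite_imageI[OF h(1), of "\<lambda>i. i + k"], of "\<lambda>j. y (j - k)" "i + k"] h(3,4) by simp
  qed
  show "filt S (y i) \<le> filt S (\<Sum>i\<in>F. y i)" if h: "finite F" "\<And>i. i \<in> F \<Longrightarrow> y i \<in> grade S i" "i \<in> F" for F y i
  proof -
    have "(\<Sum>j\<in>(\<lambda>i. i + k) ` F. y (j - k)) = sum y F" by (simp add: sum.reindex inj_on_def)
    moreover have "y (j - k) \<in> grade A j" if "j \<in> (\<lambda>i. i + k) ` F" for j
      using that h(2) assms(2) by auto
    ultimately show ?thesis
      using fc_homog[OF A finite_imageI[OF h(1), of "\<lambda>i. i + k"], of "\<lambda>j. y (j - k)" "i + k"] h(3) assms(4) by simp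
  qed
  show "linear_on (total S) (bdry S)"
    using linear_on_uminus[OF fc_lin[OF A]] assms(3) by (simp add: assms linear_on_def)
  show "bdry S x \<in> grade S (i - 1)" if "x \<in> grade S i" for i x
    using that fc_bdry[OF A, of x "i + k"] vec.subspace_neg[OF fc_sub[OF A]] by (simp add: assms algebra_simps)
  show "vec.subspace (grade S i)" for i using fc_sub[OF A] by (simp add: assms)
  fix x assume "x \<in> total S"
  then have x: "x \<in> total A" by (simp add: assms)
  show "bdry S (bdry S x) = 0"
    using x fc_bdry_neg[OF A] fc_bb[OF A] fc_bdry_total[OF A] by (simp add: assms)
  show "filt S x \<noteq> \<infinity>" "filt S x = -\<infinity> \<longleftrightarrow> x = 0" 
    using x fc_noinf[OF A] fc_minf[OF A] by (simp_all add: assms)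
  show "filt S (vscale c x) = filt S x" if "c \<noteq> 0" for c
    using x that fc_scale[OF A] by (simp add: assms)
  show "filt S (x + y) \<le> max (filt S x) (filt S y)" if "y \<in> total S" for y
    using x that fc_add[OF A] by (simp add: assms)
  show "filt S (bdry S x) \<le> filt S x"
    using x fc_fbdry[OF A] fc_neg[OF A] fc_bdry_total[OF A] by (simp add: assms)
qed

lemma filtered_shift: "filtered_complex A \<Longrightarrow> filtered_complex (shift A)"
  by (erule filtered_translate[where k = "-1"]) auto

lemma cmD:
  assumes "chain_map 0 A B f"
  shows cm_lin: "linear_on (total A) f"
    and cm_grade: "x \<in> grade A i \<Longrightarrow> f x \<in> grade B i"
    and cm_comm: "x \<in> total A \<Longrightarrow> f (bdry A x) = bdry B (f x)"
    and cm_filt: "x \<in> total A \<Longrightarrow> filt B (f x) \<le> filt A x"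
    and cm_total: "x \<in> total A \<Longrightarrow> f x \<in> total B"
  using assms chain_map_total[OF assms] by (simp_all add: chain_map_def)

lemma filtered_cone:
  assumes A: "filtered_complex A" and B: "filtered_complex B" and f: "chain_map 0 A B f"
  shows "filtered_complex (cone A B f)"
proof -
  note ct = cone_total[OF A B, of _ f]
  note fc = fc_bdry_total[OF A] fc_bdry_total[OF B] cm_total[OF f]
  show ?thesis
  proof (rule filtered_complexI)
    show "vec.subspace (grade (cone A B f) i)" for i
      using fc_sub[OF A, of "i - 1"] fc_sub[OF B, of i]
      by (simp add: vec.subspace_def cone_grade Ball_def)
  next
    fix F y i assume h: "finite F" "\<And>i. i \<in> F \<Longrightarrow> y i \<in> grade (cone A B f) i" "sum y F = 0" "i \<in> F"
    have sums: "(\<Sum>j\<in>F. prl (y j)) = 0" "(\<Sum>j\<in>F. prr (y j)) = 0"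
      using h(3) by (simp_all flip: side_sum)
    have g: "prl (y j) \<in> grade (shift A) j" "prr (y j) \<in> grade B j" if "j \<in> F" for j
      using h(2)[OF that] by (simp_all add: cone_grade)
    have "prl (y i) = 0"
      by (rule fc_indep[OF filtered_shift[OF A] h(1) g(1) sums(1) h(4)])
    moreover have "prr (y i) = 0"
      by (rule fc_indep[OF B h(1) g(2) sums(2) h(4)])
    ultimately show "y i = 0" using side_eq_0_iff[of "y i"] by blast
  next
    fix F y i assume h: "finite F" "\<And>i. i \<in> F \<Longrightarrow> y i \<in> grade (cone A B f) i" "i \<in> F"
    have g: "prl (y j) \<in> grade (shift A) j" "prr (y j) \<in> grade B j" if "j \<in> F" for j
      using h(2)[OF that] by (simp_all add: cone_grade)
    have "filt A (prl (y i)) \<le> filt A (prl (sum y F))"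
      using fc_homog[OF filtered_shift[OF A] h(1) g(1) h(3)] by (simp add: side_sum)
    moreover have "filt B (prr (y i)) \<le> filt B (prr (sum y F))"
      using fc_homog[OF B h(1) g(2) h(3)] by (simp add: side_sum)
    ultimately show "filt (cone A B f) (y i) \<le> filt (cone A B f) (\<Sum>i\<in>F. y i)"
      unfolding cone_filt by (rule max.mono)
  next
    show "linear_on (total (cone A B f)) (bdry (cone A B f))"
      unfolding linear_on_def
      by (intro conjI ballI allI; rule side_eqI;
        simp add: ct cone_bdry_sides fc_bdry_add[OF A] fc_bdry_add[OF B] fc_bdry_scale[OF A] fc_bdry_scale[OF B]
          linear_on_add[OF cm_lin[OF f]] linear_on_scale[OF cm_lin[OF f]] vec.scale_right_distrib algebra_simps)
  next
    show "bdry (cone A B f) x \<in> grade (cone A B f) (i - 1)" if "x \<in> grade (cone A B f) i" for i x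
      using that fc_bdry[OF A, of "prl x" "i - 1"] fc_bdry[OF B, of "prr x" i] cm_grade[OF f, of "prl x" "i - 1"]
        vec.subspace_neg[OF fc_sub[OF A]] vec.subspace_add[OF fc_sub[OF B]]
      by (simp add: cone_grade cone_bdry_sides)
  next
    show "bdry (cone A B f) (bdry (cone A B f) x) = 0" if "x \<in> total (cone A B f)" for x
    proof (rule side_eqI)
      have x: "prl x \<in> total A" "prr x \<in> total B" using that by (auto simp: ct)
      show "prl (bdry (cone A B f) (bdry (cone A B f) x)) = prl 0"
        using x fc by (simp add: cone_bdry_sides fc_bdry_neg[OF A] fc_bb[OF A])
      show "prr (bdry (cone A B f) (bdry (cone A B f) x)) = prr 0"
        using x fc by (simp add: cone_bdry_sides fc_bb[OF B] fc_bdry_add[OF B] linear_on_neg[OF cm_lin[OF f]] cm_comm[OF f])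
    qed
  next
    fix x assume "x \<in> total (cone A B f)"
    then have x: "prl x \<in> total A" "prr x \<in> total B" by (auto simp: ct)
    show "filt (cone A B f) x \<noteq> \<infinity>"
      using fc_noinf[OF A x(1)] fc_noinf[OF B x(2)] by (simp add: cone_filt max_def)
    show "filt (cone A B f) x = -\<infinity> \<longleftrightarrow> x = 0"
    proof -
      have "max a b = -\<infinity> \<longleftrightarrow> a = -\<infinity> \<and> b = -\<infinity>" for a b :: ereal by (auto simp: max_def)
      then show ?thesis using fc_minf[OF A x(1)] fc_minf[OF B x(2)] by (simp add: cone_filt side_eq_0_iff[of x])
    qed
    show "filt (cone A B f) (vscale c x) = filt (cone A B f) x" if "c \<noteq> 0" for c
      using fc_scale[OF A x(1) that] fc_scale[OF B x(2) that] by (simp add: cone_filt)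
    show "filt (cone A B f) (x + y) \<le> max (filt (cone A B f) x) (filt (cone A B f) y)"
      if "y \<in> total (cone A B f)" for y
    proof -
      have y: "prl y \<in> total A" "prr y \<in> total B" using that by (auto simp: ct)
      show ?thesis
        using fc_add[OF A x(1) y(1)] fc_add[OF B x(2) y(2)] by (auto simp: cone_filt le_max_iff_disj)
    qed
    show "filt (cone A B f) (bdry (cone A B f) x) \<le> filt (cone A B f) x"
    proof -
      have "filt B (f (prl x) + bdry B (prr x)) \<le> max (filt A (prl x)) (filt B (prr x))"
        using fc_add[OF B fc(3)[OF x(1)] fc(2)[OF x(2)]] fc_fbdry[OF B x(2)] cm_filt[OF f x(1)]
        by (meson dual_order.trans max.mono)
      moreover have "filt A (- bdry A (prl x)) \<le> max (filt A (prl x)) (filt B (prr x))"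
        using fc_fbdry[OF A x(1)] fc_neg[OF A fc(1)[OF x(1)]] by (simp add: le_max_iff_disj)
      ultimately show ?thesis by (simp add: cone_filt cone_bdry_sides)
    qed
  qed
qed

definition zeroC :: "'k::field fcomplex" where
  "zeroC = \<lparr>grade = (\<lambda>_. {0}), bdry = (\<lambda>_. 0), filt = (\<lambda>x. if x = 0 then -\<infinity> else 0)\<rparr>"

lemma total_zeroC [simp]: "total zeroC = {0}"
  by (simp add: total_def zeroC_def)

lemma zeroC_sel [simp]: "grade zeroC i = {0}" "bdry zeroC x = 0" "filt zeroC 0 = -\<infinity>"
  by (simp_all add: zeroC_def)

lemma filtered_zeroC [simp]: "filtered_complex zeroC"
  by (rule filtered_complexI) (auto simp: zeroC_def total_def linear_on_def)

text \<open>The inverse of the shift; a short exact sequence is a cone only after desuspending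
  the quotient.\<close>

definition desusp :: "'k::field fcomplex \<Rightarrow> 'k fcomplex" where
  "desusp A = \<lparr>grade = (\<lambda>i. grade A (i + 1)), bdry = (\<lambda>x. - bdry A x), filt = filt A\<rparr>"

lemma desusp_sel [simp]: "grade (desusp A) i = grade A (i + 1)" "bdry (desusp A) x = - bdry A x"
  "filt (desusp A) = filt A"
  by (simp_all add: desusp_def)

lemma total_desusp [simp]: "total (desusp A) = total A"
proof -
  have "(\<Union>i. grade A (i + 1)) = (\<Union>i. grade A i)"
    by (intro equalityI UN_least UN_upper[of _ UNIV "\<lambda>i. grade A i"] UNIV_I)
      (use UN_upper[of "_ - 1" UNIV "\<lambda>i. grade A (i + 1)"] in simp)
  then show ?thesis by (simp add: total_def)
qed

lemma filtered_desusp: "filtered_complex A \<Longrightarrow> filtered_complex (desusp A)"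
  by (erule filtered_translate[where k = 1]) auto

section \<open>Relations in the Grothendieck groups\<close>

lemma hequiv_trans:
  assumes R: "shifts R" and fc: "filtered_complex C" "filtered_complex D" "filtered_complex E"
    and 1: "hequiv R C D f g" and 2: "hequiv R D E f' g'"
  shows "hequiv R C E (f' \<circ> f) (g \<circ> g')"
proof -
  have c: "cmap R C D f" "cmap R D C g" "cmap R D E f'" "cmap R E D g'"
    and h: "heq R C C (g \<circ> f) id" "heq R D D (f \<circ> g) id" "heq R D D (g' \<circ> f') id" "heq R E E (f' \<circ> g') id"
    using 1 2 by (auto simp: hequiv_def)
  have "heq R C C (g \<circ> ((g' \<circ> f') \<circ> f)) (g \<circ> (id \<circ> f))"
    by (rule heq_comp_left[OF R fc(1,2,1) cmap_comp[OF R c(1) cmap_comp[OF R c(3,4)]]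
      cmap_comp[OF R c(1) cmap_id[OF R]] heq_comp_right[OF R h(3) c(1)] c(2)])
  then have a: "heq R C C ((g \<circ> g') \<circ> (f' \<circ> f)) id"
    using heq_trans[OF R fc(1,1) _ h(1)] by (simp add: comp_assoc)
  have "heq R E E (f' \<circ> ((f \<circ> g) \<circ> g')) (f' \<circ> (id \<circ> g'))"
    by (rule heq_comp_left[OF R fc(3,2,3) cmap_comp[OF R c(4) cmap_comp[OF R c(2,1)]]
      cmap_comp[OF R c(4) cmap_id[OF R]] heq_comp_right[OF R h(2) c(4)] c(3)])
  then have b: "heq R E E ((f' \<circ> f) \<circ> (g \<circ> g')) id"
    using heq_trans[OF R fc(3,3) _ h(4)] by (simp add: comp_assoc)
  show ?thesis
    unfolding hequiv_def using a b cmap_comp[OF R c(1,3)] cmap_comp[OF R c(4,2)] by blast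
qed

lemma hequiv_id: "shifts R \<Longrightarrow> filtered_complex C \<Longrightarrow> hequiv R C C id id"
  unfolding hequiv_def by (simp add: cmap_id heq_zeroI)

text \<open>A homotopy, with its sign changed, serves for the shifted complexes. This inclusion
  is all that the last square of a morphism of triangles needs.\<close>

lemma hclass_shift:
  assumes A: "filtered_complex A" and B: "filtered_complex B"
  shows "hclass R A B f \<subseteq> hclass R (shift A) (shift B) f"
proof -
  have cm: "chain_map r (shift A) (shift B) g" if g: "chain_map r A B g" for r g
    using g linear_on_neg[of "total A" g] fc_bdry_total[OF A] by (auto simp: chain_map_def)
  moreover have "homotopic r (shift A) (shift B) f g" if fg: "homotopic r A B f g" for r g
  proof -
    obtain h where h: "linear_on (total A) h" "\<forall>i. \<forall>x\<in>grade A i. h x \<in> grade B (i + 1)"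
     "\<forall>x\<in>total A. filt B (h x) \<le> filt A x + ereal r"
     "\<forall>x\<in>total A. f x - g x = bdry B (h x) + h (bdry A x)"
      using fg unfolding homotopic_def by blast
    note ht = homotopic_mapsto[OF h(1,2)]
    have "f x - g x = - bdry B (- h x) + - h (- bdry A x)" if x: "x \<in> total A" for x
      using h(4) x fc_bdry_neg[OF B ht[OF x]] linear_on_neg[OF h(1) fc_bdry_total[OF A x]] by simp
    moreover have "- h x \<in> grade B (i + 1 - 1)" if "x \<in> grade A (i - 1)" for x i
      using vec.subspace_neg[OF fc_sub[OF B] h(2)[rule_format, OF that]] by simp
    ultimately show ?thesis
      unfolding homotopic_def using h(1,3) ht
      by (intro exI[of _ "\<lambda>x. - h x"]) (simp add: linear_on_uminus fc_neg[OF B])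
  qed
  ultimately show ?thesis unfolding hclass_def by blast
qed

text \<open>The properties common to the finitely generated, the tame and the acyclic complexes
  from which triangles between their objects are built.\<close>

definition obj_class :: "'k::field fcomplex set \<Rightarrow> bool" where
  "obj_class Ob \<longleftrightarrow> (\<forall>C\<in>Ob. filtered_complex C) \<and> zeroC \<in> Ob \<and> (\<forall>C\<in>Ob. desusp C \<in> Ob)"

lemma obj_classD:
  assumes "obj_class Ob"
  shows "C \<in> Ob \<Longrightarrow> filtered_complex C" "zeroC \<in> Ob" "C \<in> Ob \<Longrightarrow> desusp C \<in> Ob"
  using assms by (auto simp: obj_class_def)

lemma carrier_free: "x \<in> carrier (free_Abelian_group Ob) \<longleftrightarrow> Poly_Mapping.keys x \<subseteq> Ob"
  by (simp add: free_Abelian_group_def)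

lemma exact_triangles_Ob: "(A, B, C, u, v, w) \<in> exact_triangles R Ob \<Longrightarrow> A \<in> Ob \<and> B \<in> Ob \<and> C \<in> Ob"
  by (auto simp: exact_triangles_def)

lemma relations_subgroup: "subgroup (relations R Ob) (free_Abelian_group Ob)"
  unfolding relations_def
proof (rule group.generate_is_subgroup[OF group_free_Abelian_group], rule subsetI)
  fix x assume "x \<in> {frag_of A - frag_of B + frag_of C |A B C u v w. (A, B, C, u, v, w) \<in> exact_triangles R Ob}"
  then obtain A B C u v w where x: "x = frag_of A - frag_of B + frag_of C" "(A, B, C, u, v, w) \<in> exact_triangles R Ob"
    by blast
  have "Poly_Mapping.keys x \<subseteq> {A, B, C}"
    unfolding x using keys_diff[of "frag_of A" "frag_of B"] keys_add[of "frag_of A - frag_of B" "frag_of C"] by auto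
  then show "x \<in> carrier (free_Abelian_group Ob)"
    using exact_triangles_Ob[OF x(2)] unfolding carrier_free by blast
qed

lemma rel_carrier: "x \<in> relations R Ob \<Longrightarrow> Poly_Mapping.keys x \<subseteq> Ob"
  using subgroup.mem_carrier[OF relations_subgroup] by (simp add: carrier_free)

lemma rel_0: "0 \<in> relations R Ob"
  using subgroup.one_closed[OF relations_subgroup[of R Ob]] by simp

lemma rel_add:
  assumes "x \<in> relations R Ob" "y \<in> relations R Ob" shows "x + y \<in> relations R Ob"
  using subgroup.m_closed[OF relations_subgroup assms] by simp

lemma rel_neg:
  assumes "x \<in> relations R Ob" shows "- x \<in> relations R Ob"
  using subgroup.m_inv_closed[OF relations_subgroup assms] inv_free_Abelian_group[OF rel_carrier[OF assms]]
  by simp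

lemma rel_diff:
  assumes "x \<in> relations R Ob" "y \<in> relations R Ob" shows "x - y \<in> relations R Ob"
  using rel_add[OF assms(1) rel_neg[OF assms(2)]] by simp

lemma rel_gen: "(A, B, C, u, v, w) \<in> exact_triangles R Ob \<Longrightarrow> frag_of A - frag_of B + frag_of C \<in> relations R Ob"
  unfolding relations_def by (rule generate.incl, rule CollectI, intro exI conjI, rule refl)

lemma rel_cong: "x \<in> relations R Ob \<Longrightarrow> x = y \<Longrightarrow> y \<in> relations R Ob"
  by simp

lemma rel_induct [consumes 1, case_names gen zero diff]:
  assumes "x \<in> relations R Ob"
    and gen: "\<And>A B C u v w. (A, B, C, u, v, w) \<in> exact_triangles R Ob \<Longrightarrow> P (frag_of A - frag_of B + frag_of C)"
    and zero: "P 0" and diff: "\<And>x y. P x \<Longrightarrow> P y \<Longrightarrow> P (x - y)"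
  shows "P x"
proof -
  have neg: "P (- y)" if "P y" for y using diff[OF zero that] by simp
  have add: "P (y + z)" if "P y" "P z" for y z using diff[OF that(1) neg[OF that(2)]] by simp
  let ?G = "{frag_of A - frag_of B + frag_of C |A B C u v w. (A, B, C, u, v, w) \<in> exact_triangles R Ob}"
  have "x \<in> generate (free_Abelian_group Ob) ?G" using assms(1) by (simp add: relations_def)
  then show ?thesis
  proof induction
    case one then show ?case using zero by (simp add: free_Abelian_group_def)
  next
    case (incl h) then show ?case using gen by blast
  next
    case (inv h)
    have "h \<in> relations R Ob" unfolding relations_def by (rule generate.incl[OF inv])
    then have "inv\<^bsub>free_Abelian_group Ob\<^esub> h = - h" by (rule inv_free_Abelian_group[OF rel_carrier])
    moreover have "P h" using inv gen by blast
    ultimately show ?case using neg by simp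
  next
    case (eng h1 h2) then show ?case using add by (simp add: free_Abelian_group_def)
  qed
qed

text \<open>Every homotopy equivalence from a mapping cone to an object \<open>C\<close> completes to an exact
  triangle ending in \<open>C\<close>.\<close>

lemma rel_cone:
  assumes R: "shifts R" and fc: "filtered_complex A" "filtered_complex B" "filtered_complex C"
    and Ob: "A \<in> Ob" "B \<in> Ob" "C \<in> Ob"
    and f: "chain_map 0 A B f" and pq: "hequiv R (cone A B f) C p q"
  shows "frag_of A - frag_of B + frag_of C \<in> relations R Ob"
proof -
  let ?K = "cone A B f"
  have K: "filtered_complex ?K" by (rule filtered_cone[OF fc(1,2) f])
  have S: "filtered_complex (shift A)" by (rule filtered_shift[OF fc(1)])
  have p: "cmap R ?K C p" and q: "cmap R C ?K q" and qp: "heq R ?K ?K (q \<circ> p) id"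
    using pq by (auto simp: hequiv_def)
  have f': "cmap R A B f" by (rule cmap_0[OF R f])
  have inr: "cmap R B ?K inr"
  proof (rule cmap_0[OF R chain_map_0I])
    show "inr x \<in> grade ?K i" if "x \<in> grade B i" for x i
      using that vec.subspace_0[OF fc_sub[OF fc(1)]] by (simp add: cone_grade)
    show "inr (bdry B x) = bdry ?K (inr x)" for x
      by (rule side_eqI) (simp_all add: cone_bdry_sides fc_bdry_0[OF fc(1)] linear_on_0[OF cm_lin[OF f] total_0])
    show "filt ?K (inr x) \<le> filt B x" for x
      by (simp add: cone_filt fc_0[OF fc(1)])
  qed simp
  have prl: "cmap R ?K (shift A) prl"
  proof (rule cmap_0[OF R chain_map_0I])
    show "prl x \<in> grade (shift A) i" if "x \<in> grade ?K i" for x i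
      using that by (simp add: cone_grade)
    show "prl (bdry ?K x) = bdry (shift A) (prl x)" for x
      by (simp add: cone_bdry_sides)
    show "filt (shift A) (prl x) \<le> filt ?K x" for x
      by (simp add: cone_filt)
  qed simp
  let ?u = "hclass R A B f" and ?v = "hclass R B C (p \<circ> inr)" and ?w = "hclass R C (shift A) (prl \<circ> q)"
  have v: "cmap R B C (p \<circ> inr)" by (rule cmap_comp[OF R inr p])
  have w: "cmap R C (shift A) (prl \<circ> q)" by (rule cmap_comp[OF R q prl])
  have 1: "Comp R A B (hclass R B B id) ?u = Comp R A B ?u (hclass R A A id)"
    using Comp_hclass[OF R fc(1,2,2) f' cmap_id[OF R]] Comp_hclass[OF R fc(1,1,2) cmap_id[OF R] f'] by simp
  have 2: "Comp R B ?K (hclass R C ?K q) ?v = Comp R B ?K (hclass R B ?K inr) (hclass R B B id)"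
  proof -
    have "heq R B ?K (q \<circ> (p \<circ> inr)) inr"
      using heq_comp_right[OF R qp inr] by (simp add: comp_assoc)
    then have "hclass R B ?K (q \<circ> (p \<circ> inr)) = hclass R B ?K inr"
      by (rule hclass_eqI[OF R fc(2) K])
    then show ?thesis
      using Comp_hclass[OF R fc(2,3) K v q] Comp_hclass[OF R fc(2,2) K cmap_id[OF R] inr] by simp
  qed
  \<comment> \<open>The class of the identity of \<open>A\<close> lies in that of the identity
    of \<open>shift A\<close> and contains the identity, which is enough to determine the
    composite.\<close>
  have 3: "Comp R C (shift A) (hclass R A A id) ?w = Comp R C (shift A) (hclass R ?K (shift A) prl) (hclass R C ?K q)"
  proof -
    have "Comp R C (shift A) (hclass R A A id) ?w \<subseteq> Comp R C (shift A) (hclass R (shift A) (shift A) id) ?w"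
      using hclass_shift[OF fc(1,1)] unfolding Comp_def by blast
    also have "\<dots> = hclass R C (shift A) (prl \<circ> q)"
      using Comp_hclass[OF R fc(3) S S w cmap_id[OF R]] by simp
    finally have "Comp R C (shift A) (hclass R A A id) ?w \<subseteq> hclass R C (shift A) (prl \<circ> q)" .
    moreover have "hclass R C (shift A) (id \<circ> (prl \<circ> q)) \<subseteq> Comp R C (shift A) (hclass R A A id) ?w"
      using hclass_self[OF R fc(1,1) cmap_id[OF R]] hclass_self[OF R fc(3) S w] unfolding Comp_def by blast
    ultimately show ?thesis
      using Comp_hclass[OF R fc(3) K S q prl] by simp
  qed
  have iso: "Iso R A A (hclass R A A id)" "Iso R B B (hclass R B B id)" "Iso R C ?K (hclass R C ?K q)"
    using Iso_hequiv[OF R _ _ hequiv_id[OF R]] fc Iso_hequiv[OF R fc(3) K hequiv_sym[OF pq]] by blast+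
  have "triangle_iso R (A, B, C, ?u, ?v, ?w) (cone_triangle R A B f)"
    unfolding cone_triangle_def triangle_iso.simps using iso 1 2 3 by blast
  then have "(A, B, C, ?u, ?v, ?w) \<in> exact_triangles R Ob"
    unfolding exact_triangles_def Hom_alt using Ob f f' v w by blast
  then show ?thesis by (rule rel_gen)
qed

lemma cone_zero_left:
  assumes R: "shifts R" and B: "filtered_complex B"
  obtains q where "hequiv R (cone zeroC B (\<lambda>_. 0)) B prr q"
proof -
  have cm: "chain_map 0 zeroC B (\<lambda>_. 0)"
    by (rule chain_map_0I) (use fc_bdry_0[OF B] vec.subspace_0[OF fc_sub[OF B]] fc_0[OF B] in simp_all)
  show thesis
  proof (rule hequiv_strict[OF R filtered_cone[OF filtered_zeroC B cm] B])
    show "prr ` grade (cone zeroC B (\<lambda>_. 0)) i = grade B i" for i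
    proof (intro equalityI subsetI)
      fix x assume "x \<in> grade B i"
      then have "inr x \<in> grade (cone zeroC B (\<lambda>_. 0)) i" by (simp add: cone_grade)
      then show "x \<in> prr ` grade (cone zeroC B (\<lambda>_. 0)) i" by (metis imageI prr_inr)
    qed (auto simp: cone_grade)
    show "prr (bdry (cone zeroC B (\<lambda>_. 0)) x) = bdry B (prr x)" for x
      by (simp add: cone_bdry_sides)
    show "filt B (prr x) = filt (cone zeroC B (\<lambda>_. 0)) x" if "x \<in> total (cone zeroC B (\<lambda>_. 0))" for x
      using that by (simp add: cone_filt cone_total[OF filtered_zeroC B])
  qed (use that in simp_all)
qed

lemma cone_zero_right:
  assumes R: "shifts R" and B: "filtered_complex B"
  obtains q where "hequiv R (cone (desusp B) zeroC (\<lambda>_. 0)) B prl q"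
proof -
  have cm: "chain_map 0 (desusp B) zeroC (\<lambda>_. 0)"
    by (rule chain_map_0I) simp_all
  let ?K = "cone (desusp B) zeroC (\<lambda>_. 0)"
  show thesis
  proof (rule hequiv_strict[OF R filtered_cone[OF filtered_desusp[OF B] filtered_zeroC cm] B])
    show "prl ` grade ?K i = grade B i" for i
    proof (intro equalityI subsetI)
      fix x assume "x \<in> grade B i"
      then have "inl x \<in> grade ?K i" by (simp add: cone_grade)
      then show "x \<in> prl ` grade ?K i" by (metis imageI prl_inl)
    qed (auto simp: cone_grade)
    show "prl (bdry ?K x) = bdry B (prl x)" for x
      by (simp add: cone_bdry_sides)
    show "filt B (prl x) = filt ?K x" if "x \<in> total ?K" for x
      using that by (simp add: cone_filt cone_total[OF filtered_desusp[OF B] filtered_zeroC])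
  qed (use that in simp_all)
qed

text \<open>The cone of \<open>0 \<rightarrow> A'\<close> is \<open>A'\<close>, hence also
  equivalent to \<open>A\<close>; this triangle gives \<open>[0] - [A'] + [A] = 0\<close>. For
  the zero complex itself it says \<open>[0] = 0\<close>.\<close>

lemma rel_iso:
  assumes Ob: "obj_class Ob" and R: "shifts R" and A: "A \<in> Ob" "A' \<in> Ob" and fg: "hequiv R A A' f g"
  shows "frag_of A - frag_of A' \<in> relations R Ob"
    and rel_zero: "frag_of (zeroC :: 'k::field fcomplex) \<in> relations R Ob"
proof -
  note O = obj_classD[OF Ob]
  have z: "chain_map 0 zeroC B (\<lambda>_. 0)" if "filtered_complex B" for B :: "'k fcomplex"
    by (rule chain_map_0I) (use fc_bdry_0[OF that] vec.subspace_0[OF fc_sub[OF that]] fc_0[OF that] in simp_all)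
  have key: "frag_of zeroC - frag_of B' + frag_of B \<in> relations R Ob"
    if B: "B \<in> Ob" "B' \<in> Ob" and hk: "hequiv R B' B h k" for B B' :: "'k fcomplex" and h k
  proof -
    have fB: "filtered_complex B" and fB': "filtered_complex B'" using O(1) B by auto
    obtain q where q: "hequiv R (cone zeroC B' (\<lambda>_. 0)) B' prr q"
      using cone_zero_left[OF R fB'] by blast
    show ?thesis
      by (rule rel_cone[OF R filtered_zeroC fB' fB O(2) B(2,1) z[OF fB']
        hequiv_trans[OF R filtered_cone[OF filtered_zeroC fB' z[OF fB']] fB' fB q hk]])
  qed
  have 0: "frag_of (zeroC :: 'k fcomplex) \<in> relations R Ob"
    by (rule rel_cong[OF key[OF O(2) O(2) hequiv_id[OF R filtered_zeroC]]]) simp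
  then show "frag_of zeroC \<in> relations R Ob" .
  show "frag_of A - frag_of A' \<in> relations R Ob"
    by (rule rel_cong[OF rel_diff[OF key[OF A hequiv_sym[OF fg]] 0]]) simp
qed

lemma rel_zeroC: "obj_class Ob \<Longrightarrow> shifts R \<Longrightarrow> frag_of (zeroC :: 'k::field fcomplex) \<in> relations R Ob"
  by (rule rel_zero[OF _ _ obj_classD(2) obj_classD(2) hequiv_id]) simp_all

text \<open>The cone of a map to the zero complex is the shift of its source.\<close>

lemma rel_desusp:
  assumes Ob: "obj_class Ob" and R: "shifts R" and B: "B \<in> Ob"
  shows "frag_of (desusp B) + frag_of B \<in> relations R Ob"
proof -
  note O = obj_classD[OF Ob]
  have cm: "chain_map 0 (desusp B) zeroC (\<lambda>_. 0)"
    by (rule chain_map_0I) simp_all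
  obtain q where q: "hequiv R (cone (desusp B) zeroC (\<lambda>_. 0)) B prl q"
    using cone_zero_right[OF R O(1)[OF B]] by blast
  have "frag_of (desusp B) - frag_of zeroC + frag_of B \<in> relations R Ob"
    by (rule rel_cone[OF R filtered_desusp[OF O(1)[OF B]] filtered_zeroC O(1)[OF B] O(3)[OF B] O(2) B cm q])
  from rel_add[OF this rel_zeroC[OF Ob R]] show ?thesis by (rule rel_cong) simp
qed

text \<open>A degreewise split short exact sequence \<open>A \<rightarrow> C \<rightarrow> B\<close> whose splitting \<open>\<beta>\<close> is compatible
  with the filtrations. The splitting need not be a chain map: its defect \<open>\<theta>\<close> is the map whose
  cone is \<open>C\<close>.\<close>

lemma rel_exact:
  assumes Ob: "obj_class Ob" and R: "shifts R" and ABC: "A \<in> Ob" "B \<in> Ob" "C \<in> Ob"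
    and lin: "linear_on (total A) \<alpha>" "linear_on (total B) \<beta>" "linear_on (total B) \<theta>"
    and gr: "\<And>i x. x \<in> grade A i \<Longrightarrow> \<alpha> x \<in> grade C i" "\<And>i x. x \<in> grade B i \<Longrightarrow> \<beta> x \<in> grade C i"
      "\<And>i x. x \<in> grade B i \<Longrightarrow> \<theta> x \<in> grade A (i - 1)"
    and bd: "\<And>x. x \<in> total A \<Longrightarrow> bdry C (\<alpha> x) = \<alpha> (bdry A x)"
      "\<And>x. x \<in> total B \<Longrightarrow> bdry C (\<beta> x) = \<beta> (bdry B x) + \<alpha> (\<theta> x)"
    and fi: "\<And>x y. x \<in> total A \<Longrightarrow> y \<in> total B \<Longrightarrow> filt C (\<alpha> x + \<beta> y) = max (filt A x) (filt B y)"
    and sp: "\<And>i z. z \<in> grade C i \<Longrightarrow> \<exists>x\<in>grade A i. \<exists>y\<in>grade B i. z = \<alpha> x + \<beta> y"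
  shows "frag_of C - frag_of A - frag_of B \<in> relations R Ob"
proof -
  note O = obj_classD[OF Ob]
  have A: "filtered_complex A" and B: "filtered_complex B" and C: "filtered_complex C" using O ABC by auto
  have at: "\<alpha> x \<in> total C" if "x \<in> total A" for x by (rule linear_total_total[OF lin(1) gr(1) that])
  have bt: "\<beta> x \<in> total C" if "x \<in> total B" for x by (rule linear_total_total[OF lin(2) gr(2) that])
  have tt: "\<theta> x \<in> total A" if "x \<in> total B" for x by (rule linear_total_total[OF lin(3) gr(3) that])
  note ab = fc_bdry_total[OF A] note bb = fc_bdry_total[OF B]
  have a0: "\<alpha> 0 = 0" and b0: "\<beta> 0 = 0" by (auto intro: linear_on_0 lin total_0)
  have inj: "x = 0" if "x \<in> total A" "\<alpha> x = 0" for x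
    using fi[OF that(1) total_0] that fc_0[OF C] b0 fc_0[OF B] fc_minf[OF A that(1)] by simp
  \<comment> \<open>The defect anticommutes with the differentials because the square of the
    differential of \<open>C\<close> is zero; the sign is absorbed by the desuspension.\<close>
  have \<theta>: "chain_map 0 (desusp B) A \<theta>"
  proof (rule chain_map_0I)
    show "\<theta> x \<in> grade A i" if "x \<in> grade (desusp B) i" for x i
      using gr(3)[of x "i + 1"] that by simp
    show "\<theta> (bdry (desusp B) x) = bdry A (\<theta> x)" if "x \<in> total (desusp B)" for x
    proof -
      have x: "x \<in> total B" using that by simp
      have "0 = bdry C (bdry C (\<beta> x))" using fc_bb[OF C bt[OF x]] by simp
      also have "\<dots> = bdry C (\<beta> (bdry B x)) + bdry C (\<alpha> (\<theta> x))"
        using bd(2)[OF x] fc_bdry_add[OF C bt[OF bb[OF x]] at[OF tt[OF x]]] by simp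
      also have "\<dots> = \<alpha> (\<theta> (bdry B x)) + \<alpha> (bdry A (\<theta> x))"
        using bd(2)[OF bb[OF x]] bd(1)[OF tt[OF x]] fc_bb[OF B x] b0 by simp
      also have "\<dots> = \<alpha> (\<theta> (bdry B x) + bdry A (\<theta> x))"
        using linear_on_add[OF lin(1) tt[OF bb[OF x]] ab[OF tt[OF x]]] by simp
      finally have "\<theta> (bdry B x) + bdry A (\<theta> x) = 0"
        using inj[OF total_add[OF tt[OF bb[OF x]] ab[OF tt[OF x]]]] by simp
      then have "bdry A (\<theta> x) = - \<theta> (bdry B x)" by (simp add: add_eq_0_iff)
      then show ?thesis using linear_on_neg[OF lin(3) bb[OF x]] by simp
    qed
    show "filt A (\<theta> x) \<le> filt (desusp B) x" if "x \<in> total (desusp B)" for x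
    proof -
      have x: "x \<in> total B" using that by simp
      have "filt A (\<theta> x) \<le> filt C (\<alpha> (\<theta> x) + \<beta> (bdry B x))"
        using fi[OF tt[OF x] bb[OF x]] by simp
      also have "\<dots> = filt C (bdry C (\<beta> x))" using bd(2)[OF x] by (simp add: add.commute)
      also have "\<dots> \<le> filt C (\<beta> x)" by (rule fc_fbdry[OF C bt[OF x]])
      also have "\<dots> = filt B x" using fi[OF total_0 x] a0 fc_0[OF A] by simp
      finally show ?thesis by simp
    qed
  qed (use lin in simp)
  let ?K = "cone (desusp B) A \<theta>"
  have K: "filtered_complex ?K" by (rule filtered_cone[OF filtered_desusp[OF B] A \<theta>])
  note Kt = cone_total[OF filtered_desusp[OF B] A, of _ \<theta>, simplified]
  \<comment> \<open>The cone has the source of \<open>\<theta>\<close> in its left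
    component.\<close>
  define \<Psi> where "\<Psi> = (\<lambda>z. \<alpha> (prr z) + \<beta> (prl z))"
  have "linear_on (total ?K) \<Psi>"
    unfolding \<Psi>_def
    by (rule linear_on_plus; rule linear_on_comp[OF _ _ lin(1)] linear_on_comp[OF _ _ lin(2)]) (auto simp: Kt)
  moreover have "\<Psi> ` grade ?K i = grade C i" for i
  proof (intro equalityI subsetI)
    fix x assume "x \<in> \<Psi> ` grade ?K i"
    then obtain z where z: "z \<in> grade ?K i" "x = \<Psi> z" by blast
    then show "x \<in> grade C i"
      using gr(1)[of "prr z" i] gr(2)[of "prl z" i] vec.subspace_add[OF fc_sub[OF C]] by (simp add: cone_grade \<Psi>_def)
  next
    fix x assume "x \<in> grade C i"
    then obtain a b where ab: "a \<in> grade A i" "b \<in> grade B i" "x = \<alpha> a + \<beta> b" using sp by blast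
    then have "inl b + inr a \<in> grade ?K i" "\<Psi> (inl b + inr a) = x" by (simp_all add: cone_grade \<Psi>_def)
    then show "x \<in> \<Psi> ` grade ?K i" by (metis imageI)
  qed
  moreover have "\<Psi> (bdry ?K z) = bdry C (\<Psi> z)" if "z \<in> total ?K" for z
  proof -
    have z: "prl z \<in> total B" "prr z \<in> total A" using that by (auto simp: Kt)
    have "bdry C (\<Psi> z) = \<alpha> (bdry A (prr z)) + (\<beta> (bdry B (prl z)) + \<alpha> (\<theta> (prl z)))"
      using fc_bdry_add[OF C at[OF z(2)] bt[OF z(1)]] bd(1)[OF z(2)] bd(2)[OF z(1)] by (simp add: \<Psi>_def)
    moreover have "\<Psi> (bdry ?K z) = \<alpha> (\<theta> (prl z)) + \<alpha> (bdry A (prr z)) + \<beta> (bdry B (prl z))"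
      using linear_on_add[OF lin(1) tt[OF z(1)] fc_bdry_total[OF A z(2)]]
      by (simp add: \<Psi>_def cone_bdry_sides)
    ultimately show ?thesis by (simp add: algebra_simps)
  qed
  moreover have "filt C (\<Psi> z) = filt ?K z" if "z \<in> total ?K" for z
    using that fi[of "prr z" "prl z"] by (simp add: Kt \<Psi>_def cone_filt max.commute)
  ultimately obtain g where g: "hequiv R ?K C \<Psi> g"
    using hequiv_strict[OF R K C] by blast
  have "frag_of (desusp B) - frag_of A + frag_of C \<in> relations R Ob"
    by (rule rel_cone[OF R filtered_desusp[OF B] A C O(3)[OF ABC(2)] ABC(1,3) \<theta> g])
  from rel_diff[OF this rel_desusp[OF Ob R ABC(2)]] show ?thesis
    by (rule rel_cong) (simp add: algebra_simps)
qed

text \<open>Exact triangles are cones up to homotopy equivalence of the three vertices, which is all that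
  the Grothendieck groups see of them.\<close>

lemma exact_triangle_cone:
  assumes Ob: "obj_class Ob" and R: "shifts R" and t: "(A, B, C, u, v, w) \<in> exact_triangles R Ob"
  obtains A' B' f a a' b b' c c' where "A \<in> Ob" "B \<in> Ob" "C \<in> Ob" "A' \<in> Ob" "B' \<in> Ob" "chain_map 0 A' B' f"
    "filtered_complex (cone A' B' f)"
    "hequiv R A A' a a'" "hequiv R B B' b b'" "hequiv R C (cone A' B' f) c c'"
proof -
  note O = obj_classD[OF Ob]
  obtain A' B' f where Ob': "A \<in> Ob" "B \<in> Ob" "C \<in> Ob" "A' \<in> Ob" "B' \<in> Ob" and f: "chain_map 0 A' B' f"
    and iso: "triangle_iso R (A, B, C, u, v, w) (cone_triangle R A' B' f)"
    using t unfolding exact_triangles_def by blast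
  have K: "filtered_complex (cone A' B' f)" using filtered_cone f O Ob' by blast
  obtain a b c where abc: "Iso R A A' a" "Iso R B B' b" "Iso R C (cone A' B' f) c"
    using iso unfolding cone_triangle_def triangle_iso.simps by blast
  obtain a1 a2 where 1: "hequiv R A A' a1 a2" by (rule hequiv_Iso[OF R O(1)[OF Ob'(1)] O(1)[OF Ob'(4)] abc(1)])
  obtain b1 b2 where 2: "hequiv R B B' b1 b2" by (rule hequiv_Iso[OF R O(1)[OF Ob'(2)] O(1)[OF Ob'(5)] abc(2)])
  obtain c1 c2 where 3: "hequiv R C (cone A' B' f) c1 c2" by (rule hequiv_Iso[OF R O(1)[OF Ob'(3)] K abc(3)])
  show thesis by (rule that[OF Ob' f K 1 2 3])
qed

section \<open>Dimensions and Euler characteristics\<close>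

lemma findim_subset: "findim S \<Longrightarrow> T \<subseteq> S \<Longrightarrow> findim T"
  unfolding findim_def by blast

lemma findim_basis:
  assumes "findim V" "vec.subspace V"
  obtains B where "finite B" "B \<subseteq> V" "vec.independent B" "vec.span B = V" "card B = vec.dim V"
proof -
  obtain B where B: "B \<subseteq> V" "vec.independent B" "V \<subseteq> vec.span B" "card B = vec.dim V"
    by (rule vec.basis_exists)
  obtain G where G: "finite G" "V \<subseteq> vec.span G" using assms(1) by (auto simp: findim_def)
  have "finite B" using vec.independent_span_bound[OF G(1) B(2)] B(1) G(2) by blast
  moreover have "vec.span B = V" using B(3) vec.span_minimal[OF B(1) assms(2)] by blast
  ultimately show thesis using that B by blast
qed

lemma independent_finite:
  assumes "findim V" "B \<subseteq> V" "vec.independent B" shows "finite B"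
proof -
  obtain G where G: "finite G" "V \<subseteq> vec.span G" using assms(1) by (auto simp: findim_def)
  show ?thesis using vec.independent_span_bound[OF G(1) assms(3)] assms(2) G(2) by blast
qed

lemma dim_zero [simp]: "vec.dim ({0} :: 'k::field vec set) = 0"
proof -
  have "vec.dim (vec.span ({} :: 'k vec set)) = card ({} :: 'k vec set)"
    by (rule vec.dim_span_eq_card_independent) (rule vec.independent_empty)
  then show ?thesis by (simp add: vec.span_empty)
qed

lemma representation_sub:
  assumes "vec.independent B" "S \<subseteq> B" "x \<in> vec.span S" "vec.representation B x b \<noteq> 0"
  shows "b \<in> S"
  using vec.representation_extend[OF assms(1,3,2)] vec.representation_ne_zero[of S x b] assms(4) by simp

lemma span_Int_independent:
  assumes "vec.independent B" "S \<subseteq> B" "T \<subseteq> B" "x \<in> vec.span S" "x \<in> vec.span T"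
  shows "x \<in> vec.span (S \<inter> T)"
proof -
  have xB: "x \<in> vec.span B" using assms(4) vec.span_mono[OF assms(2)] by blast
  have "(\<Sum>b | vec.representation B x b \<noteq> 0. vscale (vec.representation B x b) b) \<in> vec.span (S \<inter> T)"
    using representation_sub[OF assms(1,2,4)] representation_sub[OF assms(1,3,5)]
    by (intro vec.span_sum vec.span_scale vec.span_base) blast
  then show ?thesis by (simp add: vec.sum_nonzero_representation_eq[OF assms(1) xB])
qed

lemma independent_Un_span:
  assumes "finite T" "vec.independent S" "vec.independent T" "vec.span S \<inter> vec.span T \<subseteq> {0}"
  shows "vec.independent (S \<union> T)"
  using assms
proof (induction T rule: finite_induct)
  case (insert t T)
  have T: "vec.independent T" "vec.span S \<inter> vec.span T \<subseteq> {0}"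
    using insert.prems(2,3) vec.independent_mono[of "insert t T" T] vec.span_mono[of T "insert t T"] by blast+
  have "t \<notin> vec.span T"
    using insert.prems(2) insert.hyps(2) vec.independent_insert[of t T] by auto
  have "t \<notin> vec.span (S \<union> T)"
  proof
    assume "t \<in> vec.span (S \<union> T)"
    then obtain x y where xy: "x \<in> vec.span S" "y \<in> vec.span T" "t = x + y"
      unfolding vec.span_Un by blast
    have "t - y \<in> vec.span (insert t T)"
      using vec.span_diff[OF vec.span_base vec.span_mono[THEN subsetD, OF _ xy(2)]] by blast
    then have "x = 0" using xy insert.prems(3) by auto
    then show False using xy \<open>t \<notin> vec.span T\<close> by simp
  qed
  then show ?case using vec.independent_insertI[OF _ insert.IH[OF insert.prems(1) T]] by simp
qed simp

lemma dim_direct: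
  assumes "findim Z" "vec.subspace P" "vec.subspace Q" "P \<subseteq> Z" "Q \<subseteq> Z" "P \<inter> Q \<subseteq> {0}" "vec.subspace Z"
  shows dim_direct_le: "vec.dim P + vec.dim Q \<le> vec.dim Z"
    and dim_direct_eq: "(\<And>z. z \<in> Z \<Longrightarrow> \<exists>x\<in>P. \<exists>y\<in>Q. z = x + y) \<Longrightarrow> vec.dim P + vec.dim Q = vec.dim Z"
proof -
  obtain S where S: "finite S" "S \<subseteq> P" "vec.independent S" "vec.span S = P" "card S = vec.dim P"
    using findim_basis[OF findim_subset[OF assms(1,4)] assms(2)] by blast
  obtain T where T: "finite T" "T \<subseteq> Q" "vec.independent T" "vec.span T = Q" "card T = vec.dim Q"
    using findim_basis[OF findim_subset[OF assms(1,5)] assms(3)] by blast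
  obtain U where U: "finite U" "U \<subseteq> Z" "vec.independent U" "vec.span U = Z" "card U = vec.dim Z"
    using findim_basis[OF assms(1,7)] by blast
  have ind: "vec.independent (S \<union> T)" by (rule independent_Un_span) (use S T assms(6) in auto)
  have "S \<inter> T = {}"
  proof (rule ccontr)
    assume "S \<inter> T \<noteq> {}"
    then obtain x where "x \<in> S" "x \<in> T" by blast
    then have "x = 0" "x \<in> S" using S(2) T(2) assms(6) by auto
    then show False using vec.dependent_zero S(3) by blast
  qed
  then have card: "card (S \<union> T) = vec.dim P + vec.dim Q"
    using S T by (simp add: card_Un_disjoint)
  show "vec.dim P + vec.dim Q \<le> vec.dim Z"
    using vec.independent_span_bound[OF U(1) ind] U(4,5) card S(2) T(2) assms(4,5) by auto
  assume sp: "\<And>z. z \<in> Z \<Longrightarrow> \<exists>x\<in>P. \<exists>y\<in>Q. z = x + y"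
  have "Z \<subseteq> vec.span (S \<union> T)"
    unfolding vec.span_Un S(4) T(4) using sp by blast
  then show "vec.dim P + vec.dim Q = vec.dim Z"
    using vec.basis_card_eq_dim[OF _ _ ind, of Z] card S(2) T(2) assms(4,5) by (metis Un_least order_trans)
qed

lemma subspace_complement:
  assumes "vec.subspace Z" "vec.subspace Q" "Q \<subseteq> Z"
  obtains H where "vec.subspace H" "H \<subseteq> Z" "H \<inter> Q \<subseteq> {0}" "\<And>z. z \<in> Z \<Longrightarrow> \<exists>x\<in>Q. \<exists>y\<in>H. z = x + y"
proof -
  obtain S where S: "S \<subseteq> Q" "vec.independent S" "Q \<subseteq> vec.span S"
    using vec.maximal_independent_subset[of Q] by blast
  then have SQ: "vec.span S = Q" using vec.span_minimal[OF S(1) assms(2)] by blast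
  obtain T where T: "S \<subseteq> T" "T \<subseteq> Z" "vec.independent T" "Z \<subseteq> vec.span T"
    using vec.maximal_independent_subset_extend[of S Z] S assms(3) by blast
  show thesis
  proof (rule that[of "vec.span (T - S)"])
    show "vec.span (T - S) \<subseteq> Z" using T(2) by (intro vec.span_minimal assms(1)) blast
    show "vec.span (T - S) \<inter> Q \<subseteq> {0}"
    proof
      fix x assume "x \<in> vec.span (T - S) \<inter> Q"
      then have "x \<in> vec.span ((T - S) \<inter> S)"
        using span_Int_independent[OF T(3) _ T(1), of "T - S" x] SQ by blast
      moreover have "(T - S) \<inter> S = {}" by blast
      ultimately show "x \<in> {0}" by (simp add: vec.span_empty)
    qed
    show "\<exists>x\<in>Q. \<exists>y\<in>vec.span (T - S). z = x + y" if "z \<in> Z" for z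
    proof -
      have "T = S \<union> (T - S)" using T(1) by blast
      then have "z \<in> vec.span (S \<union> (T - S))" using that T(4) by auto
      then show ?thesis unfolding vec.span_Un SQ by blast
    qed
  qed (rule vec.subspace_span)
qed

lemma dim_image_inj:
  assumes "linear_on S f" "vec.subspace S" "findim S" "\<And>x. x \<in> S \<Longrightarrow> f x = 0 \<Longrightarrow> x = 0"
  shows "vec.dim (f ` S) = vec.dim S"
proof -
  obtain g where g: "Vector_Spaces.linear vscale vscale g" "\<And>x. x \<in> S \<Longrightarrow> g x = f x"
    using linear_on_extend[OF assms(1,2)] by blast
  obtain B where B: "finite B" "B \<subseteq> S" "vec.independent B" "vec.span B = S" "card B = vec.dim S"
    using findim_basis[OF assms(3,2)] by blast
  have inj: "inj_on g S"
  proof (rule inj_onI)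
    fix x y assume xy: "x \<in> S" "y \<in> S" "g x = g y"
    then have "f (x - y) = 0" using linear_on_diff[OF assms(1,2)] g(2) by simp
    then show "x = y" using assms(4)[OF vec.subspace_diff[OF assms(2) xy(1,2)]] by simp
  qed
  have "vec.independent (g ` B)"
    using vp.linear_independent_injective_image[OF g(1) B(3)] inj B(4) by simp
  moreover have "vec.span (g ` B) = f ` S"
    using vp.linear_span_image[OF g(1), of B] B(4) g(2) by auto
  ultimately have "vec.dim (f ` S) = card (g ` B)"
    using vec.dim_span_eq_card_independent[of "g ` B"] by simp
  also have "\<dots> = card B" using inj B(2) by (metis card_image inj_on_subset)
  finally show ?thesis using B(5) by simp
qed

lemma subspace_kernel:
  assumes "linear_on S f" "vec.subspace S" shows "vec.subspace {x \<in> S. f x = 0}"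
  using assms linear_on_0[OF assms(1) vec.subspace_0[OF assms(2)]]
  unfolding vec.subspace_def linear_on_def by simp

lemma rank_nullity:
  assumes f: "linear_on S f" and S: "vec.subspace S" "findim S"
  shows "vec.dim S = vec.dim {x \<in> S. f x = 0} + vec.dim (f ` S)"
proof -
  let ?K = "{x \<in> S. f x = 0}"
  have K: "vec.subspace ?K" by (rule subspace_kernel[OF f S(1)])
  obtain H where H: "vec.subspace H" "H \<subseteq> S" "H \<inter> ?K \<subseteq> {0}" "\<And>z. z \<in> S \<Longrightarrow> \<exists>x\<in>?K. \<exists>y\<in>H. z = x + y"
    using subspace_complement[OF S(1) K] by blast
  have "?K \<inter> H \<subseteq> {0}" using H(3) by blast
  from dim_direct_eq[OF S(2) K H(1) _ H(2) this S(1) H(4)]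
  have "vec.dim ?K + vec.dim H = vec.dim S" by blast
  moreover have "f ` S = f ` H"
  proof (intro equalityI subsetI)
    fix y assume "y \<in> f ` S"
    then obtain z where z: "z \<in> S" "y = f z" by blast
    obtain a b where ab: "a \<in> ?K" "b \<in> H" "z = a + b" using H(4)[OF z(1)] by blast
    have "y = f b" using ab z H(2) linear_on_add[OF f, of a b] by auto
    then show "y \<in> f ` H" using ab by blast
  qed (use H(2) in blast)
  moreover have "vec.dim (f ` H) = vec.dim H"
    by (rule dim_image_inj[OF linear_on_subset[OF f H(2)] H(1) findim_subset[OF S(2) H(2)]]) (use H(2,3) in blast)
  ultimately show ?thesis by simp
qed

definition par :: "int \<Rightarrow> int" where "par i = (if even i then 1 else - 1)"

lemma par_simps [simp]: "par (i + 1) = - par i" "par (i - 1) = - par i" "par 0 = 1"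
  by (simp_all add: par_def)

lemma par_add: "par (i + j) = par i * par j"
  by (simp add: par_def)

text \<open>The Euler characteristic of a graded vector space.\<close>

definition gchi :: "(int \<Rightarrow> 'k::field vec set) \<Rightarrow> int" where
  "gchi G = (\<Sum>i | G i \<noteq> {0}. par i * int (vec.dim (G i)))"

definition fin_graded :: "(int \<Rightarrow> 'k::field vec set) \<Rightarrow> bool" where
  "fin_graded G \<longleftrightarrow> (\<forall>i. vec.subspace (G i) \<and> findim (G i)) \<and> finite {i. G i \<noteq> {0}}"

lemma euler_gchi: "euler C = gchi (grade C)"
  by (simp add: euler_def gchi_def par_def)

lemma gchi_support:
  assumes "finite F" "\<And>i. i \<notin> F \<Longrightarrow> G i = {0}"
  shows "gchi G = (\<Sum>i\<in>F. par i * int (vec.dim (G i)))"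
  unfolding gchi_def by (rule sum.mono_neutral_left) (use assms in auto)

text \<open>The Euler characteristic of a complex is that of its homology, whose dimension in each degree
  is the difference of the dimensions of cycles and boundaries.\<close>

lemma gchi_homology:
  assumes G: "fin_graded G" and d: "\<And>i. linear_on (G i) d" 
    and F: "finite F" "\<And>i. i \<notin> F \<Longrightarrow> G i = {0}"
  shows "gchi G = (\<Sum>i\<in>F \<union> (\<lambda>i. i - 1) ` F.
    par i * (int (vec.dim {x \<in> G i. d x = 0}) - int (vec.dim (d ` G (i + 1)))))"
proof -
  let ?F = "F \<union> (\<lambda>i. i - 1) ` F"
  have sub: "vec.subspace (G i)" "findim (G i)" for i using G by (auto simp: fin_graded_def)
  have d0: "d 0 = 0" using linear_on_0[OF d vec.subspace_0[OF sub(1)]] .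
  have rn: "int (vec.dim (G i)) = int (vec.dim {x \<in> G i. d x = 0}) + int (vec.dim (d ` G i))" for i
    using rank_nullity[OF d sub, of i] by simp
  have z: "vec.dim (d ` G i) = 0" if "i \<notin> F" for i using F(2)[OF that] d0 by simp
  have "(\<Sum>i\<in>?F. par i * int (vec.dim (d ` G i))) = (\<Sum>i\<in>F. par i * int (vec.dim (d ` G i)))"
    by (rule sum.mono_neutral_right) (use F(1) z in auto)
  also have "\<dots> = (\<Sum>j\<in>(\<lambda>i. i - 1) ` F. par (j + 1) * int (vec.dim (d ` G (j + 1))))"
    by (simp add: sum.reindex inj_on_def del: par_simps)
  also have "\<dots> = (\<Sum>j\<in>?F. par (j + 1) * int (vec.dim (d ` G (j + 1))))"
  proof (rule sum.mono_neutral_left)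
    show "\<forall>i\<in>?F - (\<lambda>i. i - 1) ` F. par (i + 1) * int (vec.dim (d ` G (i + 1))) = 0"
    proof
      fix i assume "i \<in> ?F - (\<lambda>i. i - 1) ` F"
      then have "i + 1 \<notin> F" by (metis DiffD2 add_diff_cancel_right' image_eqI)
      then show "par (i + 1) * int (vec.dim (d ` G (i + 1))) = 0" using z by simp
    qed
  qed (use F(1) in auto)
  finally have shift: "(\<Sum>i\<in>?F. par i * int (vec.dim (d ` G i))) = (\<Sum>j\<in>?F. - par j * int (vec.dim (d ` G (j + 1))))"
    by simp
  have "gchi G = (\<Sum>i\<in>?F. par i * int (vec.dim (G i)))"
    by (rule gchi_support) (use F in auto)
  also have "\<dots> = (\<Sum>i\<in>?F. par i * int (vec.dim {x \<in> G i. d x = 0})) + (\<Sum>i\<in>?F. par i * int (vec.dim (d ` G i)))"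
    unfolding rn distrib_left sum.distrib ..
  also have "\<dots> = (\<Sum>i\<in>?F. par i * (int (vec.dim {x \<in> G i. d x = 0}) - int (vec.dim (d ` G (i + 1)))))"
    unfolding shift by (simp add: right_diff_distrib sum_subtractf sum_negf)
  finally show ?thesis .
qed

text \<open>If \<open>g f\<close> is homotopic to the identity, then \<open>f\<close> is injective in homology.\<close>

lemma homology_dim_le:
  assumes G: "fin_graded G" and H: "fin_graded H"
    and lin: "\<And>i. linear_on (G i) f" "\<And>i. linear_on (H i) g" "\<And>i. linear_on (G i) d" "\<And>i. linear_on (H i) e"
    and f: "\<And>i x. x \<in> G i \<Longrightarrow> f x \<in> H i" and g: "\<And>i x. x \<in> H i \<Longrightarrow> g x \<in> G i"
    and d: "\<And>i x. x \<in> G i \<Longrightarrow> d x \<in> G (i - 1)" "\<And>i x. x \<in> G i \<Longrightarrow> d (d x) = 0"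
    and e: "\<And>i x. x \<in> H i \<Longrightarrow> e x \<in> H (i - 1)" "\<And>i x. x \<in> H i \<Longrightarrow> e (e x) = 0"
    and h: "\<And>i x. x \<in> G i \<Longrightarrow> h x \<in> G (i + 1)"
    and comm: "\<And>i x. x \<in> G i \<Longrightarrow> f (d x) = e (f x)" "\<And>i x. x \<in> H i \<Longrightarrow> g (e x) = d (g x)"
    and htp: "\<And>i x. x \<in> G i \<Longrightarrow> d x = 0 \<Longrightarrow> g (f x) - x = d (h x)"
  shows "int (vec.dim {x \<in> G i. d x = 0}) - int (vec.dim (d ` G (i + 1)))
    \<le> int (vec.dim {x \<in> H i. e x = 0}) - int (vec.dim (e ` H (i + 1)))"
proof -
  have Gs: "vec.subspace (G i)" "findim (G i)" and Hs: "vec.subspace (H i)" "findim (H i)" for i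
    using G H by (auto simp: fin_graded_def)
  let ?Z = "{x \<in> G i. d x = 0}" and ?B = "d ` G (i + 1)" and ?Z' = "{x \<in> H i. e x = 0}" and ?B' = "e ` H (i + 1)"
  have Z: "vec.subspace ?Z" "vec.subspace ?Z'" by (rule subspace_kernel[OF lin(3) Gs(1)], rule subspace_kernel[OF lin(4) Hs(1)])
  have B: "vec.subspace ?B" "vec.subspace ?B'"
    by (rule subspace_image_on[OF lin(3) Gs(1)], rule subspace_image_on[OF lin(4) Hs(1)])
  have BZ: "?B \<subseteq> ?Z" "?B' \<subseteq> ?Z'"
    using d(1)[of _ "i + 1"] d(2)[of _ "i + 1"] e(1)[of _ "i + 1"] e(2)[of _ "i + 1"] by auto
  have fin: "findim ?Z" "findim ?Z'" using findim_subset[OF Gs(2)[of i]] findim_subset[OF Hs(2)[of i]] by auto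
  \<comment> \<open>\<open>W\<close> represents the homology of \<open>G\<close>; by
    \<open>key\<close>, its image meets the boundaries of \<open>H\<close> trivially.\<close>
  obtain W where W: "vec.subspace W" "W \<subseteq> ?Z" "W \<inter> ?B \<subseteq> {0}" "\<And>z. z \<in> ?Z \<Longrightarrow> \<exists>x\<in>?B. \<exists>y\<in>W. z = x + y"
    using subspace_complement[OF Z(1) B(1) BZ(1)] by blast
  have "?B \<inter> W \<subseteq> {0}" using W(3) by blast
  from dim_direct_eq[OF fin(1) B(1) W(1) BZ(1) W(2) this Z(1) W(4)]
  have dimW: "vec.dim ?B + vec.dim W = vec.dim ?Z" .
  have WG: "W \<subseteq> G i" using W(2) by blast
  have key: "x = 0" if x: "x \<in> W" and y: "y \<in> H (i + 1)" "f x = e y" for x y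
  proof -
    have xZ: "x \<in> G i" "d x = 0" using x W(2) by auto
    have hx: "h x \<in> G (i + 1)" by (rule h[OF xZ(1)])
    have "x = g (e y) - d (h x)" using htp[OF xZ] y(2) by (simp add: algebra_simps)
    also have "\<dots> = d (g y - h x)"
      using comm(2)[OF y(1)] linear_on_diff[OF lin(3) Gs(1) g[OF y(1)] hx] by simp
    finally have "x \<in> ?B" using vec.subspace_diff[OF Gs(1) g[OF y(1)] hx] by blast
    then show ?thesis using x W(3) by blast
  qed
  have y0: "0 \<in> H (i + 1)" "e 0 = 0" using vec.subspace_0[OF Hs(1)] linear_on_0[OF lin(4)] by blast+
  have linW: "linear_on W f" by (rule linear_on_subset[OF lin(1) WG])
  have "vec.dim (f ` W) = vec.dim W"
    by (rule dim_image_inj[OF linW W(1) findim_subset[OF Gs(2) WG]]) (use key[OF _ y0(1)] y0(2) in simp)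
  moreover have "vec.dim (f ` W) + vec.dim ?B' \<le> vec.dim ?Z'"
  proof (rule dim_direct_le[OF fin(2) subspace_image_on[OF linW W(1)] B(2) _ BZ(2) _ Z(2)])
    show "f ` W \<subseteq> ?Z'"
    proof
      fix y assume "y \<in> f ` W"
      then obtain x where x: "x \<in> W" "y = f x" by blast
      then have xZ: "x \<in> G i" "d x = 0" using W(2) by auto
      have "e (f x) = f 0" using comm(1)[OF xZ(1)] xZ(2) by simp
      also have "\<dots> = 0" by (rule linear_on_0[OF lin(1) xZ(1)])
      finally show "y \<in> ?Z'" using x f[OF xZ(1)] by simp
    qed
    show "f ` W \<inter> ?B' \<subseteq> {0}"
    proof
      fix y assume "y \<in> f ` W \<inter> ?B'"
      then obtain x z where xz: "x \<in> W" "y = f x" "z \<in> H (i + 1)" "y = e z" by blast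
      then have "x = 0" using key by simp
      then show "y \<in> {0}" using xz(1,2) linear_on_0[OF linW] by simp
    qed
  qed
  ultimately show ?thesis using dimW by linarith
qed

text \<open>Both complexes are retracts of each other in homology, so the dimensions of homology
  agree.\<close>

lemma gchi_homotopy:
  assumes G: "fin_graded G" and H: "fin_graded H"
    and lin: "\<And>i. linear_on (G i) f" "\<And>i. linear_on (H i) g" "\<And>i. linear_on (G i) d" "\<And>i. linear_on (H i) e"
    and f: "\<And>i x. x \<in> G i \<Longrightarrow> f x \<in> H i" and g: "\<And>i x. x \<in> H i \<Longrightarrow> g x \<in> G i"
    and d: "\<And>i x. x \<in> G i \<Longrightarrow> d x \<in> G (i - 1)" "\<And>i x. x \<in> G i \<Longrightarrow> d (d x) = 0"
    and e: "\<And>i x. x \<in> H i \<Longrightarrow> e x \<in> H (i - 1)" "\<And>i x. x \<in> H i \<Longrightarrow> e (e x) = 0"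
    and h: "\<And>i x. x \<in> G i \<Longrightarrow> h x \<in> G (i + 1)" and k: "\<And>i x. x \<in> H i \<Longrightarrow> k x \<in> H (i + 1)"
    and comm: "\<And>i x. x \<in> G i \<Longrightarrow> f (d x) = e (f x)" "\<And>i x. x \<in> H i \<Longrightarrow> g (e x) = d (g x)"
    and htp: "\<And>i x. x \<in> G i \<Longrightarrow> d x = 0 \<Longrightarrow> g (f x) - x = d (h x)"
      "\<And>i x. x \<in> H i \<Longrightarrow> e x = 0 \<Longrightarrow> f (g x) - x = e (k x)"
  shows "gchi G = gchi H"
proof -
  let ?F = "{i. G i \<noteq> {0}} \<union> {i. H i \<noteq> {0}}"
  have F: "finite ?F" using G H by (simp add: fin_graded_def)
  have out: "i \<notin> ?F \<Longrightarrow> G i = {0}" "i \<notin> ?F \<Longrightarrow> H i = {0}" for i by blast+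
  have eq: "int (vec.dim {x \<in> G i. d x = 0}) - int (vec.dim (d ` G (i + 1)))
    = int (vec.dim {x \<in> H i. e x = 0}) - int (vec.dim (e ` H (i + 1)))" for i
  proof (rule antisym)
    show "int (vec.dim {x \<in> G i. d x = 0}) - int (vec.dim (d ` G (i + 1)))
      \<le> int (vec.dim {x \<in> H i. e x = 0}) - int (vec.dim (e ` H (i + 1)))"
      by (rule homology_dim_le[OF G H lin f g d e h comm htp(1)])
    show "int (vec.dim {x \<in> H i. e x = 0}) - int (vec.dim (e ` H (i + 1)))
      \<le> int (vec.dim {x \<in> G i. d x = 0}) - int (vec.dim (d ` G (i + 1)))"
      by (rule homology_dim_le[OF H G lin(2,1,4,3) g f e d k comm(2,1) htp(2)])
  qed
  have "gchi G = (\<Sum>i\<in>?F \<union> (\<lambda>i. i - 1) ` ?F.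
      par i * (int (vec.dim {x \<in> G i. d x = 0}) - int (vec.dim (d ` G (i + 1)))))"
    by (rule gchi_homology[OF G lin(3) F]) (rule out)
  also have "\<dots> = gchi H"
    unfolding eq by (rule gchi_homology[OF H lin(4) F, symmetric]) (rule out)
  finally show ?thesis .
qed

lemma gchi_cone:
  assumes G: "fin_graded G" and H: "fin_graded H"
  shows "fin_graded (\<lambda>i. {z. prl z \<in> G (i - 1) \<and> prr z \<in> H i})"
    and "gchi (\<lambda>i. {z. prl z \<in> G (i - 1) \<and> prr z \<in> H i}) = gchi H - gchi G"
proof -
  have Gs: "vec.subspace (G i)" "findim (G i)" and Hs: "vec.subspace (H i)" "findim (H i)" for i
    using G H by (auto simp: fin_graded_def)
  let ?K = "\<lambda>i. {z. prl z \<in> G (i - 1) \<and> prr z \<in> H i}"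
  have K: "vec.subspace (?K i)" for i
    using Gs(1)[of "i - 1"] Hs(1)[of i] unfolding vec.subspace_def by simp
  have Kf: "findim (?K i)" for i
  proof -
    obtain A B where A: "finite A" "G (i - 1) \<subseteq> vec.span A" and B: "finite B" "H i \<subseteq> vec.span B"
      using Gs(2) Hs(2) unfolding findim_def by metis
    have "z \<in> vec.span (inl ` A \<union> inr ` B)" if "z \<in> ?K i" for z
    proof -
      have "inl (prl z) \<in> vec.span (inl ` A)" "inr (prr z) \<in> vec.span (inr ` B)"
        using that A(2) B(2) vp.linear_span_image[OF linear_sides(1), of A]
          vp.linear_span_image[OF linear_sides(2), of B] by auto
      then have "inl (prl z) + inr (prr z) \<in> vec.span (inl ` A \<union> inr ` B)"
        unfolding vec.span_Un by blast
      then show ?thesis by simp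
    qed
    then show ?thesis unfolding findim_def using A(1) B(1) by (intro exI[of _ "inl ` A \<union> inr ` B"]) auto
  qed
  have dimK: "vec.dim (?K i) = vec.dim (G (i - 1)) + vec.dim (H i)" for i
  proof -
    have sub: "vec.subspace (inl ` G (i - 1))" "vec.subspace (inr ` H i)"
      by (rule subspace_image_on[OF linear_on_sides(1) Gs(1)], rule subspace_image_on[OF linear_on_sides(2) Hs(1)])
    have dims: "vec.dim (inl ` G (i - 1)) = vec.dim (G (i - 1))" "vec.dim (inr ` H i) = vec.dim (H i)"
      by (rule dim_image_inj[OF linear_on_sides(1) Gs], metis prl_inl side_0(3))
        (rule dim_image_inj[OF linear_on_sides(2) Hs], metis prr_inr side_0(4))
    have sp: "\<exists>x\<in>inl ` G (i - 1). \<exists>y\<in>inr ` H i. z = x + y" if "z \<in> ?K i" for z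
      using that inl_prl_inr_prr[of z] by (intro bexI[of _ "inl (prl z)"] bexI[of _ "inr (prr z)"]) auto
    have le: "inl ` G (i - 1) \<subseteq> ?K i" "inr ` H i \<subseteq> ?K i"
      using vec.subspace_0[OF Gs(1)] vec.subspace_0[OF Hs(1)] by auto
    have int: "inl ` G (i - 1) \<inter> inr ` H i \<subseteq> {0}"
    proof
      fix z assume "z \<in> inl ` G (i - 1) \<inter> inr ` H i"
      then obtain a b where "z = inl a" "z = inr b" by blast
      then have "prl z = 0" "prr z = 0" by (metis prl_inr, metis prr_inl)
      then show "z \<in> {0}" using side_eq_0_iff by blast
    qed
    have "vec.dim (inl ` G (i - 1)) + vec.dim (inr ` H i) = vec.dim (?K i)"
      by (rule dim_direct_eq[OF Kf sub le int K sp])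
    then show ?thesis unfolding dims by simp
  qed
  let ?FG = "{i. G i \<noteq> {0}}" and ?FH = "{i. H i \<noteq> {0}}"
  let ?F = "(\<lambda>i. i + 1) ` ?FG \<union> ?FH"
  have F: "finite ?FG" "finite ?FH" using G H by (auto simp: fin_graded_def)
  have supp: "?K i = {0}" if "i \<notin> ?F" for i
  proof -
    have "G (i - 1) = {0}" using that image_eqI[of i "\<lambda>i. i + 1" "i - 1" ?FG] by auto
    moreover have "H i = {0}" using that by auto
    ultimately have GH: "G (i - 1) = {0}" "H i = {0}" by auto
    show ?thesis
    proof (intro equalityI subsetI)
      fix x assume "x \<in> ?K i"
      then have "prl x = 0" "prr x = 0" unfolding GH by simp_all
      then show "x \<in> {0}" using side_eqI[of x 0] by simp
    qed (simp add: GH)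
  qed
  have "{i. ?K i \<noteq> {0}} \<subseteq> ?F"
  proof
    fix i assume "i \<in> {i. ?K i \<noteq> {0}}"
    then show "i \<in> ?F" using supp[of i] by (cases "i \<in> ?F") auto
  qed
  then have "finite {i. ?K i \<noteq> {0}}" using F finite_subset by blast
  then show "fin_graded ?K" unfolding fin_graded_def using K Kf by blast
  have "gchi ?K = (\<Sum>i\<in>?F. par i * int (vec.dim (?K i)))"
    by (rule gchi_support) (use F supp in auto)
  also have "\<dots> = (\<Sum>i\<in>?F. par i * int (vec.dim (G (i - 1)))) + (\<Sum>i\<in>?F. par i * int (vec.dim (H i)))"
    unfolding dimK by (simp add: distrib_left sum.distrib)
  also have "(\<Sum>i\<in>?F. par i * int (vec.dim (H i))) = gchi H"
    by (rule gchi_support[symmetric]) (use F in auto)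
  also have "(\<Sum>i\<in>?F. par i * int (vec.dim (G (i - 1)))) = (\<Sum>i\<in>(\<lambda>i. i + 1) ` ?FG. par i * int (vec.dim (G (i - 1))))"
  proof (rule sum.mono_neutral_right)
    show "\<forall>i\<in>?F - (\<lambda>i. i + 1) ` ?FG. par i * int (vec.dim (G (i - 1))) = 0"
    proof
      fix i assume "i \<in> ?F - (\<lambda>i. i + 1) ` ?FG"
      then have "G (i - 1) = {0}" using image_eqI[of i "\<lambda>i. i + 1" "i - 1" ?FG] by auto
      then show "par i * int (vec.dim (G (i - 1))) = 0" by simp
    qed
  qed (use F in auto)
  also have "\<dots> = - gchi G"
    by (simp add: sum.reindex inj_on_def gchi_def sum_negf)
  finally show "gchi ?K = gchi H - gchi G" by simp
qed

section \<open>The Euler characteristics of the sublevels\<close>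

definition slice :: "'k::field fcomplex \<Rightarrow> ereal \<Rightarrow> int \<Rightarrow> 'k vec set" where
  "slice C s i = {x \<in> grade C i. filt C x \<le> s}"

text \<open>The number of bars of the barcode of \<open>C\<close> that are alive at level \<open>s\<close>, counted with the sign of
  their degree. This step function classifies the elements of the Grothendieck groups.\<close>

definition Phi :: "'k::field fcomplex \<Rightarrow> ereal \<Rightarrow> int" where
  "Phi C s = gchi (slice C s)"

lemma slice_infinity: "slice C \<infinity> = grade C"
  by (auto simp: slice_def)

lemma Phi_infinity: "Phi C \<infinity> = euler C"
  by (simp add: Phi_def slice_infinity euler_gchi)

lemma subspace_slice:
  assumes C: "filtered_complex C" shows "vec.subspace (slice C s i)"
  unfolding vec.subspace_def
proof (intro conjI ballI allI)
  note S = fc_sub[OF C, of i]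
  show "0 \<in> slice C s i" using vec.subspace_0[OF S] fc_0[OF C] by (simp add: slice_def)
  fix x assume x: "x \<in> slice C s i"
  show "x + y \<in> slice C s i" if y: "y \<in> slice C s i" for y
  proof -
    have "filt C (x + y) \<le> max (filt C x) (filt C y)"
      using x y fc_add[OF C] grade_total unfolding slice_def by blast
    also have "\<dots> \<le> s" using x y by (simp add: slice_def)
    finally show ?thesis using x y vec.subspace_add[OF S] by (simp add: slice_def)
  qed
  show "vscale c x \<in> slice C s i" for c
  proof (cases "c = 0")
    case True
    then show ?thesis using vec.subspace_0[OF S] fc_0[OF C] by (simp add: slice_def)
  next
    case False
    then have "filt C (vscale c x) = filt C x" using x fc_scale[OF C] grade_total unfolding slice_def by blast
    then show ?thesis using x vec.subspace_scale[OF S] by (simp add: slice_def)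
  qed
qed

lemma subspace_sublevel:
  assumes C: "filtered_complex C" shows "vec.subspace (sublevel C r)"
  unfolding vec.subspace_def
proof (intro conjI ballI allI)
  show "0 \<in> sublevel C r" using fc_0[OF C] by (simp add: sublevel_def)
  fix x assume x: "x \<in> sublevel C r"
  show "x + y \<in> sublevel C r" if y: "y \<in> sublevel C r" for y
  proof -
    have "filt C (x + y) \<le> max (filt C x) (filt C y)"
      using x y fc_add[OF C] unfolding sublevel_def by blast
    also have "\<dots> \<le> ereal r" using x y by (simp add: sublevel_def)
    finally show ?thesis using x y by (simp add: sublevel_def total_add)
  qed
  show "vscale c x \<in> sublevel C r" for c
  proof (cases "c = 0")
    case True
    then show ?thesis using fc_0[OF C] by (simp add: sublevel_def)
  next
    case False
    then have "filt C (vscale c x) = filt C x" using x fc_scale[OF C] unfolding sublevel_def by blast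
    then show ?thesis using x by (simp add: sublevel_def total_scale)
  qed
qed

lemma fin_graded_sub:
  assumes C: "filtered_complex C" and G: "\<And>i. vec.subspace (G i)" "\<And>i. G i \<subseteq> grade C i" "\<And>i. G i \<subseteq> V"
    and V: "findim V"
  shows "fin_graded G"
proof -
  let ?I = "{i. G i \<noteq> {0}}"
  have "\<exists>x. x \<in> G i \<and> x \<noteq> 0" if "i \<in> ?I" for i
    using that vec.subspace_0[OF G(1)[of i]] by blast
  then obtain x where x: "\<And>i. i \<in> ?I \<Longrightarrow> x i \<in> G i \<and> x i \<noteq> 0" by metis
  have inj: "inj_on x ?I"
  proof (rule inj_onI, rule ccontr)
    fix i j assume ij: "i \<in> ?I" "j \<in> ?I" "x i = x j" "i \<noteq> j"
    let ?y = "\<lambda>k. if k = i then x i else - x j"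
    have m: "?y k \<in> grade C k" if "k \<in> {i, j}" for k
      using that x[OF ij(1)] x[OF ij(2)] G(2) vec.subspace_neg[OF fc_sub[OF C]] by auto
    have "(\<Sum>k\<in>{i, j}. ?y k) = 0" using ij(3,4) by simp
    from fc_indep[OF C _ m this, of i] have "x i = 0" by simp
    then show False using x[OF ij(1)] by simp
  qed
  have "vec.independent (x ` ?I)"
    unfolding vec.independent_explicit_finite_subsets
  proof (intro allI impI ballI)
    fix S u v assume S: "S \<subseteq> x ` ?I" "finite S" "(\<Sum>v\<in>S. vscale (u v) v) = 0" "v \<in> S"
    obtain F where F: "F \<subseteq> ?I" "finite F" "S = x ` F" using finite_subset_image[OF S(2,1)] by blast
    have "(\<Sum>i\<in>F. vscale (u (x i)) (x i)) = 0"
      using S(3) inj_on_subset[OF inj F(1)] by (simp add: F(3) sum.reindex)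
    moreover have "vscale (u (x i)) (x i) \<in> grade C i" if "i \<in> F" for i
      using that x F(1) G(2) vec.subspace_scale[OF fc_sub[OF C]] by blast
    moreover obtain i where i: "i \<in> F" "v = x i" using S(4) F(3) by blast
    ultimately have "vscale (u (x i)) (x i) = 0"
      using fc_indep[OF C F(2), of "\<lambda>i. vscale (u (x i)) (x i)"] by blast
    then show "u v = 0" using x[of i] i F(1) by auto
  qed
  moreover have "x ` ?I \<subseteq> V" using x G(3) by blast
  ultimately have "finite (x ` ?I)" using independent_finite[OF V] by blast
  then have "finite ?I" using finite_imageD inj by blast
  then show ?thesis unfolding fin_graded_def using G(1) findim_subset[OF V G(3)] by blast
qed

lemma fin_slice_Ct:
  assumes "C \<in> Ct" shows "fin_graded (slice C (ereal r))"
proof -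
  have C: "filtered_complex C" and f: "findim (sublevel C r)" using assms by (auto simp: Ct_def)
  show ?thesis
    by (rule fin_graded_sub[OF C subspace_slice[OF C] _ _ f])
      (auto simp: slice_def sublevel_def grade_total)
qed

lemma fin_slice_Cfg:
  assumes "C \<in> Cfg" shows "fin_graded (slice C s)"
proof -
  have C: "filtered_complex C" and f: "findim (total C)" using assms by (auto simp: Cfg_def)
  show ?thesis
    by (rule fin_graded_sub[OF C subspace_slice[OF C] _ _ f]) (auto simp: slice_def grade_total)
qed

text \<open>A homotopy equivalence of shift \<open>0\<close> restricts to all sublevels. One of
  larger shift does not, but still preserves the total complex, which is the case of level
  \<open>\<infinity>\<close>.\<close>

lemma Phi_hequiv:
  assumes C: "filtered_complex C" and D: "filtered_complex D"
    and fin: "fin_graded (slice C s)" "fin_graded (slice D s)"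
    and R: "R = {0} \<or> s = \<infinity>" and fg: "hequiv R C D f g"
  shows "Phi C s = Phi D s"
proof -
  have f: "cmap R C D f" and g: "cmap R D C g" and gf: "heq R C C (g \<circ> f) id" and fg: "heq R D D (f \<circ> g) id"
    using fg by (auto simp: hequiv_def)
  have lev: "z \<le> s" if "z \<le> y + ereal r" "y \<le> s" "r \<in> R" for z y :: ereal and r
    using that R by auto
  obtain r1 where r1: "r1 \<in> R" "chain_map r1 C D f" using f unfolding cmap_def by blast
  obtain r2 where r2: "r2 \<in> R" "chain_map r2 D C g" using g unfolding cmap_def by blast
  obtain r h where h: "r \<in> R" "linear_on (total C) h" "\<forall>i. \<forall>x\<in>grade C i. h x \<in> grade C (i + 1)"
    "\<forall>x\<in>total C. filt C (h x) \<le> filt C x + ereal r"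
    "\<forall>x\<in>total C. (g \<circ> f) x - id x = bdry C (h x) + h (bdry C x)"
    using gf unfolding heq_def homotopic_def by blast
  obtain r' k where k: "r' \<in> R" "linear_on (total D) k" "\<forall>i. \<forall>x\<in>grade D i. k x \<in> grade D (i + 1)"
    "\<forall>x\<in>total D. filt D (k x) \<le> filt D x + ereal r'"
    "\<forall>x\<in>total D. (f \<circ> g) x - id x = bdry D (k x) + k (bdry D x)"
    using fg unfolding heq_def homotopic_def by blast
  have sub: "slice C s i \<subseteq> total C" "slice D s i \<subseteq> total D" for i
    by (auto simp: slice_def grade_total)
  show ?thesis
    unfolding Phi_def
  proof (rule gchi_homotopy[OF fin, where f = f and g = g and d = "bdry C" and e = "bdry D" and h = h and k = k])
    show "linear_on (slice C s i) f" "linear_on (slice D s i) g" "linear_on (slice C s i) (bdry C)"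
      "linear_on (slice D s i) (bdry D)" for i
      by (rule linear_on_subset[OF cmapD(1)[OF f] sub(1)], rule linear_on_subset[OF cmapD(1)[OF g] sub(2)],
        rule linear_on_subset[OF fc_lin[OF C] sub(1)], rule linear_on_subset[OF fc_lin[OF D] sub(2)])
  next
    fix i x assume x: "x \<in> slice C s i"
    then have xi: "x \<in> grade C i" "filt C x \<le> s" by (auto simp: slice_def)
    then have xt: "x \<in> total C" by (simp add: grade_total)
    have "filt D (f x) \<le> filt C x + ereal r1" using r1(2) xt by (simp add: chain_map_def)
    then show "f x \<in> slice D s i" using cmapD(2)[OF f xi(1)] lev xi(2) r1(1) unfolding slice_def by blast
    show "bdry C x \<in> slice C s (i - 1)"
      using fc_bdry[OF C xi(1)] order_trans[OF fc_fbdry[OF C xt] xi(2)] by (simp add: slice_def)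
    show "bdry C (bdry C x) = 0" by (rule fc_bb[OF C xt])
    have "filt C (h x) \<le> filt C x + ereal r" using h(4) xt by blast
    then show "h x \<in> slice C s (i + 1)" using h(3) xi lev h(1) unfolding slice_def by blast
    show "f (bdry C x) = bdry D (f x)" by (rule cmapD(3)[OF f xt])
    show "g (f x) - x = bdry C (h x)" if "bdry C x = 0"
      using h(5) xt that linear_on_0[OF h(2) total_0] by simp
  next
    fix i x assume x: "x \<in> slice D s i"
    then have xi: "x \<in> grade D i" "filt D x \<le> s" by (auto simp: slice_def)
    then have xt: "x \<in> total D" by (simp add: grade_total)
    have "filt C (g x) \<le> filt D x + ereal r2" using r2(2) xt by (simp add: chain_map_def)
    then show "g x \<in> slice C s i" using cmapD(2)[OF g xi(1)] lev xi(2) r2(1) unfolding slice_def by blast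
    show "bdry D x \<in> slice D s (i - 1)"
      using fc_bdry[OF D xi(1)] order_trans[OF fc_fbdry[OF D xt] xi(2)] by (simp add: slice_def)
    show "bdry D (bdry D x) = 0" by (rule fc_bb[OF D xt])
    have "filt D (k x) \<le> filt D x + ereal r'" using k(4) xt by blast
    then show "k x \<in> slice D s (i + 1)" using k(3) xi lev k(1) unfolding slice_def by blast
    show "g (bdry D x) = bdry C (g x)" by (rule cmapD(3)[OF g xt])
    show "f (g x) - x = bdry D (k x)" if "bdry D x = 0"
      using k(5) xt that linear_on_0[OF k(2) total_0] by simp
  qed
qed

lemma slice_cone: "slice (cone A B f) s = (\<lambda>i. {z. prl z \<in> slice A s (i - 1) \<and> prr z \<in> slice B s i})"
  unfolding slice_def fun_eq_iff set_eq_iff by (simp add: cone_grade cone_filt) blast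

lemma Phi_cone:
  assumes "fin_graded (slice A s)" "fin_graded (slice B s)"
  shows "Phi (cone A B f) s = Phi B s - Phi A s" and "fin_graded (slice (cone A B f) s)"
  unfolding Phi_def slice_cone using gchi_cone[OF assms] by auto

definition zext :: "('a \<Rightarrow> int) \<Rightarrow> ('a \<Rightarrow>\<^sub>0 int) \<Rightarrow> int" where
  "zext \<phi> x = (\<Sum>a\<in>Poly_Mapping.keys x. Poly_Mapping.lookup x a * \<phi> a)"

lemma zext_superset:
  assumes "finite F" "Poly_Mapping.keys x \<subseteq> F"
  shows "zext \<phi> x = (\<Sum>a\<in>F. Poly_Mapping.lookup x a * \<phi> a)"
  unfolding zext_def by (rule sum.mono_neutral_left) (use assms in \<open>auto simp: in_keys_iff\<close>)

lemma zext_diff: "zext \<phi> (x - y) = zext \<phi> x - zext \<phi> y"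
proof -
  let ?F = "Poly_Mapping.keys x \<union> Poly_Mapping.keys y"
  have "zext \<phi> z = (\<Sum>a\<in>?F. Poly_Mapping.lookup z a * \<phi> a)" if "Poly_Mapping.keys z \<subseteq> ?F" for z
    by (rule zext_superset) (use that in auto)
  from this[of "x - y"] this[of x] this[of y] show ?thesis
    using keys_diff[of x y] by (simp add: lookup_minus left_diff_distrib sum_subtractf)
qed

lemma zext_0 [simp]: "zext \<phi> 0 = 0"
  by (simp add: zext_def)

lemma zext_frag_of [simp]: "zext \<phi> (frag_of a) = \<phi> a"
  by (simp add: zext_def)

lemma zext_neg: "zext \<phi> (- x) = - zext \<phi> x"
  using zext_diff[of \<phi> 0 x] by simp

lemma zext_add: "zext \<phi> (x + y) = zext \<phi> x + zext \<phi> y"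
  using zext_diff[of \<phi> x "- y"] by (simp add: zext_neg)

lemma zext_frag_extend: "zext \<phi> (frag_extend g x) = zext (\<lambda>a. zext \<phi> (g a)) x"
proof -
  have "Poly_Mapping.keys x \<subseteq> UNIV" by simp
  then show ?thesis
    by (induction x rule: frag_induction) (simp_all add: zext_diff frag_extend_diff)
qed

lemma zext_cong: "(\<And>a. a \<in> Poly_Mapping.keys x \<Longrightarrow> \<phi> a = \<psi> a) \<Longrightarrow> zext \<phi> x = zext \<psi> x"
  by (simp add: zext_def)

text \<open>Soundness of the invariant: it is additive on cones and invariant under equivalence
  of the vertices.\<close>

lemma Phi_relations:
  assumes Ob: "obj_class Ob" and R: "shifts R" "R = {0} \<or> s = \<infinity>"
    and fin: "\<And>C. C \<in> Ob \<Longrightarrow> fin_graded (slice C s)" and x: "x \<in> relations R Ob"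
  shows "zext (\<lambda>C. Phi C s) x = 0"
  using x
proof (induction rule: rel_induct)
  case (gen A B C u v w)
  note O = obj_classD(1)[OF Ob]
  obtain A' B' f a a' b b' c c' where t: "A \<in> Ob" "B \<in> Ob" "C \<in> Ob" "A' \<in> Ob" "B' \<in> Ob" "chain_map 0 A' B' f"
    and K: "filtered_complex (cone A' B' f)"
    and h: "hequiv R A A' a a'" "hequiv R B B' b b'" "hequiv R C (cone A' B' f) c c'"
    by (rule exact_triangle_cone[OF Ob R(1) gen])
  have "Phi A s = Phi A' s" by (rule Phi_hequiv[OF O[OF t(1)] O[OF t(4)] fin[OF t(1)] fin[OF t(4)] R(2) h(1)])
  moreover have "Phi B s = Phi B' s" by (rule Phi_hequiv[OF O[OF t(2)] O[OF t(5)] fin[OF t(2)] fin[OF t(5)] R(2) h(2)])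
  moreover have "Phi C s = Phi (cone A' B' f) s"
    by (rule Phi_hequiv[OF O[OF t(3)] K fin[OF t(3)] Phi_cone(2)[OF fin[OF t(4)] fin[OF t(5)]] R(2) h(3)])
  ultimately show ?case
    using Phi_cone(1)[OF fin[OF t(4)] fin[OF t(5)], of f] by (simp add: zext_diff zext_add)
qed (simp_all add: zext_diff)

section \<open>The categories of finitely generated, tame and acyclic complexes\<close>

lemma findim_pair:
  assumes "findim P" "findim Q" shows "findim {z. prl z \<in> P \<and> prr z \<in> Q}"
proof -
  obtain A B where A: "finite A" "P \<subseteq> vec.span A" and B: "finite B" "Q \<subseteq> vec.span B"
    using assms unfolding findim_def by metis
  have "z \<in> vec.span (inl ` A \<union> inr ` B)" if "prl z \<in> P" "prr z \<in> Q" for z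
  proof -
    have "inl (prl z) \<in> vec.span (inl ` A)" "inr (prr z) \<in> vec.span (inr ` B)"
      using that A(2) B(2) vp.linear_span_image[OF linear_sides(1), of A]
        vp.linear_span_image[OF linear_sides(2), of B] by auto
    then have "inl (prl z) + inr (prr z) \<in> vec.span (inl ` A \<union> inr ` B)"
      unfolding vec.span_Un by blast
    then show ?thesis by simp
  qed
  then show ?thesis unfolding findim_def using A(1) B(1) by (intro exI[of _ "inl ` A \<union> inr ` B"]) auto
qed

lemma CtI: "filtered_complex C \<Longrightarrow> (\<And>r. findim (sublevel C r)) \<Longrightarrow> (\<And>r. r \<le> r0 \<Longrightarrow> sublevel C r = {0}) \<Longrightarrow> C \<in> Ct"
  by (auto simp: Ct_def)

lemma CtD:
  assumes "C \<in> Ct" shows "filtered_complex C" "findim (sublevel C r)" "\<exists>r0. \<forall>r\<le>r0. sublevel C r = {0}"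
  using assms by (auto simp: Ct_def)

lemma CfgD: "C \<in> Cfg \<Longrightarrow> filtered_complex C" "C \<in> Cfg \<Longrightarrow> findim (total C)"
  by (auto simp: Cfg_def)

lemma subspace_dim_eq:
  assumes "findim Z" "vec.subspace P" "vec.subspace Z" "P \<subseteq> Z" "vec.dim Z \<le> vec.dim P"
  shows "P = Z"
proof -
  obtain H where H: "vec.subspace H" "H \<subseteq> Z" "H \<inter> P \<subseteq> {0}" "\<And>z. z \<in> Z \<Longrightarrow> \<exists>x\<in>P. \<exists>y\<in>H. z = x + y"
    using subspace_complement[OF assms(3,2,4)] by blast
  have "P \<inter> H \<subseteq> {0}" using H(3) by blast
  then have "vec.dim P + vec.dim H \<le> vec.dim Z" by (rule dim_direct_le[OF assms(1,2) H(1) assms(4) H(2) _ assms(3)])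
  then have "vec.dim H = 0" using assms(5) by simp
  moreover obtain B where "finite B" "vec.span B = H" "card B = vec.dim H"
    using findim_basis[OF findim_subset[OF assms(1) H(2)] H(1)] by blast
  ultimately have "H = {0}" by (auto simp: vec.span_empty)
  have "z \<in> P" if z: "z \<in> Z" for z
  proof -
    obtain x y where "x \<in> P" "y \<in> H" "z = x + y" using H(4)[OF z] by blast
    then show ?thesis using \<open>H = {0}\<close> by simp
  qed
  then show ?thesis using assms(4) by blast
qed

text \<open>A filtration on a finite dimensional space is bounded below: sublevels of least dimension
  are constant towards \<open>-\<infinity>\<close>, hence zero.\<close>

lemma Cfg_subset_Ct: "Cfg \<subseteq> Ct"
proof
  fix C :: "'k::field fcomplex" assume "C \<in> Cfg"
  then have C: "filtered_complex C" "findim (total C)" by (auto simp: Cfg_def)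
  have fin: "findim (sublevel C r)" for r
    by (rule findim_subset[OF C(2)]) (auto simp: sublevel_def)
  obtain r0 where r0: "\<And>r. vec.dim (sublevel C r0) \<le> vec.dim (sublevel C r)"
    using ex_has_least_nat[of "\<lambda>_. True" 0 "\<lambda>r. vec.dim (sublevel C r)"] by blast
  have eq: "sublevel C r = sublevel C r0" if "r \<le> r0" for r
  proof (rule subspace_dim_eq[OF fin subspace_sublevel[OF C(1)] subspace_sublevel[OF C(1)] _ r0])
    show "sublevel C r \<subseteq> sublevel C r0"
      using order_trans[of "filt C _" "ereal r" "ereal r0"] that unfolding sublevel_def by auto
  qed
  have "x = 0" if x: "x \<in> sublevel C r0" for x
  proof (rule ccontr)
    assume "x \<noteq> 0"
    then have "filt C x \<noteq> -\<infinity>" "filt C x \<noteq> \<infinity>"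
      using x fc_minf[OF C(1)] fc_noinf[OF C(1)] unfolding sublevel_def by blast+
    then obtain q where q: "filt C x = ereal q" by (cases "filt C x") auto
    \<comment> \<open>The constancy below \<open>r0\<close> puts \<open>x\<close> into a
      sublevel below its own level.\<close>
    have "x \<in> sublevel C (min r0 (q - 1))" using x eq[of "min r0 (q - 1)"] by simp
    then show False using q by (simp add: sublevel_def)
  qed
  then have "sublevel C r0 = {0}" using vec.subspace_0[OF subspace_sublevel[OF C(1)]] by blast
  then show "C \<in> Ct" using CtI[OF C(1) fin, of r0] eq by blast
qed

lemma cone_sublevel:
  assumes "filtered_complex A" "filtered_complex B"
  shows "sublevel (cone A B f) r = {z. prl z \<in> sublevel A r \<and> prr z \<in> sublevel B r}"
  unfolding sublevel_def cone_total[OF assms] cone_filt by auto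

lemma cone_Ct:
  assumes "A \<in> Ct" "B \<in> Ct" "chain_map 0 A B f" shows "cone A B f \<in> Ct"
proof -
  note A = CtD[OF assms(1)] note B = CtD[OF assms(2)]
  obtain a b where ab: "\<And>r. r \<le> a \<Longrightarrow> sublevel A r = {0}" "\<And>r. r \<le> b \<Longrightarrow> sublevel B r = {0}"
    using A(3) B(3) by blast
  show ?thesis
  proof (rule CtI[OF filtered_cone[OF A(1) B(1) assms(3)]])
    show "findim (sublevel (cone A B f) r)" for r
      unfolding cone_sublevel[OF A(1) B(1)] by (rule findim_pair[OF A(2) B(2)])
    show "sublevel (cone A B f) r = {0}" if "r \<le> min a b" for r
    proof -
      have "sublevel A r = {0}" "sublevel B r = {0}" using that ab by auto
      then have "z \<in> sublevel (cone A B f) r \<longleftrightarrow> z = 0" for z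
        unfolding cone_sublevel[OF A(1) B(1)] side_eq_0_iff[of z] by simp
      then show ?thesis by blast
    qed
  qed
qed

lemma cone_Cfg:
  assumes "A \<in> Cfg" "B \<in> Cfg" "chain_map 0 A B f" shows "cone A B f \<in> Cfg"
proof -
  note A = CfgD[OF assms(1)] note B = CfgD[OF assms(2)]
  have "total (cone A B f) = {z. prl z \<in> total A \<and> prr z \<in> total B}"
    using cone_total[OF A(1) B(1)] by blast
  then show ?thesis
    using findim_pair[OF A(2) B(2)] filtered_cone[OF A(1) B(1) assms(3)] by (simp add: Cfg_def)
qed

lemma findim_0 [simp]: "findim {0}"
  unfolding findim_def by (rule exI[of _ "{}"]) (simp add: vec.span_empty)

lemma zeroC_Cfg: "zeroC \<in> Cfg"
  by (simp add: Cfg_def)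

lemma obj_class_Cfg: "obj_class Cfg"
  unfolding obj_class_def using zeroC_Cfg by (auto simp: Cfg_def filtered_desusp)

lemma sublevel_desusp: "sublevel (desusp A) = sublevel A"
  by (simp add: sublevel_def fun_eq_iff)

lemma obj_class_Ct: "obj_class Ct"
  unfolding obj_class_def using zeroC_Cfg Cfg_subset_Ct by (auto simp: Ct_def filtered_desusp sublevel_desusp)

definition contraction :: "real \<Rightarrow> 'k::field fcomplex \<Rightarrow> ('k vec \<Rightarrow> 'k vec) \<Rightarrow> bool" where
  "contraction r X h \<longleftrightarrow> linear_on (total X) h \<and> (\<forall>i. \<forall>x\<in>grade X i. h x \<in> grade X (i + 1)) \<and>
     (\<forall>x\<in>total X. filt X (h x) \<le> filt X x + ereal r) \<and>
     (\<forall>x\<in>total X. x = bdry X (h x) + h (bdry X x))"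

lemma homotopic_contraction: "homotopic r X X id (\<lambda>_. 0) \<longleftrightarrow> (\<exists>h. contraction r X h)"
  by (simp add: homotopic_def contraction_def)

text \<open>A homotopy from the identity to zero is a contraction, and conversely, since
  homotopy of shift \<open>r\<close> is reflexive and transitive.\<close>

lemma acyclic_iff:
  assumes X: "filtered_complex X" and r: "0 \<le> r"
  shows "acyclic r X \<longleftrightarrow> (\<exists>h. contraction r X h)"
proof
  have "chain_map 0 X X id" by (rule chain_map_id)
  then have id: "cmap {r} X X id"
    using filt_le_shift[OF X _ _ r] by (simp add: cmap_def chain_map_def)
  have refl: "heq {r} X X f f" for f
    unfolding heq_def homotopic_def
    by (intro bexI[of _ r] exI[of _ "\<lambda>_. 0"]) (use fc_0[OF X] fc_bdry_0[OF X] vec.subspace_0[OF fc_sub[OF X]] in simp_all)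
  {
    assume "acyclic r X"
    then have "id \<in> hclass {r} X X (\<lambda>_. 0)"
      using id refl[of id] unfolding acyclic_def hclass_alt by blast
    then have "heq {r} X X id (\<lambda>_. 0)"
      using heq_sym[OF X X] unfolding hclass_alt by blast
    then show "\<exists>h. contraction r X h" unfolding heq_def homotopic_contraction by simp
  next
    assume "\<exists>h. contraction r X h"
    then have 1: "heq {r} X X id (\<lambda>_. 0)" unfolding heq_def homotopic_contraction by simp
    have 2: "heq {r} X X (\<lambda>_. 0) id" by (rule heq_sym[OF X X 1])
    have m: "\<forall>r'\<in>{r}. \<forall>s\<in>{r}. max r' s \<in> {r}" by simp
    show "acyclic r X"
      unfolding acyclic_def hclass_alt
      using heq_trans_max[OF m X X 1] heq_trans_max[OF m X X 2] by blast
  }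
qed

lemma AcyclicsI: "filtered_complex C \<Longrightarrow> C \<in> Ob \<Longrightarrow> 0 \<le> r \<Longrightarrow> contraction r C h \<Longrightarrow> C \<in> Acyclics Ob"
  unfolding Acyclics_def using acyclic_iff by blast

lemma AcyclicsE:
  assumes "C \<in> Acyclics Ob" "filtered_complex C"
  obtains r h where "C \<in> Ob" "0 \<le> r" "contraction r C h"
proof -
  obtain r where "C \<in> Ob" "0 \<le> r" "acyclic r C" using assms(1) by (auto simp: Acyclics_def)
  then show thesis using that acyclic_iff[OF assms(2)] by blast
qed

lemma Acyclics_sub: "Acyclics Ob \<subseteq> Ob"
  by (auto simp: Acyclics_def)

text \<open>A contraction of a complex gives one of its desuspension by changing its
  sign.\<close>

lemma obj_class_Acyclics:
  assumes Ob: "obj_class Ob" shows "obj_class (Acyclics Ob)"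
proof -
  note O = obj_classD[OF Ob]
  have "contraction 0 zeroC (\<lambda>_. 0)" by (simp add: contraction_def)
  then have "zeroC \<in> Acyclics Ob" by (rule AcyclicsI[OF filtered_zeroC O(2) order_refl])
  moreover have "desusp C \<in> Acyclics Ob" if A: "C \<in> Acyclics Ob" for C
  proof -
    have fC: "filtered_complex C" using O(1) A Acyclics_sub by blast
    obtain r h where C: "C \<in> Ob" "0 \<le> r" and h: "contraction r C h"
      by (rule AcyclicsE[OF A fC])
    have h1: "linear_on (total C) h" "\<forall>i. \<forall>x\<in>grade C i. h x \<in> grade C (i + 1)" using h by (auto simp: contraction_def)
    note ht = homotopic_mapsto[OF h1]
    have "contraction r (desusp C) (\<lambda>x. - h x)"
      unfolding contraction_def
    proof (intro conjI allI ballI)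
      show "linear_on (total (desusp C)) (\<lambda>x. - h x)" using linear_on_uminus[OF h1(1)] by simp
      show "- h x \<in> grade (desusp C) (i + 1)" if "x \<in> grade (desusp C) i" for i x
        using h1(2)[rule_format, of x "i + 1"] that vec.subspace_neg[OF fc_sub[OF fC], of "h x" "i + 1 + 1"] by simp
      fix x assume "x \<in> total (desusp C)"
      then have x: "x \<in> total C" by simp
      show "filt (desusp C) (- h x) \<le> filt (desusp C) x + ereal r"
        using h x fc_neg[OF fC ht[OF x]] by (simp add: contraction_def)
      have "x = bdry C (h x) + h (bdry C x)" using h x unfolding contraction_def by blast
      then show "x = bdry (desusp C) (- h x) + - h (bdry (desusp C) x)"
        using fc_bdry_neg[OF fC ht[OF x]] linear_on_neg[OF h1(1) fc_bdry_total[OF fC x]] by simp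
    qed
    then show ?thesis by (rule AcyclicsI[OF filtered_desusp[OF fC] O(3)[OF C(1)] C(2)])
  qed
  ultimately show ?thesis using O(1) unfolding obj_class_def Acyclics_def by blast
qed

section \<open>Bases adapted to the filtration\<close>

text \<open>Orthogonality in the non-archimedean sense: no cancellation lowers the level of a linear
  combination below the levels of its terms.\<close>

definition orth :: "('k::field vec \<Rightarrow> ereal) \<Rightarrow> 'k vec set \<Rightarrow> bool" where
  "orth \<l> B \<longleftrightarrow> 0 \<notin> B \<and>
     (\<forall>t c. finite t \<longrightarrow> t \<subseteq> B \<longrightarrow> (\<forall>b\<in>t. c b \<noteq> 0 \<longrightarrow> \<l> b \<le> \<l> (\<Sum>b\<in>t. vscale (c b) b)))"

lemma orthD: "orth \<l> B \<Longrightarrow> finite t \<Longrightarrow> t \<subseteq> B \<Longrightarrow> b \<in> t \<Longrightarrow> c b \<noteq> 0 \<Longrightarrow> \<l> b \<le> \<l> (\<Sum>b\<in>t. vscale (c b) b)"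
  unfolding orth_def by blast

text \<open>Sublevels are finite dimensional and grow strictly from one level of
  \<open>T\<close> to a larger one, so a level at which the dimension is least is itself
  least.\<close>

lemma min_level_exists:
  assumes C: "C \<in> Ct" and T: "T \<subseteq> total C - {0}" "T \<noteq> {}"
  obtains x where "x \<in> T" "\<And>y. y \<in> T \<Longrightarrow> filt C x \<le> filt C y"
proof -
  note fC = CtD(1)[OF C]
  let ?n = "\<lambda>x. vec.dim (sublevel C (real_of_ereal (filt C x)))"
  obtain x where x: "x \<in> T" "\<And>y. y \<in> T \<Longrightarrow> ?n x \<le> ?n y"
    using ex_has_least_nat[of "\<lambda>x. x \<in> T" _ ?n] T(2) by blast
  have real: "ereal (real_of_ereal (filt C y)) = filt C y" if "y \<in> T" for y
    using that T(1) fc_noinf[OF fC, of y] fc_minf[OF fC, of y] by (auto simp: ereal_real)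
  have "filt C x \<le> filt C y" if y: "y \<in> T" for y
  proof (rule ccontr)
    assume "\<not> filt C x \<le> filt C y"
    then have lt: "filt C y < filt C x" by simp
    have "sublevel C (real_of_ereal (filt C y)) = sublevel C (real_of_ereal (filt C x))"
    proof (rule subspace_dim_eq[OF CtD(2)[OF C] subspace_sublevel[OF fC] subspace_sublevel[OF fC] _ x(2)[OF y]])
      show "sublevel C (real_of_ereal (filt C y)) \<subseteq> sublevel C (real_of_ereal (filt C x))"
        using lt order_trans[of _ "filt C y" "filt C x"] unfolding sublevel_def real[OF y] real[OF x(1)] by auto
    qed
    moreover have "x \<in> sublevel C (real_of_ereal (filt C x))"
      using x(1) T(1) unfolding sublevel_def real[OF x(1)] by auto
    ultimately have "x \<in> sublevel C (real_of_ereal (filt C y))" by blast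
    then have "filt C x \<le> filt C y" unfolding sublevel_def real[OF y] by blast
    then show False using lt by simp
  qed
  with x(1) show thesis by (rule that)
qed

text \<open>A maximal orthogonal set spans: a vector outside its span could be replaced by a vector of
  least level in its coset, which is orthogonal to the set.\<close>

lemma orth_extend:
  assumes C: "C \<in> Ct" and S: "vec.subspace S" "S \<subseteq> total C" and B0: "B0 \<subseteq> S" "orth (filt C) B0"
  obtains B where "B0 \<subseteq> B" "B \<subseteq> S" "orth (filt C) B" "vec.span B = S"
proof -
  note fC = CtD(1)[OF C]
  let ?A = "{B. B0 \<subseteq> B \<and> B \<subseteq> S \<and> orth (filt C) B}"
  have "\<exists>M\<in>?A. \<forall>X\<in>?A. M \<subseteq> X \<longrightarrow> X = M"
  proof (rule subset_Zorn_nonempty)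
    show "?A \<noteq> {}" using B0 by blast
    fix Ch assume ch: "Ch \<noteq> {}" "subset.chain ?A Ch"
    then have sub: "Ch \<subseteq> ?A" by (simp add: subset.chain_def)
    have "orth (filt C) (\<Union>Ch)"
      unfolding orth_def
    proof (intro conjI allI impI ballI)
      show "0 \<notin> \<Union>Ch" using sub unfolding orth_def by blast
      fix t b and c :: "'a vec \<Rightarrow> 'a" assume t: "finite t" "t \<subseteq> \<Union>Ch" "b \<in> t" "c b \<noteq> 0"
      obtain B where "B \<in> Ch" "t \<subseteq> B" by (rule finite_subset_Union_chain[OF t(1,2) ch])
      then show "filt C b \<le> filt C (\<Sum>b\<in>t. vscale (c b) b)"
        using orthD[where c = c, OF _ t(1) _ t(3,4), of "filt C" B] subsetD[OF sub, of B] by simp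
    qed
    moreover have "\<Union>Ch \<subseteq> S" by (rule Union_least) (use subsetD[OF sub] in simp)
    moreover obtain B where "B \<in> Ch" using ch(1) by blast
    then have "B0 \<subseteq> \<Union>Ch" using subsetD[OF sub, of B] by (metis (no_types, lifting) Union_upper mem_Collect_eq order_trans)
    ultimately show "\<Union>Ch \<in> ?A" by simp
  qed
  then obtain M where MA: "M \<in> ?A" and mx: "\<forall>X\<in>?A. M \<subseteq> X \<longrightarrow> X = M" by (rule bexE)
  have M: "B0 \<subseteq> M" "M \<subseteq> S" "orth (filt C) M" using MA by simp_all
  have max: "X = M" if "B0 \<subseteq> X" "X \<subseteq> S" "orth (filt C) X" "M \<subseteq> X" for X
    using mx that by simp
  have sMS: "vec.span M \<subseteq> S" by (rule vec.span_minimal[OF M(2) S(1)])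
  have "x \<in> vec.span M" if x: "x \<in> S" for x
  proof (rule ccontr)
    assume xn: "x \<notin> vec.span M"
    \<comment> \<open>A vector of least level in the coset of \<open>x\<close> modulo the span
      of \<open>M\<close> is the one to be adjoined.\<close>
    let ?T = "{x + y |y. y \<in> vec.span M}"
    have nz: "x + y \<notin> vec.span M" if "y \<in> vec.span M" for y
      using vec.span_diff[OF _ that, of "x + y"] xn by auto
    have "?T \<subseteq> total C - {0}"
    proof
      fix z assume "z \<in> ?T"
      then obtain y where y: "y \<in> vec.span M" "z = x + y" by blast
      have "z \<in> S" unfolding y(2) using vec.subspace_add[OF S(1) x] y(1) sMS by blast
      then show "z \<in> total C - {0}" using S(2) nz[OF y(1)] y(2) vec.span_zero[of M] by auto
    qed
    moreover have "?T \<noteq> {}" using vec.span_zero[of M] by blast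
    ultimately obtain x' where x': "x' \<in> ?T" and least: "\<And>z. z \<in> ?T \<Longrightarrow> filt C x' \<le> filt C z"
      using min_level_exists[OF C] by blast
    obtain y0 where y0: "y0 \<in> vec.span M" "x' = x + y0" using x' by blast
    have x'S: "x' \<in> S" unfolding y0(2) using vec.subspace_add[OF S(1) x] y0(1) sMS by blast
    have x'n: "x' \<notin> vec.span M" using nz[OF y0(1)] y0(2) by simp
    have lst: "filt C x' \<le> filt C (x' + m)" if "m \<in> vec.span M" for m
      using least[of "x' + m"] vec.span_add[OF y0(1) that] y0(2) by (auto simp: add.assoc)
    have "orth (filt C) (insert x' M)"
      unfolding orth_def
    proof (intro conjI allI impI ballI)
      show "0 \<notin> insert x' M" using x'n vec.span_zero[of M] M(3) by (auto simp: orth_def)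
      fix t b and c :: "'a vec \<Rightarrow> 'a" assume t: "finite t" "t \<subseteq> insert x' M" "b \<in> t" "c b \<noteq> 0"
      let ?t = "t - {x'}" and ?m = "\<Sum>b\<in>t - {x'}. vscale (c b) b"
      have tM: "?t \<subseteq> M" "finite ?t" using t by auto
      have m: "?m \<in> vec.span M"
        using tM(1) by (intro vec.span_sum vec.span_scale vec.span_base) blast
      have mt: "?m \<in> total C" using m sMS S(2) by blast
      show "filt C b \<le> filt C (\<Sum>b\<in>t. vscale (c b) b)"
      proof (cases "x' \<in> t \<and> c x' \<noteq> 0")
        case False
        have "(\<Sum>b\<in>t. vscale (c b) b) = ?m"
        proof (cases "x' \<in> t")
          case True
          then show ?thesis using False sum.remove[OF t(1) True, of "\<lambda>b. vscale (c b) b"] by simp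
        qed simp
        moreover have "b \<in> ?t" using False t(3,4) by auto
        ultimately show ?thesis using orthD[where c = c, OF M(3) tM(2,1) _ t(4)] by simp
      next
        case True
        let ?s = "\<Sum>b\<in>t. vscale (c b) b"
        have s: "?s = vscale (c x') x' + ?m" using sum.remove[OF t(1), of x' "\<lambda>b. vscale (c b) b"] True by simp
        have x't: "x' \<in> total C" using x'S S(2) by blast
        have st: "?s \<in> total C" unfolding s by (intro total_add total_scale x't mt)
        \<comment> \<open>After division by the coefficient of \<open>x'\<close> the sum lies in
          the coset, so its level is at least that of \<open>x'\<close>.\<close>
        define w where "w = vscale (inverse (c x')) ?m"
        have w: "w \<in> vec.span M" unfolding w_def by (rule vec.span_scale[OF m])
        have e: "vscale (c x') (x' + w) = ?s"
          unfolding s w_def using True by (simp add: vec.scale_right_distrib)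
        have wt: "x' + w \<in> total C" using total_add[OF x't] w sMS S(2) by blast
        have "c x' \<noteq> 0" using True by simp
        from fc_scale[OF fC wt this] have "filt C ?s = filt C (x' + w)" unfolding e .
        then have 1: "filt C x' \<le> filt C ?s" using lst[OF w] by simp
        show ?thesis
        proof (cases "b = x'")
          case False
          then have "b \<in> ?t" using t(3) by simp
          then have "filt C b \<le> filt C ?m" by (rule orthD[where c = c, OF M(3) tM(2,1) _ t(4)])
          also have "?m = ?s - vscale (c x') x'" unfolding s by simp
          also have "filt C \<dots> \<le> max (filt C ?s) (filt C (vscale (c x') x'))"
            by (rule fc_diff[OF fC st total_scale[OF x't]])
          also have "\<dots> \<le> filt C ?s" using 1 fc_scale[OF fC x't] True by simp
          finally show ?thesis .
        qed (use 1 in simp)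
      qed
    qed
    then have "insert x' M = M" using max[of "insert x' M"] M(1,2) x'S by blast
    then show False using x'n vec.span_base[of x' M] by blast
  qed
  then have "vec.span M = S" using sMS by blast
  then show thesis using that M by blast
qed

lemma orth_independent:
  assumes C: "filtered_complex C" and B: "orth (filt C) B" "B \<subseteq> total C"
  shows "vec.independent B"
  unfolding vec.independent_explicit_finite_subsets
proof (intro allI impI ballI, rule ccontr)
  fix t c b assume t: "t \<subseteq> B" "finite t" "(\<Sum>b\<in>t. vscale (c b) b) = 0" "b \<in> t" "c b \<noteq> 0"
  have "filt C b \<le> -\<infinity>" using orthD[where c = c, OF B(1) t(2,1,4,5)] fc_0[OF C] t(3) by simp
  then have "b = 0" using fc_minf[OF C, of b] t(1,4) B(2) by auto
  then show False using B(1) t(1,4) by (auto simp: orth_def)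
qed

text \<open>In a basis of this kind the degree components and the level of a vector can be read off from
  its coordinates; all computations with tensor products and Euler characteristics use it.\<close>

definition based :: "'k::field fcomplex \<Rightarrow> 'k vec set \<Rightarrow> ('k vec \<Rightarrow> int) \<Rightarrow> ('k vec \<Rightarrow> real) \<Rightarrow> bool" where
  "based C B dg lv \<longleftrightarrow> vec.independent B \<and> (\<forall>k. grade C k = vec.span {b \<in> B. dg b = k}) \<and>
     (\<forall>x\<in>total C. \<forall>r. filt C x \<le> ereal r \<longleftrightarrow> x \<in> vec.span {b \<in> B. lv b \<le> r})"

lemma basedD:
  assumes "based C B dg lv"
  shows "vec.independent B" "grade C k = vec.span {b \<in> B. dg b = k}"
    "x \<in> total C \<Longrightarrow> filt C x \<le> ereal r \<longleftrightarrow> x \<in> vec.span {b \<in> B. lv b \<le> r}"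
  using assms by (auto simp: based_def)

lemma based_total:
  assumes "based C B dg lv" shows "total C = vec.span B"
proof
  have "grade C k \<subseteq> vec.span B" for k
    unfolding basedD(2)[OF assms] by (rule vec.span_mono) blast
  then show "total C \<subseteq> vec.span B"
    unfolding total_def by (intro vec.span_minimal vec.subspace_span UN_least)
  have "B \<subseteq> total C"
  proof
    fix b assume "b \<in> B"
    then have "b \<in> grade C (dg b)" unfolding basedD(2)[OF assms] by (intro vec.span_base) simp
    then show "b \<in> total C" by (rule grade_total)
  qed
  then show "vec.span B \<subseteq> total C" by (rule vec.span_minimal) simp
qed

lemma ereal_eq_levels: "(\<And>r. x \<le> ereal r \<longleftrightarrow> y \<le> ereal r) \<Longrightarrow> x = (y :: ereal)"
proof (rule ccontr)
  assume h: "\<And>r. x \<le> ereal r \<longleftrightarrow> y \<le> ereal r" and "x \<noteq> y"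
  then consider "x < y" | "y < x" by fastforce
  then show False
  proof cases
    case 1
    then obtain r where "x < ereal r" and "ereal r < y" using ereal_dense2 by blast
    then have "y \<le> ereal r" using h[of r] by (simp add: less_imp_le)
    then show False using \<open>ereal r < y\<close> by simp
  next
    case 2
    then obtain r where "y < ereal r" "ereal r < x" using ereal_dense2 by blast
    then have "x \<le> ereal r" using h[of r] by (simp add: less_imp_le)
    then show False using \<open>ereal r < x\<close> by simp
  qed
qed

lemma orth_based:
  assumes C: "filtered_complex C" and B: "orth (filt C) B" "vec.span B = total C"
    and dg: "\<And>b. b \<in> B \<Longrightarrow> b \<in> grade C (dg b)" "\<And>k. vec.span {b \<in> B. dg b = k} = grade C k"
  shows "based C B dg (\<lambda>b. real_of_ereal (filt C b))"
proof -
  have Bt: "B \<subseteq> total C" using dg(1) grade_total by blast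
  have ind: "vec.independent B" by (rule orth_independent[OF C B(1) Bt])
  have real: "ereal (real_of_ereal (filt C b)) = filt C b" if "b \<in> B" for b
  proof -
    have "filt C b \<noteq> \<infinity>" "filt C b \<noteq> -\<infinity>"
      using fc_noinf[OF C, of b] fc_minf[OF C, of b] that Bt B(1) by (auto simp: orth_def)
    then show ?thesis by (auto simp: ereal_real)
  qed
  have "filt C x \<le> ereal r \<longleftrightarrow> x \<in> vec.span {b \<in> B. real_of_ereal (filt C b) \<le> r}" if x: "x \<in> total C" for x r
  proof
    assume le: "filt C x \<le> ereal r"
    let ?c = "vec.representation B x" and ?t = "{b. vec.representation B x b \<noteq> 0}"
    have xs: "(\<Sum>b\<in>?t. vscale (?c b) b) = x"
      by (rule vec.sum_nonzero_representation_eq[OF ind]) (use x B(2) in simp)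
    have t: "finite ?t" "?t \<subseteq> B" by (rule vec.finite_representation) (use vec.representation_ne_zero in blast)
    have "b \<in> {b \<in> B. real_of_ereal (filt C b) \<le> r}" if b: "b \<in> ?t" for b
    proof -
      have "filt C b \<le> filt C x" using orthD[where c = ?c, OF B(1) t b] b xs by simp
      then have "filt C b \<le> ereal r" using le by (rule order_trans)
      moreover have "b \<in> B" using b t(2) by blast
      ultimately have "ereal (real_of_ereal (filt C b)) \<le> ereal r" by (simp only: real)
      then show ?thesis using b t(2) by auto
    qed
    then have "(\<Sum>b\<in>?t. vscale (?c b) b) \<in> vec.span {b \<in> B. real_of_ereal (filt C b) \<le> r}"
      by (intro vec.span_sum vec.span_scale vec.span_base)
    then show "x \<in> vec.span {b \<in> B. real_of_ereal (filt C b) \<le> r}" unfolding xs .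
  next
    assume x: "x \<in> vec.span {b \<in> B. real_of_ereal (filt C b) \<le> r}"
    have "{b \<in> B. real_of_ereal (filt C b) \<le> r} \<subseteq> sublevel C r"
    proof
      fix b assume b: "b \<in> {b \<in> B. real_of_ereal (filt C b) \<le> r}"
      have bB: "b \<in> B" using b by blast
      have "ereal (real_of_ereal (filt C b)) \<le> ereal r" using b by simp
      then have "filt C b \<le> ereal r" by (simp only: real[OF bB])
      then show "b \<in> sublevel C r" using bB Bt unfolding sublevel_def by blast
    qed
    then have "x \<in> sublevel C r" using vec.span_minimal[OF _ subspace_sublevel[OF C]] x by blast
    then show "filt C x \<le> ereal r" by (simp add: sublevel_def)
  qed
  then show ?thesis unfolding based_def using ind dg(2) by blast
qed

text \<open>Orthogonal sets extend, so one may choose the basis of the cycles in each degree first. As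
  boundaries are cycles, the differential maps the basis into the span of this part. Homogeneity of the
  filtration makes the union over all degrees orthogonal.\<close>

lemma adapted_basis:
  assumes C: "C \<in> Ct"
  obtains B BZ dg lv where "based C B dg lv" "BZ \<subseteq> B" "\<forall>b\<in>BZ. bdry C b = 0"
    "\<forall>b\<in>B. bdry C b \<in> vec.span BZ"
proof -
  note fC = CtD(1)[OF C]
  let ?Z = "\<lambda>k. {x \<in> grade C k. bdry C x = 0}"
  have Z: "vec.subspace (?Z k)" for k
    by (rule subspace_kernel[OF linear_on_subset[OF fc_lin[OF fC]] fc_sub[OF fC]]) (rule subsetI, erule grade_total)
  have "\<exists>P Q. P \<subseteq> Q \<and> Q \<subseteq> grade C k \<and> orth (filt C) Q \<and> vec.span P = ?Z k \<and> vec.span Q = grade C k" for k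
  proof -
    have Gt: "grade C k \<subseteq> total C" by (rule subsetI) (rule grade_total)
    then have Zt: "?Z k \<subseteq> total C" by blast
    have e: "orth (filt C) {}" by (simp add: orth_def)
    obtain P where "{} \<subseteq> P" and P: "P \<subseteq> ?Z k" "orth (filt C) P" "vec.span P = ?Z k"
      by (rule orth_extend[OF C Z Zt empty_subsetI e])
    have PG: "P \<subseteq> grade C k" using P(1) by blast
    obtain Q where Q: "P \<subseteq> Q" "Q \<subseteq> grade C k" "orth (filt C) Q" "vec.span Q = grade C k"
      by (rule orth_extend[OF C fc_sub[OF fC] Gt PG P(2)])
    show ?thesis by (intro exI[of _ P] exI[of _ Q] conjI P(3) Q)
  qed
  then obtain P Q where PQ: "\<And>k. P k \<subseteq> Q k" "\<And>k. Q k \<subseteq> grade C k" "\<And>k. orth (filt C) (Q k)"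
    "\<And>k. vec.span (P k) = ?Z k" "\<And>k. vec.span (Q k) = grade C k" by metis
  define B where "B = (\<Union>k. Q k)"
  define dg where "dg b = (SOME k. b \<in> Q k)" for b
  have Qdg: "b \<in> Q (dg b)" if "b \<in> B" for b
    using that unfolding B_def dg_def by (auto intro: someI)
  have uniq: "k = dg b" if b: "b \<in> Q k" for b k
  proof (rule ccontr)
    assume ne: "k \<noteq> dg b"
    have b': "b \<in> Q (dg b)" using Qdg b unfolding B_def by blast
    let ?y = "\<lambda>i. if i = k then b else - b"
    have m: "?y i \<in> grade C i" if "i \<in> {k, dg b}" for i
      using that b b' PQ(2) vec.subspace_neg[OF fc_sub[OF fC]] by auto
    have "(\<Sum>i\<in>{k, dg b}. ?y i) = 0" using ne by simp
    from fc_indep[OF fC _ m this, of k] have "b = 0" by simp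
    then show False using b PQ(3)[of k] unfolding orth_def by blast
  qed
  have Qeq: "{b \<in> B. dg b = k} = Q k" for k
    using Qdg uniq unfolding B_def by blast
  have Bg: "b \<in> grade C (dg b)" if "b \<in> B" for b using Qdg[OF that] PQ(2) by blast
  have span: "vec.span B = total C"
  proof
    have "B \<subseteq> total C" using Bg grade_total by blast
    then show "vec.span B \<subseteq> total C" by (rule vec.span_minimal) simp
    have "grade C k \<subseteq> vec.span B" for k
      unfolding PQ(5)[symmetric] by (rule vec.span_mono) (auto simp: B_def)
    then show "total C \<subseteq> vec.span B"
      unfolding total_def by (intro vec.span_minimal vec.subspace_span UN_least)
  qed
  \<comment> \<open>A sum splits into homogeneous parts, and the level of each part is at most
    that of the sum.\<close>
  have "orth (filt C) B"
    unfolding orth_def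
  proof (intro conjI allI impI ballI)
    show "0 \<notin> B" unfolding B_def using PQ(3) unfolding orth_def by blast
    fix t b and c :: "'a vec \<Rightarrow> 'a" assume t: "finite t" "t \<subseteq> B" "b \<in> t" "c b \<noteq> 0"
    let ?s = "\<lambda>k. \<Sum>b | b \<in> t \<and> dg b = k. vscale (c b) b"
    have tk: "finite {b. b \<in> t \<and> dg b = k}" "{b. b \<in> t \<and> dg b = k} \<subseteq> Q k" for k
      using t(1,2) Qeq[of k] by auto
    have "filt C b \<le> filt C (?s (dg b))"
      by (rule orthD[where c = c, OF PQ(3) tk]) (use t in auto)
    also have "\<dots> \<le> filt C (\<Sum>k\<in>dg ` t. ?s k)"
    proof (rule fc_homog[OF fC, where y = ?s])
      show "?s k \<in> grade C k" for k
        unfolding PQ(5)[symmetric] using tk(2)[of k] by (intro vec.span_sum vec.span_scale vec.span_base) blast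
    qed (use t in auto)
    also have "(\<Sum>k\<in>dg ` t. ?s k) = (\<Sum>b\<in>t. vscale (c b) b)"
      by (rule sum.image_gen[OF t(1), symmetric])
    finally show "filt C b \<le> filt C (\<Sum>b\<in>t. vscale (c b) b)" .
  qed
  then have bs: "based C B dg (\<lambda>b. real_of_ereal (filt C b))"
    by (rule orth_based[OF fC _ span Bg]) (simp_all add: Qeq PQ(5))
  show thesis
  proof (rule that[OF bs])
    show "(\<Union>k. P k) \<subseteq> B" unfolding B_def using PQ(1) by blast
    show "\<forall>b\<in>(\<Union>k. P k). bdry C b = 0"
      using PQ(4) vec.span_base by blast
    show "\<forall>b\<in>B. bdry C b \<in> vec.span (\<Union>k. P k)"
    proof
      fix b assume b: "b \<in> B"
      have "bdry C b \<in> ?Z (dg b - 1)"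
        using fc_bdry[OF fC Bg[OF b]] fc_bb[OF fC grade_total[OF Bg[OF b]]] by simp
      then have "bdry C b \<in> vec.span (P (dg b - 1))" using PQ(4) by blast
      then show "bdry C b \<in> vec.span (\<Union>k. P k)" using vec.span_mono[of "P (dg b - 1)" "\<Union>k. P k"] by blast
    qed
  qed
qed

lemma based_finite:
  assumes C: "C \<in> Ct" and B: "based C B dg lv" shows "finite {b \<in> B. lv b \<le> r}"
proof (rule independent_finite[OF CtD(2)[OF C, of r]])
  show "vec.independent {b \<in> B. lv b \<le> r}" by (rule vec.independent_mono[OF basedD(1)[OF B]]) blast
  show "{b \<in> B. lv b \<le> r} \<subseteq> sublevel C r"
  proof
    fix b assume b: "b \<in> {b \<in> B. lv b \<le> r}"
    then have "b \<in> total C" unfolding based_total[OF B] by (intro vec.span_base) blast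
    then show "b \<in> sublevel C r"
      using basedD(3)[OF B, of b r] vec.span_base[OF b] by (simp add: sublevel_def)
  qed
qed

lemma based_finite_Cfg:
  assumes C: "C \<in> Cfg" and B: "based C B dg lv" shows "finite B"
  by (rule independent_finite[OF CfgD(2)[OF C] _ basedD(1)[OF B]])
    (simp add: based_total[OF B] vec.span_superset)

lemma gchi_span:
  assumes ind: "vec.independent S" and fin: "finite S"
  shows "gchi (\<lambda>k. vec.span {b \<in> S. dg b = k}) = (\<Sum>b\<in>S. par (dg b))"
proof -
  have "gchi (\<lambda>k. vec.span {b \<in> S. dg b = k}) = (\<Sum>k\<in>dg ` S. par k * int (vec.dim (vec.span {b \<in> S. dg b = k})))"
  proof (rule gchi_support)
    show "vec.span {b \<in> S. dg b = k} = {0}" if "k \<notin> dg ` S" for k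
    proof -
      have "{b \<in> S. dg b = k} = {}" using that by blast
      then show ?thesis by (simp only: vec.span_empty)
    qed
  qed (use fin in simp)
  also have "\<dots> = (\<Sum>k\<in>dg ` S. \<Sum>b | b \<in> S \<and> dg b = k. par (dg b))"
  proof (rule sum.cong[OF refl])
    fix k
    have "vec.dim (vec.span {b \<in> S. dg b = k}) = card {b \<in> S. dg b = k}"
      by (rule vec.dim_span_eq_card_independent[OF vec.independent_mono[OF ind]]) blast
    moreover have "(\<Sum>b | b \<in> S \<and> dg b = k. par (dg b)) = (\<Sum>b | b \<in> S \<and> dg b = k. par k)"
      by (rule sum.cong) auto
    ultimately show "par k * int (vec.dim (vec.span {b \<in> S. dg b = k})) = (\<Sum>b | b \<in> S \<and> dg b = k. par (dg b))"
      by simp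
  qed
  also have "\<dots> = (\<Sum>b\<in>S. par (dg b))"
    by (rule sum.image_gen[OF fin, symmetric])
  finally show ?thesis .
qed

lemma based_slice:
  assumes B: "based C B dg lv"
  shows "slice C (ereal r) = (\<lambda>k. vec.span {b \<in> {b \<in> B. lv b \<le> r}. dg b = k})"
proof
  fix k
  show "slice C (ereal r) k = vec.span {b \<in> {b \<in> B. lv b \<le> r}. dg b = k}"
  proof (rule Set.set_eqI)
  fix x
  let ?D = "{b \<in> B. dg b = k}" and ?L = "{b \<in> B. lv b \<le> r}"
  have eq: "{b \<in> {b \<in> B. lv b \<le> r}. dg b = k} = ?D \<inter> ?L" by blast
  have "x \<in> slice C (ereal r) k \<longleftrightarrow> x \<in> vec.span ?D \<and> x \<in> vec.span ?L"
    using basedD(3)[OF B, of x r] grade_total[of x C k] unfolding slice_def basedD(2)[OF B] by blast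
  also have "\<dots> \<longleftrightarrow> x \<in> vec.span (?D \<inter> ?L)"
    using span_Int_independent[OF basedD(1)[OF B], of ?D ?L x] vec.span_mono[of "?D \<inter> ?L" ?D]
      vec.span_mono[of "?D \<inter> ?L" ?L] by blast
  finally show "x \<in> slice C (ereal r) k \<longleftrightarrow> x \<in> vec.span {b \<in> {b \<in> B. lv b \<le> r}. dg b = k}"
    unfolding eq .
  qed
qed

lemma Phi_based:
  assumes "based C B dg lv" "finite {b \<in> B. lv b \<le> r}"
  shows "Phi C (ereal r) = (\<Sum>b | b \<in> B \<and> lv b \<le> r. par (dg b))"
  unfolding Phi_def based_slice[OF assms(1)]
  by (rule gchi_span[OF vec.independent_mono[OF basedD(1)[OF assms(1)]] assms(2)]) blast

lemma euler_based:
  assumes "based C B dg lv" "finite B"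
  shows "euler C = (\<Sum>b\<in>B. par (dg b))"
proof -
  have "grade C = (\<lambda>k. vec.span {b \<in> B. dg b = k})" using basedD(2)[OF assms(1)] by blast
  then show ?thesis unfolding euler_gchi using gchi_span[OF basedD(1)[OF assms(1)] assms(2)] by simp
qed

section \<open>Standard complexes with zero differential\<close>

lemma in_span_rep:
  assumes "vec.independent B" "x \<in> vec.span B" "L \<subseteq> B"
  shows "x \<in> vec.span L \<longleftrightarrow> (\<forall>b. vec.representation B x b \<noteq> 0 \<longrightarrow> b \<in> L)"
proof
  assume "x \<in> vec.span L"
  then show "\<forall>b. vec.representation B x b \<noteq> 0 \<longrightarrow> b \<in> L"
    using representation_sub[OF assms(1,3)] by blast
next
  assume h: "\<forall>b. vec.representation B x b \<noteq> 0 \<longrightarrow> b \<in> L"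
  have "(\<Sum>b | vec.representation B x b \<noteq> 0. vscale (vec.representation B x b) b) \<in> vec.span L"
    using h by (intro vec.span_sum vec.span_scale vec.span_base) simp
  then show "x \<in> vec.span L" unfolding vec.sum_nonzero_representation_eq[OF assms(1,2)] .
qed

text \<open>Vectors with disjoint supports do not cancel, so membership of their sum in a
  coordinate subspace can be tested separately. This is what makes levels of sums in an adapted
  basis the maximum of the levels.\<close>

lemma sum_in_span_disjoint:
  assumes B: "vec.independent B" and ST: "S \<subseteq> B" "T \<subseteq> B" "S \<inter> T = {}" and L: "L \<subseteq> B"
    and x: "x \<in> vec.span S" and y: "y \<in> vec.span T"
  shows "x + y \<in> vec.span L \<longleftrightarrow> x \<in> vec.span L \<and> y \<in> vec.span L"
proof
  have xB: "x \<in> vec.span B" and yB: "y \<in> vec.span B"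
    using x y vec.span_mono[OF ST(1)] vec.span_mono[OF ST(2)] by auto
  have rep: "vec.representation B (x + y) b = vec.representation B x b + vec.representation B y b" for b
    using vec.representation_add[OF B yB xB] by simp
  have z: "vec.representation B x b = 0 \<or> vec.representation B y b = 0" for b
    using representation_sub[OF B ST(1) x, of b] representation_sub[OF B ST(2) y, of b] ST(3) by auto
  assume "x + y \<in> vec.span L"
  then have h: "vec.representation B (x + y) b \<noteq> 0 \<Longrightarrow> b \<in> L" for b
    using representation_sub[OF B L] by simp
  have "vec.representation B x b \<noteq> 0 \<Longrightarrow> b \<in> L" "vec.representation B y b \<noteq> 0 \<Longrightarrow> b \<in> L" for b
    using h[of b] rep[of b] z[of b] by auto
  then show "x \<in> vec.span L \<and> y \<in> vec.span L"
    unfolding in_span_rep[OF B xB L] in_span_rep[OF B yB L] by simp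
qed (auto intro: vec.span_add)

abbreviation ev :: "nat \<Rightarrow> 'k::field vec" where
  "ev j \<equiv> Poly_Mapping.single j 1"

definition idx :: "'k::field vec \<Rightarrow> nat" where
  "idx b = (SOME j. b = ev j)"

lemma idx_ev [simp]: "idx (ev j :: 'k::field vec) = j"
proof -
  have "(ev j :: 'k vec) = ev (idx (ev j :: 'k vec))"
    unfolding idx_def by (rule someI[of _ j]) simp
  then have "Poly_Mapping.keys (ev j :: 'k vec) = Poly_Mapping.keys (ev (idx (ev j :: 'k vec)) :: 'k vec)" by simp
  then show ?thesis by simp
qed

lemma inj_ev: "inj_on ev J"
  by (rule inj_on_inverseI[of _ idx]) simp

lemma keys_vscale: "Poly_Mapping.keys (vscale c x) \<subseteq> Poly_Mapping.keys x"
  by (auto simp: in_keys_iff)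

lemma keys_vscale_eq: "c \<noteq> 0 \<Longrightarrow> Poly_Mapping.keys (vscale c x) = Poly_Mapping.keys x"
  by (auto simp: in_keys_iff)

lemma subspace_keys: "vec.subspace {x :: 'k::field vec. Poly_Mapping.keys x \<subseteq> J}"
proof -
  have "Poly_Mapping.keys (x + y) \<subseteq> J" if "Poly_Mapping.keys x \<subseteq> J" "Poly_Mapping.keys y \<subseteq> J" for x y :: "'k vec"
    using keys_add[of x y] that by blast
  moreover have "Poly_Mapping.keys (vscale c x) \<subseteq> J" if "Poly_Mapping.keys x \<subseteq> J" for x :: "'k vec" and c
    using keys_vscale[of c x] that by blast
  ultimately show ?thesis unfolding vec.subspace_def by simp
qed

lemma ev_expansion: "(\<Sum>j\<in>Poly_Mapping.keys x. vscale (Poly_Mapping.lookup x j) (ev j)) = (x :: 'k::field vec)"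
proof (rule poly_mapping_eqI)
  fix k
  have "Poly_Mapping.lookup (\<Sum>j\<in>Poly_Mapping.keys x. vscale (Poly_Mapping.lookup x j) (ev j)) k =
    (\<Sum>j\<in>Poly_Mapping.keys x. if j = k then Poly_Mapping.lookup x j else 0)"
    unfolding lookup_sum by (rule sum.cong) (auto simp: lookup_single when_def)
  then show "Poly_Mapping.lookup (\<Sum>j\<in>Poly_Mapping.keys x. vscale (Poly_Mapping.lookup x j) (ev j)) k = Poly_Mapping.lookup x k"
    by (auto simp: in_keys_iff)
qed

lemma span_ev: "vec.span (ev ` J) = {x :: 'k::field vec. Poly_Mapping.keys x \<subseteq> J}"
proof
  show "vec.span (ev ` J) \<subseteq> {x :: 'k vec. Poly_Mapping.keys x \<subseteq> J}"
    by (rule vec.span_minimal[OF _ subspace_keys]) auto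
  show "{x :: 'k vec. Poly_Mapping.keys x \<subseteq> J} \<subseteq> vec.span (ev ` J)"
  proof
    fix x :: "'k vec" assume "x \<in> {x. Poly_Mapping.keys x \<subseteq> J}"
    then have "(\<Sum>j\<in>Poly_Mapping.keys x. vscale (Poly_Mapping.lookup x j) (ev j)) \<in> vec.span (ev ` J)"
      by (intro vec.span_sum vec.span_scale vec.span_base) auto
    then show "x \<in> vec.span (ev ` J)" unfolding ev_expansion .
  qed
qed

lemma independent_ev: "vec.independent (ev ` J :: 'k::field vec set)"
  unfolding vec.independent_explicit_finite_subsets
proof (intro allI impI ballI)
  fix S u and v :: "'k vec" assume S: "S \<subseteq> ev ` J" "finite S" "(\<Sum>v\<in>S. vscale (u v) v) = 0" "v \<in> S"
  have "0 = Poly_Mapping.lookup (\<Sum>v\<in>S. vscale (u v) v) (idx v)" unfolding S(3) by simp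
  also have "\<dots> = (\<Sum>w\<in>S. if w = v then u w else 0)"
    unfolding lookup_sum
  proof (rule sum.cong[OF refl])
    fix w assume "w \<in> S"
    then obtain i j where ij: "w = ev i" "v = ev j" using S(1,4) by blast
    have "w = v \<longleftrightarrow> i = j" unfolding ij by (metis idx_ev)
    then show "Poly_Mapping.lookup (vscale (u w) w) (idx v) = (if w = v then u w else 0)"
      by (simp add: ij lookup_single when_def)
  qed
  also have "\<dots> = u v" using S(2,4) by simp
  finally show "u v = 0" by simp
qed

lemma linear_from_ev:
  obtains g where "Vector_Spaces.linear vscale vscale g" "\<forall>j. g (ev j) = (\<beta> j :: 'k::field vec)"
proof -
  obtain g where g: "Vector_Spaces.linear vscale vscale g" "\<forall>x\<in>range ev. g x = \<beta> (idx x)"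
    using vp.linear_independent_extend[OF independent_ev[of UNIV], of "\<lambda>x. \<beta> (idx x)"] by blast
  show thesis by (rule that[OF g(1)]) (use g(2) in simp)
qed

definition Std :: "nat set \<Rightarrow> (nat \<Rightarrow> real) \<Rightarrow> (nat \<Rightarrow> int) \<Rightarrow> 'k::field fcomplex" where
  "Std J a d = \<lparr>grade = (\<lambda>i. {x. Poly_Mapping.keys x \<subseteq> {j \<in> J. d j = i}}), bdry = (\<lambda>_. 0),
     filt = (\<lambda>x. SUP j\<in>Poly_Mapping.keys x. ereal (a j))\<rparr>"

lemma Std_sel: "grade (Std J a d) i = {x. Poly_Mapping.keys x \<subseteq> {j \<in> J. d j = i}}" "bdry (Std J a d) x = 0"
    "filt (Std J a d) x = (SUP j\<in>Poly_Mapping.keys x. ereal (a j))"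
  by (simp_all add: Std_def)

lemma filt_Std_le: "filt (Std J a d) x \<le> ereal r \<longleftrightarrow> (\<forall>j\<in>Poly_Mapping.keys x. a j \<le> r)"
  by (simp add: Std_sel SUP_le_iff)

lemma total_Std: "total (Std J a d :: 'k::field fcomplex) = {x. Poly_Mapping.keys x \<subseteq> J}"
proof
  show "total (Std J a d :: 'k fcomplex) \<subseteq> {x. Poly_Mapping.keys x \<subseteq> J}"
    unfolding total_def by (rule vec.span_minimal[OF _ subspace_keys]) (auto simp: Std_sel)
  have "ev ` J \<subseteq> total (Std J a d :: 'k fcomplex)"
  proof
    fix x :: "'k vec" assume "x \<in> ev ` J"
    then obtain j where "j \<in> J" "x = ev j" by blast
    then have "x \<in> grade (Std J a d) (d j)" by (simp add: Std_sel)
    then show "x \<in> total (Std J a d)" by (rule grade_total)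
  qed
  then show "{x. Poly_Mapping.keys x \<subseteq> J} \<subseteq> total (Std J a d :: 'k fcomplex)"
    unfolding span_ev[symmetric] by (rule vec.span_minimal) simp
qed

lemma lookup_disjoint_sum:
  fixes y :: "int \<Rightarrow> 'k::field vec"
  assumes "finite F" "\<And>i. i \<in> F \<Longrightarrow> Poly_Mapping.keys (y i) \<subseteq> {j \<in> J. d j = i}" "i \<in> F" "d j = i"
  shows "Poly_Mapping.lookup (\<Sum>i\<in>F. y i) j = Poly_Mapping.lookup (y i) j"
proof -
  have "Poly_Mapping.lookup (y k) j = 0" if "k \<in> F - {i}" for k
    using that assms(2)[of k] assms(4) by (auto simp: in_keys_iff)
  then have "(\<Sum>k\<in>F - {i}. Poly_Mapping.lookup (y k) j) = 0" by (rule sum.neutral[OF ballI])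
  then show ?thesis
    unfolding sum.remove[OF assms(1,3)] lookup_add lookup_sum by simp
qed

lemma filtered_Std: "filtered_complex (Std J a d)"
proof (rule filtered_complexI)
  show "vec.subspace (grade (Std J a d) i)" for i unfolding Std_sel by (rule subspace_keys)
  show "y i = 0" if h: "finite F" "\<And>i. i \<in> F \<Longrightarrow> y i \<in> grade (Std J a d) i" "sum y F = 0" "i \<in> F" for F y i
  proof (rule poly_mapping_eqI)
    fix j
    have k: "Poly_Mapping.keys (y i) \<subseteq> {j \<in> J. d j = i}" if "i \<in> F" for i using h(2)[OF that] by (simp add: Std_sel)
    show "Poly_Mapping.lookup (y i) j = Poly_Mapping.lookup 0 j"
    proof (cases "d j = i")
      case True
      then show ?thesis using lookup_disjoint_sum[OF h(1) k h(4) True] h(3) by simp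
    next
      case False
      then show ?thesis using k[OF h(4)] by (auto simp: in_keys_iff)
    qed
  qed
  show "filt (Std J a d) (y i) \<le> filt (Std J a d) (\<Sum>i\<in>F. y i)"
    if h: "finite F" "\<And>i. i \<in> F \<Longrightarrow> y i \<in> grade (Std J a d) i" "i \<in> F" for F y i
  proof -
    have k: "Poly_Mapping.keys (y i) \<subseteq> {j \<in> J. d j = i}" if "i \<in> F" for i using h(2)[OF that] by (simp add: Std_sel)
    have "Poly_Mapping.keys (y i) \<subseteq> Poly_Mapping.keys (\<Sum>i\<in>F. y i)"
    proof
      fix j assume j: "j \<in> Poly_Mapping.keys (y i)"
      then have "d j = i" using k[OF h(3)] by blast
      then show "j \<in> Poly_Mapping.keys (\<Sum>i\<in>F. y i)"
        using lookup_disjoint_sum[OF h(1) k h(3)] j by (simp add: in_keys_iff)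
    qed
    then show ?thesis unfolding Std_sel by (intro SUP_subset_mono order_refl)
  qed
  show "linear_on (total (Std J a d)) (bdry (Std J a d))" by (simp add: linear_on_def Std_sel)
  fix x assume x: "x \<in> total (Std J a d)"
  have ne: "filt (Std J a d) x \<noteq> \<infinity> \<and> (filt (Std J a d) x = -\<infinity> \<longleftrightarrow> x = 0)"
  proof (cases "Poly_Mapping.keys x = {}")
    case True
    then show ?thesis by (simp add: Std_sel bot_ereal_def)
  next
    case False
    then have "Max ((\<lambda>j. ereal (a j)) ` Poly_Mapping.keys x) \<in> (\<lambda>j. ereal (a j)) ` Poly_Mapping.keys x"
      by (intro Max_in) auto
    moreover have "filt (Std J a d) x = Max ((\<lambda>j. ereal (a j)) ` Poly_Mapping.keys x)"
      unfolding Std_sel using False by (intro Max_Sup[symmetric]) auto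
    ultimately obtain j where "filt (Std J a d) x = ereal (a j)" by auto
    then show ?thesis using False by auto
  qed
  then show "filt (Std J a d) x \<noteq> \<infinity>" "filt (Std J a d) x = -\<infinity> \<longleftrightarrow> x = 0" by blast+
  show "filt (Std J a d) (vscale c x) = filt (Std J a d) x" if "c \<noteq> 0" for c
    unfolding Std_sel keys_vscale_eq[OF that] ..
  show "filt (Std J a d) (x + y) \<le> max (filt (Std J a d) x) (filt (Std J a d) y)" for y
  proof -
    have "filt (Std J a d) (x + y) \<le> (SUP j\<in>Poly_Mapping.keys x \<union> Poly_Mapping.keys y. ereal (a j))"
      unfolding Std_sel by (rule SUP_subset_mono[OF keys_add order_refl])
    also have "\<dots> = max (filt (Std J a d) x) (filt (Std J a d) y)"
      unfolding Std_sel SUP_union sup_max ..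
    finally show ?thesis .
  qed
qed (simp_all add: Std_sel)

lemma based_Std: "based (Std J a d) (ev ` J) (\<lambda>b. d (idx b)) (\<lambda>b. a (idx b))"
proof -
  have e: "{b \<in> ev ` J. d (idx b) = k} = ev ` {j \<in> J. d j = k}" "{b \<in> ev ` J. a (idx b) \<le> r} = ev ` {j \<in> J. a j \<le> r}" for k r
    by auto
  have h: "filt (Std J a d) x \<le> ereal r \<longleftrightarrow> x \<in> vec.span {b \<in> ev ` J. a (idx b) \<le> r}"
    if "x \<in> total (Std J a d)" for x r
    using that unfolding e filt_Std_le span_ev total_Std by auto
  show ?thesis
    unfolding based_def
  proof (intro conjI allI ballI)
    show "grade (Std J a d) k = vec.span {b \<in> ev ` J. d (idx b) = k}" for k
      unfolding e span_ev Std_sel ..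
  qed (rule independent_ev, rule h)
qed

text \<open>Sets of levels occurring in finitely generated, respectively tame, complexes.\<close>

definition adm :: "bool \<Rightarrow> nat set \<Rightarrow> (nat \<Rightarrow> real) \<Rightarrow> bool" where
  "adm fin J a \<longleftrightarrow> (fin \<longrightarrow> finite J) \<and> (\<forall>r. finite {j \<in> J. a j \<le> r})"

definition objs :: "bool \<Rightarrow> 'k::field fcomplex set" where
  "objs fin = (if fin then Cfg else Ct)"

lemma obj_class_objs [simp]: "obj_class (objs fin)"
  by (simp add: objs_def obj_class_Cfg obj_class_Ct)

lemma objs_Ct: "C \<in> objs fin \<Longrightarrow> C \<in> Ct"
  using Cfg_subset_Ct by (auto simp: objs_def split: if_splits)

lemma findim_keys: "finite J \<Longrightarrow> findim {x :: 'k::field vec. Poly_Mapping.keys x \<subseteq> J}"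
  unfolding span_ev[symmetric] findim_def by (intro exI[of _ "ev ` J"]) simp

lemma Std_objs:
  assumes "adm fin J a" shows "(Std J a d :: 'k::field fcomplex) \<in> objs fin"
proof -
  have "(Std J a d :: 'k fcomplex) \<in> Cfg" if "finite J"
    unfolding Cfg_def using findim_keys[OF that] by (simp add: total_Std filtered_Std)
  moreover have "(Std J a d :: 'k fcomplex) \<in> Ct"
  proof -
    have sl: "sublevel (Std J a d :: 'k fcomplex) r = {x. Poly_Mapping.keys x \<subseteq> {j \<in> J. a j \<le> r}}" for r
      unfolding sublevel_def total_Std filt_Std_le by auto
    have f: "finite {j \<in> J. a j \<le> r}" for r using assms by (simp add: adm_def)
    obtain r0 where r0: "{j \<in> J. a j \<le> r} = {}" if "r \<le> r0" for r
    proof (cases "{j \<in> J. a j \<le> 0} = {}")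
      case True
      then show ?thesis using that[of 0] by fastforce
    next
      case False
      let ?m = "Min (a ` {j \<in> J. a j \<le> 0})"
      have m: "?m \<le> a j" if "j \<in> J" "a j \<le> 0" for j
        using that f[of 0] by (intro Min_le) auto
      have "?m \<in> a ` {j \<in> J. a j \<le> 0}" using f[of 0] False by (intro Min_in) auto
      then have "?m \<le> 0" by auto
      have "{j \<in> J. a j \<le> r} = {}" if "r \<le> ?m - 1" for r
      proof (rule ccontr)
        assume "{j \<in> J. a j \<le> r} \<noteq> {}"
        then obtain j where j: "j \<in> J" "a j \<le> r" by blast
        then have "a j \<le> 0" using that \<open>?m \<le> 0\<close> by linarith
        then show False using m[OF j(1)] j that by linarith
      qed
      then show ?thesis by (rule that)
    qed
    show ?thesis
    proof (rule CtI[OF filtered_Std])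
      show "findim (sublevel (Std J a d :: 'k fcomplex) r)" for r unfolding sl by (rule findim_keys[OF f])
      show "sublevel (Std J a d :: 'k fcomplex) r = {0}" if "r \<le> r0" for r
        unfolding sl r0[OF that] by auto
    qed
  qed
  ultimately show ?thesis using assms by (simp add: objs_def adm_def)
qed

lemma adm_subset: "adm fin J a \<Longrightarrow> J' \<subseteq> J \<Longrightarrow> adm fin J' a"
proof -
  assume h: "adm fin J a" "J' \<subseteq> J"
  have "{j \<in> J'. a j \<le> r} \<subseteq> {j \<in> J. a j \<le> r}" for r using h(2) by blast
  then show ?thesis using h finite_subset unfolding adm_def by meson
qed

text \<open>Finitely many copies of each generator at the level of the original do not spoil
  local finiteness. The copies are indexed by pairs, encoded through \<open>p\<close>.\<close>

lemma adm_image: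
  assumes "adm fin J a" "J' \<subseteq> p ` (SIGMA j:J. M j)" "\<And>j m. j \<in> J \<Longrightarrow> m \<in> M j \<Longrightarrow> a' (p (j, m)) = a j"
    "\<And>j. j \<in> J \<Longrightarrow> finite (M j)"
  shows "adm fin J' a'"
  unfolding adm_def
proof (intro conjI impI allI)
  assume "fin"
  then have "finite J" using assms(1) by (simp add: adm_def)
  then have "finite (SIGMA j:J. M j)" using assms(4) by blast
  then show "finite J'" using assms(2) finite_subset by blast
next
  fix r
  have "finite {j \<in> J. a j \<le> r}" using assms(1) by (simp add: adm_def)
  then have "finite (SIGMA j:{j \<in> J. a j \<le> r}. M j)" using assms(4) by blast
  moreover have "{n \<in> J'. a' n \<le> r} \<subseteq> p ` (SIGMA j:{j \<in> J. a j \<le> r}. M j)"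
  proof
    fix n assume n: "n \<in> {n \<in> J'. a' n \<le> r}"
    then obtain j m where jm: "j \<in> J" "m \<in> M j" "n = p (j, m)" using assms(2) by blast
    then have "a j \<le> r" using n assms(3) by simp
    then show "n \<in> p ` (SIGMA j:{j \<in> J. a j \<le> r}. M j)" using jm by blast
  qed
  ultimately show "finite {n \<in> J'. a' n \<le> r}" using finite_subset by blast
qed

lemma hequiv_strict_ex:
  assumes "shifts R" "filtered_complex C" "filtered_complex D" "linear_on (total C) f"
    "\<And>i. f ` grade C i = grade D i" "\<And>x. x \<in> total C \<Longrightarrow> f (bdry C x) = bdry D (f x)"
    "\<And>x. x \<in> total C \<Longrightarrow> filt D (f x) = filt C x"
  shows "\<exists>g. hequiv R C D f g"
  using hequiv_strict[OF assms] by blast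

text \<open>Degrees and levels are determined by the spans of parts of the basis, which a linear
  map between the bases carries onto each other.\<close>

lemma based_iso:
  assumes R: "shifts R" and fc: "filtered_complex C" "filtered_complex D"
    and B: "based C B dg lv" and B': "based D B' dg' lv'"
    and g: "Vector_Spaces.linear vscale vscale g" "bij_betw g B B'"
    and pres: "\<And>b. b \<in> B \<Longrightarrow> dg' (g b) = dg b" "\<And>b. b \<in> B \<Longrightarrow> lv' (g b) = lv b"
      "\<And>b. b \<in> B \<Longrightarrow> g (bdry C b) = bdry D (g b)"
  obtains k where "hequiv R C D g k"
proof -
  have im: "g ` {b \<in> B. P b} = {b' \<in> B'. P' b'}" if "\<And>b. b \<in> B \<Longrightarrow> P b = P' (g b)" for P P'
    using that g(2) unfolding bij_betw_def by auto
  have sp: "g ` vec.span S = vec.span (g ` S)" for S using vp.linear_span_image[OF g(1)] by simp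
  have tot: "total C = vec.span B" "total D = vec.span B'" using based_total B B' by blast+
  have inj: "inj_on g (vec.span B)"
  proof (rule vp.linear_inj_on_span_independent_image[OF g(1)])
    show "vec.independent (g ` B)" using basedD(1)[OF B'] g(2) by (simp add: bij_betw_def)
  qed (use g(2) in \<open>simp add: bij_betw_def\<close>)
  have gt: "g x \<in> total D" if "x \<in> total C" for x
    using that sp[of B] g(2) unfolding tot bij_betw_def by blast
  show thesis
  proof (rule hequiv_strict[OF R fc linear_imp_linear_on[OF g(1)]])
    show "g ` grade C i = grade D i" for i
      unfolding basedD(2)[OF B] basedD(2)[OF B'] sp using im[of "\<lambda>b. dg b = i" "\<lambda>b. dg' b = i"] pres(1) by simp
    show "g (bdry C x) = bdry D (g x)" if "x \<in> total C" for x
    proof (rule linear_on_eq_span[of B "\<lambda>x. g (bdry C x)" "\<lambda>x. bdry D (g x)" x])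
      show "linear_on (vec.span B) (\<lambda>x. g (bdry C x))"
        by (rule linear_on_comp[OF _ subset_UNIV linear_imp_linear_on[OF g(1)]]) (use fc_lin[OF fc(1)] tot in simp)
      show "linear_on (vec.span B) (\<lambda>x. bdry D (g x))"
        by (rule linear_on_comp[OF linear_imp_linear_on[OF g(1)] _ fc_lin[OF fc(2)]]) (use gt tot(1) in auto)
      show "x \<in> vec.span B" using that tot by simp
    qed (rule pres(3))
    show "filt D (g x) = filt C x" if x: "x \<in> total C" for x
    proof (rule ereal_eq_levels)
      fix r
      let ?L = "{b \<in> B. lv b \<le> r}"
      have L: "g ` ?L = {b' \<in> B'. lv' b' \<le> r}" by (rule im) (simp add: pres(2))
      have "filt D (g x) \<le> ereal r \<longleftrightarrow> g x \<in> g ` vec.span ?L"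
        unfolding sp L by (rule basedD(3)[OF B' gt[OF x]])
      also have "\<dots> \<longleftrightarrow> x \<in> vec.span ?L"
        using inj_on_image_mem_iff[OF inj, of x "vec.span ?L"] x tot(1) vec.span_mono[of ?L B] by blast
      also have "\<dots> \<longleftrightarrow> filt C x \<le> ereal r" by (rule basedD(3)[OF B x, symmetric])
      finally show "filt D (g x) \<le> ereal r \<longleftrightarrow> filt C x \<le> ereal r" .
    qed
  qed (rule that)
qed

lemma rel_std_bij:
  assumes R: "shifts R" and adm: "adm fin J a" "adm fin J' a'" and p: "bij_betw p J J'"
    and pres: "\<And>j. j \<in> J \<Longrightarrow> a' (p j) = a j" "\<And>j. j \<in> J \<Longrightarrow> d' (p j) = d j"
  shows "frag_of (Std J a d) - frag_of (Std J' a' d' :: 'k::field fcomplex) \<in> relations R (objs fin)"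
proof -
  obtain g where g: "Vector_Spaces.linear vscale vscale g" "\<forall>j. g (ev j) = (ev (p j) :: 'k vec)"
    by (rule linear_from_ev[of "\<lambda>j. ev (p j)"])
  have bij: "bij_betw g (ev ` J) (ev ` J')"
  proof (rule bij_betw_imageI)
    have "inj_on p J" using p by (rule bij_betw_imp_inj_on)
    show "inj_on g (ev ` J)"
    proof (rule inj_onI)
      fix x y assume "x \<in> ev ` J" "y \<in> ev ` J" "g x = g y"
      then obtain i j where ij: "i \<in> J" "j \<in> J" "x = ev i" "y = ev j" "g x = g y" by blast
      then have "idx (ev (p i) :: 'k vec) = idx (ev (p j) :: 'k vec)" using g(2) by simp
      then have "i = j" using \<open>inj_on p J\<close> ij(1,2) by (simp add: inj_on_def)
      then show "x = y" using ij by simp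
    qed
    have "g ` ev ` J = ev ` p ` J" by (simp add: g(2) image_image)
    then show "g ` ev ` J = (ev ` J' :: 'k vec set)" using p by (simp add: bij_betw_def)
  qed
  obtain k where k: "hequiv R (Std J a d) (Std J' a' d' :: 'k fcomplex) g k"
  proof (rule based_iso[OF R filtered_Std filtered_Std based_Std based_Std g(1) bij])
    show "d' (idx (g b)) = d (idx b)" if "b \<in> ev ` J" for b using that by (auto simp: g(2) pres(2))
    show "a' (idx (g b)) = a (idx b)" if "b \<in> ev ` J" for b using that by (auto simp: g(2) pres(1))
    show "g (bdry (Std J a d) b) = bdry (Std J' a' d') (g b)" for b
      by (simp add: Std_sel vp.linear_0[OF g(1)])
  qed
  show ?thesis
    by (rule rel_iso[OF obj_class_objs R Std_objs[OF adm(1)] Std_objs[OF adm(2)] k])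
qed

lemma keys_add_disjoint:
  assumes "Poly_Mapping.keys x \<inter> Poly_Mapping.keys y = {}"
  shows "Poly_Mapping.keys (x + y :: 'k::field vec) = Poly_Mapping.keys x \<union> Poly_Mapping.keys y"
proof
  show "Poly_Mapping.keys x \<union> Poly_Mapping.keys y \<subseteq> Poly_Mapping.keys (x + y)"
  proof
    fix j assume "j \<in> Poly_Mapping.keys x \<union> Poly_Mapping.keys y"
    moreover have "j \<notin> Poly_Mapping.keys x \<or> j \<notin> Poly_Mapping.keys y" using assms by blast
    ultimately show "j \<in> Poly_Mapping.keys (x + y)"
      by (auto simp: in_keys_iff lookup_add)
  qed
qed (rule keys_add)

lemma rel_std_union:
  assumes R: "shifts R" and adm: "adm fin (J1 \<union> J2) a" and disj: "J1 \<inter> J2 = {}"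
  shows "frag_of (Std (J1 \<union> J2) a d) - frag_of (Std J1 a d) - frag_of (Std J2 a d :: 'k::field fcomplex)
    \<in> relations R (objs fin)"
proof (rule rel_exact[OF obj_class_objs R, where \<alpha> = "\<lambda>x. x" and \<beta> = "\<lambda>x. x" and \<theta> = "\<lambda>_. 0"])
  show "Std J1 a d \<in> objs fin" "Std J2 a d \<in> objs fin" "Std (J1 \<union> J2) a d \<in> objs fin"
    by (rule Std_objs, rule adm_subset[OF adm], blast)+
  show "filt (Std (J1 \<union> J2) a d) (x + y) = max (filt (Std J1 a d) x) (filt (Std J2 a d) y)"
    if "x \<in> total (Std J1 a d)" "y \<in> total (Std J2 a d)" for x y :: "'k vec"
  proof -
    have dj: "Poly_Mapping.keys x \<inter> Poly_Mapping.keys y = {}" using that disj unfolding total_Std by blast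
    show ?thesis unfolding Std_sel keys_add_disjoint[OF dj] SUP_union sup_max ..
  qed
  show "\<exists>x\<in>grade (Std J1 a d) i. \<exists>y\<in>grade (Std J2 a d) i. z = x + y"
    if z: "z \<in> grade (Std (J1 \<union> J2) a d) i" for i and z :: "'k vec"
  proof -
    have "{j \<in> J1 \<union> J2. d j = i} = {j \<in> J1. d j = i} \<union> {j \<in> J2. d j = i}" by blast
    then have "z \<in> vec.span (ev ` {j \<in> J1. d j = i} \<union> ev ` {j \<in> J2. d j = i})"
      using z unfolding Std_sel image_Un[symmetric] span_ev by simp
    then show ?thesis unfolding vec.span_Un span_ev Std_sel by blast
  qed
qed (auto simp: Std_sel)

text \<open>A complex with zero differential, desuspended, is the same graded space one degree
  lower.\<close>

lemma rel_std_shift: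
  assumes R: "shifts R" and adm: "adm fin J a"
  shows "frag_of (Std J a (\<lambda>j. d j + 1)) + frag_of (Std J a d :: 'k::field fcomplex) \<in> relations R (objs fin)"
proof -
  let ?S = "Std J a (\<lambda>j. d j + 1) :: 'k fcomplex"
  have gr: "grade (desusp ?S) i = grade (Std J a d) i" for i
    unfolding desusp_sel Std_sel by auto
  have "\<exists>g. hequiv R (desusp ?S) (Std J a d) (\<lambda>x. x) g"
    by (rule hequiv_strict_ex[OF R filtered_desusp[OF filtered_Std] filtered_Std])
      (simp_all add: gr, simp_all add: Std_sel)
  then obtain g where g: "hequiv R (desusp ?S) (Std J a d) (\<lambda>x. x) g" by (rule exE)
  have S: "?S \<in> objs fin" "Std J a d \<in> objs fin" by (rule Std_objs[OF adm])+
  have "frag_of (desusp ?S) - frag_of (Std J a d) \<in> relations R (objs fin)"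
    by (rule rel_iso[OF obj_class_objs R obj_classD(3)[OF obj_class_objs S(1)] S(2) g])
  from rel_diff[OF rel_desusp[OF obj_class_objs R S(1)] this] show ?thesis
    by (rule rel_cong) simp
qed

section \<open>The Euler characteristics of the sublevels determine the class\<close>

text \<open>An Eilenberg swindle of bounded length: for each generator \<open>j\<close> insert copies in the degrees
  \<open>d j, d j + 2, \<dots>, e j\<close>. Removing the last copy or the first one leaves complexes that differ by a
  double shift, which does not change the class. So infinitely many degrees can be changed at once
  without leaving the tame complexes.\<close>

lemma rel_std_even_le:
  assumes R: "shifts R" and adm: "adm fin J a" and e: "\<And>j. j \<in> J \<Longrightarrow> e j = d j + 2 * int (k j)"
  shows "frag_of (Std J a d) - frag_of (Std J a e :: 'k::field fcomplex) \<in> relations R (objs fin)"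
proof -
  define p1 p2 where "p1 n = fst (prod_decode n)" and "p2 n = snd (prod_decode n)" for n :: nat
  have p [simp]: "p1 (prod_encode (j, m)) = j" "p2 (prod_encode (j, m)) = m" "prod_encode (p1 n, p2 n) = n" for j m n
    by (simp_all add: p1_def p2_def)
  \<comment> \<open>\<open>T\<close> indexes the copies \<open>(j, m)\<close>, \<open>0 \<le> m
    \<le> k j\<close>, in degree \<open>d j + 2 m\<close>. It is split in two ways: the first
    copies \<open>T0\<close>, which form the source, and the others; the last copies
    \<open>Te\<close>, which form the target, and the others.\<close>
  define T where "T = {n. p1 n \<in> J \<and> p2 n \<le> k (p1 n)}"
  define T0 T1 Te Tl where "T0 = {n \<in> T. p2 n = 0}" and "T1 = {n \<in> T. p2 n \<noteq> 0}"
    and "Te = {n \<in> T. p2 n = k (p1 n)}" and "Tl = {n \<in> T. p2 n \<noteq> k (p1 n)}"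
  define a' d' where "a' n = a (p1 n)" and "d' n = d (p1 n) + 2 * int (p2 n)" for n
  have admT: "adm fin T a'"
  proof (rule adm_image[OF adm, of T prod_encode "\<lambda>j. {..k j}"])
    show "T \<subseteq> prod_encode ` (SIGMA j:J. {..k j})"
    proof
      fix n assume "n \<in> T"
      then have "(p1 n, p2 n) \<in> (SIGMA j:J. {..k j})" by (simp add: T_def)
      then have "prod_encode (p1 n, p2 n) \<in> prod_encode ` (SIGMA j:J. {..k j})" by (rule imageI)
      then show "n \<in> prod_encode ` (SIGMA j:J. {..k j})" by simp
    qed
  qed (simp_all add: a'_def)
  have sub: "T0 \<subseteq> T" "T1 \<subseteq> T" "Te \<subseteq> T" "Tl \<subseteq> T" by (auto simp: T0_def T1_def Te_def Tl_def)
  note admS = adm_subset[OF admT sub(1)] adm_subset[OF admT sub(2)] adm_subset[OF admT sub(3)] adm_subset[OF admT sub(4)]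
  have T01: "T = T0 \<union> T1" "T0 \<inter> T1 = {}" and Tel: "T = Te \<union> Tl" "Te \<inter> Tl = {}"
    by (auto simp: T0_def T1_def Te_def Tl_def)
  let ?S = "\<lambda>T. frag_of (Std T a' d' :: 'k fcomplex)"
  have X1: "?S T - ?S T0 - ?S T1 \<in> relations R (objs fin)"
    using rel_std_union[OF R, of fin T0 T1 a' d'] T01 admT by simp
  have X2: "?S T - ?S Te - ?S Tl \<in> relations R (objs fin)"
    using rel_std_union[OF R, of fin Te Tl a' d'] Tel admT by simp
  have X3: "frag_of (Std J a d) - ?S T0 \<in> relations R (objs fin)"
  proof (rule rel_std_bij[OF R adm admS(1), of "\<lambda>j. prod_encode (j, 0)"])
    show "bij_betw (\<lambda>j. prod_encode (j, 0)) J T0"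
      by (rule bij_betw_byWitness[of _ p1]) (auto simp: T0_def T_def, metis p(3))
  qed (simp_all add: a'_def d'_def)
  have X4: "frag_of (Std J a e) - ?S Te \<in> relations R (objs fin)"
  proof (rule rel_std_bij[OF R adm admS(3), of "\<lambda>j. prod_encode (j, k j)"])
    show "bij_betw (\<lambda>j. prod_encode (j, k j)) J Te"
      by (rule bij_betw_byWitness[of _ p1]) (auto simp: Te_def T_def, metis p(3))
  qed (simp_all add: a'_def d'_def e)
  \<comment> \<open>Replacing \<open>m\<close> by \<open>m + 1\<close> identifies
    \<open>Tl\<close>, moved up by two degrees, with \<open>T1\<close>; and moving by two
    degrees changes the sign of the class twice.\<close>
  have X5: "frag_of (Std Tl a' (\<lambda>n. d' n + 1 + 1)) - ?S T1 \<in> relations R (objs fin)"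
  proof (rule rel_std_bij[OF R admS(4,2), of "\<lambda>n. prod_encode (p1 n, p2 n + 1)"])
    show "bij_betw (\<lambda>n. prod_encode (p1 n, p2 n + 1)) Tl T1"
      by (rule bij_betw_byWitness[of _ "\<lambda>n. prod_encode (p1 n, p2 n - 1)"]) (auto simp: Tl_def T1_def T_def)
  qed (simp_all add: a'_def d'_def)
  have X6: "frag_of (Std Tl a' (\<lambda>n. d' n + 1 + 1)) - ?S Tl \<in> relations R (objs fin)"
    by (rule rel_cong[OF rel_diff[OF rel_std_shift[OF R admS(4), of "\<lambda>n. d' n + 1"] rel_std_shift[OF R admS(4), of d']]])
      simp
  have "(frag_of (Std J a d) - ?S T0) - (frag_of (Std J a e) - ?S Te) + (?S T - ?S Te - ?S Tl) - (?S T - ?S T0 - ?S T1)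
    - (frag_of (Std Tl a' (\<lambda>n. d' n + 1 + 1)) - ?S Tl) + (frag_of (Std Tl a' (\<lambda>n. d' n + 1 + 1)) - ?S T1)
    \<in> relations R (objs fin)"
    by (intro rel_add rel_diff X1 X2 X3 X4 X5 X6)
  then show ?thesis by (rule rel_cong) (simp add: algebra_simps)
qed

text \<open>Go up from both degree functions to a common bound that has the right
  parity.\<close>

lemma rel_std_parity:
  assumes R: "shifts R" and adm: "adm fin J a" and par: "\<And>j. j \<in> J \<Longrightarrow> even (d j - e j)"
  shows "frag_of (Std J a d) - frag_of (Std J a e :: 'k::field fcomplex) \<in> relations R (objs fin)"
proof -
  define c where "c j = max (d j) (e j)" for j
  have "frag_of (Std J a d) - frag_of (Std J a c :: 'k fcomplex) \<in> relations R (objs fin)"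
  proof (rule rel_std_even_le[OF R adm, of c d "\<lambda>j. nat ((c j - d j) div 2)"])
    fix j assume "j \<in> J"
    then have "even (c j - d j)" using par[of j] by (auto simp: c_def max_def)
    moreover have "0 \<le> c j - d j" by (simp add: c_def)
    ultimately show "c j = d j + 2 * int (nat ((c j - d j) div 2))" by simp
  qed
  moreover have "frag_of (Std J a e) - frag_of (Std J a c :: 'k fcomplex) \<in> relations R (objs fin)"
  proof (rule rel_std_even_le[OF R adm, of c e "\<lambda>j. nat ((c j - e j) div 2)"])
    fix j assume "j \<in> J"
    then have "even (c j - e j)" using par[of j] by (auto simp: c_def max_def)
    moreover have "0 \<le> c j - e j" by (simp add: c_def)
    ultimately show "c j = e j + 2 * int (nat ((c j - e j) div 2))" by simp
  qed
  ultimately show ?thesis by (rule rel_cong[OF rel_diff]) simp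
qed

abbreviation Std0 :: "nat set \<Rightarrow> (nat \<Rightarrow> real) \<Rightarrow> 'k::field fcomplex" where
  "Std0 J a \<equiv> Std J a (\<lambda>_. 0)"

lemma rel_std_degree0:
  assumes R: "shifts R" and adm: "adm fin J a"
  shows "frag_of (Std J a d :: 'k::field fcomplex) - (frag_of (Std0 {j \<in> J. even (d j)} a) - frag_of (Std0 {j \<in> J. odd (d j)} a))
    \<in> relations R (objs fin)"
proof -
  let ?E = "{j \<in> J. even (d j)}" and ?O = "{j \<in> J. odd (d j)}"
  have un: "?E \<union> ?O = J" "?E \<inter> ?O = {}" by auto
  have E: "adm fin ?E a" and O: "adm fin ?O a" by (rule adm_subset[OF adm], blast)+
  have 1: "frag_of (Std J a d :: 'k fcomplex) - frag_of (Std ?E a d) - frag_of (Std ?O a d) \<in> relations R (objs fin)"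
    using rel_std_union[OF R, of fin ?E ?O a d] un adm by simp
  have 2: "frag_of (Std ?E a d :: 'k fcomplex) - frag_of (Std0 ?E a) \<in> relations R (objs fin)"
    by (rule rel_std_parity[OF R E]) simp
  have 3: "frag_of (Std ?O a d :: 'k fcomplex) - frag_of (Std ?O a (\<lambda>_. 0 + 1)) \<in> relations R (objs fin)"
    by (rule rel_std_parity[OF R O]) simp
  have 4: "frag_of (Std ?O a (\<lambda>_. 0 + 1) :: 'k fcomplex) + frag_of (Std0 ?O a) \<in> relations R (objs fin)"
    by (rule rel_std_shift[OF R O, of "\<lambda>_. 0"])
  show ?thesis
    by (rule rel_cong[OF rel_add[OF rel_add[OF rel_add[OF 1 2] 3] 4]]) (simp add: algebra_simps)
qed

definition zsub :: "'k::field fcomplex \<Rightarrow> (int \<Rightarrow> 'k vec set) \<Rightarrow> 'k fcomplex" where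
  "zsub C G = \<lparr>grade = G, bdry = (\<lambda>_. 0), filt = filt C\<rparr>"

lemma zsub_sel [simp]: "grade (zsub C G) = G" "bdry (zsub C G) x = 0" "filt (zsub C G) = filt C"
  by (simp_all add: zsub_def)

lemma zsub_total:
  assumes "\<And>i. G i \<subseteq> grade C i" shows "total (zsub C G) \<subseteq> total C"
  unfolding total_def zsub_sel by (rule vec.span_mono) (use assms in blast)

lemma filtered_zsub:
  assumes C: "filtered_complex C" and G: "\<And>i. vec.subspace (G i)" "\<And>i. G i \<subseteq> grade C i"
  shows "filtered_complex (zsub C G)"
proof -
  have t: "x \<in> total C" if "x \<in> total (zsub C G)" for x using zsub_total[OF G(2)] that by blast
  show ?thesis
  proof (rule filtered_complexI)
    show "y i = 0" if "finite F" "\<And>i. i \<in> F \<Longrightarrow> y i \<in> grade (zsub C G) i" "sum y F = 0" "i \<in> F" for F y i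
      by (rule fc_indep[OF C that(1) _ that(3,4)]) (use that(2) G(2) in auto)
    show "filt (zsub C G) (y i) \<le> filt (zsub C G) (sum y F)"
      if "finite F" "\<And>i. i \<in> F \<Longrightarrow> y i \<in> grade (zsub C G) i" "i \<in> F" for F y i
      unfolding zsub_sel by (rule fc_homog[OF C that(1) _ that(3)]) (use that(2) G(2) in auto)
    fix x assume x: "x \<in> total (zsub C G)"
    show "filt (zsub C G) x \<noteq> \<infinity>" "filt (zsub C G) x = -\<infinity> \<longleftrightarrow> x = 0"
      using fc_noinf[OF C t[OF x]] fc_minf[OF C t[OF x]] by simp_all
    show "filt (zsub C G) (vscale c x) = filt (zsub C G) x" if "c \<noteq> 0" for c
      using fc_scale[OF C t[OF x] that] by simp
    show "filt (zsub C G) (x + y) \<le> max (filt (zsub C G) x) (filt (zsub C G) y)" if "y \<in> total (zsub C G)" for y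
      using fc_add[OF C t[OF x] t[OF that]] by simp
    show "filt (zsub C G) (bdry (zsub C G) x) \<le> filt (zsub C G) x"
      using fc_0[OF C] by simp
  qed (use G vec.subspace_0[OF G(1)] in \<open>auto simp: linear_on_def\<close>)
qed

lemma zsub_objs:
  assumes C: "C \<in> objs fin" and G: "\<And>i. vec.subspace (G i)" "\<And>i. G i \<subseteq> grade C i"
  shows "zsub C G \<in> objs fin"
proof -
  have fC: "filtered_complex C" using CtD(1)[OF objs_Ct[OF C]] .
  note fz = filtered_zsub[OF fC G] and t = zsub_total[OF G(2)]
  have sl: "sublevel (zsub C G) r \<subseteq> sublevel C r" for r using t unfolding sublevel_def by auto
  show ?thesis
  proof (cases fin)
    case True
    then have "findim (total C)" using C by (simp add: objs_def Cfg_def)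
    then show ?thesis using True fz findim_subset[OF _ t] by (simp add: objs_def Cfg_def)
  next
    case False
    obtain r0 where r0: "\<And>r. r \<le> r0 \<Longrightarrow> sublevel C r = {0}" using CtD(3)[OF objs_Ct[OF C]] by blast
    have "zsub C G \<in> Ct"
    proof (rule CtI[OF fz findim_subset[OF CtD(2)[OF objs_Ct[OF C]] sl]])
      show "sublevel (zsub C G) r = {0}" if "r \<le> r0" for r
        using sl[of r] r0[OF that] vec.subspace_0[OF subspace_sublevel[OF fz]] by blast
    qed
    then show ?thesis using False by (simp add: objs_def)
  qed
qed

lemma span_homog:
  assumes B: "based C B dg lv" and S: "S \<subseteq> B"
  shows "total (zsub C (\<lambda>k. vec.span {b \<in> S. dg b = k})) = vec.span S"
proof
  show "total (zsub C (\<lambda>k. vec.span {b \<in> S. dg b = k})) \<subseteq> vec.span S"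
    unfolding total_def zsub_sel by (intro vec.span_minimal vec.subspace_span UN_least vec.span_mono) blast
  have "S \<subseteq> total (zsub C (\<lambda>k. vec.span {b \<in> S. dg b = k}))"
  proof
    fix b assume "b \<in> S"
    then have "b \<in> grade (zsub C (\<lambda>k. vec.span {b \<in> S. dg b = k})) (dg b)"
      unfolding zsub_sel by (intro vec.span_base) simp
    then show "b \<in> total (zsub C (\<lambda>k. vec.span {b \<in> S. dg b = k}))" by (rule grade_total)
  qed
  then show "vec.span S \<subseteq> total (zsub C (\<lambda>k. vec.span {b \<in> S. dg b = k}))"
    by (rule vec.span_minimal) simp
qed

text \<open>Forgetting the differential does not change the class: the cycles \<open>Z\<close>
  and the complement \<open>W\<close> spanned by the other basis vectors have zero differential,
  and both the complex and its underlying graded space are extensions of \<open>W\<close> by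
  \<open>Z\<close>, the defect \<open>\<theta>\<close> being the differential in one case and
  zero in the other.\<close>

lemma rel_forget_differential:
  assumes R: "shifts R" and C: "C \<in> objs fin"
  shows "frag_of C - frag_of (zsub C (grade C)) \<in> relations R (objs fin)"
proof -
  note Ct = objs_Ct[OF C]
  note fC = CtD(1)[OF Ct]
  obtain B BZ dg lv where B: "based C B dg lv" and Z: "BZ \<subseteq> B" "\<forall>b\<in>BZ. bdry C b = 0"
    "\<forall>b\<in>B. bdry C b \<in> vec.span BZ"
    by (rule adapted_basis[OF Ct])
  let ?W = "B - BZ"
  let ?G = "\<lambda>S k. vec.span {b \<in> S. dg b = k}"
  let ?Z = "zsub C (?G BZ)" and ?Q = "zsub C (?G ?W)" and ?C0 = "zsub C (grade C)"
  have ind: "vec.independent B" by (rule basedD(1)[OF B])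
  have Gsub: "?G S k \<subseteq> grade C k" if "S \<subseteq> B" for S k
    unfolding basedD(2)[OF B] by (rule vec.span_mono) (use that in blast)
  have objs: "?Z \<in> objs fin" "?Q \<in> objs fin" "?C0 \<in> objs fin"
    by (rule zsub_objs[OF C vec.subspace_span Gsub[OF Z(1)]], rule zsub_objs[OF C vec.subspace_span Gsub], blast,
      rule zsub_objs[OF C fc_sub[OF fC] order_refl])
  have W: "?W \<subseteq> B" by blast
  have tZ: "total ?Z = vec.span BZ" and tW: "total ?Q = vec.span ?W" using span_homog[OF B] Z(1) W by blast+
  have tC0: "total ?C0 = total C" by (rule total_cong) simp
  have subt: "total ?Z \<subseteq> total C" "total ?Q \<subseteq> total C"
    by (rule zsub_total[OF Gsub[OF Z(1)]], rule zsub_total[OF Gsub[OF W]])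
  have fi: "filt C (x + y) = max (filt C x) (filt C y)" if "x \<in> total ?Z" "y \<in> total ?Q" for x y
  proof (rule ereal_eq_levels)
    fix r
    let ?L = "{b \<in> B. lv b \<le> r}"
    have xy: "x \<in> vec.span BZ" "y \<in> vec.span ?W" using that tZ tW by auto
    have xyt: "x \<in> total C" "y \<in> total C" using that subt by auto
    have "filt C (x + y) \<le> ereal r \<longleftrightarrow> x + y \<in> vec.span ?L" by (rule basedD(3)[OF B total_add[OF xyt]])
    also have "\<dots> \<longleftrightarrow> x \<in> vec.span ?L \<and> y \<in> vec.span ?L"
      by (rule sum_in_span_disjoint[OF ind Z(1) W _ _ xy]) auto
    also have "\<dots> \<longleftrightarrow> max (filt C x) (filt C y) \<le> ereal r"
      using basedD(3)[OF B xyt(1)] basedD(3)[OF B xyt(2)] by simp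
    finally show "filt C (x + y) \<le> ereal r \<longleftrightarrow> max (filt C x) (filt C y) \<le> ereal r" .
  qed
  have sp: "\<exists>x\<in>?G BZ i. \<exists>y\<in>?G ?W i. z = x + y" if "z \<in> grade C i" for z i
  proof -
    have "{b \<in> B. dg b = i} = {b \<in> BZ. dg b = i} \<union> {b \<in> ?W. dg b = i}" using Z(1) by blast
    then show ?thesis using that unfolding basedD(2)[OF B] by (auto simp: vec.span_Un)
  qed
  have bz: "bdry C x = 0" if "x \<in> vec.span BZ" for x
  proof (rule linear_on_eq_span[of BZ "bdry C" "\<lambda>_. 0"])
    show "linear_on (vec.span BZ) (bdry C)" using linear_on_subset[OF fc_lin[OF fC] subt(1)] tZ by simp
  qed (use Z(2) that in auto)
  have bw: "bdry C x \<in> ?G BZ (i - 1)" if x: "x \<in> ?G ?W i" for x i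
  proof -
    have xg: "x \<in> grade C i" using x Gsub[OF W] by blast
    have "bdry C ` vec.span B \<subseteq> vec.span BZ"
    proof
      fix y assume "y \<in> bdry C ` vec.span B"
      then obtain z where z: "z \<in> vec.span B" "y = bdry C z" by blast
      obtain g where g: "Vector_Spaces.linear vscale vscale g" "\<And>x. x \<in> total C \<Longrightarrow> g x = bdry C x"
        using linear_on_extend[OF fc_lin[OF fC] subspace_total] by blast
      have Bt: "B \<subseteq> total C" unfolding based_total[OF B] by (rule vec.span_superset)
      have "g ` B \<subseteq> vec.span BZ" using g(2) Bt Z(3) by auto
      then have "vec.span (g ` B) \<subseteq> vec.span BZ" by (rule vec.span_minimal) simp
      moreover have "y \<in> vec.span (g ` B)"
        using z g(2) based_total[OF B] vp.linear_span_image[OF g(1), of B] by auto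
      ultimately show "y \<in> vec.span BZ" by blast
    qed
    then have 1: "bdry C x \<in> vec.span BZ" using grade_total[OF xg] based_total[OF B] by blast
    have 2: "bdry C x \<in> vec.span {b \<in> B. dg b = i - 1}" using fc_bdry[OF fC xg] unfolding basedD(2)[OF B] .
    have "{b \<in> B. dg b = i - 1} \<subseteq> B" by blast
    from span_Int_independent[OF ind Z(1) this 1 2]
    have "bdry C x \<in> vec.span (BZ \<inter> {b \<in> B. dg b = i - 1})" .
    moreover have "BZ \<inter> {b \<in> B. dg b = i - 1} = {b \<in> BZ. dg b = i - 1}" using Z(1) by blast
    ultimately show ?thesis by simp
  qed
  have 1: "frag_of C - frag_of ?Z - frag_of ?Q \<in> relations R (objs fin)"
  proof (rule rel_exact[OF obj_class_objs R objs(1,2) C, where \<alpha> = "\<lambda>x. x" and \<beta> = "\<lambda>x. x" and \<theta> = "bdry C"])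
    show "linear_on (total ?Q) (bdry C)" by (rule linear_on_subset[OF fc_lin[OF fC] subt(2)])
    show "x \<in> grade C i" if "x \<in> grade ?Z i" for i x using that Gsub[OF Z(1)] by auto
    show "x \<in> grade C i" if "x \<in> grade ?Q i" for i x using that Gsub[OF W] by auto
    show "bdry C x \<in> grade ?Z (i - 1)" if "x \<in> grade ?Q i" for i x using that bw by simp
    show "bdry C x = bdry ?Z x" if "x \<in> total ?Z" for x using that bz tZ by simp
    show "filt C (x + y) = max (filt ?Z x) (filt ?Q y)" if "x \<in> total ?Z" "y \<in> total ?Q" for x y
      unfolding zsub_sel by (rule fi[OF that])
    show "\<exists>x\<in>grade ?Z i. \<exists>y\<in>grade ?Q i. z = x + y" if "z \<in> grade C i" for i z
      unfolding zsub_sel by (rule sp[OF that])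
  qed simp_all
  have 2: "frag_of ?C0 - frag_of ?Z - frag_of ?Q \<in> relations R (objs fin)"
  proof (rule rel_exact[OF obj_class_objs R objs(1,2,3), where \<alpha> = "\<lambda>x. x" and \<beta> = "\<lambda>x. x" and \<theta> = "\<lambda>_. 0"])
    show "x \<in> grade ?C0 i" if "x \<in> grade ?Z i" for i x using that Gsub[OF Z(1)] by auto
    show "x \<in> grade ?C0 i" if "x \<in> grade ?Q i" for i x using that Gsub[OF W] by auto
    show "filt ?C0 (x + y) = max (filt ?Z x) (filt ?Q y)" if "x \<in> total ?Z" "y \<in> total ?Q" for x y
      unfolding zsub_sel by (rule fi[OF that])
    show "\<exists>x\<in>grade ?Z i. \<exists>y\<in>grade ?Q i. z = x + y" if "z \<in> grade ?C0 i" for i z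
      using sp[of z i] that unfolding zsub_sel .
    show "0 \<in> grade ?Z (i - 1)" for i unfolding zsub_sel by (rule vec.span_zero)
  qed simp_all
  show ?thesis by (rule rel_cong[OF rel_diff[OF 1 2]]) simp
qed

lemma rel_to_std:
  assumes R: "shifts R" and C: "(C :: 'k::field fcomplex) \<in> objs fin"
  obtains J a d where "adm fin J a" "frag_of C - frag_of (Std J a d) \<in> relations R (objs fin)"
proof -
  note Ct = objs_Ct[OF C]
  note fC = CtD(1)[OF Ct]
  obtain B BZ dg lv where B: "based C B dg lv" and "BZ \<subseteq> B" "\<forall>b\<in>BZ. bdry C b = 0"
    "\<forall>b\<in>B. bdry C b \<in> vec.span BZ"
    by (rule adapted_basis[OF Ct])
  have finL: "finite {b \<in> B. lv b \<le> r}" for r by (rule based_finite[OF Ct B])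
  have "B = (\<Union>n::nat. {b \<in> B. lv b \<le> real n})"
    using real_arch_simple by auto
  moreover have "countable (\<Union>n::nat. {b \<in> B. lv b \<le> real n})"
    by (intro countable_UN countable_finite[OF finL]) auto
  ultimately have "countable B" by simp
  then obtain f :: "'k vec \<Rightarrow> nat" where f: "inj_on f B" by (rule countableE)
  let ?J = "f ` B" and ?e = "inv_into B f"
  have e: "?e (f b) = b" if "b \<in> B" for b by (rule inv_into_f_f[OF f that])
  have bij: "bij_betw f B ?J" using f by (simp add: bij_betw_def)
  have adm: "adm fin ?J (\<lambda>j. lv (?e j))"
    unfolding adm_def
  proof (intro conjI impI allI)
    assume fin
    then have "C \<in> Cfg" using C by (simp add: objs_def)
    then show "finite ?J" using based_finite_Cfg[OF _ B] by blast
  next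
    fix r
    have "{j \<in> ?J. lv (?e j) \<le> r} \<subseteq> f ` {b \<in> B. lv b \<le> r}" using e by auto
    then show "finite {j \<in> ?J. lv (?e j) \<le> r}" using finL[of r] by (meson finite_imageI finite_subset)
  qed
  let ?S = "Std ?J (\<lambda>j. lv (?e j)) (\<lambda>j. dg (?e j)) :: 'k fcomplex" and ?C0 = "zsub C (grade C)"
  note objs = zsub_objs[OF C fc_sub[OF fC] order_refl]
  have f0: "filtered_complex ?C0" by (rule filtered_zsub[OF fC fc_sub[OF fC] order_refl])
  have tC0: "total ?C0 = total C" by (rule total_cong) simp
  have B0: "based ?C0 B dg lv" using B unfolding based_def tC0 zsub_sel .
  obtain g where g: "Vector_Spaces.linear vscale vscale g" "\<forall>j. g (ev j) = ?e j"
    by (rule linear_from_ev)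
  have gb: "bij_betw g (ev ` ?J) B"
  proof (rule bij_betw_imageI)
    show "inj_on g (ev ` ?J)"
    proof (rule inj_onI)
      fix x y assume "x \<in> ev ` ?J" "y \<in> ev ` ?J" "g x = g y"
      then obtain b c where "b \<in> B" "c \<in> B" "x = ev (f b)" "y = ev (f c)" "g x = g y" by blast
      then show "x = y" using g(2) e by simp
    qed
    show "g ` ev ` ?J = B" using g(2) e by (auto simp: image_image)
  qed
  obtain k where "hequiv R ?S ?C0 g k"
  proof (rule based_iso[OF R filtered_Std f0 based_Std B0 g(1) gb])
    show "dg (g b) = dg (?e (idx b))" if "b \<in> ev ` ?J" for b using that by (auto simp: g(2))
    show "lv (g b) = lv (?e (idx b))" if "b \<in> ev ` ?J" for b using that by (auto simp: g(2))
    show "g (bdry ?S b) = bdry ?C0 (g b)" for b by (simp add: Std_sel vp.linear_0[OF g(1)])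
  qed
  then have "frag_of ?S - frag_of ?C0 \<in> relations R (objs fin)"
    by (rule rel_iso[OF obj_class_objs R Std_objs[OF adm] objs])
  from rel_diff[OF rel_forget_differential[OF R C] this]
  have "frag_of C - frag_of ?S \<in> relations R (objs fin)" by (rule rel_cong) simp
  with adm show thesis by (rule that)
qed

lemma rel_std_sum:
  assumes R: "shifts R" and P: "adm fin P a" and N: "adm fin N b"
  obtains J c where "adm fin J c" "frag_of (Std0 J c) - frag_of (Std0 P a) - frag_of (Std0 N b :: 'k::field fcomplex) \<in> relations R (objs fin)"
proof -
  \<comment> \<open>Even and odd indices keep the two families apart.\<close>
  define c where "c n = (if even n then a (n div 2) else b (n div 2))" for n :: nat
  let ?P = "(\<lambda>n. 2 * n) ` P" and ?N = "(\<lambda>n. 2 * n + 1) ` N"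
  have aP: "adm fin ?P c" by (rule adm_image[OF P, of _ "\<lambda>(j, _). 2 * j" "\<lambda>_. {()}"]) (force simp: c_def)+
  have aN: "adm fin ?N c" by (rule adm_image[OF N, of _ "\<lambda>(j, _). 2 * j + 1" "\<lambda>_. {()}"]) (force simp: c_def)+
  have aU: "adm fin (?P \<union> ?N) c"
  proof -
    have "{j \<in> ?P \<union> ?N. c j \<le> r} = {j \<in> ?P. c j \<le> r} \<union> {j \<in> ?N. c j \<le> r}" for r by blast
    then show ?thesis using aP aN unfolding adm_def by simp
  qed
  have "?P \<inter> ?N = {}" by (auto, presburger)
  from rel_std_union[OF R aU this, of "\<lambda>_. 0"]
  have 1: "frag_of (Std0 (?P \<union> ?N) c) - frag_of (Std0 ?P c) - frag_of (Std0 ?N c :: 'k fcomplex) \<in> relations R (objs fin)" .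
  have 2: "frag_of (Std0 P a) - frag_of (Std0 ?P c :: 'k fcomplex) \<in> relations R (objs fin)"
    by (rule rel_std_bij[OF R P aP, of "\<lambda>n. 2 * n"]) (auto simp: c_def bij_betw_def inj_on_def)
  have 3: "frag_of (Std0 N b) - frag_of (Std0 ?N c :: 'k fcomplex) \<in> relations R (objs fin)"
    by (rule rel_std_bij[OF R N aN, of "\<lambda>n. 2 * n + 1"]) (auto simp: c_def bij_betw_def inj_on_def)
  have "frag_of (Std0 (?P \<union> ?N) c) - frag_of (Std0 P a) - frag_of (Std0 N b :: 'k fcomplex) \<in> relations R (objs fin)"
    by (rule rel_cong[OF rel_diff[OF rel_diff[OF 1 2] 3]]) (simp add: algebra_simps)
  with aU show thesis by (rule that)
qed

text \<open>A combination is a difference of two sums of objects; the sums are formed in one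
  standard complex each.\<close>

lemma rel_normal_form:
  assumes R: "shifts R" and x: "Poly_Mapping.keys x \<subseteq> (objs fin :: 'k::field fcomplex set)"
  shows "\<exists>P a N b. adm fin P a \<and> adm fin N b \<and> x - (frag_of (Std0 P a) - frag_of (Std0 N b)) \<in> relations R (objs fin)"
  using x
proof (induction x rule: frag_induction)
  case zero
  have "adm fin {} (\<lambda>_. 0)" by (simp add: adm_def)
  then show ?case by (intro exI[of _ "{}"] exI[of _ "\<lambda>_. 0"] conjI) (simp_all add: rel_0)
next
  case (one C)
  obtain J a d where J: "adm fin J a" "frag_of C - frag_of (Std J a d) \<in> relations R (objs fin)"
    by (rule rel_to_std[OF R one])
  let ?E = "{j \<in> J. even (d j)}" and ?O = "{j \<in> J. odd (d j)}"
  have "frag_of C - (frag_of (Std0 ?E a) - frag_of (Std0 ?O a)) \<in> relations R (objs fin)"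
    by (rule rel_cong[OF rel_add[OF J(2) rel_std_degree0[OF R J(1), of d]]]) simp
  moreover have "adm fin ?E a" "adm fin ?O a" by (rule adm_subset[OF J(1)], blast)+
  ultimately show ?case by blast
next
  case (diff x y)
  obtain P a N b where 1: "adm fin P a" "adm fin N b" "x - (frag_of (Std0 P a) - frag_of (Std0 N b)) \<in> relations R (objs fin)"
    using diff(1) by (elim exE conjE)
  obtain P' a' N' b' where 2: "adm fin P' a'" "adm fin N' b'" "y - (frag_of (Std0 P' a') - frag_of (Std0 N' b')) \<in> relations R (objs fin)"
    using diff(2) by (elim exE conjE)
  obtain J c where J: "adm fin J c" "frag_of (Std0 J c) - frag_of (Std0 P a) - frag_of (Std0 N' b' :: 'k fcomplex) \<in> relations R (objs fin)"
    by (rule rel_std_sum[OF R 1(1) 2(2)])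
  obtain H e where H: "adm fin H e" "frag_of (Std0 H e) - frag_of (Std0 N b) - frag_of (Std0 P' a' :: 'k fcomplex) \<in> relations R (objs fin)"
    by (rule rel_std_sum[OF R 1(2) 2(1)])
  have "(x - y) - (frag_of (Std0 J c) - frag_of (Std0 H e)) \<in> relations R (objs fin)"
    by (rule rel_cong[OF rel_add[OF rel_diff[OF rel_diff[OF 1(3) 2(3)] J(2)] H(2)]]) (simp add: algebra_simps)
  then show ?case using J(1) H(1) by blast
qed

lemma Phi_Std0:
  assumes "adm fin J a"
  shows "Phi (Std0 J a :: 'k::field fcomplex) (ereal r) = int (card {j \<in> J. a j \<le> r})"
proof -
  have e: "{b \<in> ev ` J. a (idx b) \<le> r} = (ev ` {j \<in> J. a j \<le> r} :: 'k vec set)" by auto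
  have fin: "finite {j \<in> J. a j \<le> r}" using assms by (simp add: adm_def)
  have f: "finite {b \<in> (ev ` J :: 'k vec set). a (idx b) \<le> r}" unfolding e using fin by simp
  have bs: "based (Std0 J a :: 'k fcomplex) (ev ` J) (\<lambda>b. 0) (\<lambda>b. a (idx b))"
    using based_Std[of J a "\<lambda>_. 0"] by simp
  have "Phi (Std0 J a :: 'k fcomplex) (ereal r) = (\<Sum>b | b \<in> (ev ` J :: 'k vec set) \<and> a (idx b) \<le> r. par 0)"
    by (rule Phi_based[OF bs f])
  also have "\<dots> = int (card (ev ` {j \<in> J. a j \<le> r} :: 'k vec set))"
    unfolding e[symmetric] by simp
  also have "\<dots> = int (card {j \<in> J. a j \<le> r})"
    by (simp add: card_image[OF inj_ev])
  finally show ?thesis .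
qed

text \<open>The numbers of levels at most \<open>r\<close> determine the multiset of levels, since levels do not
  accumulate.\<close>

lemma bij_of_counts:
  assumes P: "\<And>r. finite {j \<in> P. a j \<le> r}" and N: "\<And>r. finite {j \<in> N. b j \<le> r}"
    and eq: "\<And>r :: real. card {j \<in> P. a j \<le> r} = card {j \<in> N. b j \<le> r}"
  obtains p :: "nat \<Rightarrow> nat" where "bij_betw p P N" "\<And>j. j \<in> P \<Longrightarrow> b (p j) = a j"
proof -
  have fib: "card {j \<in> P. a j = r} = card {j \<in> N. b j = r}" for r
  proof -
    \<comment> \<open>\<open>s\<close> is a level just below \<open>r\<close>: nothing of either
      family lies strictly between them.\<close>
    let ?V = "insert (r - 1) (a ` {j \<in> P. a j < r} \<union> b ` {j \<in> N. b j < r})"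
    have fP: "finite {j \<in> P. a j < r}" by (rule finite_subset[OF _ P[of r]]) auto
    have fN: "finite {j \<in> N. b j < r}" by (rule finite_subset[OF _ N[of r]]) auto
    have fV: "finite ?V" using fP fN by simp
    define s where "s = Max ?V"
    have "s \<in> ?V" unfolding s_def by (rule Max_in[OF fV]) simp
    then have sr: "s < r" by auto
    have le: "v \<le> s" if "v \<in> ?V" for v unfolding s_def by (rule Max_ge[OF fV that])
    have ltP: "{j \<in> P. a j < r} = {j \<in> P. a j \<le> s}" using le sr by fastforce
    have ltN: "{j \<in> N. b j < r} = {j \<in> N. b j \<le> s}" using le sr by fastforce
    have "card {j \<in> P. a j \<le> r} = card {j \<in> P. a j = r} + card {j \<in> P. a j < r}"
      by (subst card_Un_disjoint[symmetric]) (auto intro: arg_cong[of _ _ card] finite_subset[OF _ P[of r]])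
    moreover have "card {j \<in> N. b j \<le> r} = card {j \<in> N. b j = r} + card {j \<in> N. b j < r}"
      by (subst card_Un_disjoint[symmetric]) (auto intro: arg_cong[of _ _ card] finite_subset[OF _ N[of r]])
    ultimately show ?thesis using eq[of r] eq[of s] unfolding ltP ltN by simp
  qed
  have "\<exists>h. bij_betw h {j \<in> P. a j = r} {j \<in> N. b j = r}" for r
  proof (rule finite_same_card_bij[OF _ _ fib])
    show "finite {j \<in> P. a j = r}" by (rule finite_subset[OF _ P[of r]]) auto
    show "finite {j \<in> N. b j = r}" by (rule finite_subset[OF _ N[of r]]) auto
  qed
  then obtain h where h: "\<And>r. bij_betw (h r) {j \<in> P. a j = r} {j \<in> N. b j = r}" by metis
  define p where "p j = h (a j) j" for j
  have pj: "p j \<in> N" "b (p j) = a j" if "j \<in> P" for j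
    using bij_betwE[OF h[of "a j"]] that by (auto simp: p_def)
  have "inj_on p P"
  proof (rule inj_onI)
    fix i j assume ij: "i \<in> P" "j \<in> P" "p i = p j"
    then have "a i = a j" using pj(2) by metis
    then show "i = j" using bij_betw_imp_inj_on[OF h[of "a j"]] ij by (auto simp: p_def inj_on_def)
  qed
  moreover have "p ` P = N"
  proof (intro equalityI subsetI)
    fix n assume n: "n \<in> N"
    then have "n \<in> h (b n) ` {j \<in> P. a j = b n}" using h[of "b n"] by (simp add: bij_betw_def)
    then obtain x where x: "x \<in> P" "a x = b n" "n = h (b n) x" by auto
    then have "n = p x" by (simp add: p_def)
    then show "n \<in> p ` P" using x(1) by blast
  qed (use pj in auto)
  ultimately have "bij_betw p P N" by (simp add: bij_betw_def)
  then show thesis using pj(2) by (rule that)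
qed

text \<open>Equal values of the invariant force the two multisets of levels in the normal form
  to coincide.\<close>

lemma relations_complete:
  assumes R: "shifts R" and x: "Poly_Mapping.keys x \<subseteq> (objs fin :: 'k::field fcomplex set)"
    and sound: "\<And>y r. y \<in> relations R (objs fin :: 'k fcomplex set) \<Longrightarrow> zext (\<lambda>C. Phi C (ereal r)) y = 0"
    and zero: "\<And>r. zext (\<lambda>C. Phi C (ereal r)) x = 0"
  shows "x \<in> relations R (objs fin)"
proof -
  obtain P a N b where PN: "adm fin P a" "adm fin N b"
    "x - (frag_of (Std0 P a) - frag_of (Std0 N b)) \<in> relations R (objs fin)"
    using rel_normal_form[OF R x] by (elim exE conjE)
  have "card {j \<in> P. a j \<le> r} = card {j \<in> N. b j \<le> r}" for r
    using sound[OF PN(3), of r] zero[of r] by (simp add: zext_diff Phi_Std0[OF PN(1)] Phi_Std0[OF PN(2)])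
  then obtain p where p: "bij_betw p P N" "\<And>j. j \<in> P \<Longrightarrow> b (p j) = a j"
    using bij_of_counts[of P a N b] PN(1,2) unfolding adm_def by blast
  have "frag_of (Std0 P a) - frag_of (Std0 N b :: 'k fcomplex) \<in> relations R (objs fin)"
    by (rule rel_std_bij[OF R PN(1,2) p]) simp_all
  from rel_add[OF PN(3) this] show ?thesis by (rule rel_cong) simp
qed

lemma relations_objs_iff:
  assumes x: "Poly_Mapping.keys x \<subseteq> (objs fin :: 'k::field fcomplex set)"
  shows "x \<in> relations {0} (objs fin) \<longleftrightarrow> (\<forall>r. zext (\<lambda>C. Phi C (ereal r)) x = 0)"
proof -
  have sound: "zext (\<lambda>C. Phi C (ereal r)) y = 0" if "y \<in> relations {0} (objs fin :: 'k fcomplex set)" for y r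
    by (rule Phi_relations[OF obj_class_objs shifts_zero _ fin_slice_Ct[OF objs_Ct] that]) auto
  show ?thesis using sound relations_complete[OF shifts_zero x sound] by blast
qed

section \<open>Tensor products\<close>

lemma ereal_le_levels:
  assumes "\<And>r. y \<le> ereal r \<Longrightarrow> x \<le> ereal r" shows "x \<le> (y :: ereal)"
proof (rule ccontr)
  assume "\<not> x \<le> y"
  then have "y < x" by simp
  then obtain r where "y < ereal r" and "ereal r < x" using ereal_dense2 by blast
  then have "x \<le> ereal r" using assms by (simp add: less_imp_le)
  then show False using \<open>ereal r < x\<close> by simp
qed

lemma linear_on_span_into:
  assumes "linear_on V f" "vec.span S \<subseteq> V" "\<And>b. b \<in> S \<Longrightarrow> f b \<in> T" "vec.subspace T" "vec.subspace V" "x \<in> vec.span S"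
  shows "f x \<in> T"
proof -
  obtain g where g: "Vector_Spaces.linear vscale vscale g" "\<And>x. x \<in> V \<Longrightarrow> g x = f x"
    using linear_on_extend[OF assms(1,5)] by blast
  have SV: "S \<subseteq> V" using assms(2) vec.span_superset by blast
  have "g ` S \<subseteq> T" using g(2) SV assms(3) by auto
  then have "vec.span (g ` S) \<subseteq> T" using vec.span_minimal assms(4) by blast
  moreover have "g x \<in> vec.span (g ` S)" using vp.linear_span_image[OF g(1), of S] assms(6) by blast
  moreover have "g x = f x" using g(2) assms(2,6) by blast
  ultimately show ?thesis by auto
qed

text \<open>The sublevels and the degree components are coordinate subspaces, which accounts for all axioms that
  do not mention the differential; those that do need to be checked on the basis only.\<close>

lemma based_filtered:
  assumes B: "based X B dg lv" and lin: "linear_on (total X) (bdry X)"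
    and deg: "\<And>b. b \<in> B \<Longrightarrow> bdry X b \<in> vec.span {b' \<in> B. dg b' = dg b - 1}"
    and lev: "\<And>b. b \<in> B \<Longrightarrow> bdry X b \<in> vec.span {b' \<in> B. lv b' \<le> lv b}"
    and dd: "\<And>b. b \<in> B \<Longrightarrow> bdry X (bdry X b) = 0"
  shows "filtered_complex X"
proof -
  note ind = basedD(1)[OF B] and tot = based_total[OF B] and fl = basedD(3)[OF B]
  let ?L = "\<lambda>r. {b \<in> B. lv b \<le> r}"
  have LB: "?L r \<subseteq> B" for r by blast
  have homog: "y i \<in> vec.span L"
    if h: "finite F" "\<And>i. i \<in> F \<Longrightarrow> y i \<in> grade X i" "i \<in> F" "sum y F \<in> vec.span L" "L \<subseteq> B" for F y i L
  proof -
    have yg: "y k \<in> vec.span {b \<in> B. dg b = k}" if "k \<in> F" for k using h(2)[OF that] unfolding basedD(2)[OF B] .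
    have yt: "y k \<in> vec.span B" if "k \<in> F" for k using grade_total[OF h(2)[OF that]] tot by simp
    have rs: "vec.representation B (sum y F) b = (\<Sum>k\<in>F. vec.representation B (y k) b)" for b
      using vec.representation_sum[OF ind, of F y] yt by simp
    have "b \<in> L" if b: "vec.representation B (y i) b \<noteq> 0" for b
    proof -
      have db: "dg b = i" using representation_sub[OF ind _ yg[OF h(3)] b] by blast
      have "vec.representation B (y k) b = 0" if "k \<in> F - {i}" for k
        using representation_sub[OF ind _ yg, of k b] that db by blast
      then have "(\<Sum>k\<in>F - {i}. vec.representation B (y k) b) = 0" by (rule sum.neutral[OF ballI])
      then have "vec.representation B (sum y F) b \<noteq> 0"
        using b rs[of b] sum.remove[OF h(1,3), of "\<lambda>k. vec.representation B (y k) b"] by simp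
      then show "b \<in> L" by (rule representation_sub[OF ind h(5,4)])
    qed
    then show ?thesis unfolding in_span_rep[OF ind yt[OF h(3)] h(5)] by simp
  qed
  show ?thesis
  proof (rule filtered_complexI)
    show "vec.subspace (grade X i)" for i unfolding basedD(2)[OF B] by simp
    show "y i = 0" if h: "finite F" "\<And>i. i \<in> F \<Longrightarrow> y i \<in> grade X i" "sum y F = 0" "i \<in> F" for F y i
      using homog[OF h(1,2,4), of "{}"] h(3) by (simp add: vec.span_empty)
    show "filt X (y i) \<le> filt X (sum y F)" if h: "finite F" "\<And>i. i \<in> F \<Longrightarrow> y i \<in> grade X i" "i \<in> F" for F y i
    proof (rule ereal_le_levels)
      fix r assume "filt X (sum y F) \<le> ereal r"
      moreover have "sum y F \<in> total X"
        using h(2) by (intro vec.subspace_sum[OF subspace_total] grade_total)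
      ultimately have "sum y F \<in> vec.span (?L r)" using fl by blast
      from homog[OF h(1,2,3) this LB] have "y i \<in> vec.span (?L r)" .
      then show "filt X (y i) \<le> ereal r" using fl[OF grade_total[OF h(2)[OF h(3)]]] by blast
    qed
    show "linear_on (total X) (bdry X)" by (rule lin)
    show "bdry X x \<in> grade X (i - 1)" if "x \<in> grade X i" for i x
    proof (rule linear_on_span_into[OF lin])
      show "vec.span {b \<in> B. dg b = i} \<subseteq> total X" unfolding tot by (rule vec.span_mono) blast
      show "bdry X b \<in> grade X (i - 1)" if "b \<in> {b \<in> B. dg b = i}" for b
        using that deg[of b] unfolding basedD(2)[OF B] by simp
      show "vec.subspace (grade X (i - 1))" unfolding basedD(2)[OF B] by simp
      show "x \<in> vec.span {b \<in> B. dg b = i}" using that unfolding basedD(2)[OF B] .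
    qed simp
    have bt: "bdry X x \<in> total X" if "x \<in> total X" for x
    proof (rule linear_on_span_into[OF lin _ _ subspace_total subspace_total])
      show "x \<in> vec.span B" using that tot by simp
      show "bdry X b \<in> total X" if "b \<in> B" for b
        using deg[OF that] vec.span_mono[of "{b' \<in> B. dg b' = dg b - 1}" B] unfolding tot by blast
    qed (simp add: tot)
    fix x assume x: "x \<in> total X"
    show "bdry X (bdry X x) = 0"
    proof (rule linear_on_eq_span[of B "\<lambda>x. bdry X (bdry X x)" "\<lambda>_. 0"])
      show "linear_on (vec.span B) (\<lambda>x. bdry X (bdry X x))"
        by (rule linear_on_comp[OF _ _ lin]) (use lin bt in \<open>simp_all add: tot image_subset_iff\<close>)
    qed (use dd x in \<open>simp_all add: tot\<close>)
    have rep: "filt X x \<le> ereal r \<longleftrightarrow> (\<forall>b. vec.representation B x b \<noteq> 0 \<longrightarrow> b \<in> ?L r)" for r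
      using fl[OF x] in_span_rep[OF ind _ LB] x tot by blast
    let ?S = "{b. vec.representation B x b \<noteq> 0}"
    have S: "finite ?S" "?S \<subseteq> B" by (rule vec.finite_representation) (use vec.representation_ne_zero in blast)
    have "filt X x \<le> ereal (Max (insert 0 (lv ` ?S)))"
      unfolding rep using S by auto
    then show "filt X x \<noteq> \<infinity>" by auto
    show "filt X x = -\<infinity> \<longleftrightarrow> x = 0"
    proof
      assume m: "filt X x = -\<infinity>"
      have "?S = {}"
      proof (rule ccontr)
        assume "?S \<noteq> {}"
        then obtain b where b: "vec.representation B x b \<noteq> 0" by blast
        have "filt X x \<le> ereal (lv b - 1)" using m by simp
        then have "b \<in> ?L (lv b - 1)" using b unfolding rep by blast
        then show False by simp
      qed
      then have "x \<in> vec.span {}" using in_span_rep[OF ind, of x "{}"] x tot by auto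
      then show "x = 0" by (simp add: vec.span_empty)
    next
      assume "x = 0"
      then have "filt X x \<le> ereal r" for r using fl[OF x, of r] vec.span_zero by blast
      then show "filt X x = -\<infinity>" by (rule ereal_bot)
    qed
    show "filt X (vscale c x) = filt X x" if "c \<noteq> 0" for c
    proof (rule ereal_eq_levels)
      fix r
      have "vscale c x \<in> vec.span (?L r) \<longleftrightarrow> x \<in> vec.span (?L r)"
        using vec.span_scale[of "vscale c x" "?L r" "inverse c"] vec.span_scale[of x "?L r" c] that by auto
      then show "filt X (vscale c x) \<le> ereal r \<longleftrightarrow> filt X x \<le> ereal r"
        using fl[OF x] fl[OF total_scale[OF x]] by blast
    qed
    show "filt X (x + y) \<le> max (filt X x) (filt X y)" if y: "y \<in> total X" for y
    proof (rule ereal_le_levels)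
      fix r assume "max (filt X x) (filt X y) \<le> ereal r"
      then have "x + y \<in> vec.span (?L r)" using fl[OF x] fl[OF y] vec.span_add by auto
      then show "filt X (x + y) \<le> ereal r" using fl[OF total_add[OF x y]] by blast
    qed
    show "filt X (bdry X x) \<le> filt X x"
    proof (rule ereal_le_levels)
      fix r assume "filt X x \<le> ereal r"
      then have xr: "x \<in> vec.span (?L r)" using fl[OF x] by blast
      have "bdry X x \<in> vec.span (?L r)"
      proof (rule linear_on_span_into[OF lin _ _ _ subspace_total xr])
        show "vec.span (?L r) \<subseteq> total X" unfolding tot by (rule vec.span_mono[OF LB])
        show "bdry X b \<in> vec.span (?L r)" if b: "b \<in> ?L r" for b
        proof -
          have "?L (lv b) \<subseteq> ?L r" using b by auto
          from vec.span_mono[OF this] show ?thesis using lev[of b] b by blast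
        qed
      qed simp
      then show "filt X (bdry X x) \<le> ereal r" using fl[OF bt[OF x]] by blast
    qed
  qed
qed

lemma levels_bounded_below:
  assumes "\<And>r. finite {b \<in> B. lv b \<le> (r :: real)}"
  obtains m where "\<forall>b\<in>B. m \<le> lv b"
proof -
  let ?m = "Min (insert 0 (lv ` {b \<in> B. lv b \<le> 0}))"
  have "?m \<le> lv b" if "b \<in> B" for b
  proof (cases "lv b \<le> 0")
    case True
    then show ?thesis using assms[of 0] that by (intro Min_le) auto
  next
    case False
    have "?m \<le> 0" using assms[of 0] by (intro Min_le) auto
    then show ?thesis using False by simp
  qed
  then show thesis using that by blast
qed

lemma based_Ct:
  assumes X: "filtered_complex X" and B: "based X B dg lv" and fin: "\<And>r. finite {b \<in> B. lv b \<le> r}"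
  shows "X \<in> Ct"
proof -
  have sub: "sublevel X r = vec.span {b \<in> B. lv b \<le> r}" for r
    using basedD(3)[OF B] based_total[OF B] vec.span_mono[of "{b \<in> B. lv b \<le> r}" B]
    unfolding sublevel_def by blast
  obtain m where m: "\<forall>b\<in>B. m \<le> lv b" by (rule levels_bounded_below[OF fin])
  show ?thesis
  proof (rule CtI[OF X])
    show "findim (sublevel X r)" for r unfolding sub findim_def using fin[of r] by blast
    show "sublevel X r = {0}" if "r \<le> m - 1" for r
    proof -
      have "{b \<in> B. lv b \<le> r} = {}" using m that by force
      then show ?thesis unfolding sub by (simp only: vec.span_empty)
    qed
  qed
qed

lemma based_Cfg:
  assumes "filtered_complex X" "based X B dg lv" "finite B" shows "X \<in> Cfg"
  unfolding Cfg_def using assms based_total[OF assms(2)] by (auto simp: findim_def)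

lemma lookup_tens:
  "Poly_Mapping.lookup (tens x y) k = Poly_Mapping.lookup x (fst (prod_decode k)) * Poly_Mapping.lookup y (snd (prod_decode k))"
proof -
  obtain p q where k: "prod_decode k = (p, q)" by (cases "prod_decode k")
  have kk: "prod_encode (m, n) = k \<longleftrightarrow> m = p \<and> n = q" for m n
    using k by (metis fst_conv prod_decode_inverse prod_encode_inverse snd_conv)
  have "Poly_Mapping.lookup (tens x y) k =
    (\<Sum>m\<in>Poly_Mapping.keys x. \<Sum>n\<in>Poly_Mapping.keys y. if n = q then (if m = p then Poly_Mapping.lookup x m * Poly_Mapping.lookup y n else 0) else 0)"
    unfolding tens_def lookup_sum lookup_single by (intro sum.cong refl) (simp add: when_def kk)
  also have "\<dots> = (\<Sum>m\<in>Poly_Mapping.keys x. if m = p then Poly_Mapping.lookup x m * Poly_Mapping.lookup y q else 0)"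
    by (intro sum.cong refl) (auto simp: in_keys_iff)
  also have "\<dots> = Poly_Mapping.lookup x p * Poly_Mapping.lookup y q"
    by (auto simp: in_keys_iff)
  finally show ?thesis by (simp add: k)
qed

lemma tens_simps:
  "tens (x + x') y = tens x y + tens x' y" "tens x (y + y') = tens x y + tens x y'"
  "tens (vscale c x) y = vscale c (tens x y)" "tens x (vscale c y) = vscale c (tens x y)"
  "tens 0 y = 0" "tens x 0 = 0"
  by (auto intro!: poly_mapping_eqI simp: lookup_tens lookup_add algebra_simps)

lemma linear_tens:
  "Vector_Spaces.linear vscale vscale (\<lambda>x. tens x y)" "Vector_Spaces.linear vscale vscale (\<lambda>y. tens x y)"
  by (simp_all add: Vector_Spaces.linear_iff vec.vector_space_axioms tens_simps)

definition row :: "nat \<Rightarrow> 'k::field vec \<Rightarrow> 'k vec" where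
  "row m z = Poly_Mapping.map_key (\<lambda>n. prod_encode (m, n)) z"

lemma lookup_row: "Poly_Mapping.lookup (row m z) n = Poly_Mapping.lookup z (prod_encode (m, n))"
  unfolding row_def by (subst map_key.rep_eq) (auto intro: injI)

lemma linear_row: "Vector_Spaces.linear vscale vscale (row m)"
  by (auto simp: Vector_Spaces.linear_iff vec.vector_space_axioms lookup_row lookup_add intro!: poly_mapping_eqI)

lemma row_tens: "row m (tens x y) = vscale (Poly_Mapping.lookup x m) y"
  by (auto intro!: poly_mapping_eqI simp: lookup_row lookup_tens)

text \<open>Comparing coefficients in each row of the tensor square uses independence of the
  second family, and then independence of the first family applies to the coefficients.\<close>

lemma tens_independent_grid:
  assumes B: "vec.independent B" "vec.independent B'" and S: "finite S" "S \<subseteq> B" "finite S'" "S' \<subseteq> B'"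
    and z: "(\<Sum>b\<in>S. \<Sum>b'\<in>S'. vscale (c b b') (tens b b')) = 0" and b: "b \<in> S" "b' \<in> S'"
  shows "c b b' = 0"
proof -
  have ex: "u v = 0" if "vec.independent A" "finite T" "T \<subseteq> A" "(\<Sum>v\<in>T. vscale (u v) v) = 0" "v \<in> T" for A T and u :: "'a vec \<Rightarrow> 'a" and v
    using that unfolding vec.independent_explicit_finite_subsets by blast
  have "(\<Sum>b\<in>S. vscale (c b b') b) = 0"
  proof (rule poly_mapping_eqI)
    fix m
    have "0 = row m (\<Sum>b\<in>S. \<Sum>b'\<in>S'. vscale (c b b') (tens b b'))"
      unfolding z by (rule vp.linear_0[OF linear_row, symmetric])
    also have "\<dots> = (\<Sum>b\<in>S. \<Sum>b'\<in>S'. vscale (c b b' * Poly_Mapping.lookup b m) b')"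
      by (simp add: vp.linear_sum[OF linear_row] vp.linear_scale[OF linear_row] row_tens)
    also have "\<dots> = (\<Sum>b'\<in>S'. vscale (\<Sum>b\<in>S. c b b' * Poly_Mapping.lookup b m) b')"
      by (subst sum.swap) (simp add: vec.scale_sum_left)
    finally have "(\<Sum>b\<in>S. c b b' * Poly_Mapping.lookup b m) = 0"
      by (intro ex[OF B(2) S(3,4) _ b(2), of "\<lambda>b'. \<Sum>b\<in>S. c b b' * Poly_Mapping.lookup b m"]) simp
    then show "Poly_Mapping.lookup (\<Sum>b\<in>S. vscale (c b b') b) m = Poly_Mapping.lookup 0 m"
      by (simp add: lookup_sum)
  qed
  then show ?thesis by (rule ex[OF B(1) S(1,2) _ b(1), of "\<lambda>b. c b b'"])
qed

abbreviation tensp :: "'k::field vec \<times> 'k vec \<Rightarrow> 'k vec" where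
  "tensp p \<equiv> tens (fst p) (snd p)"

lemma tens_independent_pairs:
  assumes B: "vec.independent B" "vec.independent B'" and F: "finite F" "F \<subseteq> B \<times> B'"
    and z: "(\<Sum>p\<in>F. vscale (c p) (tensp p)) = 0" and p: "p \<in> F"
  shows "c p = 0"
proof -
  let ?c = "\<lambda>b b'. if (b, b') \<in> F then c (b, b') else 0"
  have FS: "F \<subseteq> fst ` F \<times> snd ` F" by force
  have "(\<Sum>b\<in>fst ` F. \<Sum>b'\<in>snd ` F. vscale (?c b b') (tens b b')) = (\<Sum>p\<in>fst ` F \<times> snd ` F. vscale (?c (fst p) (snd p)) (tensp p))"
    by (simp add: sum.cartesian_product case_prod_unfold)
  also have "\<dots> = (\<Sum>p\<in>F. vscale (c p) (tensp p))"
    by (rule sum.mono_neutral_cong_right) (use F(1) FS in auto)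
  finally have "(\<Sum>b\<in>fst ` F. \<Sum>b'\<in>snd ` F. vscale (?c b b') (tens b b')) = 0" using z by simp
  then have "?c (fst p) (snd p) = 0"
    by (rule tens_independent_grid[OF B, where c = ?c and S = "fst ` F" and S' = "snd ` F", rotated 4]) (use F p in auto)
  then show ?thesis using p by simp
qed

lemma tensp_inj:
  assumes B: "vec.independent B" "vec.independent B'" shows "inj_on tensp (B \<times> B')"
proof (rule inj_onI, rule ccontr)
  fix p q assume pq: "p \<in> B \<times> B'" "q \<in> B \<times> B'" "tensp p = tensp q" "p \<noteq> q"
  let ?c = "\<lambda>r. if r = p then 1 else - 1"
  have "(\<Sum>r\<in>{p, q}. vscale (?c r) (tensp r)) = 0" using pq(3,4) by auto
  from tens_independent_pairs[OF B _ _ this, of p] show False using pq by simp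
qed

lemma tens_independent:
  assumes B: "vec.independent B" "vec.independent B'" shows "vec.independent (tensp ` (B \<times> B'))"
  unfolding vec.independent_explicit_finite_subsets
proof (intro allI impI ballI)
  fix T u and v :: "'a vec" assume T: "T \<subseteq> tensp ` (B \<times> B')" "finite T" "(\<Sum>v\<in>T. vscale (u v) v) = 0" "v \<in> T"
  obtain F where F: "F \<subseteq> B \<times> B'" "finite F" "T = tensp ` F" using finite_subset_image[OF T(2,1)] by blast
  have "(\<Sum>p\<in>F. vscale (u (tensp p)) (tensp p)) = 0"
    using T(3) unfolding F(3) sum.reindex[OF inj_on_subset[OF tensp_inj[OF B] F(1)]] by simp
  moreover obtain p where p: "p \<in> F" "v = tensp p" using T(4) F(3) by blast
  ultimately have "u (tensp p) = 0" using tens_independent_pairs[OF B F(2,1), of "\<lambda>p. u (tensp p)"] by blast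
  then show "u v = 0" using p by simp
qed

lemma tens_span:
  assumes "x \<in> vec.span P" "y \<in> vec.span Q" shows "tens x y \<in> vec.span (tensp ` (P \<times> Q))"
proof -
  have P: "tens b y \<in> vec.span (tensp ` (P \<times> Q))" if "b \<in> P" for b
  proof (rule linear_on_span_into[OF linear_imp_linear_on[OF linear_tens(2), of UNIV] subset_UNIV _ vec.subspace_span vec.subspace_UNIV assms(2)])
    fix b' assume "b' \<in> Q"
    then have "tensp (b, b') \<in> tensp ` (P \<times> Q)" using that by blast
    from vec.span_base[OF this] show "tens b b' \<in> vec.span (tensp ` (P \<times> Q))" by simp
  qed
  show ?thesis
    by (rule linear_on_span_into[OF linear_imp_linear_on[OF linear_tens(1), of UNIV] subset_UNIV P vec.subspace_span vec.subspace_UNIV assms(1)])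
qed

text \<open>Bases of the factors, with which the tensor product is computed.\<close>

locale tensor_factors =
  fixes C D :: "'k::field fcomplex" and B B' dg dg' lv lv'
  assumes Ct: "C \<in> Ct" "D \<in> Ct" and bC: "based C B dg lv" and bD: "based D B' dg' lv'"
begin

definition "TB = tensp ` (B \<times> B')"
definition "pair t = the_inv_into (B \<times> B') tensp t"
definition "tdg t = dg (fst (pair t)) + dg' (snd (pair t))"
definition "tlv t = lv (fst (pair t)) + lv' (snd (pair t))"

lemmas ind = basedD(1)[OF bC] basedD(1)[OF bD]

lemma pair [simp]: "b \<in> B \<Longrightarrow> b' \<in> B' \<Longrightarrow> pair (tens b b') = (b, b')"
  unfolding pair_def using the_inv_into_f_f[OF tensp_inj[OF ind], of "(b, b')"] by simp

lemma TB_levels: "{t \<in> TB. P (pair t)} = tensp ` {p \<in> B \<times> B'. P p}"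
  unfolding TB_def by auto

lemma Bt: "B \<subseteq> total C" "B' \<subseteq> total D"
  unfolding based_total[OF bC] based_total[OF bD] by (rule vec.span_superset)+

lemma grade_tensor: "grade (tensor C D) n = vec.span {t \<in> TB. tdg t = n}"
proof -
  have "grade (tensor C D) n = vec.span (\<Union>p. {tens x y |x y. x \<in> grade C p \<and> y \<in> grade D (n - p)})"
    by (simp add: tensor_def)
  also have "\<dots> = vec.span {t \<in> TB. tdg t = n}"
  proof (rule antisym)
    show "vec.span (\<Union>p. {tens x y |x y. x \<in> grade C p \<and> y \<in> grade D (n - p)}) \<subseteq> vec.span {t \<in> TB. tdg t = n}"
    proof (intro vec.span_minimal UN_least subsetI vec.subspace_span)
      fix p z assume "z \<in> {tens x y |x y. x \<in> grade C p \<and> y \<in> grade D (n - p)}"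
      then obtain x y where xy: "z = tens x y" "x \<in> grade C p" "y \<in> grade D (n - p)" by blast
      have "z \<in> vec.span (tensp ` ({b \<in> B. dg b = p} \<times> {b \<in> B'. dg' b = n - p}))"
        unfolding xy(1) using xy(2,3) unfolding basedD(2)[OF bC] basedD(2)[OF bD] by (rule tens_span)
      moreover have "tensp ` ({b \<in> B. dg b = p} \<times> {b \<in> B'. dg' b = n - p}) \<subseteq> {t \<in> TB. tdg t = n}"
        by (auto simp: tdg_def TB_def)
      ultimately show "z \<in> vec.span {t \<in> TB. tdg t = n}" using vec.span_mono by blast
    qed
    show "vec.span {t \<in> TB. tdg t = n} \<subseteq> vec.span (\<Union>p. {tens x y |x y. x \<in> grade C p \<and> y \<in> grade D (n - p)})"
    proof (rule vec.span_mono, rule subsetI)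
      fix t assume "t \<in> {t \<in> TB. tdg t = n}"
      then obtain b b' where b: "b \<in> B" "b' \<in> B'" "t = tens b b'" "dg b + dg' b' = n"
        by (auto simp: TB_def tdg_def)
      have "b \<in> grade C (dg b)" "b' \<in> grade D (n - dg b)"
        unfolding basedD(2)[OF bC] basedD(2)[OF bD] using b by (auto intro!: vec.span_base)
      then show "t \<in> (\<Union>p. {tens x y |x y. x \<in> grade C p \<and> y \<in> grade D (n - p)})" using b(3) by blast
    qed
  qed
  finally show ?thesis .
qed

lemma tens_grade:
  assumes "x \<in> grade C p" "y \<in> grade D q" shows "tens x y \<in> grade (tensor C D) (p + q)"
proof -
  have "tens x y \<in> {tens x y |x y. x \<in> grade C p \<and> y \<in> grade D (p + q - p)}" using assms by auto
  then have "tens x y \<in> (\<Union>r. {tens x y |x y. x \<in> grade C r \<and> y \<in> grade D (p + q - r)})" by blast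
  from vec.span_base[OF this] show ?thesis by (simp add: tensor_def)
qed

lemma total_tensor: "total (tensor C D) = vec.span TB"
proof
  show "total (tensor C D) \<subseteq> vec.span TB"
    unfolding total_def grade_tensor by (intro vec.span_minimal UN_least vec.span_mono vec.subspace_span) blast
  have "TB \<subseteq> total (tensor C D)"
  proof
    fix t assume "t \<in> TB"
    then have "t \<in> grade (tensor C D) (tdg t)" unfolding grade_tensor by (intro vec.span_base) simp
    then show "t \<in> total (tensor C D)" by (rule grade_total)
  qed
  then show "vec.span TB \<subseteq> total (tensor C D)" by (rule vec.span_minimal) simp
qed

lemma tens_total: "x \<in> total C \<Longrightarrow> y \<in> total D \<Longrightarrow> tens x y \<in> total (tensor C D)"
  unfolding total_tensor TB_def based_total[OF bC] based_total[OF bD] by (rule tens_span)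

lemma tensor_generators: "vec.span {tens x y |x y. x \<in> total C \<and> y \<in> total D} = vec.span TB"
proof (rule antisym)
  show "vec.span {tens x y |x y. x \<in> total C \<and> y \<in> total D} \<subseteq> vec.span TB"
    using tens_total unfolding total_tensor by (intro vec.span_minimal vec.subspace_span) blast
  show "vec.span TB \<subseteq> vec.span {tens x y |x y. x \<in> total C \<and> y \<in> total D}"
  proof (rule vec.span_mono, rule subsetI)
    fix t assume "t \<in> TB"
    then obtain b b' where "b \<in> B" "b' \<in> B'" "t = tens b b'" unfolding TB_def by auto
    then show "t \<in> {tens x y |x y. x \<in> total C \<and> y \<in> total D}" using Bt by blast
  qed
qed

lemma tens_level:
  assumes "x \<in> total C" "y \<in> total D" "filt C x \<le> ereal p" "filt D y \<le> ereal q" "p + q \<le> s"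
  shows "tens x y \<in> vec.span {t \<in> TB. tlv t \<le> s}"
proof -
  have "tens x y \<in> vec.span (tensp ` ({b \<in> B. lv b \<le> p} \<times> {b \<in> B'. lv' b \<le> q}))"
    using assms basedD(3)[OF bC] basedD(3)[OF bD] by (intro tens_span) auto
  moreover have "tensp ` ({b \<in> B. lv b \<le> p} \<times> {b \<in> B'. lv' b \<le> q}) \<subseteq> {t \<in> TB. tlv t \<le> s}"
    using assms(5) by (auto simp: tlv_def TB_def)
  ultimately show ?thesis using vec.span_mono by blast
qed

lemma filt_basis: "b \<in> B \<Longrightarrow> filt C b \<le> ereal (lv b)" "b' \<in> B' \<Longrightarrow> filt D b' \<le> ereal (lv' b')"
proof -
  show "filt C b \<le> ereal (lv b)" if "b \<in> B"
  proof -
    have "b \<in> vec.span {x \<in> B. lv x \<le> lv b}" by (rule vec.span_base) (use that in simp)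
    then show ?thesis using basedD(3)[OF bC subsetD[OF Bt(1) that], of "lv b"] by simp
  qed
  show "filt D b' \<le> ereal (lv' b')" if "b' \<in> B'"
  proof -
    have "b' \<in> vec.span {x \<in> B'. lv' x \<le> lv' b'}" by (rule vec.span_base) (use that in simp)
    then show ?thesis using basedD(3)[OF bD subsetD[OF Bt(2) that], of "lv' b'"] by simp
  qed
qed

text \<open>Tensors of vectors with levels adding up to at most \<open>s\<close> expand into
  tensors of basis vectors with the same property, as the expansion of a vector involves no
  basis vector above its level.\<close>

lemma tensor_level_span:
  "vec.span {tens x y |x y. x \<in> total C \<and> y \<in> total D \<and> filt C x + filt D y \<le> ereal s} = vec.span {t \<in> TB. tlv t \<le> s}"
proof (rule antisym)
  note fC = CtD(1)[OF Ct(1)] and fD = CtD(1)[OF Ct(2)]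
  show "vec.span {tens x y |x y. x \<in> total C \<and> y \<in> total D \<and> filt C x + filt D y \<le> ereal s} \<subseteq> vec.span {t \<in> TB. tlv t \<le> s}"
  proof (intro vec.span_minimal subsetI vec.subspace_span)
    fix z assume "z \<in> {tens x y |x y. x \<in> total C \<and> y \<in> total D \<and> filt C x + filt D y \<le> ereal s}"
    then obtain x y where xy: "z = tens x y" "x \<in> total C" "y \<in> total D" "filt C x + filt D y \<le> ereal s" by blast
    show "z \<in> vec.span {t \<in> TB. tlv t \<le> s}"
    proof (cases "x = 0 \<or> y = 0")
      case True
      then show ?thesis using xy(1) by (auto simp: tens_simps vec.span_zero)
    next
      case False
      then have "filt C x \<noteq> -\<infinity>" "filt C x \<noteq> \<infinity>" "filt D y \<noteq> -\<infinity>" "filt D y \<noteq> \<infinity>"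
        using fc_minf[OF fC xy(2)] fc_minf[OF fD xy(3)] fc_noinf[OF fC xy(2)] fc_noinf[OF fD xy(3)] by auto
      then obtain p q where "filt C x = ereal p" "filt D y = ereal q" by (metis ereal_cases)
      then show ?thesis unfolding xy(1) using xy(4) by (intro tens_level[OF xy(2,3), of p q]) auto
    qed
  qed
  show "vec.span {t \<in> TB. tlv t \<le> s} \<subseteq> vec.span {tens x y |x y. x \<in> total C \<and> y \<in> total D \<and> filt C x + filt D y \<le> ereal s}"
  proof (rule vec.span_mono, rule subsetI)
    fix t assume "t \<in> {t \<in> TB. tlv t \<le> s}"
    then obtain b b' where b: "b \<in> B" "b' \<in> B'" "t = tens b b'" "lv b + lv' b' \<le> s"
      by (auto simp: TB_def tlv_def)
    have "filt C b + filt D b' \<le> ereal (lv b) + ereal (lv' b')" by (rule add_mono[OF filt_basis(1)[OF b(1)] filt_basis(2)[OF b(2)]])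
    also have "\<dots> \<le> ereal s" using b(4) by simp
    finally show "t \<in> {tens x y |x y. x \<in> total C \<and> y \<in> total D \<and> filt C x + filt D y \<le> ereal s}"
      using b Bt by blast
  qed
qed

lemma TB_independent: "vec.independent TB"
  unfolding TB_def by (rule tens_independent[OF ind])

lemma filt_tensor:
  assumes z: "z \<in> total (tensor C D)"
  shows "filt (tensor C D) z \<le> ereal r \<longleftrightarrow> z \<in> vec.span {t \<in> TB. tlv t \<le> r}"
proof -
  let ?U = "\<lambda>s. vec.span {tens x y |x y. x \<in> total C \<and> y \<in> total D \<and> filt C x + filt D y \<le> s}"
  have filt: "filt (tensor C D) z = Inf {s. z \<in> ?U s}" by (simp add: tensor_def)
  have mono: "?U s \<subseteq> ?U s'" if "s \<le> s'" for s s' :: ereal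
    using that order_trans by (intro vec.span_mono) blast
  have zT: "z \<in> vec.span TB" using z total_tensor by simp
  show ?thesis
  proof
    assume "z \<in> vec.span {t \<in> TB. tlv t \<le> r}"
    then have "z \<in> ?U (ereal r)" unfolding tensor_level_span .
    then show "filt (tensor C D) z \<le> ereal r" unfolding filt by (intro Inf_lower) simp
  next
    assume le: "filt (tensor C D) z \<le> ereal r"
    show "z \<in> vec.span {t \<in> TB. tlv t \<le> r}"
    proof (rule ccontr)
      assume n: "z \<notin> vec.span {t \<in> TB. tlv t \<le> r}"
      then obtain t where t: "vec.representation TB z t \<noteq> 0" "t \<notin> {t \<in> TB. tlv t \<le> r}"
        using in_span_rep[OF TB_independent zT, of "{t \<in> TB. tlv t \<le> r}"] by blast
      then have lt: "r < tlv t" using vec.representation_ne_zero[of TB z t] by auto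
      have real: "tlv t \<le> s" if "z \<in> ?U (ereal s)" for s
        using representation_sub[OF TB_independent _ that[unfolded tensor_level_span] t(1)] by blast
      have "ereal (tlv t) \<le> s" if s: "z \<in> ?U s" for s
      proof (cases s)
        case (real q)
        then show ?thesis using \<open>\<And>s. z \<in> ?U (ereal s) \<Longrightarrow> tlv t \<le> s\<close>[of q] s by simp
      next
        case MInf
        then have "z \<in> ?U (ereal r)" using mono[of s "ereal r"] s by auto
        then show ?thesis using n unfolding tensor_level_span by blast
      qed simp
      then have "ereal (tlv t) \<le> filt (tensor C D) z" unfolding filt by (intro Inf_greatest) simp
      then have "ereal (tlv t) \<le> ereal r" using le by (rule order_trans)
      then show False using lt by simp
    qed
  qed
qed

lemma based_tensor: "based (tensor C D) TB tdg tlv"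
  unfolding based_def using TB_independent grade_tensor filt_tensor by blast

definition sg :: "int \<Rightarrow> 'k" where "sg p = (if even p then 1 else - 1)"

text \<open>The differential of a tensor product is a choice among the maps that satisfy the
  Leibniz rule. On a basis of the tensor product the rule prescribes a map, and bilinearity
  extends the rule to all homogeneous tensors; so the choice is not empty.\<close>

lemma bdry_tensor:
  shows lin_bdry_tensor: "linear_on (total (tensor C D)) (bdry (tensor C D))"
    and "x \<in> grade C p \<Longrightarrow> y \<in> total D \<Longrightarrow>
      bdry (tensor C D) (tens x y) = tens (bdry C x) y + vscale (sg p) (tens x (bdry D y))"
proof -
  note fC = CtD(1)[OF Ct(1)] and fD = CtD(1)[OF Ct(2)]
  let ?V = "vec.span {tens x y |x y. x \<in> total C \<and> y \<in> total D}"
  define P where "P d \<longleftrightarrow> linear_on ?V d \<and> (\<forall>p. \<forall>x\<in>grade C p. \<forall>y\<in>total D.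
    d (tens x y) = tens (bdry C x) y + vscale (if even p then 1 else - 1) (tens x (bdry D y)))" for d
  \<comment> \<open>\<open>TB\<close> is independent, so the Leibniz rule may be used as a
    definition on it.\<close>
  obtain g where g: "Vector_Spaces.linear vscale vscale g"
    "\<forall>t\<in>TB. g t = tens (bdry C (fst (pair t))) (snd (pair t)) + vscale (sg (dg (fst (pair t)))) (tens (fst (pair t)) (bdry D (snd (pair t))))"
    using vp.linear_independent_extend[OF TB_independent, of "\<lambda>t. tens (bdry C (fst (pair t))) (snd (pair t)) + vscale (sg (dg (fst (pair t)))) (tens (fst (pair t)) (bdry D (snd (pair t))))"]
    by (elim exE conjE)
  have gb: "g (tens b b') = tens (bdry C b) b' + vscale (sg (dg b)) (tens b (bdry D b'))" if "b \<in> B" "b' \<in> B'" for b b'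
  proof -
    have "tens b b' \<in> TB" unfolding TB_def using that by force
    then show ?thesis using g(2) that by simp
  qed
  have lt1: "linear_on S (\<lambda>x. tens x y)" and lt2: "linear_on S (\<lambda>y. tens x y)" for S x y
    using linear_tens linear_imp_linear_on by blast+
  have ls: "linear_on S (\<lambda>x. vscale c (f x))" if "linear_on S f" for S c f
    using that unfolding linear_on_def by (auto simp: vec.scale_right_distrib mult.commute)
  have gby: "g (tens b y) = tens (bdry C b) y + vscale (sg (dg b)) (tens b (bdry D y))" if b: "b \<in> B" and y: "y \<in> total D" for b y
  proof (rule linear_on_eq_span[of B' "\<lambda>y. g (tens b y)" "\<lambda>y. tens (bdry C b) y + vscale (sg (dg b)) (tens b (bdry D y))" y])
    show "linear_on (vec.span B') (\<lambda>y. g (tens b y))"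
      by (rule linear_on_comp[OF lt2 subset_UNIV linear_imp_linear_on[OF g(1)]])
    show "linear_on (vec.span B') (\<lambda>y. tens (bdry C b) y + vscale (sg (dg b)) (tens b (bdry D y)))"
      by (intro linear_on_plus lt2 ls linear_on_comp[OF _ subset_UNIV lt2]) (use fc_lin[OF fD] based_total[OF bD] in simp)
  qed (use gb[OF b] y based_total[OF bD] in auto)
  have gxy: "g (tens x y) = tens (bdry C x) y + vscale (sg p) (tens x (bdry D y))" if x: "x \<in> grade C p" and y: "y \<in> total D" for p x y
  proof (rule linear_on_eq_span[of "{b \<in> B. dg b = p}" "\<lambda>x. g (tens x y)" "\<lambda>x. tens (bdry C x) y + vscale (sg p) (tens x (bdry D y))" x])
    have sub: "vec.span {b \<in> B. dg b = p} \<subseteq> total C"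
      unfolding based_total[OF bC] by (rule vec.span_mono) blast
    show "linear_on (vec.span {b \<in> B. dg b = p}) (\<lambda>x. g (tens x y))"
      by (rule linear_on_comp[OF lt1 subset_UNIV linear_imp_linear_on[OF g(1)]])
    show "linear_on (vec.span {b \<in> B. dg b = p}) (\<lambda>x. tens (bdry C x) y + vscale (sg p) (tens x (bdry D y)))"
      by (intro linear_on_plus lt1 ls linear_on_comp[OF _ subset_UNIV lt1]) (rule linear_on_subset[OF fc_lin[OF fC] sub])
    show "x \<in> vec.span {b \<in> B. dg b = p}" using x unfolding basedD(2)[OF bC] .
  qed (use gby y in auto)
  have "P g" using linear_imp_linear_on[OF g(1)] gxy unfolding sg_def P_def by blast
  then have "P (SOME d. P d)" by (rule someI[of P g])
  moreover have "bdry (tensor C D) = (SOME d. P d)" unfolding P_def by (simp add: tensor_def)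
  ultimately have P: "P (bdry (tensor C D))" by simp
  show "linear_on (total (tensor C D)) (bdry (tensor C D))"
    using P unfolding P_def total_tensor tensor_generators by blast
  show "bdry (tensor C D) (tens x y) = tens (bdry C x) y + vscale (sg p) (tens x (bdry D y))"
    if "x \<in> grade C p" "y \<in> total D"
    using P that unfolding P_def sg_def by blast
qed

lemma TB_E:
  assumes "t \<in> TB" obtains b b' where "b \<in> B" "b' \<in> B'" "t = tens b b'" "tdg t = dg b + dg' b'" "tlv t = lv b + lv' b'"
  using assms that unfolding TB_def tdg_def tlv_def by auto

lemma filtered_tensor: "filtered_complex (tensor C D)"
proof (rule based_filtered[OF based_tensor lin_bdry_tensor])
  note fC = CtD(1)[OF Ct(1)] and fD = CtD(1)[OF Ct(2)]
  fix t assume "t \<in> TB"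
  then obtain b b' where b: "b \<in> B" "b' \<in> B'" "t = tens b b'" "tdg t = dg b + dg' b'" "tlv t = lv b + lv' b'" by (rule TB_E)
  have gb: "b \<in> grade C (dg b)" "b' \<in> grade D (dg' b')"
    unfolding basedD(2)[OF bC] basedD(2)[OF bD] using b by (auto intro: vec.span_base)
  have tb: "b \<in> total C" "b' \<in> total D" using gb grade_total by blast+
  note dtb = fc_bdry_total[OF fC tb(1)] fc_bdry_total[OF fD tb(2)]
  have d: "bdry (tensor C D) t = tens (bdry C b) b' + vscale (sg (dg b)) (tens b (bdry D b'))"
    unfolding b(3) by (rule bdry_tensor(2)[OF gb(1) tb(2)])
  have G: "tens x y \<in> vec.span {t' \<in> TB. tdg t' = tdg t - 1}" if "x \<in> grade C p" "y \<in> grade D q" "p + q = tdg t - 1" for x y p q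
  proof -
    have "tens x y \<in> grade (tensor C D) (p + q)" by (rule tens_grade[OF that(1,2)])
    then show ?thesis unfolding grade_tensor that(3) .
  qed
  show "bdry (tensor C D) t \<in> vec.span {t' \<in> TB. tdg t' = tdg t - 1}"
    unfolding d using G[OF fc_bdry[OF fC gb(1)] gb(2)] G[OF gb(1) fc_bdry[OF fD gb(2)]] b(4)
    by (intro vec.span_add vec.span_scale) simp_all
  have lv: "filt C b \<le> ereal (lv b)" "filt D b' \<le> ereal (lv' b')" using filt_basis b by blast+
  have dlv: "filt C (bdry C b) \<le> ereal (lv b)" "filt D (bdry D b') \<le> ereal (lv' b')"
    using order_trans[OF fc_fbdry[OF fC tb(1)] lv(1)] order_trans[OF fc_fbdry[OF fD tb(2)] lv(2)] .
  show "bdry (tensor C D) t \<in> vec.span {t' \<in> TB. tlv t' \<le> tlv t}"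
    unfolding d using tens_level[OF dtb(1) tb(2) dlv(1) lv(2)] tens_level[OF tb(1) dtb(2) lv(1) dlv(2)] b(5)
    by (intro vec.span_add vec.span_scale) simp_all
  have sg: "sg (p - 1) = - sg p" "sg p * sg p = 1" for p by (simp_all add: sg_def)
  have "bdry (tensor C D) (bdry (tensor C D) t) =
    bdry (tensor C D) (tens (bdry C b) b') + vscale (sg (dg b)) (bdry (tensor C D) (tens b (bdry D b')))"
    unfolding d using linear_on_add[OF lin_bdry_tensor tens_total[OF dtb(1) tb(2)] total_scale[OF tens_total[OF tb(1) dtb(2)]]]
      linear_on_scale[OF lin_bdry_tensor tens_total[OF tb(1) dtb(2)]] by simp
  also have "\<dots> = 0"
    unfolding bdry_tensor(2)[OF fc_bdry[OF fC gb(1)] tb(2)] bdry_tensor(2)[OF gb(1) dtb(2)]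
      fc_bb[OF fC tb(1)] fc_bb[OF fD tb(2)] sg(1) by (simp add: tens_simps)
  finally show "bdry (tensor C D) (bdry (tensor C D) t) = 0" .
qed

lemma levels_product_finite: "finite {p \<in> B \<times> B'. lv (fst p) + lv' (snd p) \<le> r}"
proof -
  obtain m where m: "\<forall>b\<in>B. m \<le> lv b" by (rule levels_bounded_below[OF based_finite[OF Ct(1) bC]])
  obtain m' where m': "\<forall>b\<in>B'. m' \<le> lv' b" by (rule levels_bounded_below[OF based_finite[OF Ct(2) bD]])
  have "{p \<in> B \<times> B'. lv (fst p) + lv' (snd p) \<le> r} \<subseteq> {b \<in> B. lv b \<le> r - m'} \<times> {b \<in> B'. lv' b \<le> r - m}"
    using m m' by force
  then show ?thesis
    using finite_subset[OF _ finite_cartesian_product[OF based_finite[OF Ct(1) bC] based_finite[OF Ct(2) bD]]] by blast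
qed

lemma TB_level_set: "{t \<in> TB. tlv t \<le> r} = tensp ` {p \<in> B \<times> B'. lv (fst p) + lv' (snd p) \<le> r}"
  using TB_levels[of "\<lambda>p. lv (fst p) + lv' (snd p) \<le> r"] unfolding tlv_def .

lemma tensor_Ct: "tensor C D \<in> Ct"
  by (rule based_Ct[OF filtered_tensor based_tensor])
    (simp only: TB_level_set finite_imageI[OF levels_product_finite])

lemma tensor_Cfg: "C \<in> Cfg \<Longrightarrow> D \<in> Cfg \<Longrightarrow> tensor C D \<in> Cfg"
  by (rule based_Cfg[OF filtered_tensor based_tensor])
    (simp add: TB_def based_finite_Cfg[OF _ bC] based_finite_Cfg[OF _ bD])

lemma Phi_tensor_pairs:
  "Phi (tensor C D) (ereal r) = (\<Sum>p | p \<in> B \<times> B' \<and> lv (fst p) + lv' (snd p) \<le> r. par (dg (fst p)) * par (dg' (snd p)))"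
proof -
  have "Phi (tensor C D) (ereal r) = (\<Sum>t | t \<in> TB \<and> tlv t \<le> r. par (tdg t))"
    by (rule Phi_based[OF based_tensor]) (simp only: TB_level_set finite_imageI[OF levels_product_finite])
  also have "\<dots> = (\<Sum>p | p \<in> B \<times> B' \<and> lv (fst p) + lv' (snd p) \<le> r. par (tdg (tensp p)))"
    unfolding TB_level_set
    by (rule sum.reindex[OF inj_on_subset[OF tensp_inj[OF ind]], unfolded comp_def]) blast
  also have "\<dots> = (\<Sum>p | p \<in> B \<times> B' \<and> lv (fst p) + lv' (snd p) \<le> r. par (dg (fst p)) * par (dg' (snd p)))"
    by (rule sum.cong) (auto simp: tdg_def par_add)
  finally show ?thesis .
qed

text \<open>If \<open>h\<close> contracts \<open>C\<close>, then \<open>h \<otimes> id\<close>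
  contracts \<open>C \<otimes> D\<close>: the terms with the differential of \<open>D\<close>
  cancel because \<open>h\<close> changes the degree, and with it the Koszul sign.\<close>

lemma contraction_tensor:
  assumes h: "contraction r C h" shows "\<exists>H. contraction r (tensor C D) H"
proof -
  note fC = CtD(1)[OF Ct(1)] and fD = CtD(1)[OF Ct(2)]
  have h1: "linear_on (total C) h" "\<forall>i. \<forall>x\<in>grade C i. h x \<in> grade C (i + 1)"
    "\<forall>x\<in>total C. filt C (h x) \<le> filt C x + ereal r" "\<forall>x\<in>total C. x = bdry C (h x) + h (bdry C x)"
    using h unfolding contraction_def by blast+
  note ht = homotopic_mapsto[OF h1(1,2)]
  obtain H where H: "Vector_Spaces.linear vscale vscale H" "\<forall>t\<in>TB. H t = tens (h (fst (pair t))) (snd (pair t))"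
    using vp.linear_independent_extend[OF TB_independent, of "\<lambda>t. tens (h (fst (pair t))) (snd (pair t))"]
    by (elim exE conjE)
  have Hb: "H (tens b b') = tens (h b) b'" if "b \<in> B" "b' \<in> B'" for b b'
  proof -
    have "tens b b' \<in> TB" unfolding TB_def using that by force
    then show ?thesis using H(2) that by simp
  qed
  have Hby: "H (tens b y) = tens (h b) y" if b: "b \<in> B" and y: "y \<in> total D" for b y
  proof (rule linear_on_eq_span[of B' "\<lambda>y. H (tens b y)" "\<lambda>y. tens (h b) y" y])
    show "linear_on (vec.span B') (\<lambda>y. H (tens b y))"
      by (rule linear_on_comp[OF linear_imp_linear_on[OF linear_tens(2)] subset_UNIV linear_imp_linear_on[OF H(1)]])
    show "linear_on (vec.span B') (\<lambda>y. tens (h b) y)" by (rule linear_imp_linear_on[OF linear_tens(2)])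
  qed (use Hb[OF b] y based_total[OF bD] in auto)
  have Hxy: "H (tens x y) = tens (h x) y" if x: "x \<in> total C" and y: "y \<in> total D" for x y
  proof (rule linear_on_eq_span[of B "\<lambda>x. H (tens x y)" "\<lambda>x. tens (h x) y" x])
    show "linear_on (vec.span B) (\<lambda>x. H (tens x y))"
      by (rule linear_on_comp[OF linear_imp_linear_on[OF linear_tens(1)] subset_UNIV linear_imp_linear_on[OF H(1)]])
    show "linear_on (vec.span B) (\<lambda>x. tens (h x) y)"
      by (rule linear_on_comp[OF _ subset_UNIV linear_imp_linear_on[OF linear_tens(1)]]) (use h1(1) based_total[OF bC] in simp)
  qed (use Hby y x based_total[OF bC] in auto)
  have T: "filtered_complex (tensor C D)" by (rule filtered_tensor)
  have Hg: "H x \<in> grade (tensor C D) (i + 1)" if x: "x \<in> grade (tensor C D) i" for i x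
  proof (rule linear_on_span_into[OF linear_imp_linear_on[OF H(1)] subset_UNIV _ fc_sub[OF T] vec.subspace_UNIV x[unfolded grade_tensor]])
    fix t assume "t \<in> {t \<in> TB. tdg t = i}"
    then obtain b b' where b: "b \<in> B" "b' \<in> B'" "t = tens b b'" "dg b + dg' b' = i" by (auto simp: TB_def tdg_def)
    have gb: "b \<in> grade C (dg b)" "b' \<in> grade D (dg' b')"
      unfolding basedD(2)[OF bC] basedD(2)[OF bD] using b by (auto intro: vec.span_base)
    have "h b \<in> grade C (dg b + 1)" using h1(2) gb by blast
    from tens_grade[OF this gb(2)] have "tens (h b) b' \<in> grade (tensor C D) (i + 1)"
      using b(4) by (simp add: algebra_simps)
    then show "H t \<in> grade (tensor C D) (i + 1)" using Hb b by simp
  qed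
  have Ht: "H x \<in> total (tensor C D)" if "x \<in> total (tensor C D)" for x
    by (rule linear_total_total[OF linear_imp_linear_on[OF H(1)] Hg that])
  have Hl: "H x \<in> vec.span {t \<in> TB. tlv t \<le> s + r}" if x: "x \<in> vec.span {t \<in> TB. tlv t \<le> s}" for s x
  proof (rule linear_on_span_into[OF linear_imp_linear_on[OF H(1)] subset_UNIV _ vec.subspace_span vec.subspace_UNIV x])
    fix t assume "t \<in> {t \<in> TB. tlv t \<le> s}"
    then obtain b b' where b: "b \<in> B" "b' \<in> B'" "t = tens b b'" "lv b + lv' b' \<le> s" by (auto simp: TB_def tlv_def)
    have tb: "b \<in> total C" "b' \<in> total D" using Bt b by blast+
    have "filt C (h b) \<le> filt C b + ereal r" using h1(3) tb by blast
    also have "\<dots> \<le> ereal (lv b) + ereal r" by (intro add_right_mono filt_basis(1) b(1))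
    finally have "filt C (h b) \<le> ereal (lv b + r)" by simp
    then have "tens (h b) b' \<in> vec.span {t \<in> TB. tlv t \<le> s + r}"
      by (rule tens_level[OF ht[OF tb(1)] tb(2) _ filt_basis(2)[OF b(2)]]) (use b(4) in simp)
    then show "H t \<in> vec.span {t \<in> TB. tlv t \<le> s + r}" using Hb b by simp
  qed
  have "contraction r (tensor C D) H"
    unfolding contraction_def
  proof (intro conjI allI ballI)
    show "linear_on (total (tensor C D)) H" by (rule linear_imp_linear_on[OF H(1)])
    show "H x \<in> grade (tensor C D) (i + 1)" if "x \<in> grade (tensor C D) i" for i x by (rule Hg[OF that])
    fix x assume x: "x \<in> total (tensor C D)"
    show "filt (tensor C D) (H x) \<le> filt (tensor C D) x + ereal r"
    proof (cases "filt (tensor C D) x")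
      case (real s)
      then have "H x \<in> vec.span {t \<in> TB. tlv t \<le> s + r}" using filt_tensor[OF x, of s] Hl by simp
      then show ?thesis using filt_tensor[OF Ht[OF x]] real by simp
    next
      case MInf
      then have "x = 0" using fc_minf[OF T x] by simp
      then show ?thesis using vp.linear_0[OF H(1)] fc_0[OF T] by simp
    qed (use fc_noinf[OF T x] in simp)
    show "x = bdry (tensor C D) (H x) + H (bdry (tensor C D) x)"
    proof (rule linear_on_eq_span[of TB "\<lambda>x. x" "\<lambda>x. bdry (tensor C D) (H x) + H (bdry (tensor C D) x)" x])
      show "linear_on (vec.span TB) (\<lambda>x. bdry (tensor C D) (H x) + H (bdry (tensor C D) x))"
        unfolding total_tensor[symmetric]
        by (intro linear_on_plus linear_on_comp[OF linear_imp_linear_on[OF H(1)] _ lin_bdry_tensor]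
          linear_on_comp[OF lin_bdry_tensor subset_UNIV linear_imp_linear_on[OF H(1)]]) (use Ht in blast)
      show "x \<in> vec.span TB" using x total_tensor by simp
      fix t assume "t \<in> TB"
      then obtain b b' where b: "b \<in> B" "b' \<in> B'" "t = tens b b'" by (rule TB_E)
      have gb: "b \<in> grade C (dg b)" unfolding basedD(2)[OF bC] using b by (auto intro: vec.span_base)
      have tb: "b \<in> total C" "b' \<in> total D" using Bt b by blast+
      have hb: "h b \<in> grade C (dg b + 1)" using h1(2) gb by blast
      have sg: "sg (p + 1) = - sg p" for p by (simp add: sg_def)
      have "H (bdry (tensor C D) t) = tens (h (bdry C b)) b' + vscale (sg (dg b)) (tens (h b) (bdry D b'))"
        unfolding b(3) bdry_tensor(2)[OF gb tb(2)]
        by (simp add: vp.linear_add[OF H(1)] vp.linear_scale[OF H(1)] Hxy fc_bdry_total[OF fC] fc_bdry_total[OF fD] tb)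
      moreover have "bdry (tensor C D) (H t) = tens (bdry C (h b)) b' - vscale (sg (dg b)) (tens (h b) (bdry D b'))"
        unfolding b(3) Hb[OF b(1,2)] bdry_tensor(2)[OF hb tb(2)] sg by simp
      moreover have "t = tens (bdry C (h b)) b' + tens (h (bdry C b)) b'"
        unfolding b(3) using h1(4) tb(1) tens_simps(1) by metis
      ultimately show "t = bdry (tensor C D) (H t) + H (bdry (tensor C D) t)" by simp
    qed simp
  qed
  then show ?thesis by blast
qed

end

section \<open>The product of Grothendieck groups\<close>

definition fmul :: "('k::field fcomplex \<Rightarrow>\<^sub>0 int) \<Rightarrow> ('k fcomplex \<Rightarrow>\<^sub>0 int) \<Rightarrow> ('k fcomplex \<Rightarrow>\<^sub>0 int)" where
  "fmul x y = frag_extend (\<lambda>C. frag_extend (\<lambda>D. frag_of (tensor C D)) y) x"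

lemma zext_fmul: "zext \<phi> (fmul x y) = zext (\<lambda>C. zext (\<lambda>D. \<phi> (tensor C D)) y) x"
  by (simp add: fmul_def zext_frag_extend)

lemma fmul_keys:
  assumes "\<And>C D. C \<in> Poly_Mapping.keys x \<Longrightarrow> D \<in> Poly_Mapping.keys y \<Longrightarrow> tensor C D \<in> Ob"
  shows "Poly_Mapping.keys (fmul x y) \<subseteq> Ob"
proof -
  have 1: "Poly_Mapping.keys (frag_extend (\<lambda>D. frag_of (tensor C D)) y) \<subseteq> Ob" if "C \<in> Poly_Mapping.keys x" for C
    using keys_frag_extend[of "\<lambda>D. frag_of (tensor C D)" y] assms[OF that] by auto
  show ?thesis
    using keys_frag_extend[of "\<lambda>C. frag_extend (\<lambda>D. frag_of (tensor C D)) y" x] 1 unfolding fmul_def by blast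
qed

lemma fmul_add: "fmul (x + x') y = fmul x y + fmul x' y" "fmul x (y + y') = fmul x y + fmul x y'"
proof -
  show "fmul (x + x') y = fmul x y + fmul x' y" by (simp add: fmul_def frag_extend_add)
  have "Poly_Mapping.keys x \<subseteq> UNIV" by simp
  then show "fmul x (y + y') = fmul x y + fmul x y'"
    unfolding fmul_def
    by (induction x rule: frag_induction) (simp_all add: frag_extend_diff frag_extend_add)
qed

lemma fmul_diff: "fmul (x - x') y = fmul x y - fmul x' y" "fmul x (y - y') = fmul x y - fmul x y'"
  unfolding eq_diff_eq fmul_add[symmetric] by simp_all

lemma zext_swap: "zext (\<lambda>a. zext (\<phi> a) y) x = zext (\<lambda>b. zext (\<lambda>a. \<phi> a b) x) y"
  unfolding zext_def sum_distrib_left by (subst sum.swap) (simp add: mult.left_commute)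

lemma zext_sum: "zext (\<lambda>a. \<Sum>i\<in>I. c i * \<phi> i a) x = (\<Sum>i\<in>I. c i * zext (\<phi> i) x)"
  unfolding zext_def sum_distrib_left by (subst sum.swap) (simp add: mult.left_commute)

lemma based_exists:
  assumes "C \<in> Ct" obtains B dg lv where "based C B dg lv"
  using adapted_basis[OF assms] by metis

lemma tensor_objs:
  assumes "C \<in> objs fin" "D \<in> objs fin" shows "tensor C D \<in> objs fin"
proof -
  note Ct = objs_Ct[OF assms(1)] objs_Ct[OF assms(2)]
  obtain B dg lv where B: "based C B dg lv" by (rule based_exists[OF Ct(1)])
  obtain B' dg' lv' where B': "based D B' dg' lv'" by (rule based_exists[OF Ct(2)])
  interpret tensor_factors C D B B' dg dg' lv lv' by unfold_locales (rule Ct B B')+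
  show ?thesis using tensor_Ct tensor_Cfg assms by (simp add: objs_def split: if_splits)
qed

lemma tensor_Acyclics:
  assumes "C \<in> Acyclics (objs fin)" "D \<in> objs fin" shows "tensor C D \<in> Acyclics (objs fin)"
proof -
  have C: "C \<in> objs fin" using assms(1) Acyclics_sub by blast
  note Ct = objs_Ct[OF C] objs_Ct[OF assms(2)]
  obtain B dg lv where B: "based C B dg lv" by (rule based_exists[OF Ct(1)])
  obtain B' dg' lv' where B': "based D B' dg' lv'" by (rule based_exists[OF Ct(2)])
  interpret tensor_factors C D B B' dg dg' lv lv' by unfold_locales (rule Ct B B')+
  obtain r h where rh: "0 \<le> r" "contraction r C h" by (rule AcyclicsE[OF assms(1) CtD(1)[OF Ct(1)]])
  obtain H where H: "contraction r (tensor C D) H" using contraction_tensor[OF rh(2)] by (rule exE)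
  show ?thesis by (rule AcyclicsI[OF filtered_tensor tensor_objs[OF C assms(2)] rh(1) H])
qed

text \<open>The sum over pairs of basis vectors, arranged by the first component. The bound on the levels of \<open>b\<close>
  only removes vanishing terms, and makes the sum finite. It may be lowered, so that one bound serves
  several complexes \<open>D\<close> at once.\<close>

lemma (in tensor_factors) Phi_tensor_left:
  "\<exists>m. \<forall>m'\<le>m. \<forall>r. Phi (tensor C D) (ereal r) = (\<Sum>b | b \<in> B \<and> lv b \<le> r - m'. par (dg b) * Phi D (ereal (r - lv b)))"
proof -
  obtain m where m: "\<forall>b\<in>B'. m \<le> lv' b" by (rule levels_bounded_below[OF based_finite[OF Ct(2) bD]])
  have "Phi (tensor C D) (ereal r) = (\<Sum>b | b \<in> B \<and> lv b \<le> r - m'. par (dg b) * Phi D (ereal (r - lv b)))" if m': "m' \<le> m" for m' r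
  proof -
    have eq: "{p \<in> B \<times> B'. lv (fst p) + lv' (snd p) \<le> r} = (SIGMA b:{b \<in> B. lv b \<le> r - m'}. {b' \<in> B'. lv' b' \<le> r - lv b})"
      using m m' by force
    have "Phi (tensor C D) (ereal r) = (\<Sum>(b, b')\<in>(SIGMA b:{b \<in> B. lv b \<le> r - m'}. {b' \<in> B'. lv' b' \<le> r - lv b}). par (dg b) * par (dg' b'))"
      unfolding Phi_tensor_pairs eq by (simp add: case_prod_unfold)
    also have "\<dots> = (\<Sum>b | b \<in> B \<and> lv b \<le> r - m'. \<Sum>b' | b' \<in> B' \<and> lv' b' \<le> r - lv b. par (dg b) * par (dg' b'))"
      by (rule sum.Sigma[symmetric]) (use based_finite[OF Ct(1) bC] based_finite[OF Ct(2) bD] in auto)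
    also have "\<dots> = (\<Sum>b | b \<in> B \<and> lv b \<le> r - m'. par (dg b) * Phi D (ereal (r - lv b)))"
      unfolding Phi_based[OF bD based_finite[OF Ct(2) bD]] sum_distrib_left ..
    finally show ?thesis .
  qed
  then show ?thesis by blast
qed

lemma (in tensor_factors) Phi_tensor_right:
  "\<exists>m. \<forall>m'\<le>m. \<forall>r. Phi (tensor C D) (ereal r) = (\<Sum>b | b \<in> B' \<and> lv' b \<le> r - m'. par (dg' b) * Phi C (ereal (r - lv' b)))"
proof -
  obtain m where m: "\<forall>b\<in>B. m \<le> lv b" by (rule levels_bounded_below[OF based_finite[OF Ct(1) bC]])
  have "Phi (tensor C D) (ereal r) = (\<Sum>b | b \<in> B' \<and> lv' b \<le> r - m'. par (dg' b) * Phi C (ereal (r - lv' b)))" if m': "m' \<le> m" for m' r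
  proof -
    let ?S = "SIGMA b':{b' \<in> B'. lv' b' \<le> r - m'}. {b \<in> B. lv b \<le> r - lv' b'}"
    have "Phi (tensor C D) (ereal r) = (\<Sum>(b', b)\<in>?S. par (dg' b') * par (dg b))"
      unfolding Phi_tensor_pairs
      by (rule sum.reindex_bij_witness[of _ "\<lambda>(b', b). (b, b')" "\<lambda>(b, b'). (b', b)"]) (use m m' in \<open>force+\<close>)
    also have "\<dots> = (\<Sum>b' | b' \<in> B' \<and> lv' b' \<le> r - m'. \<Sum>b | b \<in> B \<and> lv b \<le> r - lv' b'. par (dg' b') * par (dg b))"
      by (rule sum.Sigma[symmetric]) (use based_finite[OF Ct(1) bC] based_finite[OF Ct(2) bD] in auto)
    also have "\<dots> = (\<Sum>b' | b' \<in> B' \<and> lv' b' \<le> r - m'. par (dg' b') * Phi C (ereal (r - lv' b')))"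
      unfolding Phi_based[OF bC based_finite[OF Ct(1) bC]] sum_distrib_left ..
    finally show ?thesis .
  qed
  then show ?thesis by blast
qed

lemma finite_lower_bound:
  assumes "finite S" "\<And>a. a \<in> S \<Longrightarrow> \<exists>m::real. \<forall>m'\<le>m. Q a m'"
  shows "\<exists>m. \<forall>a\<in>S. Q a m"
proof -
  have "\<exists>f. \<forall>a\<in>S. \<forall>m'\<le>f a. Q a m'" by (rule bchoice) (use assms(2) in blast)
  then obtain f where f: "\<forall>a\<in>S. \<forall>m'\<le>f a. Q a m'" by (rule exE)
  have "Min (insert 0 (f ` S)) \<le> f a" if "a \<in> S" for a using assms(1) that by (intro Min_le) auto
  then show ?thesis using f by blast
qed

text \<open>By the two convolution formulas, the elements on which all Euler characteristics of sublevels
  vanish form an ideal.\<close>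

lemma fmul_zero_right:
  assumes x: "Poly_Mapping.keys x \<subseteq> Ct" and y: "Poly_Mapping.keys y \<subseteq> Ct"
    and z: "\<And>r. zext (\<lambda>D. Phi D (ereal r)) y = 0"
  shows "zext (\<lambda>D. Phi D (ereal r)) (fmul x y) = 0"
proof -
  have "zext (\<lambda>D. Phi (tensor C D) (ereal r)) y = 0" if C: "C \<in> Poly_Mapping.keys x" for C
  proof -
    have Ct: "C \<in> Ct" using C x by blast
    obtain B dg lv where B: "based C B dg lv" by (rule based_exists[OF Ct])
    \<comment> \<open>One bound for all the finitely many \<open>D\<close>, so that the sum over
      \<open>b\<close> can be exchanged with that over \<open>D\<close>.\<close>
    have "\<exists>m. \<forall>D\<in>Poly_Mapping.keys y. \<forall>r. Phi (tensor C D) (ereal r) = (\<Sum>b | b \<in> B \<and> lv b \<le> r - m. par (dg b) * Phi D (ereal (r - lv b)))"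
    proof (rule finite_lower_bound)
      fix D assume "D \<in> Poly_Mapping.keys y"
      then have D: "D \<in> Ct" using y by blast
      obtain B' dg' lv' where B': "based D B' dg' lv'" by (rule based_exists[OF D])
      interpret tensor_factors C D B B' dg dg' lv lv' by unfold_locales (rule Ct D B B')+
      show "\<exists>m. \<forall>m'\<le>m. \<forall>r. Phi (tensor C D) (ereal r) = (\<Sum>b | b \<in> B \<and> lv b \<le> r - m'. par (dg b) * Phi D (ereal (r - lv b)))"
        by (rule Phi_tensor_left)
    qed simp
    then obtain m where m: "\<forall>D\<in>Poly_Mapping.keys y. \<forall>r. Phi (tensor C D) (ereal r) = (\<Sum>b | b \<in> B \<and> lv b \<le> r - m. par (dg b) * Phi D (ereal (r - lv b)))"
      by (rule exE)
    have "zext (\<lambda>D. Phi (tensor C D) (ereal r)) y = zext (\<lambda>D. \<Sum>b | b \<in> B \<and> lv b \<le> r - m. par (dg b) * Phi D (ereal (r - lv b))) y"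
      by (rule zext_cong) (use m in blast)
    also have "\<dots> = 0" unfolding zext_sum z by simp
    finally show ?thesis .
  qed
  then show ?thesis unfolding zext_fmul using zext_cong[of x _ "\<lambda>_. 0"] by (simp add: zext_def)
qed

lemma fmul_zero_left:
  assumes x: "Poly_Mapping.keys x \<subseteq> Ct" and y: "Poly_Mapping.keys y \<subseteq> Ct"
    and z: "\<And>r. zext (\<lambda>D. Phi D (ereal r)) x = 0"
  shows "zext (\<lambda>D. Phi D (ereal r)) (fmul x y) = 0"
proof -
  have "zext (\<lambda>C. Phi (tensor C D) (ereal r)) x = 0" if D: "D \<in> Poly_Mapping.keys y" for D
  proof -
    have Ct: "D \<in> Ct" using D y by blast
    obtain B' dg' lv' where B': "based D B' dg' lv'" by (rule based_exists[OF Ct])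
    have "\<exists>m. \<forall>C\<in>Poly_Mapping.keys x. \<forall>r. Phi (tensor C D) (ereal r) = (\<Sum>b | b \<in> B' \<and> lv' b \<le> r - m. par (dg' b) * Phi C (ereal (r - lv' b)))"
    proof (rule finite_lower_bound)
      fix C assume "C \<in> Poly_Mapping.keys x"
      then have C: "C \<in> Ct" using x by blast
      obtain B dg lv where B: "based C B dg lv" by (rule based_exists[OF C])
      interpret tensor_factors C D B B' dg dg' lv lv' by unfold_locales (rule Ct C B B')+
      show "\<exists>m. \<forall>m'\<le>m. \<forall>r. Phi (tensor C D) (ereal r) = (\<Sum>b | b \<in> B' \<and> lv' b \<le> r - m'. par (dg' b) * Phi C (ereal (r - lv' b)))"
        by (rule Phi_tensor_right)
    qed simp
    then obtain m where m: "\<forall>C\<in>Poly_Mapping.keys x. \<forall>r. Phi (tensor C D) (ereal r) = (\<Sum>b | b \<in> B' \<and> lv' b \<le> r - m. par (dg' b) * Phi C (ereal (r - lv' b)))"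
      by (rule exE)
    have "zext (\<lambda>C. Phi (tensor C D) (ereal r)) x = zext (\<lambda>C. \<Sum>b | b \<in> B' \<and> lv' b \<le> r - m. par (dg' b) * Phi C (ereal (r - lv' b))) x"
      by (rule zext_cong) (use m in blast)
    also have "\<dots> = 0" unfolding zext_sum z by simp
    finally show ?thesis .
  qed
  then show ?thesis unfolding zext_fmul zext_swap[of _ y x] using zext_cong[of y _ "\<lambda>_. 0"] by (simp add: zext_def)
qed

lemma tens_mem: "b \<in> B \<Longrightarrow> b' \<in> B' \<Longrightarrow> tens b b' \<in> tensp ` (B \<times> B')"
  by force

text \<open>The levels and degrees of the basis of triple tensors do not depend on the
  bracketing, so both sides are the same signed count.\<close>

lemma Phi_tensor_assoc:
  assumes "C \<in> Ct" "D \<in> Ct" "E \<in> Ct"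
  shows "Phi (tensor (tensor C D) E) (ereal r) = Phi (tensor C (tensor D E)) (ereal r)"
proof -
  obtain B dg lv where B: "based C B dg lv" by (rule based_exists[OF assms(1)])
  obtain B' dg' lv' where B': "based D B' dg' lv'" by (rule based_exists[OF assms(2)])
  obtain B'' dg'' lv'' where B'': "based E B'' dg'' lv''" by (rule based_exists[OF assms(3)])
  interpret X: tensor_factors C D B B' dg dg' lv lv' by unfold_locales (rule assms B B')+
  interpret Y: tensor_factors D E B' B'' dg' dg'' lv' lv'' by unfold_locales (rule assms B' B'')+
  interpret XE: tensor_factors "tensor C D" E X.TB B'' X.tdg dg'' X.tlv lv''
    by unfold_locales (rule X.tensor_Ct assms X.based_tensor B'')+
  interpret CY: tensor_factors C "tensor D E" B Y.TB dg Y.tdg lv Y.tlv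
    by unfold_locales (rule Y.tensor_Ct assms Y.based_tensor B)+
  show ?thesis
    unfolding XE.Phi_tensor_pairs CY.Phi_tensor_pairs
    by (rule sum.reindex_bij_witness[of _ "\<lambda>(b, u). (tens b (fst (Y.pair u)), snd (Y.pair u))"
          "\<lambda>(t, e). (fst (X.pair t), tens (snd (X.pair t)) e)"])
      (auto simp: X.TB_def Y.TB_def X.tdg_def Y.tdg_def X.tlv_def Y.tlv_def par_add intro!: tens_mem)
qed

lemma euler_tensor:
  assumes "C \<in> Cfg" "D \<in> Cfg" shows "euler (tensor C D) = euler C * euler D"
proof -
  have Ct: "C \<in> Ct" "D \<in> Ct" using assms Cfg_subset_Ct by blast+
  obtain B dg lv where B: "based C B dg lv" by (rule based_exists[OF Ct(1)])
  obtain B' dg' lv' where B': "based D B' dg' lv'" by (rule based_exists[OF Ct(2)])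
  interpret tensor_factors C D B B' dg dg' lv lv' by unfold_locales (rule Ct B B')+
  have fin: "finite B" "finite B'" using based_finite_Cfg[OF assms(1) B] based_finite_Cfg[OF assms(2) B'] .
  have "euler (tensor C D) = (\<Sum>t\<in>TB. par (tdg t))"
    by (rule euler_based[OF based_tensor]) (simp add: TB_def fin)
  also have "\<dots> = (\<Sum>p\<in>B \<times> B'. par (tdg (tensp p)))"
    unfolding TB_def by (rule sum.reindex[OF tensp_inj[OF ind], unfolded comp_def])
  also have "\<dots> = (\<Sum>(b, b')\<in>B \<times> B'. par (dg b) * par (dg' b'))"
    by (rule sum.cong) (auto simp: tdg_def par_add)
  also have "\<dots> = euler C * euler D"
    unfolding euler_based[OF B fin(1)] euler_based[OF B' fin(2)] by (simp add: sum_product sum.cartesian_product)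
  finally show ?thesis .
qed

section \<open>Raising the filtration\<close>

definition lev :: "(ereal \<Rightarrow> ereal) \<Rightarrow> 'k::field fcomplex \<Rightarrow> 'k fcomplex" where
  "lev \<phi> C = \<lparr>grade = grade C, bdry = bdry C, filt = (\<lambda>x. \<phi> (filt C x))\<rparr>"

lemma lev_sel [simp]: "grade (lev \<phi> C) = grade C" "bdry (lev \<phi> C) = bdry C" "filt (lev \<phi> C) x = \<phi> (filt C x)"
  by (simp_all add: lev_def)

lemma total_lev [simp]: "total (lev \<phi> C) = total C"
  by (rule total_cong) simp

text \<open>The reparametrizations of levels under which raising the filtration is an endofunctor that
  preserves tameness and acyclicity.\<close>

definition raising :: "(ereal \<Rightarrow> ereal) \<Rightarrow> bool" where
  "raising \<phi> \<longleftrightarrow> mono \<phi> \<and> \<phi> (-\<infinity>) = -\<infinity> \<and> (\<forall>s::real. \<phi> (ereal s) \<noteq> \<infinity>) \<and> (\<forall>s. s \<le> \<phi> s) \<and>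
     (\<forall>s r. 0 \<le> r \<longrightarrow> \<phi> (s + ereal r) \<le> \<phi> s + ereal r)"

lemma raisingD:
  assumes "raising \<phi>"
  shows "x \<le> y \<Longrightarrow> \<phi> x \<le> \<phi> y" "\<phi> (-\<infinity>) = -\<infinity>" "\<phi> (ereal s) \<noteq> \<infinity>" "x \<le> \<phi> x"
    "0 \<le> r \<Longrightarrow> \<phi> (x + ereal r) \<le> \<phi> x + ereal r" "\<phi> (max x y) = max (\<phi> x) (\<phi> y)"
  using assms by (auto simp: raising_def mono_def max_of_mono)

lemma filtered_lev:
  assumes C: "filtered_complex C" and \<phi>: "raising \<phi>" shows "filtered_complex (lev \<phi> C)"
proof (rule filtered_complexI)
  show "y i = 0" if "finite F" "\<And>i. i \<in> F \<Longrightarrow> y i \<in> grade (lev \<phi> C) i" "sum y F = 0" "i \<in> F" for F y i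
    by (rule fc_indep[OF C that(1) _ that(3,4)]) (use that(2) in simp)
  show "filt (lev \<phi> C) (y i) \<le> filt (lev \<phi> C) (sum y F)"
    if "finite F" "\<And>i. i \<in> F \<Longrightarrow> y i \<in> grade (lev \<phi> C) i" "i \<in> F" for F y i
    unfolding lev_sel by (rule raisingD(1)[OF \<phi> fc_homog[OF C that(1) _ that(3)]]) (use that(2) in simp)
  show "linear_on (total (lev \<phi> C)) (bdry (lev \<phi> C))" using fc_lin[OF C] by simp
  fix x assume "x \<in> total (lev \<phi> C)"
  then have x: "x \<in> total C" by simp
  show "filt (lev \<phi> C) x \<noteq> \<infinity>"
  proof (cases "filt C x")
    case (real s) then show ?thesis using raisingD(3)[OF \<phi>, of s] by simp
  next
    case MInf then show ?thesis using raisingD(2)[OF \<phi>] by simp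
  qed (use fc_noinf[OF C x] in simp)
  show "filt (lev \<phi> C) x = -\<infinity> \<longleftrightarrow> x = 0"
    using raisingD(2)[OF \<phi>] raisingD(4)[OF \<phi>, of "filt C x"] fc_minf[OF C x] by auto
  show "filt (lev \<phi> C) (vscale c x) = filt (lev \<phi> C) x" if "c \<noteq> 0" for c using fc_scale[OF C x that] by simp
  show "filt (lev \<phi> C) (x + y) \<le> max (filt (lev \<phi> C) x) (filt (lev \<phi> C) y)" if "y \<in> total (lev \<phi> C)" for y
    using raisingD(1)[OF \<phi> fc_add[OF C x]] that raisingD(6)[OF \<phi>] by simp
  show "filt (lev \<phi> C) (bdry (lev \<phi> C) x) \<le> filt (lev \<phi> C) x"
    using raisingD(1)[OF \<phi> fc_fbdry[OF C x]] by simp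
  show "bdry (lev \<phi> C) (bdry (lev \<phi> C) x) = 0" using fc_bb[OF C x] by simp
qed (use fc_sub[OF C] fc_bdry[OF C] in simp_all)

lemma lev_objs:
  assumes C: "C \<in> objs fin" and \<phi>: "raising \<phi>" shows "lev \<phi> C \<in> objs fin"
proof -
  have fC: "filtered_complex C" using CtD(1)[OF objs_Ct[OF C]] .
  note f = filtered_lev[OF fC \<phi>]
  have sl: "sublevel (lev \<phi> C) r \<subseteq> sublevel C r" for r
    using order_trans[OF raisingD(4)[OF \<phi>]] unfolding sublevel_def by auto
  show ?thesis
  proof (cases fin)
    case True
    then show ?thesis using C f by (simp add: objs_def Cfg_def)
  next
    case False
    obtain r0 where r0: "\<forall>r\<le>r0. sublevel C r = {0}" using CtD(3)[OF objs_Ct[OF C]] by (rule exE)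
    have "lev \<phi> C \<in> Ct"
    proof (rule CtI[OF f findim_subset[OF CtD(2)[OF objs_Ct[OF C]] sl]])
      show "sublevel (lev \<phi> C) r = {0}" if "r \<le> r0" for r
        using sl[of r] r0 that vec.subspace_0[OF subspace_sublevel[OF f]] by blast
    qed
    then show ?thesis using False by (simp add: objs_def)
  qed
qed

lemma contraction_lev:
  assumes \<phi>: "raising \<phi>" and r: "0 \<le> r" and h: "contraction r C h" shows "contraction r (lev \<phi> C) h"
proof -
  have "\<phi> (filt C (h x)) \<le> \<phi> (filt C x) + ereal r" if x: "x \<in> total C" for x
  proof -
    have "filt C (h x) \<le> filt C x + ereal r" using h x unfolding contraction_def by blast
    from order_trans[OF raisingD(1)[OF \<phi> this] raisingD(5)[OF \<phi> r]] show ?thesis .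
  qed
  then show ?thesis using h by (simp add: contraction_def)
qed

lemma lev_Acyclics:
  assumes "C \<in> Acyclics (objs fin)" "raising \<phi>" shows "lev \<phi> C \<in> Acyclics (objs fin)"
proof -
  have C: "C \<in> objs fin" using assms(1) Acyclics_sub by blast
  note fC = CtD(1)[OF objs_Ct[OF C]]
  obtain r h where rh: "0 \<le> r" "contraction r C h" by (rule AcyclicsE[OF assms(1) fC])
  show ?thesis
    by (rule AcyclicsI[OF filtered_lev[OF fC assms(2)] lev_objs[OF C assms(2)] rh(1) contraction_lev[OF assms(2) rh]])
qed

text \<open>The cofibre of the canonical map from the raised complex. It is acyclic when levels are
  raised by a bounded amount, and exact in \<open>C\<close>; so it turns relations between all objects into
  relations between acyclic ones.\<close>

definition Theta :: "(ereal \<Rightarrow> ereal) \<Rightarrow> 'k::field fcomplex \<Rightarrow> 'k fcomplex" where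
  "Theta \<phi> C = cone (lev \<phi> C) C id"

lemma chain_map_lev_id: "raising \<phi> \<Longrightarrow> chain_map 0 (lev \<phi> C) C id"
  by (rule chain_map_0I) (simp_all add: raisingD(4))

lemma filtered_Theta: "filtered_complex C \<Longrightarrow> raising \<phi> \<Longrightarrow> filtered_complex (Theta \<phi> C)"
  unfolding Theta_def by (rule filtered_cone[OF filtered_lev _ chain_map_lev_id])

lemma Theta_objs: "C \<in> objs fin \<Longrightarrow> raising \<phi> \<Longrightarrow> Theta \<phi> C \<in> objs fin"
  unfolding Theta_def using lev_objs[of C fin \<phi>] chain_map_lev_id[of \<phi> C] cone_Ct[of "lev \<phi> C" C id] cone_Cfg[of "lev \<phi> C" C id]
  by (simp add: objs_def split: if_splits)

lemma Theta_grade: "z \<in> grade (Theta \<phi> C) i \<longleftrightarrow> prl z \<in> grade C (i - 1) \<and> prr z \<in> grade C i"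
  by (simp add: Theta_def cone_grade)

lemma Theta_bdry: "prl (bdry (Theta \<phi> C) z) = - bdry C (prl z)" "prr (bdry (Theta \<phi> C) z) = prl z + bdry C (prr z)"
  by (simp_all add: Theta_def cone_bdry_sides)

lemma Theta_filt: "filt (Theta \<phi> C) z = max (\<phi> (filt C (prl z))) (filt C (prr z))"
  by (simp add: Theta_def cone_filt)

lemma Theta_total: "filtered_complex C \<Longrightarrow> raising \<phi> \<Longrightarrow> z \<in> total (Theta \<phi> C) \<longleftrightarrow> prl z \<in> total C \<and> prr z \<in> total C"
  unfolding Theta_def using cone_total[OF filtered_lev[of C \<phi>], of C z id] by simp

text \<open>The inclusion of \<open>C\<close> into the raised summand contracts the cone; it
  costs the amount of raising.\<close>

lemma Theta_Acyclics:
  assumes C: "C \<in> objs fin" and \<phi>: "raising \<phi>" and r: "0 \<le> r" "\<And>x. x \<in> total C \<Longrightarrow> \<phi> (filt C x) \<le> filt C x + ereal r"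
  shows "Theta \<phi> C \<in> Acyclics (objs fin)"
proof -
  note fC = CtD(1)[OF objs_Ct[OF C]]
  have "contraction r (Theta \<phi> C) (\<lambda>z. inl (prr z))"
    unfolding contraction_def
  proof (intro conjI allI ballI)
    show "linear_on (total (Theta \<phi> C)) (\<lambda>z. inl (prr z))" by (simp add: linear_on_def)
    show "inl (prr x) \<in> grade (Theta \<phi> C) (i + 1)" if "x \<in> grade (Theta \<phi> C) i" for i x
      using that vec.subspace_0[OF fc_sub[OF fC]] by (simp add: Theta_grade)
    fix x assume "x \<in> total (Theta \<phi> C)"
    then have x: "prl x \<in> total C" "prr x \<in> total C" using Theta_total[OF fC \<phi>] by auto
    have "filt (Theta \<phi> C) (inl (prr x)) = \<phi> (filt C (prr x))" by (simp add: Theta_filt fc_0[OF fC])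
    also have "\<dots> \<le> filt C (prr x) + ereal r" by (rule r(2)[OF x(2)])
    also have "\<dots> \<le> filt (Theta \<phi> C) x + ereal r" by (intro add_right_mono) (simp add: Theta_filt)
    finally show "filt (Theta \<phi> C) (inl (prr x)) \<le> filt (Theta \<phi> C) x + ereal r" .
    show "x = bdry (Theta \<phi> C) (inl (prr x)) + inl (prr (bdry (Theta \<phi> C) x))"
      by (rule side_eqI) (simp_all add: Theta_bdry fc_bdry_0[OF fC])
  qed
  then show ?thesis by (rule AcyclicsI[OF filtered_Theta[OF fC \<phi>] Theta_objs[OF C \<phi>] r(1)])
qed

definition dbl :: "('k::field vec \<Rightarrow> 'k vec) \<Rightarrow> 'k vec \<Rightarrow> 'k vec" where
  "dbl f z = inl (f (prl z)) + inr (f (prr z))"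

lemma dbl_sel [simp]: "prl (dbl f z) = f (prl z)" "prr (dbl f z) = f (prr z)"
  by (simp_all add: dbl_def)

lemma linear_dbl:
  assumes C: "filtered_complex C" and \<phi>: "raising \<phi>" and f: "linear_on (total C) f"
  shows "linear_on (total (Theta \<phi> C)) (dbl f)"
  unfolding linear_on_def
  by (intro conjI ballI allI; rule side_eqI; simp add: Theta_total[OF C \<phi>] linear_on_add[OF f] linear_on_scale[OF f])

lemma chain_map_dbl:
  assumes C: "filtered_complex C" and \<phi>: "raising \<phi>" and f: "chain_map 0 C D f"
  shows "chain_map 0 (Theta \<phi> C) (Theta \<phi> D) (dbl f)"
proof (rule chain_map_0I[OF linear_dbl[OF C \<phi> cm_lin[OF f]]])
  show "dbl f x \<in> grade (Theta \<phi> D) i" if "x \<in> grade (Theta \<phi> C) i" for i x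
    using that cm_grade[OF f] by (simp add: Theta_grade)
  fix x assume "x \<in> total (Theta \<phi> C)"
  then have x: "prl x \<in> total C" "prr x \<in> total C" using Theta_total[OF C \<phi>] by auto
  show "dbl f (bdry (Theta \<phi> C) x) = bdry (Theta \<phi> D) (dbl f x)"
    by (rule side_eqI) (simp_all add: Theta_bdry cm_comm[OF f] x linear_on_neg[OF cm_lin[OF f]]
      linear_on_add[OF cm_lin[OF f]] fc_bdry_total[OF C])
  show "filt (Theta \<phi> D) (dbl f x) \<le> filt (Theta \<phi> C) x"
    unfolding Theta_filt dbl_sel by (intro max.mono raisingD(1)[OF \<phi>] cm_filt[OF f] x)
qed

text \<open>The homotopy acts on both summands, with a sign on the shifted one.\<close>

lemma heq_dbl:
  assumes C: "filtered_complex C" and \<phi>: "raising \<phi>" and h: "heq {0} C C f id"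
  shows "heq {0} (Theta \<phi> C) (Theta \<phi> C) (dbl f) id"
proof -
  obtain h where h: "linear_on (total C) h" "\<forall>i. \<forall>x\<in>grade C i. h x \<in> grade C (i + 1)"
     "\<forall>x\<in>total C. filt C (h x) \<le> filt C x + ereal 0"
     "\<forall>x\<in>total C. f x - id x = bdry C (h x) + h (bdry C x)"
    using h by (auto simp: heq_def homotopic_def)
  note ht = homotopic_mapsto[OF h(1,2)]
  define H where "H z = inl (- h (prl z)) + inr (h (prr z))" for z
  have H: "prl (H z) = - h (prl z)" "prr (H z) = h (prr z)" for z by (simp_all add: H_def)
  have "homotopic 0 (Theta \<phi> C) (Theta \<phi> C) (dbl f) id"
    unfolding homotopic_def
  proof (intro exI[of _ H] conjI allI ballI)
    show "linear_on (total (Theta \<phi> C)) H"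
      unfolding linear_on_def
      by (intro conjI ballI allI; rule side_eqI; simp add: H Theta_total[OF C \<phi>] linear_on_add[OF h(1)] linear_on_scale[OF h(1)])
    show "H x \<in> grade (Theta \<phi> C) (i + 1)" if "x \<in> grade (Theta \<phi> C) i" for i x
      using h(2)[rule_format, of "prl x" "i - 1"] h(2)[rule_format, of "prr x" i] that vec.subspace_neg[OF fc_sub[OF C]]
      by (simp add: Theta_grade H)
    fix x assume "x \<in> total (Theta \<phi> C)"
    then have x: "prl x \<in> total C" "prr x \<in> total C" using Theta_total[OF C \<phi>] by auto
    have "filt C (h (prl x)) \<le> filt C (prl x)" "filt C (h (prr x)) \<le> filt C (prr x)" using h(3) x by auto
    then have "filt (Theta \<phi> C) (H x) \<le> filt (Theta \<phi> C) x"
      unfolding Theta_filt H fc_neg[OF C ht[OF x(1)]] by (intro max.mono raisingD(1)[OF \<phi>])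
    then show "filt (Theta \<phi> C) (H x) \<le> filt (Theta \<phi> C) x + ereal 0" by simp
    have e: "f y - y = bdry C (h y) + h (bdry C y)" if "y \<in> total C" for y using h(4) that by simp
    show "dbl f x - id x = bdry (Theta \<phi> C) (H x) + H (bdry (Theta \<phi> C) x)"
      by (rule side_eqI) (simp_all add: Theta_bdry H e x fc_bdry_neg[OF C] ht linear_on_neg[OF h(1)]
        linear_on_add[OF h(1)] fc_bdry_total[OF C])
  qed
  then show ?thesis by (simp add: heq_def)
qed

lemma Theta_hequiv:
  assumes C: "filtered_complex C" and D: "filtered_complex D" and \<phi>: "raising \<phi>" and fg: "hequiv {0} C D f g"
  shows "hequiv {0} (Theta \<phi> C) (Theta \<phi> D) (dbl f) (dbl g)"
proof -
  have f: "chain_map 0 C D f" and g: "chain_map 0 D C g" and h: "heq {0} C C (g \<circ> f) id" "heq {0} D D (f \<circ> g) id"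
    using fg by (auto simp: hequiv_def cmap_def)
  have "dbl g \<circ> dbl f = dbl (g \<circ> f)" "dbl f \<circ> dbl g = dbl (f \<circ> g)"
    by (auto simp: fun_eq_iff dbl_def)
  then show ?thesis
    unfolding hequiv_def cmap_def
    using chain_map_dbl[OF C \<phi> f] chain_map_dbl[OF D \<phi> g] heq_dbl[OF C \<phi> h(1)] heq_dbl[OF D \<phi> h(2)] by simp
qed

text \<open>Both sides are built from two copies of \<open>A\<close> and two of
  \<open>B\<close>. Exchanging the order of the two cone constructions swaps the middle summands
  and changes the sign on the doubly shifted one.\<close>

lemma Theta_cone:
  assumes A: "filtered_complex A" and B: "filtered_complex B" and \<phi>: "raising \<phi>" and f: "chain_map 0 A B f"
  shows "\<exists>\<sigma> \<tau>. hequiv {0} (Theta \<phi> (cone A B f)) (cone (Theta \<phi> A) (Theta \<phi> B) (dbl f)) \<sigma> \<tau>"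
proof -
  let ?K = "cone A B f" and ?L = "cone (Theta \<phi> A) (Theta \<phi> B) (dbl f)"
  have K: "filtered_complex ?K" by (rule filtered_cone[OF A B f])
  have L: "filtered_complex ?L" by (rule filtered_cone[OF filtered_Theta[OF A \<phi>] filtered_Theta[OF B \<phi>] chain_map_dbl[OF A \<phi> f]])
  \<comment> \<open>The components of the source are, in this order: \<open>A\<close> twice
    shifted, \<open>B\<close> raised, \<open>A\<close>, \<open>B\<close>.\<close>
  define \<sigma> where "\<sigma> z = inl (inl (- prl (prl z)) + inr (prl (prr z))) + inr (inl (prr (prl z)) + inr (prr (prr z)))" for z :: "'a vec"
  have \<sigma>: "prl (prl (\<sigma> z)) = - prl (prl z)" "prr (prl (\<sigma> z)) = prl (prr z)" "prl (prr (\<sigma> z)) = prr (prl z)" "prr (prr (\<sigma> z)) = prr (prr z)" for z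
    by (simp_all add: \<sigma>_def)
  have eqI: "x = y" if "prl (prl x) = prl (prl y)" "prr (prl x) = prr (prl y)" "prl (prr x) = prl (prr y)" "prr (prr x) = prr (prr y)" for x y :: "'a vec"
    by (rule side_eqI; rule side_eqI; rule that)
  have inv: "\<sigma> (\<sigma> z) = z" for z by (rule eqI) (simp_all add: \<sigma>)
  have gr: "\<sigma> z \<in> grade ?L i \<longleftrightarrow> z \<in> grade (Theta \<phi> ?K) i" for z i
  proof -
    have "- x \<in> grade A j \<longleftrightarrow> x \<in> grade A j" for x j
      using vec.subspace_neg[OF fc_sub[OF A], of x j] vec.subspace_neg[OF fc_sub[OF A], of "- x" j] by auto
    then show ?thesis by (auto simp: cone_grade Theta_grade \<sigma>)
  qed
  have "\<exists>\<tau>. hequiv {0} (Theta \<phi> ?K) ?L \<sigma> \<tau>"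
  proof (rule hequiv_strict_ex[OF shifts_zero filtered_Theta[OF K \<phi>] L])
    show "linear_on (total (Theta \<phi> ?K)) \<sigma>"
      unfolding linear_on_def by (intro conjI ballI allI; rule eqI; simp add: \<sigma>)
    show "\<sigma> ` grade (Theta \<phi> ?K) i = grade ?L i" for i
    proof (intro equalityI subsetI)
      fix w assume "w \<in> grade ?L i"
      then have "\<sigma> (\<sigma> w) \<in> grade ?L i" by (simp add: inv)
      then have "\<sigma> w \<in> grade (Theta \<phi> ?K) i" by (simp add: gr)
      then have "\<sigma> (\<sigma> w) \<in> \<sigma> ` grade (Theta \<phi> ?K) i" by (rule imageI)
      then show "w \<in> \<sigma> ` grade (Theta \<phi> ?K) i" by (simp add: inv)
    qed (auto simp: gr)
    fix z assume "z \<in> total (Theta \<phi> ?K)"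
    then have z: "prl (prl z) \<in> total A" "prr (prl z) \<in> total B" "prl (prr z) \<in> total A" "prr (prr z) \<in> total B"
      using Theta_total[OF K \<phi>] cone_total[OF A B] by auto
    show "\<sigma> (bdry (Theta \<phi> ?K) z) = bdry ?L (\<sigma> z)"
      by (rule eqI) (simp_all add: \<sigma> Theta_bdry cone_bdry_sides z fc_bdry_neg[OF A] fc_bdry_neg[OF B]
        linear_on_neg[OF cm_lin[OF f]] algebra_simps)
    show "filt ?L (\<sigma> z) = filt (Theta \<phi> ?K) z"
      unfolding cone_filt Theta_filt \<sigma> fc_neg[OF A z(1)] raisingD(6)[OF \<phi>] by (simp add: max.assoc max.left_commute)
  qed
  then show ?thesis by blast
qed

text \<open>The object map of a functor on free abelian groups.\<close>

abbreviation fmap :: "('a \<Rightarrow> 'b) \<Rightarrow> ('a \<Rightarrow>\<^sub>0 int) \<Rightarrow> ('b \<Rightarrow>\<^sub>0 int)" where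
  "fmap F \<equiv> frag_extend (\<lambda>C. frag_of (F C))"

text \<open>As a functor compatible with homotopies and with cones, \<open>Theta \<phi>\<close>
  maps the exact triangles that generate the relations to exact triangles.\<close>

lemma Theta_relations:
  fixes x :: "'k::field fcomplex \<Rightarrow>\<^sub>0 int"
  assumes \<phi>: "raising \<phi>" and A: "\<And>C :: 'k fcomplex. C \<in> objs fin \<Longrightarrow> Theta \<phi> C \<in> Acyclics (objs fin)"
    and x: "x \<in> relations {0} (objs fin)"
  shows "fmap (Theta \<phi>) x \<in> relations {0} (Acyclics (objs fin))"
  using x
proof (induction rule: rel_induct)
  case (gen X Y Z u v w)
  note O = obj_classD(1)[OF obj_class_objs]
  note OA = obj_class_Acyclics[OF obj_class_objs, of fin]
  obtain X' Y' f a a' b b' c c' where t: "X \<in> objs fin" "Y \<in> objs fin" "Z \<in> objs fin" "X' \<in> objs fin" "Y' \<in> objs fin" "chain_map 0 X' Y' f"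
    and K: "filtered_complex (cone X' Y' f)"
    and h: "hequiv {0} X X' a a'" "hequiv {0} Y Y' b b'" "hequiv {0} Z (cone X' Y' f) c c'"
    by (rule exact_triangle_cone[OF obj_class_objs shifts_zero gen])
  note f = O[OF t(1)] O[OF t(2)] O[OF t(3)] O[OF t(4)] O[OF t(5)]
  note TX = filtered_Theta[OF f(4) \<phi>] and TY = filtered_Theta[OF f(5) \<phi>] and TZ = filtered_Theta[OF f(3) \<phi>]
  note cm = chain_map_dbl[OF f(4) \<phi> t(6)]
  obtain \<sigma> \<tau> where st: "hequiv {0} (Theta \<phi> (cone X' Y' f)) (cone (Theta \<phi> X') (Theta \<phi> Y') (dbl f)) \<sigma> \<tau>"
    using Theta_cone[OF f(4,5) \<phi> t(6)] by (elim exE)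
  have eq: "hequiv {0} (cone (Theta \<phi> X') (Theta \<phi> Y') (dbl f)) (Theta \<phi> Z) (dbl c' \<circ> \<tau>) (\<sigma> \<circ> dbl c)"
    by (rule hequiv_trans[OF shifts_zero filtered_cone[OF TX TY cm] filtered_Theta[OF K \<phi>] TZ hequiv_sym[OF st]
      hequiv_sym[OF Theta_hequiv[OF f(3) K \<phi> h(3)]]])
  have 1: "frag_of (Theta \<phi> X') - frag_of (Theta \<phi> Y') + frag_of (Theta \<phi> Z) \<in> relations {0} (Acyclics (objs fin))"
    by (rule rel_cone[OF shifts_zero TX TY TZ A[OF t(4)] A[OF t(5)] A[OF t(3)] cm eq])
  have 2: "frag_of (Theta \<phi> X) - frag_of (Theta \<phi> X') \<in> relations {0} (Acyclics (objs fin))"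
    by (rule rel_iso[OF OA shifts_zero A[OF t(1)] A[OF t(4)] Theta_hequiv[OF f(1,4) \<phi> h(1)]])
  have 3: "frag_of (Theta \<phi> Y) - frag_of (Theta \<phi> Y') \<in> relations {0} (Acyclics (objs fin))"
    by (rule rel_iso[OF OA shifts_zero A[OF t(2)] A[OF t(5)] Theta_hequiv[OF f(2,5) \<phi> h(2)]])
  from rel_diff[OF rel_add[OF 1 2] 3] show ?case
    by (rule rel_cong) (simp add: frag_extend_add frag_extend_diff)
qed (simp_all add: rel_0 rel_diff frag_extend_diff)

lemma rel_Theta:
  assumes Ob: "obj_class Ob" and \<phi>: "raising \<phi>" and X: "X \<in> Ob" "lev \<phi> X \<in> Ob" "Theta \<phi> X \<in> Ob"
  shows "frag_of X - frag_of (Theta \<phi> X) - frag_of (lev \<phi> X) \<in> relations {0} Ob"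
proof -
  note O = obj_classD(1)[OF Ob]
  have e: "hequiv {0} (cone (lev \<phi> X) X id) (Theta \<phi> X) id id"
    using hequiv_id[OF shifts_zero O[OF X(3)]] by (simp add: Theta_def)
  have "frag_of (lev \<phi> X) - frag_of X + frag_of (Theta \<phi> X) \<in> relations {0} Ob"
    by (rule rel_cone[OF shifts_zero O[OF X(2)] O[OF X(1)] O[OF X(3)] X(2,1,3) chain_map_lev_id[OF \<phi>] e])
  from rel_neg[OF this] show ?thesis by (rule rel_cong) simp
qed

lemma rel_contractible:
  assumes Ob: "obj_class Ob" and R: "shifts R" and X: "X \<in> Ob" and h: "contraction r X h" "r \<in> R"
  shows "frag_of X \<in> relations R Ob"
proof -
  note fX = obj_classD(1)[OF Ob X]
  have "heq R X X id (\<lambda>_. 0)" using h homotopic_contraction[of r X] unfolding heq_def by blast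
  then have 1: "heq R X X ((\<lambda>_. 0) \<circ> (\<lambda>_. 0)) id" using heq_sym[OF fX fX] by (simp add: comp_def)
  have 2: "heq R zeroC zeroC ((\<lambda>_. 0) \<circ> (\<lambda>_. 0)) id"
    by (rule heq_zeroI[OF R filtered_zeroC filtered_zeroC]) simp
  have "chain_map 0 X zeroC (\<lambda>_. 0)" "chain_map 0 zeroC X (\<lambda>_. 0)"
    by (rule chain_map_0I, simp_all, rule chain_map_0I)
      (simp_all add: fc_bdry_0[OF fX] fc_0[OF fX] vec.subspace_0[OF fc_sub[OF fX]])
  then have "hequiv R X zeroC (\<lambda>_. 0) (\<lambda>_. 0)"
    unfolding hequiv_def using 1 2 cmap_0[OF R] by blast
  then have "frag_of X - frag_of zeroC \<in> relations R Ob"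
    by (rule rel_iso[OF Ob R X obj_classD(2)[OF Ob]])
  from rel_add[OF this rel_zeroC[OF Ob R]] show ?thesis by (rule rel_cong) simp
qed

section \<open>The staircase and the Eilenberg swindle\<close>

(* keeps the basis vector ev 0 in the form that the rules about ev match *)
declare single_one [simp del]

definition plus1 :: "ereal \<Rightarrow> ereal" where
  "plus1 s = s + 1"

lemma raising_plus1: "raising plus1"
proof -
  have le: "s \<le> s + 1" for s :: ereal by (cases s) auto
  have "mono plus1" unfolding plus1_def by (intro monoI add_right_mono)
  moreover have "s + ereal r + 1 = s + 1 + ereal r" for s r by (simp only: add.assoc add.commute[of "ereal r" 1])
  ultimately show ?thesis unfolding raising_def plus1_def using le by simp
qed

text \<open>If \<open>q\<close> denotes the operation of raising levels by one, tensoring with the staircase is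
  multiplication by the geometric series \<open>1 + q + q\<^sup>2 + \<dots>\<close>, and so the inverse of the operation
  \<open>1 - q\<close> which \<open>Theta plus1\<close> induces.\<close>

definition stair :: "'k::field fcomplex" where
  "stair = Std0 UNIV real"

lemma stair_Ct: "stair \<in> Ct"
proof -
  have "finite {n. real n \<le> r}" for r
    by (rule finite_subset[of _ "{..nat \<lfloor>r\<rfloor>}"]) (auto simp: le_nat_floor)
  then have "adm False UNIV real" by (simp add: adm_def)
  from Std_objs[OF this] show ?thesis by (simp add: stair_def objs_def)
qed

lemma based_stair: "based stair (range ev) (\<lambda>_. 0) (\<lambda>b. real (idx b))"
  unfolding stair_def using based_Std[of UNIV real "\<lambda>_. 0"] by simp

definition col0 :: "'k::field vec \<Rightarrow> 'k vec" where
  "col0 z = Poly_Mapping.map_key (\<lambda>m. prod_encode (m, 0)) z"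

lemma lookup_col0: "Poly_Mapping.lookup (col0 z) m = Poly_Mapping.lookup z (prod_encode (m, 0))"
  unfolding col0_def by (subst map_key.rep_eq) (auto intro: injI)

lemma linear_col0: "Vector_Spaces.linear vscale vscale col0"
  by (auto simp: Vector_Spaces.linear_iff vec.vector_space_axioms lookup_col0 lookup_add intro!: poly_mapping_eqI)

lemma col0_tens: "col0 (tens x (ev n)) = (if n = 0 then x else 0)"
  by (auto intro!: poly_mapping_eqI simp: lookup_col0 lookup_tens lookup_single)

lemma tens_ev: "tens (ev m) (ev n) = ev (prod_encode (m, n))"
proof (rule poly_mapping_eqI)
  fix k
  have "prod_encode (m, n) = k \<longleftrightarrow> m = fst (prod_decode k) \<and> n = snd (prod_decode k)"
    by (metis fst_conv prod.collapse prod_decode_inverse prod_encode_inverse snd_conv)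
  then show "Poly_Mapping.lookup (tens (ev m) (ev n)) k = Poly_Mapping.lookup (ev (prod_encode (m, n))) k"
    by (auto simp: lookup_tens lookup_single when_def)
qed

lemma linear_eq_ev:
  assumes f: "Vector_Spaces.linear vscale vscale f" and g: "Vector_Spaces.linear vscale vscale g"
    and eq: "\<And>m n. f (tens (ev m) (ev n)) = (g (tens (ev m) (ev n)) :: 'k::field vec)"
  shows "f z = g z"
proof (rule linear_on_eq_span[of "range ev" f g])
  show "linear_on (vec.span (range ev)) f" "linear_on (vec.span (range ev)) g"
    by (rule linear_imp_linear_on[OF f], rule linear_imp_linear_on[OF g])
  show "z \<in> vec.span (range ev)" by (simp add: span_ev)
  fix x :: "'k vec" assume "x \<in> range ev"
  then obtain k where "x = ev k" by blast
  then have "x = tens (ev (fst (prod_decode k))) (ev (snd (prod_decode k)))" by (simp add: tens_ev)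
  then show "f x = g x" using eq by simp
qed

lemma linear_comp2:
  "Vector_Spaces.linear vscale vscale f \<Longrightarrow> Vector_Spaces.linear vscale vscale g \<Longrightarrow> Vector_Spaces.linear vscale vscale (\<lambda>x. g (f x))"
  using Vector_Spaces.linear_compose[of vscale vscale f vscale g] by (simp add: comp_def)

lemma linear_plus2:
  "Vector_Spaces.linear vscale vscale f \<Longrightarrow> Vector_Spaces.linear vscale vscale g \<Longrightarrow> Vector_Spaces.linear vscale vscale (\<lambda>x. f x + g x)"
  by (rule vp.linear_compose_add)

lemma linear_zero2: "Vector_Spaces.linear vscale vscale (\<lambda>_. 0)"
  by (rule vp.linear_zero)

text \<open>The column of the basis vector \<open>ev 0\<close> in the tensor square of the ambient space is split off by
  \<open>col0\<close>, and the remaining columns are moved onto all columns by \<open>dn\<close>, with inverse \<open>up\<close>.\<close>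

lemma step_shifts:
  obtains up dn :: "'k::field vec \<Rightarrow> 'k vec" where
    "Vector_Spaces.linear vscale vscale up" "Vector_Spaces.linear vscale vscale dn"
    "\<forall>x n. up (tens x (ev n)) = tens x (ev (Suc n))"
    "\<forall>x n. dn (tens x (ev n)) = (if n = 0 then 0 else tens x (ev (n - 1)))"
    "\<forall>z. z = tens (col0 z) (ev 0) + up (dn z)" "\<forall>z. col0 (up z) = 0" "\<forall>z. dn (up z) = z"
proof -
  obtain up where up: "Vector_Spaces.linear vscale vscale up"
    "\<forall>k. up (ev k) = (ev (prod_encode (fst (prod_decode k), Suc (snd (prod_decode k)))) :: 'k vec)"
    by (rule linear_from_ev[of "\<lambda>k. ev (prod_encode (fst (prod_decode k), Suc (snd (prod_decode k))))"])
  obtain dn where dn: "Vector_Spaces.linear vscale vscale dn"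
    "\<forall>k. dn (ev k) = (if snd (prod_decode k) = 0 then 0 else ev (prod_encode (fst (prod_decode k), snd (prod_decode k) - 1)) :: 'k vec)"
    by (rule linear_from_ev[of "\<lambda>k. if snd (prod_decode k) = 0 then 0 else ev (prod_encode (fst (prod_decode k), snd (prod_decode k) - 1))"])
  have ext: "f x = g x" if "Vector_Spaces.linear vscale vscale f" "Vector_Spaces.linear vscale vscale g" "\<And>m. f (ev m) = g (ev m)"
    for f g :: "'k vec \<Rightarrow> 'k vec" and x
    by (rule linear_on_eq_span[of "range ev" f g]) (use that in \<open>auto simp: span_ev intro: linear_imp_linear_on\<close>)
  have upt: "up (tens x (ev n)) = tens x (ev (Suc n))" for x n
    by (rule ext[OF linear_comp2[OF linear_tens(1) up(1)] linear_tens(1)]) (simp add: tens_ev up(2))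
  have dnt: "dn (tens x (ev n)) = (if n = 0 then 0 else tens x (ev (n - 1)))" for x n
  proof (cases "n = 0")
    case True
    have "dn (tens x (ev n)) = 0"
      by (rule ext[OF linear_comp2[OF linear_tens(1) dn(1)] linear_zero2]) (simp add: tens_ev dn(2) True)
    then show ?thesis using True by simp
  next
    case False
    have "dn (tens x (ev n)) = tens x (ev (n - 1))"
      by (rule ext[OF linear_comp2[OF linear_tens(1) dn(1)] linear_tens(1)]) (simp add: tens_ev dn(2) False)
    then show ?thesis using False by simp
  qed
  have "z = tens (col0 z) (ev 0) + up (dn z)" for z
    by (rule linear_eq_ev[of "\<lambda>z. z", OF vec.linear_ident linear_plus2[OF linear_comp2[OF linear_col0 linear_tens(1)] linear_comp2[OF dn(1) up(1)]]])
      (simp add: col0_tens dnt upt vp.linear_0[OF up(1)] tens_simps)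
  moreover have "col0 (up z) = 0" for z
    by (rule linear_eq_ev[OF linear_comp2[OF up(1) linear_col0] linear_zero2]) (simp add: upt col0_tens)
  moreover have "dn (up z) = z" for z
    by (rule linear_eq_ev[OF linear_comp2[OF up(1) dn(1)] vec.linear_ident]) (simp add: upt dnt)
  ultimately show thesis using that[OF up(1) dn(1)] upt dnt by blast
qed

text \<open>The bottom step of \<open>X \<otimes> stair\<close> is \<open>X\<close> and the other steps are \<open>X \<otimes> stair\<close> raised by one.\<close>

lemma rel_stair:
  assumes Ob: "obj_class Ob" "Ob \<subseteq> Ct" and X: "X \<in> Ob" "tensor X stair \<in> Ob" "lev plus1 (tensor X stair) \<in> Ob"
  shows "frag_of (tensor X stair) - frag_of X - frag_of (lev plus1 (tensor X stair :: 'k::field fcomplex)) \<in> relations {0} Ob"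
proof -
  have XCt: "X \<in> Ct" using Ob(2) X(1) by blast
  obtain B dg lv where B: "based X B dg lv" by (rule based_exists[OF XCt])
  interpret T: tensor_factors X stair B "range ev" dg "\<lambda>_. 0" lv "\<lambda>b. real (idx b)"
    by unfold_locales (rule XCt stair_Ct B based_stair)+
  let ?T = "tensor X stair"
  note fX = CtD(1)[OF XCt] and fT = T.filtered_tensor
  obtain up dn :: "'k vec \<Rightarrow> 'k vec" where lu: "Vector_Spaces.linear vscale vscale up" and ld: "Vector_Spaces.linear vscale vscale dn"
    and upt: "\<forall>x n. up (tens x (ev n)) = tens x (ev (Suc n))"
    and dnt: "\<forall>x n. dn (tens x (ev n)) = (if n = 0 then 0 else tens x (ev (n - 1)))"
    and dec: "\<forall>z. z = tens (col0 z) (ev 0) + up (dn z)" and c0: "\<forall>z. col0 (up z) = 0" and du: "\<forall>z. dn (up z) = z"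
    by (rule step_shifts)
  have TB: "tens b (ev n) \<in> T.TB" "T.tdg (tens b (ev n)) = dg b" "T.tlv (tens b (ev n)) = lv b + real n" if "b \<in> B" for b n
    using that tens_mem[of b B "ev n" "range ev"] by (simp_all add: T.TB_def T.tdg_def T.tlv_def)
  have TBE: "\<exists>b\<in>B. \<exists>n. t = tens b (ev n) \<and> T.tdg t = dg b \<and> T.tlv t = lv b + real n" if t: "t \<in> T.TB" for t
  proof -
    obtain b e where "b \<in> B" "e \<in> range ev" "t = tens b e" using t by (rule T.TB_E)
    then obtain n where "b \<in> B" "t = tens b (ev n)" by blast
    then show ?thesis using TB by blast
  qed
  have ev0: "ev n \<in> grade stair 0" for n unfolding basedD(2)[OF based_stair] by (rule vec.span_base) simp
  have evt: "ev n \<in> total stair" for n by (rule grade_total[OF ev0])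
  have bev: "bdry stair x = 0" for x by (simp add: stair_def Std_sel)
  have bd: "bdry ?T (tens x (ev n)) = tens (bdry X x) (ev n)" if x: "x \<in> total X" for x n
  proof (rule linear_on_eq_span[of B "\<lambda>x. bdry ?T (tens x (ev n))" "\<lambda>x. tens (bdry X x) (ev n)"])
    show "linear_on (vec.span B) (\<lambda>x. bdry ?T (tens x (ev n)))"
      by (rule linear_on_comp[OF linear_imp_linear_on[OF linear_tens(1)] _ T.lin_bdry_tensor])
        (use T.tens_total[OF _ evt] based_total[OF B] in auto)
    show "linear_on (vec.span B) (\<lambda>x. tens (bdry X x) (ev n))"
      by (rule linear_on_comp[OF _ subset_UNIV linear_imp_linear_on[OF linear_tens(1)]]) (use fc_lin[OF fX] based_total[OF B] in simp)
    show "x \<in> vec.span B" using x based_total[OF B] by simp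
    fix b assume b: "b \<in> B"
    have "b \<in> grade X (dg b)" unfolding basedD(2)[OF B] by (rule vec.span_base) (use b in simp)
    from T.bdry_tensor(2)[OF this evt[of n]] show "bdry ?T (tens b (ev n)) = tens (bdry X b) (ev n)"
      by (simp add: bev tens_simps)
  qed
  have upg: "up z \<in> grade ?T i" if "z \<in> grade ?T i" for z i
    unfolding T.grade_tensor
  proof (rule linear_on_span_into[OF linear_imp_linear_on[OF lu, of UNIV] subset_UNIV _ vec.subspace_span vec.subspace_UNIV that[unfolded T.grade_tensor]])
    fix t assume t: "t \<in> {t \<in> T.TB. T.tdg t = i}"
    then obtain b n where "b \<in> B" "t = tens b (ev n)" "dg b = i" using TBE[of t] by auto
    then show "up t \<in> vec.span {t \<in> T.TB. T.tdg t = i}"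
      using TB[of b "Suc n"] upt by (intro vec.span_base) simp
  qed
  have dng: "dn z \<in> grade ?T i" if "z \<in> grade ?T i" for z i
    unfolding T.grade_tensor
  proof (rule linear_on_span_into[OF linear_imp_linear_on[OF ld, of UNIV] subset_UNIV _ vec.subspace_span vec.subspace_UNIV that[unfolded T.grade_tensor]])
    fix t assume t: "t \<in> {t \<in> T.TB. T.tdg t = i}"
    then obtain b n where bn: "b \<in> B" "t = tens b (ev n)" "dg b = i" using TBE[of t] by auto
    show "dn t \<in> vec.span {t \<in> T.TB. T.tdg t = i}"
    proof (cases "n = 0")
      case True
      then show ?thesis using dnt bn vec.span_zero by simp
    next
      case False
      then have "dn t = tens b (ev (n - 1))" using dnt bn by simp
      then show ?thesis using TB[OF bn(1), of "n - 1"] bn(3) by (intro vec.span_base) simp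
    qed
  qed
  have colg: "col0 z \<in> grade X i" if "z \<in> grade ?T i" for z i
  proof (rule linear_on_span_into[OF linear_imp_linear_on[OF linear_col0, of UNIV] subset_UNIV _ fc_sub[OF fX] vec.subspace_UNIV that[unfolded T.grade_tensor]])
    fix t assume t: "t \<in> {t \<in> T.TB. T.tdg t = i}"
    then obtain b n where bn: "b \<in> B" "t = tens b (ev n)" "dg b = i" using TBE[of t] by auto
    have "b \<in> grade X i" unfolding basedD(2)[OF B] by (rule vec.span_base) (use bn in simp)
    then show "col0 t \<in> grade X i" using bn(2) col0_tens[of b n] vec.subspace_0[OF fc_sub[OF fX]] by simp
  qed
  have upt_total: "up z \<in> total ?T" if "z \<in> total ?T" for z
    by (rule linear_total_total[OF linear_imp_linear_on[OF lu] upg that])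
  have upl: "up z \<in> vec.span {t \<in> T.TB. T.tlv t \<le> r}" if "z \<in> vec.span {t \<in> T.TB. T.tlv t \<le> r - 1}" for z r
  proof (rule linear_on_span_into[OF linear_imp_linear_on[OF lu, of UNIV] subset_UNIV _ vec.subspace_span vec.subspace_UNIV that])
    fix t assume t: "t \<in> {t \<in> T.TB. T.tlv t \<le> r - 1}"
    then obtain b n where "b \<in> B" "t = tens b (ev n)" "lv b + real n \<le> r - 1" using TBE[of t] by auto
    then show "up t \<in> vec.span {t \<in> T.TB. T.tlv t \<le> r}"
      using TB[of b "Suc n"] upt by (intro vec.span_base) simp
  qed
  have dnl: "dn z \<in> vec.span {t \<in> T.TB. T.tlv t \<le> r - 1}" if "z \<in> vec.span {t \<in> T.TB. T.tlv t \<le> r}" for z r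
  proof (rule linear_on_span_into[OF linear_imp_linear_on[OF ld, of UNIV] subset_UNIV _ vec.subspace_span vec.subspace_UNIV that])
    fix t assume t: "t \<in> {t \<in> T.TB. T.tlv t \<le> r}"
    then obtain b n where bn: "b \<in> B" "t = tens b (ev n)" "lv b + real n \<le> r" using TBE[of t] by auto
    show "dn t \<in> vec.span {t \<in> T.TB. T.tlv t \<le> r - 1}"
    proof (cases n)
      case 0
      then show ?thesis using dnt bn vec.span_zero by simp
    next
      case (Suc m)
      then have "dn t = tens b (ev m)" using dnt bn by simp
      then show ?thesis using TB[OF bn(1), of m] bn(3) Suc by (intro vec.span_base) simp
    qed
  qed
  have coll: "col0 z \<in> vec.span {b \<in> B. lv b \<le> r}" if "z \<in> vec.span {t \<in> T.TB. T.tlv t \<le> r}" for z r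
  proof (rule linear_on_span_into[OF linear_imp_linear_on[OF linear_col0, of UNIV] subset_UNIV _ vec.subspace_span vec.subspace_UNIV that])
    fix t assume t: "t \<in> {t \<in> T.TB. T.tlv t \<le> r}"
    then obtain b n where bn: "b \<in> B" "t = tens b (ev n)" "lv b + real n \<le> r" using TBE[of t] by auto
    then have "b \<in> vec.span {b \<in> B. lv b \<le> r}" by (intro vec.span_base) simp
    then show "col0 t \<in> vec.span {b \<in> B. lv b \<le> r}" using bn(2) col0_tens[of b n] by (simp add: vec.span_zero)
  qed
  have fev: "filt stair (ev 0 :: 'k vec) \<le> ereal 0" using T.filt_basis(2)[of "ev 0"] by simp
  have p1: "plus1 s \<le> ereal r \<longleftrightarrow> s \<le> ereal (r - 1)" for s r unfolding plus1_def by (cases s) auto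
  show ?thesis
  proof (rule rel_exact[OF Ob(1) shifts_zero X(1,3,2), where \<alpha> = "\<lambda>x. tens x (ev 0)" and \<beta> = up and \<theta> = "\<lambda>_. 0"])
    show "linear_on (total X) (\<lambda>x. tens x (ev 0))" "linear_on (total (lev plus1 ?T)) up"
      by (rule linear_imp_linear_on[OF linear_tens(1)], rule linear_imp_linear_on[OF lu])
    show "tens x (ev 0) \<in> grade ?T i" if "x \<in> grade X i" for i x using T.tens_grade[OF that ev0] by simp
    show "up x \<in> grade ?T i" if "x \<in> grade (lev plus1 ?T) i" for i x using upg that by simp
    show "0 \<in> grade X (i - 1)" for i by (rule vec.subspace_0[OF fc_sub[OF fX]])
    show "bdry ?T (tens x (ev 0)) = tens (bdry X x) (ev 0)" if "x \<in> total X" for x by (rule bd[OF that])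
    show "bdry ?T (up x) = up (bdry (lev plus1 ?T) x) + tens 0 (ev 0)" if "x \<in> total (lev plus1 ?T)" for x
    proof -
      have "bdry ?T (up x) = up (bdry ?T x)"
      proof (rule linear_on_eq_span[of T.TB "\<lambda>x. bdry ?T (up x)" "\<lambda>x. up (bdry ?T x)"])
        show "linear_on (vec.span T.TB) (\<lambda>x. bdry ?T (up x))"
          by (rule linear_on_comp[OF linear_imp_linear_on[OF lu] _ T.lin_bdry_tensor]) (use upt_total T.total_tensor in auto)
        show "linear_on (vec.span T.TB) (\<lambda>x. up (bdry ?T x))"
          by (rule linear_on_comp[OF _ subset_UNIV linear_imp_linear_on[OF lu]]) (use T.lin_bdry_tensor T.total_tensor in simp)
        show "x \<in> vec.span T.TB" using that T.total_tensor by simp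
        fix t assume "t \<in> T.TB"
        then obtain b n where bn: "b \<in> B" "t = tens b (ev n)" using TBE by blast
        have "b \<in> total X" using T.Bt(1) bn(1) by blast
        then show "bdry ?T (up t) = up (bdry ?T t)" using bd bn(2) upt by simp
      qed
      then show ?thesis by (simp add: tens_simps)
    qed
    show "filt ?T (tens x (ev 0) + up y) = max (filt X x) (filt (lev plus1 ?T) y)"
      if x: "x \<in> total X" and "y \<in> total (lev plus1 ?T)" for x y
    proof (rule ereal_eq_levels)
      fix r
      have y: "y \<in> total ?T" using that by simp
      let ?w = "tens x (ev 0) + up y"
      have w: "?w \<in> total ?T" by (rule total_add[OF T.tens_total[OF x evt] upt_total[OF y]])
      have cw: "col0 ?w = x" "dn ?w = y"
        using c0 du dnt by (simp_all add: vp.linear_add[OF linear_col0] vp.linear_add[OF ld] col0_tens)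
      have "?w \<in> vec.span {t \<in> T.TB. T.tlv t \<le> r} \<longleftrightarrow> x \<in> vec.span {b \<in> B. lv b \<le> r} \<and> y \<in> vec.span {t \<in> T.TB. T.tlv t \<le> r - 1}"
      proof
        assume "?w \<in> vec.span {t \<in> T.TB. T.tlv t \<le> r}"
        from coll[OF this] dnl[OF this] show "x \<in> vec.span {b \<in> B. lv b \<le> r} \<and> y \<in> vec.span {t \<in> T.TB. T.tlv t \<le> r - 1}"
          unfolding cw by blast
      next
        assume h: "x \<in> vec.span {b \<in> B. lv b \<le> r} \<and> y \<in> vec.span {t \<in> T.TB. T.tlv t \<le> r - 1}"
        then have "filt X x \<le> ereal r" using basedD(3)[OF B x] by blast
        then have "tens x (ev 0) \<in> vec.span {t \<in> T.TB. T.tlv t \<le> r}" by (rule T.tens_level[OF x evt _ fev]) simp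
        then show "?w \<in> vec.span {t \<in> T.TB. T.tlv t \<le> r}" using upl h by (intro vec.span_add) blast+
      qed
      then show "filt ?T ?w \<le> ereal r \<longleftrightarrow> max (filt X x) (filt (lev plus1 ?T) y) \<le> ereal r"
        unfolding T.filt_tensor[OF w] lev_sel max.bounded_iff p1 basedD(3)[OF B x] T.filt_tensor[OF y] .
    qed
    show "\<exists>x\<in>grade X i. \<exists>y\<in>grade (lev plus1 ?T) i. z = tens x (ev 0) + up y" if z: "z \<in> grade ?T i" for i z
      using dec colg[OF z] dng[OF z] by (intro bexI[of _ "col0 z"] bexI[of _ "dn z"]) simp_all
  qed simp_all
qed

text \<open>The two relations for \<open>X \<otimes> stair\<close>, whose raised terms
  cancel.\<close>

lemma rel_Theta_stair:
  assumes Ob: "obj_class Ob" "Ob \<subseteq> Ct"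
    and X: "X \<in> Ob" "tensor X stair \<in> Ob" "lev plus1 (tensor X stair) \<in> Ob" "Theta plus1 (tensor X stair) \<in> Ob"
  shows "frag_of X - frag_of (Theta plus1 (tensor X stair)) \<in> relations {0} Ob"
  by (rule rel_cong[OF rel_diff[OF rel_Theta[OF Ob(1) raising_plus1 X(2-4)] rel_stair[OF Ob X(1-3)]]]) simp

lemma Theta_plus1_Acyclics: "C \<in> objs fin \<Longrightarrow> Theta plus1 C \<in> Acyclics (objs fin)"
  by (rule Theta_Acyclics[OF _ raising_plus1, of _ _ 1]) (simp_all add: plus1_def one_ereal_def)

section \<open>Collapsing the levels of finitely generated complexes\<close>

text \<open>All levels below \<open>M\<close> are moved up to \<open>M\<close>; the zero vector
  has to keep level \<open>-\<infinity>\<close>.\<close>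

definition collapse :: "real \<Rightarrow> ereal \<Rightarrow> ereal" where
  "collapse M s = (if s = -\<infinity> then -\<infinity> else max s (ereal M))"

lemma raising_collapse: "raising (collapse M)"
proof -
  have "mono (collapse M)" by (auto simp: mono_def collapse_def max_def)
  moreover have "collapse M (s + ereal r) \<le> collapse M s + ereal r" if "0 \<le> r" for s r
    using that by (cases s) (auto simp: collapse_def max_def)
  moreover have "s \<le> collapse M s" for s by (simp add: collapse_def)
  moreover have "collapse M (ereal s) \<noteq> \<infinity>" for s by (simp add: collapse_def max_def)
  ultimately show ?thesis by (simp add: raising_def collapse_def)
qed

text \<open>The levels of a tame complex are bounded below by some \<open>r0\<close>, so moving
  up to \<open>M\<close> costs at most \<open>M - r0\<close>.\<close>

lemma Theta_collapse_Acyclics: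
  assumes C: "C \<in> objs fin" shows "Theta (collapse M) C \<in> Acyclics (objs fin)"
proof -
  note Ct = objs_Ct[OF C] note fC = CtD(1)[OF Ct]
  obtain r0 where r0: "\<forall>r\<le>r0. sublevel C r = {0}" using CtD(3)[OF Ct] by (rule exE)
  show ?thesis
  proof (rule Theta_Acyclics[OF C raising_collapse, of "max 0 (M - r0)"])
    fix x assume x: "x \<in> total C"
    show "collapse M (filt C x) \<le> filt C x + ereal (max 0 (M - r0))"
    proof (cases "filt C x")
      case (real s)
      have "r0 \<le> s"
      proof (rule ccontr)
        assume "\<not> r0 \<le> s"
        then have "x \<in> sublevel C r0" using x real by (simp add: sublevel_def)
        then have "x = 0" using r0 by simp
        then show False using real fc_0[OF fC] by simp
      qed
      then show ?thesis using real by (auto simp: collapse_def max_def)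
    qed (simp_all add: collapse_def)
  qed simp
qed

lemma finite_upper_bound:
  assumes "finite S" "\<And>a. a \<in> S \<Longrightarrow> \<exists>m::real. \<forall>m'\<ge>m. Q a m'"
  shows "\<exists>m. \<forall>a\<in>S. Q a m"
proof -
  have "\<exists>f. \<forall>a\<in>S. \<forall>m'\<ge>f a. Q a m'" by (rule bchoice) (use assms(2) in blast)
  then obtain f where f: "\<forall>a\<in>S. \<forall>m'\<ge>f a. Q a m'" by (rule exE)
  have "f a \<le> Max (insert 0 (f ` S))" if "a \<in> S" for a using assms(1) that by (intro Max_ge) auto
  then show ?thesis using f by blast
qed

lemma top_level:
  assumes C: "C \<in> Cfg" shows "\<exists>m. \<forall>m'\<ge>m. \<forall>x\<in>total C. filt C x \<le> ereal m'"
proof -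
  have Ct: "C \<in> Ct" using C Cfg_subset_Ct by blast
  obtain B dg lv where B: "based C B dg lv" by (rule based_exists[OF Ct])
  have fin: "finite B" by (rule based_finite_Cfg[OF C B])
  have "filt C x \<le> ereal m'" if "Max (insert 0 (lv ` B)) \<le> m'" "x \<in> total C" for m' x
  proof -
    have "lv b \<le> m'" if "b \<in> B" for b
      using Max_ge[of "insert 0 (lv ` B)" "lv b"] fin that \<open>Max _ \<le> m'\<close> by simp
    then have "{b \<in> B. lv b \<le> m'} = B" by blast
    then show ?thesis using basedD(3)[OF B that(2), of m'] that(2) based_total[OF B] by simp
  qed
  then show ?thesis by blast
qed

lemma common_top_level:
  assumes "Poly_Mapping.keys x \<subseteq> Cfg"
  obtains M where "\<forall>C\<in>Poly_Mapping.keys x. \<forall>z\<in>total C. filt C z \<le> ereal M"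
  using finite_upper_bound[of "Poly_Mapping.keys x" "\<lambda>C M. \<forall>z\<in>total C. filt C z \<le> ereal M"] top_level assms that
  by (metis finite_keys subsetD)

text \<open>Above its top level, an acyclic complex collapses to a contractible one.\<close>

lemma contraction_collapse:
  assumes C: "filtered_complex C" and h: "contraction r C h" and M: "\<forall>z\<in>total C. filt C z \<le> ereal M"
  shows "contraction 0 (lev (collapse M) C) h"
proof -
  have h1: "linear_on (total C) h" "\<forall>i. \<forall>x\<in>grade C i. h x \<in> grade C (i + 1)" using h by (auto simp: contraction_def)
  have "collapse M (filt C (h x)) \<le> collapse M (filt C x)" if x: "x \<in> total C" for x
  proof (cases "x = 0")
    case True
    then show ?thesis using linear_on_0[OF h1(1) total_0] by simp
  next
    case False
    have "filt C (h x) \<le> ereal M" using M homotopic_mapsto[OF h1 x] by blast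
    moreover have "filt C x \<noteq> -\<infinity>" using False fc_minf[OF C x] by simp
    ultimately show ?thesis by (simp add: collapse_def le_max_iff_disj)
  qed
  then show ?thesis using h by (simp add: contraction_def)
qed

text \<open>All levels become \<open>M\<close>, so only the total Euler characteristic is left
  of the invariant.\<close>

lemma Phi_collapse:
  assumes C: "filtered_complex C" and M: "\<forall>z\<in>total C. filt C z \<le> ereal M"
  shows "Phi (lev (collapse M) C) (ereal r) = (if M \<le> r then euler C else 0)"
proof (cases "M \<le> r")
  case True
  have "collapse M (filt C x) \<le> ereal r" if "x \<in> grade C i" for x i
  proof -
    have "filt C x \<le> ereal M" using M grade_total[OF that] by blast
    then have "filt C x \<le> ereal r" using order_trans[of "filt C x" "ereal M" "ereal r"] True by simp
    then show ?thesis using True by (simp add: collapse_def)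
  qed
  then have "slice (lev (collapse M) C) (ereal r) = grade C" by (auto simp: slice_def fun_eq_iff)
  then show ?thesis using True by (simp add: Phi_def euler_gchi)
next
  case False
  have "slice (lev (collapse M) C) (ereal r) i = {0}" for i
  proof (intro equalityI subsetI)
    fix x assume "x \<in> slice (lev (collapse M) C) (ereal r) i"
    then have x: "x \<in> grade C i" "collapse M (filt C x) \<le> ereal r" by (auto simp: slice_def)
    then have "filt C x = -\<infinity>" using False by (auto simp: collapse_def split: if_splits)
    then show "x \<in> {0}" using fc_minf[OF C grade_total[OF x(1)]] by simp
  next
    fix x :: "'a vec" assume "x \<in> {0}"
    then show "x \<in> slice (lev (collapse M) C) (ereal r) i"
      using vec.subspace_0[OF fc_sub[OF C]] fc_0[OF C] by (simp add: slice_def collapse_def)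
  qed
  then show ?thesis using False by (simp add: Phi_def gchi_def)
qed

section \<open>Comparison of the Grothendieck groups\<close>

lemma exact_triangles_mono:
  assumes "Ob \<subseteq> Ob'" "(A, B, C, u, v, w) \<in> exact_triangles R Ob"
  shows "(A, B, C, u, v, w) \<in> exact_triangles R Ob'"
proof -
  obtain A' B' f where "A \<in> Ob" "B \<in> Ob" "C \<in> Ob" "u \<in> Hom R A B" "v \<in> Hom R B C" "w \<in> Hom R C (shift A)"
    "A' \<in> Ob" "B' \<in> Ob" "chain_map 0 A' B' f" "triangle_iso R (A, B, C, u, v, w) (cone_triangle R A' B' f)"
    using assms(2) unfolding exact_triangles_def by blast
  then show ?thesis unfolding exact_triangles_def using subsetD[OF assms(1)] by blast
qed

lemma relations_mono:
  assumes "Ob \<subseteq> Ob'" "x \<in> relations R Ob" shows "x \<in> relations R Ob'"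
  using assms(2)
proof (induction rule: rel_induct)
  case (gen A B C u v w)
  show ?case by (rule rel_gen[OF exact_triangles_mono[OF assms(1) gen]])
qed (simp_all add: rel_0 rel_diff)

lemma fmap_keys: "(\<And>C. C \<in> Poly_Mapping.keys x \<Longrightarrow> F C \<in> S) \<Longrightarrow> Poly_Mapping.keys (fmap F x) \<subseteq> S"
  using keys_frag_extend[of "\<lambda>C. frag_of (F C)" x] by fastforce

lemma rel_fmap:
  assumes "\<And>C. C \<in> Poly_Mapping.keys x \<Longrightarrow> frag_of C - g C \<in> relations R Ob"
  shows "x - frag_extend g x \<in> relations R Ob"
proof -
  have "Poly_Mapping.keys x \<subseteq> Poly_Mapping.keys x" by simp
  then show ?thesis
  proof (induction x rule: frag_induction)
    case (diff a b)
    from rel_diff[OF diff] show ?case by (rule rel_cong) (simp add: frag_extend_diff)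
  qed (simp_all add: rel_0 assms)
qed

lemma rel_fmap_zero:
  assumes "\<And>C. C \<in> Poly_Mapping.keys x \<Longrightarrow> g C \<in> relations R Ob"
  shows "frag_extend g x \<in> relations R Ob"
proof -
  have "Poly_Mapping.keys x \<subseteq> Poly_Mapping.keys x" by simp
  then show ?thesis
    by (induction x rule: frag_induction) (simp_all add: rel_0 assms rel_diff frag_extend_diff)
qed

lemma obj_class_A: "obj_class (Acyclics (objs fin))"
  by (rule obj_class_Acyclics[OF obj_class_objs])

lemma tame_decompose:
  assumes Ob: "obj_class Ob" "Ob \<subseteq> Ct" and cl: "\<And>X. X \<in> Ob \<Longrightarrow> tensor X stair \<in> Ob" "\<And>X. X \<in> Ob \<Longrightarrow> lev plus1 X \<in> Ob"
    "\<And>X. X \<in> Ob \<Longrightarrow> Theta plus1 X \<in> Ob" and x: "Poly_Mapping.keys x \<subseteq> Ob"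
  shows "x - fmap (Theta plus1) (fmap (\<lambda>X. tensor X stair) x) \<in> relations {0} Ob"
proof -
  have "fmap (Theta plus1) (fmap (\<lambda>X. tensor X stair) x) = fmap (\<lambda>X. Theta plus1 (tensor X stair)) x"
    using frag_extend_compose[of "\<lambda>C. frag_of (Theta plus1 C)" "\<lambda>X. tensor X stair" x] by (simp add: comp_def)
  moreover have "frag_of X - frag_of (Theta plus1 (tensor X stair)) \<in> relations {0} Ob" if "X \<in> Poly_Mapping.keys x" for X
  proof -
    have X: "X \<in> Ob" using x that by (rule subsetD)
    show ?thesis by (rule rel_Theta_stair[OF Ob X cl(1)[OF X] cl(2)[OF cl(1)[OF X]] cl(3)[OF cl(1)[OF X]]])
  qed
  then have "x - fmap (\<lambda>X. Theta plus1 (tensor X stair)) x \<in> relations {0} Ob" by (rule rel_fmap)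
  ultimately show ?thesis by simp
qed

lemma Acyclics_Ct: "Acyclics Ct \<subseteq> Ct"
  by (rule Acyclics_sub)

text \<open>Injectivity: a relation between acyclic objects that holds among all objects is mapped by
  \<open>Theta\<close> to a relation among acyclic objects, and \<open>Theta\<close> differs from the identity by a class
  that vanishes (finitely generated case) or that the swindle absorbs (tame case).\<close>

lemma relations_Acyclics:
  fixes x :: "'k::field fcomplex \<Rightarrow>\<^sub>0 int"
  assumes x: "Poly_Mapping.keys x \<subseteq> Acyclics (objs fin)" and rel: "x \<in> relations {0} (objs fin)"
  shows "x \<in> relations {0} (Acyclics (objs fin))"
proof -
  let ?A = "Acyclics (objs fin) :: 'k fcomplex set"
  have xo: "Poly_Mapping.keys x \<subseteq> objs fin" using x Acyclics_sub by blast
  show ?thesis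
  proof (cases fin)
    case True
    then have xf: "Poly_Mapping.keys x \<subseteq> Cfg" using xo by (simp add: objs_def)
    obtain M where M: "\<forall>C\<in>Poly_Mapping.keys x. \<forall>z\<in>total C. filt C z \<le> ereal M"
      by (rule common_top_level[OF xf])
    have 1: "frag_of C - frag_of (Theta (collapse M) C) - frag_of (lev (collapse M) C) \<in> relations {0} ?A"
      and 2: "frag_of (lev (collapse M) C) \<in> relations {0} ?A" if C: "C \<in> Poly_Mapping.keys x" for C
    proof -
      have CA: "C \<in> ?A" "C \<in> objs fin" using C x xo by auto
      note fC = obj_classD(1)[OF obj_class_objs CA(2)]
      note L = lev_Acyclics[OF CA(1) raising_collapse[of M]]
      show "frag_of C - frag_of (Theta (collapse M) C) - frag_of (lev (collapse M) C) \<in> relations {0} ?A"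
        by (rule rel_Theta[OF obj_class_A raising_collapse CA(1) L Theta_collapse_Acyclics[OF CA(2)]])
      obtain r h where "0 \<le> r" and h: "contraction r C h" by (rule AcyclicsE[OF CA(1) fC])
      have M': "\<forall>z\<in>total C. filt C z \<le> ereal M" using M C by blast
      show "frag_of (lev (collapse M) C) \<in> relations {0} ?A"
        by (rule rel_contractible[OF obj_class_A shifts_zero L contraction_collapse[OF fC h M']]) simp
    qed
    have "frag_of C - frag_of (Theta (collapse M) C) \<in> relations {0} ?A" if "C \<in> Poly_Mapping.keys x" for C
      by (rule rel_cong[OF rel_add[OF 1[OF that] 2[OF that]]]) simp
    then have "x - fmap (Theta (collapse M)) x \<in> relations {0} ?A" by (rule rel_fmap)
    moreover have "fmap (Theta (collapse M)) x \<in> relations {0} ?A"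
      by (rule Theta_relations[OF raising_collapse Theta_collapse_Acyclics rel])
    ultimately have "x - fmap (Theta (collapse M)) x + fmap (Theta (collapse M)) x \<in> relations {0} ?A" by (rule rel_add)
    then show ?thesis by simp
  next
    case False
    then have o: "objs fin = (Ct :: 'k fcomplex set)" by (simp add: objs_def)
    have st: "(stair :: 'k fcomplex) \<in> objs fin" using stair_Ct o by simp
    let ?Y = "fmap (\<lambda>X. tensor X stair)"
    have Y: "?Y x = fmul x (frag_of stair)" by (simp add: fmul_def)
    have xC: "Poly_Mapping.keys x \<subseteq> Ct" using xo o by simp
    \<comment> \<open>\<open>X \<otimes> stair\<close> maps relations to relations, because they
      form an ideal.\<close>
    have z: "zext (\<lambda>C. Phi C (ereal r)) x = 0" for r using relations_objs_iff[OF xo] rel by blast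
    have sC: "Poly_Mapping.keys (frag_of (stair :: 'k fcomplex)) \<subseteq> Ct" using stair_Ct by simp
    have "zext (\<lambda>C. Phi C (ereal r)) (?Y x) = 0" for r
      unfolding Y by (rule fmul_zero_left[OF xC sC z])
    moreover have "Poly_Mapping.keys (?Y x) \<subseteq> objs fin"
      by (rule fmap_keys) (use tensor_objs[OF _ st] xo in blast)
    ultimately have Yr: "?Y x \<in> relations {0} (objs fin)" using relations_objs_iff by blast
    have 1: "fmap (Theta plus1) (?Y x) \<in> relations {0} ?A"
      by (rule Theta_relations[OF raising_plus1 Theta_plus1_Acyclics Yr])
    have "x - fmap (Theta plus1) (?Y x) \<in> relations {0} ?A"
    proof (rule tame_decompose[OF obj_class_A])
      show "?A \<subseteq> Ct" using Acyclics_Ct o by simp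
      show "tensor X stair \<in> ?A" if "X \<in> ?A" for X by (rule tensor_Acyclics[OF that st])
      show "lev plus1 X \<in> ?A" if "X \<in> ?A" for X by (rule lev_Acyclics[OF that raising_plus1])
      show "Theta plus1 X \<in> ?A" if "X \<in> ?A" for X
        by (rule Theta_plus1_Acyclics) (use that Acyclics_sub in blast)
    qed (rule x)
    from rel_add[OF this 1] show ?thesis by (rule rel_cong) simp
  qed
qed

text \<open>Surjectivity: \<open>c\<close> differs from \<open>Theta\<close> of a combination by
  the raised part, which the Euler characteristic kills (finitely generated case) or which the
  swindle avoids (tame case).\<close>

lemma Acyclics_generate:
  fixes c :: "'k::field fcomplex \<Rightarrow>\<^sub>0 int"
  assumes c: "Poly_Mapping.keys c \<subseteq> objs fin" and e: "fin \<Longrightarrow> zext euler c = 0"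
  obtains y where "Poly_Mapping.keys y \<subseteq> Acyclics (objs fin)" "c - y \<in> relations {0} (objs fin)"
proof (cases fin)
  case True
  then have cf: "Poly_Mapping.keys c \<subseteq> Cfg" using c by (simp add: objs_def)
  obtain M where M: "\<forall>C\<in>Poly_Mapping.keys c. \<forall>z\<in>total C. filt C z \<le> ereal M"
    by (rule common_top_level[OF cf])
  let ?y = "fmap (Theta (collapse M)) c" and ?l = "fmap (lev (collapse M)) c"
  have "frag_of C - (frag_of (Theta (collapse M) C) + frag_of (lev (collapse M) C)) \<in> relations {0} (objs fin)"
    if C: "C \<in> Poly_Mapping.keys c" for C
  proof -
    have Co: "C \<in> objs fin" using C c by blast
    show ?thesis
      by (rule rel_cong[OF rel_Theta[OF obj_class_objs raising_collapse Co lev_objs[OF Co raising_collapse]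
        Theta_objs[OF Co raising_collapse]]]) (simp add: algebra_simps)
  qed
  then have "c - frag_extend (\<lambda>C. frag_of (Theta (collapse M) C) + frag_of (lev (collapse M) C)) c \<in> relations {0} (objs fin)"
    by (rule rel_fmap)
  moreover have "frag_extend (\<lambda>C. frag_of (Theta (collapse M) C) + frag_of (lev (collapse M) C)) c = ?y + ?l"
    by (simp add: frag_extend_def frag_cmul_distrib2 sum.distrib)
  ultimately have 1: "c - (?y + ?l) \<in> relations {0} (objs fin)" by simp
  have lk: "Poly_Mapping.keys ?l \<subseteq> objs fin" by (rule fmap_keys) (use lev_objs[OF _ raising_collapse] c in blast)
  \<comment> \<open>The collapsed part has class zero because its Euler characteristic
    vanishes.\<close>
  have "zext (\<lambda>C. Phi C (ereal r)) ?l = 0" for r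
  proof -
    have "zext (\<lambda>C. Phi C (ereal r)) ?l = zext (\<lambda>C. Phi (lev (collapse M) C) (ereal r)) c"
      by (simp add: zext_frag_extend)
    also have "\<dots> = zext (\<lambda>C. if M \<le> r then euler C else 0) c"
      by (rule zext_cong, rule Phi_collapse) (use cf CfgD(1) M in blast)+
    also have "\<dots> = 0" using e[OF True] by (cases "M \<le> r") (simp_all add: zext_def)
    finally show ?thesis .
  qed
  then have "?l \<in> relations {0} (objs fin)" using relations_objs_iff[OF lk] by blast
  from rel_add[OF 1 this] have "c - ?y \<in> relations {0} (objs fin)" by (rule rel_cong) simp
  moreover have "Poly_Mapping.keys ?y \<subseteq> Acyclics (objs fin)"
    by (rule fmap_keys) (use Theta_collapse_Acyclics c in blast)
  ultimately show thesis using that by blast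
next
  case False
  then have o: "objs fin = (Ct :: 'k fcomplex set)" by (simp add: objs_def)
  have st: "(stair :: 'k fcomplex) \<in> objs fin" using stair_Ct o by simp
  let ?y = "fmap (Theta plus1) (fmap (\<lambda>X. tensor X stair) c)"
  have "c - ?y \<in> relations {0} (objs fin)"
  proof (rule tame_decompose[OF obj_class_objs])
    show "objs fin \<subseteq> (Ct :: 'k fcomplex set)" using o by simp
    show "tensor X stair \<in> objs fin" if "X \<in> objs fin" for X :: "'k fcomplex" by (rule tensor_objs[OF that st])
    show "lev plus1 X \<in> objs fin" if "X \<in> objs fin" for X :: "'k fcomplex" by (rule lev_objs[OF that raising_plus1])
    show "Theta plus1 X \<in> objs fin" if "X \<in> objs fin" for X :: "'k fcomplex" by (rule Theta_objs[OF that raising_plus1])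
  qed (rule c)
  moreover have "Poly_Mapping.keys (fmap (\<lambda>X. tensor X stair) c) \<subseteq> objs fin"
    by (rule fmap_keys) (use tensor_objs[OF _ st] c in blast)
  then have "Poly_Mapping.keys ?y \<subseteq> Acyclics (objs fin)"
    by (intro fmap_keys) (use Theta_plus1_Acyclics in blast)
  ultimately show thesis using that by blast
qed

text \<open>The invariant is complete for the acyclic complexes as well, because their relations
  are those that hold among all objects.\<close>

lemma relations_Acyclics_iff:
  assumes "Poly_Mapping.keys x \<subseteq> (Acyclics (objs fin) :: 'k::field fcomplex set)"
  shows "x \<in> relations {0} (Acyclics (objs fin)) \<longleftrightarrow> (\<forall>r. zext (\<lambda>C. Phi C (ereal r)) x = 0)"
proof -
  have "Poly_Mapping.keys x \<subseteq> objs fin" using assms Acyclics_sub by blast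
  from relations_objs_iff[OF this] show ?thesis
    using relations_Acyclics[OF assms] relations_mono[OF Acyclics_sub] by blast
qed

lemma relations_UNIV:
  assumes "x \<in> relations {0} (objs fin)" shows "x \<in> relations UNIV (objs fin)"
  using assms
proof (induction rule: rel_induct)
  case (gen A B C u v w)
  note O = obj_classD(1)[OF obj_class_objs]
  obtain A' B' f a a' b b' c c' where t: "A \<in> objs fin" "B \<in> objs fin" "C \<in> objs fin" "A' \<in> objs fin" "B' \<in> objs fin" "chain_map 0 A' B' f"
    and K: "filtered_complex (cone A' B' f)"
    and h: "hequiv {0} A A' a a'" "hequiv {0} B B' b b'" "hequiv {0} C (cone A' B' f) c c'"
    by (rule exact_triangle_cone[OF obj_class_objs shifts_zero gen])
  have 1: "frag_of A' - frag_of B' + frag_of C \<in> relations UNIV (objs fin)"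
    by (rule rel_cone[OF shifts_UNIV O[OF t(4)] O[OF t(5)] O[OF t(3)] t(4,5,3,6) hequiv_mono[OF hequiv_sym[OF h(3)] subset_UNIV]])
  have 2: "frag_of A - frag_of A' \<in> relations UNIV (objs fin)"
    by (rule rel_iso[OF obj_class_objs shifts_UNIV t(1,4) hequiv_mono[OF h(1) subset_UNIV]])
  have 3: "frag_of B - frag_of B' \<in> relations UNIV (objs fin)"
    by (rule rel_iso[OF obj_class_objs shifts_UNIV t(2,5) hequiv_mono[OF h(2) subset_UNIV]])
  from rel_diff[OF rel_add[OF 1 2] 3] show ?case by (rule rel_cong) simp
qed (simp_all add: rel_0 rel_diff)

text \<open>A contraction of any shift makes an object isomorphic to zero in the limit category.\<close>

lemma Acyclics_relations_UNIV:
  fixes y :: "'k::field fcomplex \<Rightarrow>\<^sub>0 int"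
  assumes y: "Poly_Mapping.keys y \<subseteq> Acyclics (objs fin)" shows "y \<in> relations UNIV (objs fin)"
proof -
  have "frag_of X \<in> relations UNIV (objs fin)" if X: "X \<in> Poly_Mapping.keys y" for X
  proof -
    have XA: "X \<in> Acyclics (objs fin)" using X y by blast
    then have Xo: "X \<in> objs fin" using Acyclics_sub by blast
    obtain r h where h: "0 \<le> r" "contraction r X h" by (rule AcyclicsE[OF XA obj_classD(1)[OF obj_class_objs Xo]])
    show ?thesis by (rule rel_contractible[OF obj_class_objs shifts_UNIV Xo h(2)]) simp
  qed
  then have "frag_extend frag_of y \<in> relations UNIV (objs fin)" by (rule rel_fmap_zero)
  then show ?thesis by (simp flip: frag_expansion)
qed

text \<open>What the acyclic objects generate vanishes in the limit.\<close>

lemma relations_limit: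
  fixes c :: "'k::field fcomplex \<Rightarrow>\<^sub>0 int"
  assumes c: "Poly_Mapping.keys c \<subseteq> objs fin" and e: "fin \<Longrightarrow> zext euler c = 0"
  shows "c \<in> relations UNIV (objs fin)"
proof -
  obtain y where y: "Poly_Mapping.keys y \<subseteq> Acyclics (objs fin)" "c - y \<in> relations {0} (objs fin)"
    by (rule Acyclics_generate[OF c e])
  from rel_add[OF relations_UNIV[OF y(2)] Acyclics_relations_UNIV[OF y(1)]] show ?thesis by (rule rel_cong) simp
qed

lemma relations_UNIV_Cfg_iff:
  assumes "Poly_Mapping.keys c \<subseteq> (Cfg :: 'k::field fcomplex set)"
  shows "c \<in> relations UNIV Cfg \<longleftrightarrow> zext euler c = 0"
proof
  assume "c \<in> relations UNIV Cfg"
  from Phi_relations[OF obj_class_Cfg shifts_UNIV disjI2[OF refl] fin_slice_Cfg this]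
  show "zext euler c = 0" by (simp add: Phi_infinity)
next
  assume "zext euler c = 0"
  then show "c \<in> relations UNIV Cfg"
    using relations_limit[of c True] assms by (simp add: objs_def)
qed

lemma euler_relations_Cfg: "c \<in> relations {0} Cfg \<Longrightarrow> zext euler c = 0"
  using Phi_relations[OF obj_class_Cfg shifts_zero disjI2[OF refl] fin_slice_Cfg] by (simp add: Phi_infinity)

section \<open>The ring structure\<close>

text \<open>The residue class of a combination in the Grothendieck group.\<close>

definition kclass :: "real set \<Rightarrow> 'k::field fcomplex set \<Rightarrow> ('k fcomplex \<Rightarrow>\<^sub>0 int) \<Rightarrow> ('k fcomplex \<Rightarrow>\<^sub>0 int) set" where
  "kclass R Ob x = (\<lambda>h. h + x) ` relations R Ob"

abbreviation combos :: "'k::field fcomplex set \<Rightarrow> ('k fcomplex \<Rightarrow>\<^sub>0 int) set" where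
  "combos Ob \<equiv> {x. Poly_Mapping.keys x \<subseteq> Ob}"

lemma kclass_self: "x \<in> kclass R Ob x"
  unfolding kclass_def using rel_0 by (rule rev_image_eqI) simp

lemma kclass_memD: "y \<in> kclass R Ob x \<Longrightarrow> y - x \<in> relations R Ob"
  unfolding kclass_def by auto

lemma kclass_eqI:
  assumes "x - y \<in> relations R Ob" shows "kclass R Ob x = kclass R Ob y"
proof -
  have "kclass R Ob x \<subseteq> kclass R Ob y" if d: "x - y \<in> relations R Ob" for x y
  proof
    fix z assume "z \<in> kclass R Ob x"
    from rel_add[OF kclass_memD[OF this] d] have "z - y \<in> relations R Ob" by simp
    then show "z \<in> kclass R Ob y" unfolding kclass_def by (rule rev_image_eqI) simp
  qed
  from this[OF assms] this[of y x] show ?thesis using rel_neg[OF assms] by simp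
qed

lemma kclass_eqD: "kclass R Ob x = kclass R Ob y \<Longrightarrow> x - y \<in> relations R Ob"
  using kclass_self[of x R Ob] by (simp add: kclass_memD)

lemma kclass_0: "kclass R Ob 0 = relations R Ob"
  by (simp add: kclass_def)

lemma objs_True: "objs True = Cfg" and objs_False: "objs False = Ct"
  by (simp_all add: objs_def)

lemma a_r_coset_kclass: "relations R Ob +>\<^bsub>free_rng Ob\<^esub> x = kclass R Ob x"
  by (auto simp: a_r_coset_def' free_rng_def kclass_def)

lemma carrier_K: "carrier (K_ring R Ob) = kclass R Ob ` combos Ob"
  unfolding K_ring_def FactRing_def A_RCOSETS_def' a_r_coset_kclass by (auto simp: free_rng_def carrier_free)

lemma zero_K: "\<zero>\<^bsub>K_ring R Ob\<^esub> = kclass R Ob 0"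
  by (simp add: K_ring_def FactRing_def kclass_0)

lemma add_K: "kclass R Ob x \<oplus>\<^bsub>K_ring R Ob\<^esub> kclass R Ob y = kclass R Ob (x + y)"
proof -
  have "kclass R Ob x \<oplus>\<^bsub>K_ring R Ob\<^esub> kclass R Ob y = (\<Union>a\<in>kclass R Ob x. \<Union>b\<in>kclass R Ob y. {a + b})"
    by (simp add: K_ring_def FactRing_def set_add_def' free_rng_def)
  also have "\<dots> = kclass R Ob (x + y)"
  proof (intro equalityI subsetI)
    fix z assume "z \<in> (\<Union>a\<in>kclass R Ob x. \<Union>b\<in>kclass R Ob y. {a + b})"
    then obtain a b where ab: "a \<in> kclass R Ob x" "b \<in> kclass R Ob y" "z = a + b" by blast
    from rel_add[OF kclass_memD[OF ab(1)] kclass_memD[OF ab(2)]] have "z - (x + y) \<in> relations R Ob"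
      by (rule rel_cong) (simp add: ab(3) algebra_simps)
    then show "z \<in> kclass R Ob (x + y)" unfolding kclass_def by (rule rev_image_eqI) simp
  next
    fix z assume "z \<in> kclass R Ob (x + y)"
    from kclass_memD[OF this] have "z - y \<in> kclass R Ob x" unfolding kclass_def by (rule rev_image_eqI) (simp add: algebra_simps)
    then show "z \<in> (\<Union>a\<in>kclass R Ob x. \<Union>b\<in>kclass R Ob y. {a + b})"
      using kclass_self[of y R Ob] by (intro UN_I[of "z - y"] UN_I[of y]) simp_all
  qed
  finally show ?thesis .
qed

text \<open>What the tensor product has to satisfy for the quotient to be a ring.\<close>

definition tensor_compatible :: "real set \<Rightarrow> 'k::field fcomplex set \<Rightarrow> bool" where
  "tensor_compatible R Ob \<longleftrightarrow> (\<forall>x\<in>combos Ob. \<forall>y\<in>combos Ob. fmul x y \<in> combos Ob \<and>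
     (x \<in> relations R Ob \<or> y \<in> relations R Ob \<longrightarrow> fmul x y \<in> relations R Ob) \<and>
     (\<forall>z\<in>combos Ob. fmul (fmul x y) z - fmul x (fmul y z) \<in> relations R Ob))"

lemma tensor_compatibleD:
  assumes "tensor_compatible R Ob" "x \<in> combos Ob" "y \<in> combos Ob"
  shows "fmul x y \<in> combos Ob" "x \<in> relations R Ob \<Longrightarrow> fmul x y \<in> relations R Ob"
    "y \<in> relations R Ob \<Longrightarrow> fmul x y \<in> relations R Ob"
    "z \<in> combos Ob \<Longrightarrow> fmul (fmul x y) z - fmul x (fmul y z) \<in> relations R Ob"
  using assms unfolding tensor_compatible_def by blast+

lemma combos_kclass: "a \<in> kclass R Ob x \<Longrightarrow> x \<in> combos Ob \<Longrightarrow> a \<in> combos Ob"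
  using Poly_Mapping.keys_add[of "a - x" x] rel_carrier[OF kclass_memD[of a R Ob x]] by auto

lemma mult_K:
  assumes T: "tensor_compatible R Ob" and x: "x \<in> combos Ob" and y: "y \<in> combos Ob"
  shows "kclass R Ob x \<otimes>\<^bsub>K_ring R Ob\<^esub> kclass R Ob y = kclass R Ob (fmul x y)"
proof -
  have "kclass R Ob x \<otimes>\<^bsub>K_ring R Ob\<^esub> kclass R Ob y = (\<Union>a\<in>kclass R Ob x. \<Union>b\<in>kclass R Ob y. kclass R Ob (fmul a b))"
    by (simp add: K_ring_def FactRing_def rcoset_mult_def a_r_coset_kclass) (simp add: free_rng_def fmul_def)
  also have "\<dots> = (\<Union>a\<in>kclass R Ob x. \<Union>b\<in>kclass R Ob y. kclass R Ob (fmul x y))"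
  proof (intro SUP_cong refl)
    fix a b assume a: "a \<in> kclass R Ob x" and b: "b \<in> kclass R Ob y"
    have ax: "a - x \<in> relations R Ob" and by': "b - y \<in> relations R Ob" using a b by (auto dest: kclass_memD)
    have "fmul (a - x) b \<in> relations R Ob"
      by (rule tensor_compatibleD(2)[OF T _ combos_kclass[OF b y] ax]) (use rel_carrier[OF ax] in simp)
    moreover have "fmul x (b - y) \<in> relations R Ob"
      by (rule tensor_compatibleD(3)[OF T x _ by']) (use rel_carrier[OF by'] in simp)
    ultimately have "fmul (a - x) b + fmul x (b - y) \<in> relations R Ob" by (rule rel_add)
    then have "fmul a b - fmul x y \<in> relations R Ob" by (simp add: fmul_diff)
    then show "kclass R Ob (fmul a b) = kclass R Ob (fmul x y)" by (rule kclass_eqI)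
  qed
  also have "\<dots> = kclass R Ob (fmul x y)" using kclass_self[of x R Ob] kclass_self[of y R Ob] by auto
  finally show ?thesis .
qed

text \<open>For a set of combinations closed under the operations; besides the full Grothendieck
  rings this covers the subring of elements of Euler characteristic zero.\<close>

lemma rng_K_sub:
  assumes T: "tensor_compatible R Ob" and S: "S \<subseteq> combos Ob" "0 \<in> S"
    "\<And>x y. x \<in> S \<Longrightarrow> y \<in> S \<Longrightarrow> x + y \<in> S" "\<And>x. x \<in> S \<Longrightarrow> - x \<in> S"
    "\<And>x y. x \<in> S \<Longrightarrow> y \<in> S \<Longrightarrow> fmul x y \<in> S"
  shows "rng ((K_ring R Ob)\<lparr>carrier := kclass R Ob ` S\<rparr>)"
proof -
  let ?Q = "(K_ring R Ob)\<lparr>carrier := kclass R Ob ` S\<rparr>"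
  have add: "kclass R Ob x \<oplus>\<^bsub>?Q\<^esub> kclass R Ob y = kclass R Ob (x + y)" for x y by (simp add: add_K)
  have zero: "\<zero>\<^bsub>?Q\<^esub> = kclass R Ob 0" by (simp add: zero_K)
  have mult: "kclass R Ob x \<otimes>\<^bsub>?Q\<^esub> kclass R Ob y = kclass R Ob (fmul x y)" if "x \<in> S" "y \<in> S" for x y
    using mult_K[OF T subsetD[OF S(1) that(1)] subsetD[OF S(1) that(2)]] by simp
  have car: "carrier ?Q = kclass R Ob ` S" by simp
  have "abelian_group ?Q"
  proof (rule abelian_groupI, unfold car)
    show "\<exists>y\<in>kclass R Ob ` S. y \<oplus>\<^bsub>?Q\<^esub> x = \<zero>\<^bsub>?Q\<^esub>" if x: "x \<in> kclass R Ob ` S" for x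
    proof -
      obtain a where a: "a \<in> S" "x = kclass R Ob a" using x by blast
      have "kclass R Ob (- a) \<oplus>\<^bsub>?Q\<^esub> x = \<zero>\<^bsub>?Q\<^esub>" unfolding a(2) add zero by simp
      then show ?thesis using S(4)[OF a(1)] by blast
    qed
    show "x \<oplus>\<^bsub>?Q\<^esub> y = y \<oplus>\<^bsub>?Q\<^esub> x" if xy: "x \<in> kclass R Ob ` S" "y \<in> kclass R Ob ` S" for x y
    proof -
      obtain a b where "x = kclass R Ob a" "y = kclass R Ob b" using xy by blast
      then show ?thesis by (simp only: add add.commute)
    qed
  qed (auto simp only: add zero add.assoc add_0 S intro!: imageI)
  moreover have "x \<otimes>\<^bsub>?Q\<^esub> y \<in> carrier ?Q" if xy: "x \<in> carrier ?Q" "y \<in> carrier ?Q" for x y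
  proof -
    obtain a b where "a \<in> S" "x = kclass R Ob a" "b \<in> S" "y = kclass R Ob b" using xy unfolding car by blast
    then show ?thesis unfolding car using mult S(5) by simp
  qed
  moreover have "(x \<otimes>\<^bsub>?Q\<^esub> y) \<otimes>\<^bsub>?Q\<^esub> z = x \<otimes>\<^bsub>?Q\<^esub> (y \<otimes>\<^bsub>?Q\<^esub> z) \<and>
        (x \<oplus>\<^bsub>?Q\<^esub> y) \<otimes>\<^bsub>?Q\<^esub> z = x \<otimes>\<^bsub>?Q\<^esub> z \<oplus>\<^bsub>?Q\<^esub> y \<otimes>\<^bsub>?Q\<^esub> z \<and>
        x \<otimes>\<^bsub>?Q\<^esub> (y \<oplus>\<^bsub>?Q\<^esub> z) = x \<otimes>\<^bsub>?Q\<^esub> y \<oplus>\<^bsub>?Q\<^esub> x \<otimes>\<^bsub>?Q\<^esub> z"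
    if xyz: "x \<in> carrier ?Q" "y \<in> carrier ?Q" "z \<in> carrier ?Q" for x y z
  proof -
    obtain a b c where abc: "a \<in> S" "x = kclass R Ob a" "b \<in> S" "y = kclass R Ob b" "c \<in> S" "z = kclass R Ob c"
      using xyz unfolding car by blast
    note s = subsetD[OF S(1)]
    have "kclass R Ob (fmul (fmul a b) c) = kclass R Ob (fmul a (fmul b c))"
      by (rule kclass_eqI, rule tensor_compatibleD(4)[OF T s s s]) (rule abc)+
    then show ?thesis unfolding abc(2,4,6) add mult[OF abc(1,3)] mult[OF abc(3,5)] mult[OF abc(1,5)]
      mult[OF S(5)[OF abc(1,3)] abc(5)] mult[OF abc(1) S(5)[OF abc(3,5)]]
      mult[OF S(3)[OF abc(1,3)] abc(5)] mult[OF abc(1) S(3)[OF abc(3,5)]] by (simp add: fmul_add)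
  qed
  ultimately show ?thesis unfolding rng_def by blast
qed

lemma combos_closed:
  "x \<in> combos Ob \<Longrightarrow> y \<in> combos Ob \<Longrightarrow> x + y \<in> combos Ob" "x \<in> combos Ob \<Longrightarrow> - x \<in> combos Ob"
  using Poly_Mapping.keys_add[of x y] by auto

lemma rng_K: assumes T: "tensor_compatible R Ob" shows "rng (K_ring R Ob)"
proof -
  have "rng ((K_ring R Ob)\<lparr>carrier := kclass R Ob ` combos Ob\<rparr>)"
    by (rule rng_K_sub[OF T subset_refl _ combos_closed tensor_compatibleD(1)[OF T]]) auto
  then show ?thesis by (simp flip: carrier_K)
qed

text \<open>Where the invariant is complete, the ideal property and associativity may be checked
  on its values.\<close>

lemma tensor_compatible_Phi:
  fixes Ob :: "'k::field fcomplex set"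
  assumes Ob: "Ob \<subseteq> Ct" "\<And>C D. C \<in> Ob \<Longrightarrow> D \<in> Ob \<Longrightarrow> tensor C D \<in> Ob"
    and iff: "\<And>x. x \<in> combos Ob \<Longrightarrow> x \<in> relations {0} Ob \<longleftrightarrow> (\<forall>r. zext (\<lambda>C. Phi C (ereal r)) x = 0)"
  shows "tensor_compatible {0} Ob"
  unfolding tensor_compatible_def
proof (intro ballI conjI impI)
  fix x y assume x: "x \<in> combos Ob" and y: "y \<in> combos Ob"
  show xy: "fmul x y \<in> combos Ob" using fmul_keys[of x y Ob] Ob(2) x y by blast
  have Ct: "Poly_Mapping.keys x \<subseteq> Ct" "Poly_Mapping.keys y \<subseteq> Ct" using x y Ob(1) by auto
  show "fmul x y \<in> relations {0} Ob" if "x \<in> relations {0} Ob \<or> y \<in> relations {0} Ob"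
    using that
  proof
    assume "x \<in> relations {0} Ob"
    then have "zext (\<lambda>C. Phi C (ereal r)) x = 0" for r using iff[OF x] by blast
    from fmul_zero_left[OF Ct this] show ?thesis using iff[OF xy] by blast
  next
    assume "y \<in> relations {0} Ob"
    then have "zext (\<lambda>C. Phi C (ereal r)) y = 0" for r using iff[OF y] by blast
    from fmul_zero_right[OF Ct this] show ?thesis using iff[OF xy] by blast
  qed
  fix z assume z: "z \<in> combos Ob"
  have yz: "fmul y z \<in> combos Ob" using fmul_keys[of y z Ob] Ob(2) y z by blast
  have "fmul (fmul x y) z \<in> combos Ob" "fmul x (fmul y z) \<in> combos Ob"
    using fmul_keys[of "fmul x y" z Ob] fmul_keys[of x "fmul y z" Ob] Ob(2) x xy yz z by blast+
  then have d: "fmul (fmul x y) z - fmul x (fmul y z) \<in> combos Ob"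
    using combos_closed(1)[OF _ combos_closed(2)] by (metis diff_conv_add_uminus)
  have "zext (\<lambda>C. Phi C (ereal r)) (fmul (fmul x y) z) = zext (\<lambda>C. Phi C (ereal r)) (fmul x (fmul y z))" for r
    unfolding zext_fmul
  proof (intro zext_cong)
    fix C D E assume "C \<in> Poly_Mapping.keys x" "D \<in> Poly_Mapping.keys y" "E \<in> Poly_Mapping.keys z"
    then have "C \<in> Ct" "D \<in> Ct" "E \<in> Ct" using Ct z Ob(1) by auto
    then show "Phi (tensor (tensor C D) E) (ereal r) = Phi (tensor C (tensor D E)) (ereal r)" by (rule Phi_tensor_assoc)
  qed
  then have "\<forall>r. zext (\<lambda>C. Phi C (ereal r)) (fmul (fmul x y) z - fmul x (fmul y z)) = 0" by (simp add: zext_diff)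
  then show "fmul (fmul x y) z - fmul x (fmul y z) \<in> relations {0} Ob" using iff[OF d] by blast
qed

lemma tensor_compatible_objs: "tensor_compatible {0} (objs fin :: 'k::field fcomplex set)"
proof (rule tensor_compatible_Phi)
  show "objs fin \<subseteq> (Ct :: 'k fcomplex set)" using objs_Ct by blast
qed (rule tensor_objs, assumption+, rule relations_objs_iff, simp)

lemma tensor_compatible_Acyclics: "tensor_compatible {0} (Acyclics (objs fin) :: 'k::field fcomplex set)"
proof (rule tensor_compatible_Phi)
  show "Acyclics (objs fin) \<subseteq> (Ct :: 'k fcomplex set)" using Acyclics_sub objs_Ct by blast
  show "tensor C D \<in> Acyclics (objs fin)" if "C \<in> Acyclics (objs fin)" "D \<in> Acyclics (objs fin)" for C D :: "'k fcomplex"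
    by (rule tensor_Acyclics[OF that(1) subsetD[OF Acyclics_sub that(2)]])
qed (rule relations_Acyclics_iff, simp)

lemma zext_mult: "zext (\<lambda>a. c * \<phi> a) x = c * zext \<phi> x" "zext (\<lambda>a. \<phi> a * c) x = zext \<phi> x * c"
  by (simp_all add: zext_def sum_distrib_left sum_distrib_right mult.left_commute mult.assoc)

lemma zext_euler_fmul:
  assumes x: "x \<in> combos Cfg" and y: "y \<in> combos Cfg"
  shows "zext euler (fmul x y) = zext euler x * zext euler y"
proof -
  have "zext euler (fmul x y) = zext (\<lambda>C. zext (\<lambda>D. euler C * euler D) y) x"
    unfolding zext_fmul by (intro zext_cong euler_tensor) (use x y in auto)
  then show ?thesis by (simp add: zext_mult)
qed

lemma Cfg_fmul: "x \<in> combos Cfg \<Longrightarrow> y \<in> combos Cfg \<Longrightarrow> fmul x y \<in> combos (Cfg :: 'k::field fcomplex set)"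
  using tensor_compatibleD(1)[OF tensor_compatible_objs[of True], of x y] by (simp add: objs_def)

lemma tensor_compatible_UNIV_Cfg: "tensor_compatible UNIV (Cfg :: 'k::field fcomplex set)"
  unfolding tensor_compatible_def
proof (intro ballI conjI impI)
  fix x y :: "'k fcomplex \<Rightarrow>\<^sub>0 int" assume x: "x \<in> combos Cfg" and y: "y \<in> combos Cfg"
  have iff: "c \<in> relations UNIV Cfg \<longleftrightarrow> zext euler c = 0" if "c \<in> combos Cfg" for c :: "'k fcomplex \<Rightarrow>\<^sub>0 int"
    using relations_UNIV_Cfg_iff that by blast
  show xy: "fmul x y \<in> combos Cfg" by (rule Cfg_fmul[OF x y])
  show "fmul x y \<in> relations UNIV Cfg" if "x \<in> relations UNIV Cfg \<or> y \<in> relations UNIV Cfg"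
    using that unfolding iff[OF x] iff[OF y] iff[OF xy] zext_euler_fmul[OF x y] by simp
  fix z :: "'k fcomplex \<Rightarrow>\<^sub>0 int" assume z: "z \<in> combos Cfg"
  have yz: "fmul y z \<in> combos Cfg" by (rule Cfg_fmul[OF y z])
  have d: "fmul (fmul x y) z - fmul x (fmul y z) \<in> combos Cfg"
    using combos_closed(1)[OF Cfg_fmul[OF xy z] combos_closed(2)[OF Cfg_fmul[OF x yz]]] by simp
  show "fmul (fmul x y) z - fmul x (fmul y z) \<in> relations UNIV Cfg"
    unfolding iff[OF d] zext_diff zext_euler_fmul[OF xy z] zext_euler_fmul[OF x y] zext_euler_fmul[OF x yz] zext_euler_fmul[OF y z]
    by simp
qed

section \<open>The comparison map and the limit category\<close>

text \<open>All representatives of a class have the same Euler characteristic if it vanishes on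
  the relations.\<close>

lemma chi_kclass:
  assumes "\<And>c. c \<in> relations R Ob \<Longrightarrow> zext euler c = 0" shows "chi (kclass R Ob x) = zext euler x"
proof -
  have 1: "zext euler y = zext euler x" if "y \<in> kclass R Ob x" for y
    using assms[OF kclass_memD[OF that]] by (simp add: zext_diff)
  show ?thesis unfolding chi_def zext_def[symmetric]
  proof (rule the_equality)
    show "\<forall>y\<in>kclass R Ob x. zext euler x = zext euler y" using 1 by simp
    show "n = zext euler x" if "\<forall>y\<in>kclass R Ob x. n = zext euler y" for n using that kclass_self[of x R Ob] by blast
  qed
qed

lemma j_map_kclass:
  assumes "x \<in> combos (Acyclics Ob)" shows "j_map Ob (kclass {0} (Acyclics Ob) x) = kclass {0} Ob x"
proof -
  have "kclass {0} Ob y = kclass {0} Ob x" if "y \<in> kclass {0} (Acyclics Ob) x" for y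
    by (rule kclass_eqI, rule relations_mono[OF Acyclics_sub kclass_memD[OF that]])
  then show ?thesis unfolding j_map_def a_r_coset_kclass using kclass_self[of x "{0}" "Acyclics Ob"] by blast
qed

lemma inj_j_map: "inj_on (j_map (objs fin)) (carrier (KA (objs fin :: 'k::field fcomplex set)))"
proof (rule inj_onI)
  fix X Y assume X: "X \<in> carrier (KA (objs fin :: 'k fcomplex set))" and Y: "Y \<in> carrier (KA (objs fin :: 'k fcomplex set))"
    and e: "j_map (objs fin) X = j_map (objs fin) Y"
  obtain x where x: "x \<in> combos (Acyclics (objs fin))" "X = kclass {0} (Acyclics (objs fin)) x" using X unfolding carrier_K by blast
  obtain y where y: "y \<in> combos (Acyclics (objs fin))" "Y = kclass {0} (Acyclics (objs fin)) y" using Y unfolding carrier_K by blast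
  have "kclass {0} (objs fin) x = kclass {0} (objs fin) y" using e unfolding x(2) y(2) j_map_kclass[OF x(1)] j_map_kclass[OF y(1)] .
  then have 1: "x - y \<in> relations {0} (objs fin)" by (rule kclass_eqD)
  have "x + - y \<in> combos (Acyclics (objs fin))" by (rule combos_closed(1)[OF x(1) combos_closed(2)[OF y(1)]])
  then have "Poly_Mapping.keys (x - y) \<subseteq> Acyclics (objs fin)" by simp
  from kclass_eqI[OF relations_Acyclics[OF this 1]] show "X = Y" unfolding x(2) y(2) .
qed

lemma TorK_zero: "TorK (objs fin :: 'k::field fcomplex set) = {\<zero>\<^bsub>KA (objs fin)\<^esub>}"
proof -
  let ?A = "Acyclics (objs fin) :: 'k fcomplex set"
  have z: "kclass {0} ?A 0 \<in> carrier (KA (objs fin))" unfolding carrier_K by (rule imageI) simp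
  have jz: "j_map (objs fin) (kclass {0} ?A 0) = kclass {0} (objs fin) 0" by (rule j_map_kclass) simp
  have "X = kclass {0} ?A 0" if "X \<in> carrier (KA (objs fin))" "j_map (objs fin) X = kclass {0} (objs fin) 0" for X
    by (rule inj_onD[OF inj_j_map _ that(1) z]) (use that(2) jz in simp)
  then show ?thesis unfolding TorK_def a_kernel_def' zero_K using z jz by blast
qed

text \<open>The combinations whose classes will turn out to form the image of \<open>j\<close>.\<close>

definition j_image :: "bool \<Rightarrow> ('k::field fcomplex \<Rightarrow>\<^sub>0 int) set" where
  "j_image fin = {x \<in> combos (objs fin). fin \<longrightarrow> zext euler x = 0}"

lemma rng_iso_j_map:
  "rng_iso (KA (objs fin :: 'k::field fcomplex set)) ((K (objs fin))\<lparr>carrier := kclass {0} (objs fin) ` j_image fin\<rparr>) (j_map (objs fin))"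
proof -
  let ?A = "Acyclics (objs fin) :: 'k fcomplex set" and ?j = "j_map (objs fin :: 'k fcomplex set)"
  let ?c = "kclass {0} (objs fin) :: ('k fcomplex \<Rightarrow>\<^sub>0 int) \<Rightarrow> _" and ?S = "j_image fin :: ('k fcomplex \<Rightarrow>\<^sub>0 int) set"
  have sub: "combos ?A \<subseteq> ?S"
  proof
    fix x assume x: "x \<in> combos ?A"
    have "x \<in> relations UNIV (objs fin)" by (rule Acyclics_relations_UNIV) (use x in simp)
    moreover have "Poly_Mapping.keys x \<subseteq> objs fin" using x Acyclics_sub by blast
    ultimately show "x \<in> ?S" using relations_UNIV_Cfg_iff[of x] by (auto simp: j_image_def objs_def)
  qed
  have rngS: "rng ((K (objs fin))\<lparr>carrier := ?c ` ?S\<rparr>)"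
  proof (rule rng_K_sub[OF tensor_compatible_objs])
    show "?S \<subseteq> combos (objs fin)" "0 \<in> ?S" by (auto simp: j_image_def)
    show "x + y \<in> ?S" if "x \<in> ?S" "y \<in> ?S" for x y
      using that combos_closed(1)[of x "objs fin" y] by (simp add: j_image_def zext_add)
    show "- x \<in> ?S" if "x \<in> ?S" for x using that by (simp add: j_image_def zext_neg)
    show "fmul x y \<in> ?S" if "x \<in> ?S" "y \<in> ?S" for x y
    proof -
      have xy: "x \<in> combos (objs fin)" "y \<in> combos (objs fin)" using that by (auto simp: j_image_def)
      have "zext euler (fmul x y) = 0" if fin
        using xy zext_euler_fmul[of x y] \<open>x \<in> ?S\<close> that by (simp add: objs_def j_image_def)
      then show ?thesis using tensor_compatibleD(1)[OF tensor_compatible_objs xy] by (simp add: j_image_def)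
    qed
  qed
  have "?j ` carrier (KA (objs fin)) = ?c ` ?S"
  proof (intro equalityI subsetI)
    fix Z assume "Z \<in> ?j ` carrier (KA (objs fin))"
    then obtain x where x: "x \<in> combos ?A" "Z = ?j (kclass {0} ?A x)" unfolding carrier_K by blast
    then show "Z \<in> ?c ` ?S" using j_map_kclass[OF x(1)] subsetD[OF sub x(1)] by simp
  next
    fix Z assume "Z \<in> ?c ` ?S"
    then obtain x where x: "x \<in> ?S" "Z = ?c x" by blast
    have k: "Poly_Mapping.keys x \<subseteq> objs fin" and e: "fin \<Longrightarrow> zext euler x = 0" using x(1) by (auto simp: j_image_def)
    obtain y where y: "Poly_Mapping.keys y \<subseteq> ?A" "x - y \<in> relations {0} (objs fin)" by (rule Acyclics_generate[OF k e])
    have yA: "y \<in> combos ?A" using y(1) by simp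
    have "Z = ?j (kclass {0} ?A y)" unfolding x(2) j_map_kclass[OF yA] by (rule kclass_eqI[OF y(2)])
    then show "Z \<in> ?j ` carrier (KA (objs fin))" unfolding carrier_K using yA by blast
  qed
  then have bij: "bij_betw ?j (carrier (KA (objs fin))) (?c ` ?S)" using inj_j_map by (simp add: bij_betw_def)
  have "?j (X \<oplus>\<^bsub>KA (objs fin)\<^esub> Y) = ?j X \<oplus>\<^bsub>K (objs fin)\<^esub> ?j Y \<and> ?j (X \<otimes>\<^bsub>KA (objs fin)\<^esub> Y) = ?j X \<otimes>\<^bsub>K (objs fin)\<^esub> ?j Y"
    if XY: "X \<in> carrier (KA (objs fin))" "Y \<in> carrier (KA (objs fin))" for X Y
  proof -
    obtain x y where x: "x \<in> combos ?A" "X = kclass {0} ?A x" and y: "y \<in> combos ?A" "Y = kclass {0} ?A y"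
      using XY unfolding carrier_K by blast
    have o: "x \<in> combos (objs fin)" "y \<in> combos (objs fin)" using x(1) y(1) Acyclics_sub by blast+
    show ?thesis
      unfolding x(2) y(2) add_K mult_K[OF tensor_compatible_Acyclics x(1) y(1)] j_map_kclass[OF x(1)] j_map_kclass[OF y(1)]
        mult_K[OF tensor_compatible_objs o] j_map_kclass[OF combos_closed(1)[OF x(1) y(1)]]
        j_map_kclass[OF tensor_compatibleD(1)[OF tensor_compatible_Acyclics x(1) y(1)]] by simp
  qed
  then show ?thesis unfolding rng_iso_def using rng_K[OF tensor_compatible_Acyclics] rngS bij by simp
qed

lemma K0fg_eq: "K0fg = (K Cfg)\<lparr>carrier := kclass {0} Cfg ` (j_image True :: ('k::field fcomplex \<Rightarrow>\<^sub>0 int) set)\<rparr>"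
proof -
  have "{X \<in> kclass {0} Cfg ` combos Cfg. chi X = 0} = kclass {0} Cfg ` (j_image True :: ('k fcomplex \<Rightarrow>\<^sub>0 int) set)"
    by (auto simp: j_image_def objs_True chi_kclass[OF euler_relations_Cfg])
  then show ?thesis unfolding K0fg_def carrier_K by simp
qed

text \<open>A complex with one generator has Euler characteristic one, so \<open>chi\<close> is onto the integers.\<close>

lemma euler_point: obtains P :: "'k::field fcomplex" where "P \<in> Cfg" "euler P = 1"
proof
  have "adm True {0} (\<lambda>_. 0)" by (simp add: adm_def)
  from Std_objs[OF this] show "(Std0 {0} (\<lambda>_. 0) :: 'k fcomplex) \<in> Cfg" by (simp add: objs_def)
  show "euler (Std0 {0} (\<lambda>_. 0) :: 'k fcomplex) = 1"
    using euler_based[OF based_Std[of "{0}" "\<lambda>_. 0" "\<lambda>_. 0"]] by (simp add: par_def)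
qed

lemma rng_iso_K_inf_Cfg: "rng_iso (K_inf (Cfg :: 'k::field fcomplex set)) \<Z> chi"
proof -
  have iff: "c \<in> relations UNIV Cfg \<longleftrightarrow> zext euler c = 0" if "c \<in> combos Cfg" for c :: "'k fcomplex \<Rightarrow>\<^sub>0 int"
    using relations_UNIV_Cfg_iff that by blast
  have rel: "zext euler c = 0" if c: "c \<in> relations UNIV Cfg" for c :: "'k fcomplex \<Rightarrow>\<^sub>0 int"
    using relations_UNIV_Cfg_iff[OF rel_carrier[OF c]] c by blast
  have chi: "chi (kclass UNIV Cfg x) = zext euler x" for x :: "'k fcomplex \<Rightarrow>\<^sub>0 int"
    by (rule chi_kclass) (rule rel)
  obtain P :: "'k fcomplex" where P: "P \<in> Cfg" "euler P = 1" by (rule euler_point)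
  have "n \<in> chi ` carrier (K_inf (Cfg :: 'k fcomplex set))" for n
  proof -
    have "zext euler (frag_cmul n (frag_of P)) = n" 
      using zext_superset[of "{P}" "frag_cmul n (frag_of P)" euler] keys_cmul[of n "frag_of P"] P(2) by simp
    then have "n = chi (kclass UNIV Cfg (frag_cmul n (frag_of P)))" by (simp add: chi)
    then show ?thesis unfolding carrier_K using P(1) by (intro image_eqI[of n chi] imageI) auto
  qed
  moreover have "inj_on chi (carrier (K_inf (Cfg :: 'k fcomplex set)))"
  proof (rule inj_onI)
    fix X Y assume XY: "X \<in> carrier (K_inf (Cfg :: 'k fcomplex set))" "Y \<in> carrier (K_inf (Cfg :: 'k fcomplex set))" "chi X = chi Y"
    obtain x y where x: "x \<in> combos Cfg" "X = kclass UNIV Cfg x" and y: "y \<in> combos Cfg" "Y = kclass UNIV Cfg y"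
      using XY(1,2) unfolding carrier_K by blast
    have "x + - y \<in> combos Cfg" by (rule combos_closed(1)[OF x(1) combos_closed(2)[OF y(1)]])
    then have "x - y \<in> combos Cfg" by simp
    from iff[OF this] have "x - y \<in> relations UNIV Cfg" using XY(3) unfolding x(2) y(2) chi by (simp add: zext_diff)
    from kclass_eqI[OF this] show "X = Y" unfolding x(2) y(2) .
  qed
  ultimately have bij: "bij_betw chi (carrier (K_inf (Cfg :: 'k fcomplex set))) (carrier \<Z>)"
    unfolding bij_betw_def by auto
  have "chi (X \<oplus>\<^bsub>K_inf Cfg\<^esub> Y) = chi X \<oplus>\<^bsub>\<Z>\<^esub> chi Y \<and> chi (X \<otimes>\<^bsub>K_inf Cfg\<^esub> Y) = chi X \<otimes>\<^bsub>\<Z>\<^esub> chi Y"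
    if XY: "X \<in> carrier (K_inf (Cfg :: 'k fcomplex set))" "Y \<in> carrier (K_inf (Cfg :: 'k fcomplex set))" for X Y
  proof -
    obtain x y where x: "x \<in> combos Cfg" "X = kclass UNIV Cfg x" and y: "y \<in> combos Cfg" "Y = kclass UNIV Cfg y"
      using XY unfolding carrier_K by blast
    show ?thesis unfolding x(2) y(2) add_K mult_K[OF tensor_compatible_UNIV_Cfg x(1) y(1)] chi
      by (simp add: zext_add zext_euler_fmul[OF x(1) y(1)])
  qed
  moreover have "rng \<Z>"
    unfolding rng_def using int.is_abelian_group by (simp add: algebra_simps)
  ultimately show ?thesis unfolding rng_iso_def using rng_K[OF tensor_compatible_UNIV_Cfg] bij by blast
qed

lemma K_inf_Ct: "carrier (K_inf (Ct :: 'k::field fcomplex set)) = {\<zero>\<^bsub>K_inf Ct\<^esub>}"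
proof -
  have "kclass UNIV Ct x = kclass UNIV Ct 0" if "x \<in> combos Ct" for x :: "'k fcomplex \<Rightarrow>\<^sub>0 int"
  proof (rule kclass_eqI)
    have "x \<in> relations UNIV (objs False)" by (rule relations_limit) (use that in \<open>simp_all add: objs_def\<close>)
    then show "x - 0 \<in> relations UNIV Ct" by (simp add: objs_def)
  qed
  moreover have "(0 :: 'k fcomplex \<Rightarrow>\<^sub>0 int) \<in> combos Ct" by simp
  ultimately show ?thesis unfolding carrier_K zero_K by blast
qed

theorem corollary4p3p4:
  shows "rng_iso (KA (Cfg :: 'k::field fcomplex set)) K0fg (j_map Cfg) \<and>
    rng_iso (KA (Ct :: 'k fcomplex set)) (K Ct) (j_map Ct) \<and>
    inj_on (j_map (Cfg :: 'k fcomplex set)) (carrier (KA Cfg)) \<and>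
    inj_on (j_map (Ct :: 'k fcomplex set)) (carrier (KA Ct)) \<and>
    TorK (Cfg :: 'k fcomplex set) = {\<zero>\<^bsub>KA Cfg\<^esub>} \<and>
    TorK (Ct :: 'k fcomplex set) = {\<zero>\<^bsub>KA Ct\<^esub>} \<and>
    (\<exists>h. rng_iso (K_inf (Cfg :: 'k fcomplex set)) \<Z> h) \<and>
    carrier (K_inf (Ct :: 'k fcomplex set)) = {\<zero>\<^bsub>K_inf Ct\<^esub>}"
proof -
  have "j_image False = combos (Ct :: 'k fcomplex set)" by (simp add: j_image_def objs_False)
  then have "(K Ct)\<lparr>carrier := kclass {0} Ct ` j_image False\<rparr> = K (Ct :: 'k fcomplex set)" by (simp flip: carrier_K)
  moreover have "rng_iso (KA Ct) ((K Ct)\<lparr>carrier := kclass {0} (Ct :: 'k fcomplex set) ` j_image False\<rparr>) (j_map Ct)"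
    by (rule rng_iso_j_map[of False, unfolded objs_False])
  ultimately have "rng_iso (KA (Ct :: 'k fcomplex set)) (K Ct) (j_map Ct)" by simp
  moreover have "rng_iso (KA (Cfg :: 'k fcomplex set)) K0fg (j_map Cfg)"
    unfolding K0fg_eq by (rule rng_iso_j_map[of True, unfolded objs_True])
  moreover note inj_j_map[of True, unfolded objs_True] inj_j_map[of False, unfolded objs_False]
    TorK_zero[of True, unfolded objs_True] TorK_zero[of False, unfolded objs_False] rng_iso_K_inf_Cfg K_inf_Ct
  ultimately show ?thesis by (intro conjI exI[of _ chi])
qed

end
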